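(* Let $n\ge3$, $N\ge1$, let $\Omega\subset\mathbb{R}^n$ be an open connected set, and let $L$ be an operator as in the context, with strongly elliptic (constant $\lambda>0$) and bounded (constant $\Lambda>0$) measurable coefficients. Assume that $\Omega$ satisfies the condition (S) uniformly on $\partial\Omega$ with parameters $\theta>0$, $R_a\in(0,\infty]$, and that the operators $L$ and ${}^tL$ satisfy the property (H) with constants $\mu_0,H_0$ and the property (BH) with constants $\mu_1,H_1$ (at every boundary point). Denote $d_x=\mathrm{dist}(x,\partial\Omega)$ and $R_{x,y}:=\min(|x-y|,4R_a)$. Then the Green's matrix $G(x,y)$ of $L$ in $\Omega$ satisfies, for $x,y\in\Omega$, $x\neq y$, $$|G(x,y)|\le C\,d_x^{\mu}\,R_{x,y}^{1-n/2-\mu}\,d_y^{1-n/2}\quad\text{if } d_x\le R_{x,y}/8,$$ $$|G(x,y)|\le C\,d_y^{\mu}\,R_{x,y}^{1-n/2-\mu}\,d_x^{1-n/2}\quad\text{if } d_y\le R_{x,y}/8,$$ where $C=C(n,N,\lambda,\Lambda,\theta,\mu_0,\mu_1,H_0,H_1)>0$ and $\mu=\min(\mu_0,\mu_1)$. As a consequence, $G(\cdot,y)=0$ and $G(x,\cdot)=0$ on $\partial\Omega$ in the usual sense (i.e. $G(x,y)\to0$ as $x\to\bar x\in\partial\Omega$ for fixed $y\in\Omega$, and as $y\to\bar y\in\partial\Omega$ for fixed $x\in\Omega$).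
   Context: Summation over repeated indices is understood ($\alpha,\beta=1,\dots,n$; $i,j=1,\dots,N$). $B_r(x)$ is the ball of radius $r$ centered at $x$; $|S|$ is Lebesgue measure; $\Omega_r(x):=\Omega\cap B_r(x)$; $\Sigma_r(x):=\partial\Omega\cap B_r(x)$. Operator: $(Lu)^i=-D_\alpha(A^{\alpha\beta}_{ij}D_\beta u^j)$, acting on $u=(u^1,\dots,u^N)^T$. Strong ellipticity: $A^{\alpha\beta}_{ij}(x)\xi^j_\beta\xi^i_\alpha\ge\lambda\sum_{i,\alpha}|\xi^i_\alpha|^2$ for all $x\in\mathbb{R}^n$ and real $\xi=(\xi^i_\alpha)$. Boundedness: $\sum_{i,j,\alpha,\beta}|A^{\alpha\beta}_{ij}(x)|^2\le\Lambda^2$ for all $x\in\mathbb{R}^n$. The transpose ${}^tL$ is the operator of the same form with coefficients ${}^tA^{\alpha\beta}_{ij}=A^{\beta\alpha}_{ji}$. Property (H) (constants $\mu_0,H_0>0$): for every ball $B_R=B_R(x_0)\subset\mathbb{R}^n$, every weak solution $u\in W^{1,2}(B_R)^N$ of $Lu=0$ in $B_R$ satisfies $\int_{B_r}|Du|^2\le H_0\left(\frac rs\right)^{n-2+2\mu_0}\int_{B_s}|Du|^2$ for $0<r<s\le R$ (concentric balls). Similarly for ${}^tL$. Condition (S): $\Omega$ satisfies (S) at $\bar x\in\partial\Omega$ with parameters $\theta>0$, $R_a\in(0,\infty]$ if $|B_R(\bar x)\setminus\Omega|\ge\theta|B_R(\bar x)|$ for all $R<R_a$; it satisfies (S) uniformly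 on $\partial\Omega$ if this holds for all $\bar x\in\partial\Omega$ with the same $\theta,R_a$. Vanishing on part of the boundary: $u\in W^{1,2}(\Omega_R(\bar x))$ satisfies $u=0$ on $\Sigma_R(\bar x)$ if $u$ is a limit in $W^{1,2}(\Omega_R(\bar x))$ of functions in $C_c^\infty(\overline{\Omega_R(\bar x)}\setminus\Sigma_R(\bar x))$. Property (BH) at $\bar x$ (constants $\mu_1,H_1>0$), where $\Omega$ satisfies (S) at $\bar x$: whenever $R<R_a$ and $u\in W^{1,2}(\Omega_R(\bar x))^N$ is a weak solution of $Lu=0$ in $\Omega_R(\bar x)$ with $u=0$ on $\Sigma_R(\bar x)$, then $\int_{\Omega_r(\bar x)}|Du|^2\le H_1\left(\frac rs\right)^{n-2+2\mu_1}\int_{\Omega_s(\bar x)}|Du|^2$ for all $0<r<s\le R$. Similarly for ${}^tL$. Here (BH) is assumed at every $\bar x\in\partial\Omega$ with the same constants. Function spaces: $Y^{1,2}(\Omega)$ is the space of weakly differentiable $u\in L^{2n/(n-2)}(\Omega)$ with $Du\in L^2(\Omega)$, normed by $\|u\|_{L^{2n/(n-2)}(\Omega)}+\|Du\|_{L^2(\Omega)}$; $Y^{1,2}_0(\Omega)$ is the closure of $C_c^\infty(\Omega)$ in it. Green's matrix: when $L,{}^tL$ satisfy (H), the Green's matrix of $L$ in $\Omega$ is the unique $G(x,y)=(G_{ij}(x,y))_{i,j=1}^N$, continuous on $\{(x,y)\in\Omega\times\Omega:x\ne y\}$, with $G(x,\cdot)$ locally integrable in $\Omega$ for all $x\in\Omega$,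 such that for all $f\in C_c^\infty(\Omega)^N$ the function $u(x)=\int_\Omega G(x,y)f(y)\,dy$ belongs to $Y^{1,2}_0(\Omega)^N$ and satisfies $\int_\Omega A^{\alpha\beta}_{ij}D_\beta u^jD_\alpha\phi^i=\int_\Omega f^i\phi^i$ for all $\phi\in C_c^\infty(\Omega)^N$. *)

theory Defs
  imports "HOL-Analysis.Analysis"
begin

subsection \<open>Smooth functions\<close>

primrec C_k :: "nat \<Rightarrow> ('a::real_normed_vector \<Rightarrow> 'b::real_normed_vector) \<Rightarrow> bool" where
  "C_k 0 f \<longleftrightarrow> continuous_on UNIV f"
| "C_k (Suc k) f \<longleftrightarrow>
     (\<forall>x. f differentiable (at x)) \<and> (\<forall>v. C_k k (\<lambda>x. frechet_derivative f (at x) v))"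

definition smooth :: "('a::real_normed_vector \<Rightarrow> 'b::real_normed_vector) \<Rightarrow> bool" where
  "smooth f \<longleftrightarrow> (\<forall>k. C_k k f)"

text \<open>Elements of \<open>C\<^sub>c\<^sup>\<infinity>(U)\<close> for open \<open>U\<close>, extended by zero.\<close>

definition test_function ::
    "'a::real_normed_vector set \<Rightarrow> ('a \<Rightarrow> 'b::real_normed_vector) \<Rightarrow> bool" where
  "test_function U \<phi> \<longleftrightarrow>
     smooth \<phi> \<and> compact (closure {x. \<phi> x \<noteq> 0}) \<and> closure {x. \<phi> x \<noteq> 0} \<subseteq> U"

text \<open>
  Elements of \<open>C\<^sub>c\<^sup>\<infinity>(closure U - S)\<close>, where the set \<open>closure U - S\<close> need not be open. A function
  is smooth on it if it is the restriction of a smooth function on the whole space, and its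
  support is taken relative to \<open>closure U\<close>; what \<open>\<phi>\<close> does outside of \<open>closure U\<close> is irrelevant.
\<close>

definition test_function_off ::
    "'a::real_normed_vector set \<Rightarrow> 'a set \<Rightarrow> ('a \<Rightarrow> 'b::real_normed_vector) \<Rightarrow> bool" where
  "test_function_off U S \<phi> \<longleftrightarrow>
     smooth \<phi> \<and> compact (closure {x \<in> closure U. \<phi> x \<noteq> 0}) \<and>
     closure {x \<in> closure U. \<phi> x \<noteq> 0} \<subseteq> closure U - S"

subsection \<open>Lebesgue and Sobolev spaces\<close>

definition locally_integrable ::
    "'a::euclidean_space set \<Rightarrow> ('a \<Rightarrow> 'b::euclidean_space) \<Rightarrow> bool" where
  "locally_integrable U f \<longleftrightarrow> (\<forall>K. compact K \<and> K \<subseteq> U \<longrightarrow> set_integrable lebesgue K f)"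

definition in_Lp :: "real \<Rightarrow> 'a::euclidean_space set \<Rightarrow> ('a \<Rightarrow> 'b::euclidean_space) \<Rightarrow> bool" where
  "in_Lp p U f \<longleftrightarrow>
     set_borel_measurable lebesgue U f \<and> set_integrable lebesgue U (\<lambda>x. norm (f x) powr p)"

definition Lp_norm :: "real \<Rightarrow> 'a::euclidean_space set \<Rightarrow> ('a \<Rightarrow> 'b::euclidean_space) \<Rightarrow> real" where
  "Lp_norm p U f = (LINT x:U|lebesgue. norm (f x) powr p) powr (1 / p)"

text \<open>
  The gradient of a vector-valued function \<open>u\<close> is matrix-valued, with \<open>D\<^sub>\<alpha> u\<^sup>i\<close> at position
  \<open>$ i $ \<alpha>\<close>; this is the layout of the library's \<^const>\<open>jacobian\<close>. A weak gradient is only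
  determined up to null sets, so it is carried along explicitly as a second argument \<open>Du\<close>.
\<close>

definition weak_gradient ::
    "(real^'n) set \<Rightarrow> (real^'n \<Rightarrow> real^'N) \<Rightarrow> (real^'n \<Rightarrow> real^'n^'N) \<Rightarrow> bool" where
  "weak_gradient U u Du \<longleftrightarrow>
     locally_integrable U u \<and> locally_integrable U Du \<and>
     (\<forall>\<phi> :: real^'n \<Rightarrow> real. test_function U \<phi> \<longrightarrow>
        (\<forall>i \<alpha>. (LINT x:U|lebesgue. u x $ i * frechet_derivative \<phi> (at x) (axis \<alpha> 1)) =
               - (LINT x:U|lebesgue. Du x $ i $ \<alpha> * \<phi> x)))"

definition in_W12 ::
    "(real^'n) set \<Rightarrow> (real^'n \<Rightarrow> real^'N) \<Rightarrow> (real^'n \<Rightarrow> real^'n^'N) \<Rightarrow> bool" where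
  "in_W12 U u Du \<longleftrightarrow> weak_gradient U u Du \<and> in_Lp 2 U u \<and> in_Lp 2 U Du"

definition sobolev_exponent :: "'n::finite itself \<Rightarrow> real" where
  "sobolev_exponent _ = 2 * real CARD('n) / (real CARD('n) - 2)"

definition in_Y12 ::
    "(real^'n) set \<Rightarrow> (real^'n \<Rightarrow> real^'N) \<Rightarrow> (real^'n \<Rightarrow> real^'n^'N) \<Rightarrow> bool" where
  "in_Y12 U u Du \<longleftrightarrow>
     weak_gradient U u Du \<and> in_Lp (sobolev_exponent TYPE('n)) U u \<and> in_Lp 2 U Du"

definition in_Y12_0 ::
    "(real^'n) set \<Rightarrow> (real^'n \<Rightarrow> real^'N) \<Rightarrow> (real^'n \<Rightarrow> real^'n^'N) \<Rightarrow> bool" where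
  "in_Y12_0 U u Du \<longleftrightarrow>
     in_Y12 U u Du \<and>
     (\<exists>\<phi> :: nat \<Rightarrow> real^'n \<Rightarrow> real^'N.
        (\<forall>k. test_function U (\<phi> k)) \<and>
        (\<lambda>k. Lp_norm (sobolev_exponent TYPE('n)) U (\<lambda>x. u x - \<phi> k x)
            + Lp_norm 2 U (\<lambda>x. Du x - jacobian (\<phi> k) (at x))) \<longlonglongrightarrow> 0)"

text \<open>\<open>u \<in> W\<^sup>1\<^sup>,\<^sup>2(U)\<close> with \<open>u = 0\<close> on the part \<open>S\<close> of the boundary of the bounded open set \<open>U\<close>.\<close>

definition in_W12_vanishing ::
    "(real^'n) set \<Rightarrow> (real^'n) set \<Rightarrow> (real^'n \<Rightarrow> real^'N) \<Rightarrow> (real^'n \<Rightarrow> real^'n^'N) \<Rightarrow> bool" where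
  "in_W12_vanishing U S u Du \<longleftrightarrow>
     in_W12 U u Du \<and>
     (\<exists>\<phi> :: nat \<Rightarrow> real^'n \<Rightarrow> real^'N.
        (\<forall>k. test_function_off U S (\<phi> k)) \<and>
        (\<lambda>k. Lp_norm 2 U (\<lambda>x. u x - \<phi> k x)
            + Lp_norm 2 U (\<lambda>x. Du x - jacobian (\<phi> k) (at x))) \<longlonglongrightarrow> 0)"

subsection \<open>The elliptic operator\<close>

text \<open>\<open>A \<alpha> \<beta> i j x\<close> is \<open>A\<^sup>\<alpha>\<^sup>\<beta>\<^sub>i\<^sub>j(x)\<close>.\<close>

type_synonym ('n, 'N) coeffs = "'n \<Rightarrow> 'n \<Rightarrow> 'N \<Rightarrow> 'N \<Rightarrow> real^'n \<Rightarrow> real"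

text \<open>\<open>A\<^sup>\<alpha>\<^sup>\<beta>\<^sub>i\<^sub>j(x) p\<^sup>j\<^sub>\<beta> q\<^sup>i\<^sub>\<alpha>\<close>\<close>

definition coeff_form ::
    "('n::finite, 'N::finite) coeffs \<Rightarrow> real^'n \<Rightarrow> real^'n^'N \<Rightarrow> real^'n^'N \<Rightarrow> real" where
  "coeff_form A x p q =
     (\<Sum>\<alpha>\<in>UNIV. \<Sum>\<beta>\<in>UNIV. \<Sum>i\<in>UNIV. \<Sum>j\<in>UNIV. A \<alpha> \<beta> i j x * p $ j $ \<beta> * q $ i $ \<alpha>)"

definition measurable_coeffs :: "('n::finite, 'N::finite) coeffs \<Rightarrow> bool" where
  "measurable_coeffs A \<longleftrightarrow> (\<forall>\<alpha> \<beta> i j. A \<alpha> \<beta> i j \<in> borel_measurable lebesgue)"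

definition strongly_elliptic :: "real \<Rightarrow> ('n::finite, 'N::finite) coeffs \<Rightarrow> bool" where
  "strongly_elliptic lam A \<longleftrightarrow>
     (\<forall>x. \<forall>\<xi> :: real^'n^'N. coeff_form A x \<xi> \<xi> \<ge> lam * (\<Sum>i\<in>UNIV. \<Sum>\<alpha>\<in>UNIV. \<bar>\<xi> $ i $ \<alpha>\<bar>\<^sup>2))"

definition bounded_coeffs :: "real \<Rightarrow> ('n::finite, 'N::finite) coeffs \<Rightarrow> bool" where
  "bounded_coeffs Lam A \<longleftrightarrow>
     (\<forall>x. (\<Sum>i\<in>UNIV. \<Sum>j\<in>UNIV. \<Sum>\<alpha>\<in>UNIV. \<Sum>\<beta>\<in>UNIV. \<bar>A \<alpha> \<beta> i j x\<bar>\<^sup>2) \<le> Lam\<^sup>2)"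

definition transpose_coeffs :: "('n, 'N) coeffs \<Rightarrow> ('n, 'N) coeffs" where
  "transpose_coeffs A = (\<lambda>\<alpha> \<beta> i j. A \<beta> \<alpha> j i)"

text \<open>Weak form of \<open>L u = f\<close> in \<open>U\<close>, where \<open>Du\<close> is the weak gradient of \<open>u\<close>.\<close>

definition weak_equation ::
    "('n::finite, 'N::finite) coeffs \<Rightarrow> (real^'n) set \<Rightarrow> (real^'n \<Rightarrow> real^'n^'N) \<Rightarrow>
     (real^'n \<Rightarrow> real^'N) \<Rightarrow> bool" where
  "weak_equation A U Du f \<longleftrightarrow>
     (\<forall>\<phi> :: real^'n \<Rightarrow> real^'N. test_function U \<phi> \<longrightarrow>
        (LINT x:U|lebesgue. coeff_form A x (Du x) (jacobian \<phi> (at x))) =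
        (LINT x:U|lebesgue. f x \<bullet> \<phi> x))"

subsection \<open>The conditions (H), (S) and (BH)\<close>

definition property_H :: "('n::finite, 'N::finite) coeffs \<Rightarrow> real \<Rightarrow> real \<Rightarrow> bool" where
  "property_H A \<mu>\<^sub>0 H\<^sub>0 \<longleftrightarrow>
     (\<forall>x\<^sub>0 R u Du. 0 < R \<and> in_W12 (ball x\<^sub>0 R) u Du \<and>
        weak_equation A (ball x\<^sub>0 R) Du (\<lambda>_. 0) \<longrightarrow>
        (\<forall>r s. 0 < r \<and> r < s \<and> s \<le> R \<longrightarrow>
           (LINT x:ball x\<^sub>0 r|lebesgue. (norm (Du x))\<^sup>2)
             \<le> H\<^sub>0 * (r / s) powr (real CARD('n) - 2 + 2 * \<mu>\<^sub>0)
                * (LINT x:ball x\<^sub>0 s|lebesgue. (norm (Du x))\<^sup>2)))"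

definition condition_S_at ::
    "(real^'n) set \<Rightarrow> real \<Rightarrow> ereal \<Rightarrow> real^'n \<Rightarrow> bool" where
  "condition_S_at \<Omega> \<theta> R\<^sub>a x \<longleftrightarrow>
     (\<forall>R. 0 < R \<and> ereal R < R\<^sub>a \<longrightarrow>
        measure lebesgue (ball x R - \<Omega>) \<ge> \<theta> * measure lebesgue (ball x R))"

definition condition_S :: "(real^'n) set \<Rightarrow> real \<Rightarrow> ereal \<Rightarrow> bool" where
  "condition_S \<Omega> \<theta> R\<^sub>a \<longleftrightarrow> (\<forall>x\<in>frontier \<Omega>. condition_S_at \<Omega> \<theta> R\<^sub>a x)"

definition property_BH_at ::
    "('n::finite, 'N::finite) coeffs \<Rightarrow> (real^'n) set \<Rightarrow> ereal \<Rightarrow> real \<Rightarrow> real \<Rightarrow> real^'n \<Rightarrow> bool" where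
  "property_BH_at A \<Omega> R\<^sub>a \<mu>\<^sub>1 H\<^sub>1 x\<^sub>0 \<longleftrightarrow>
     (\<forall>R u Du. 0 < R \<and> ereal R < R\<^sub>a \<and>
        in_W12_vanishing (\<Omega> \<inter> ball x\<^sub>0 R) (frontier \<Omega> \<inter> ball x\<^sub>0 R) u Du \<and>
        weak_equation A (\<Omega> \<inter> ball x\<^sub>0 R) Du (\<lambda>_. 0) \<longrightarrow>
        (\<forall>r s. 0 < r \<and> r < s \<and> s \<le> R \<longrightarrow>
           (LINT x:\<Omega> \<inter> ball x\<^sub>0 r|lebesgue. (norm (Du x))\<^sup>2)
             \<le> H\<^sub>1 * (r / s) powr (real CARD('n) - 2 + 2 * \<mu>\<^sub>1)
                * (LINT x:\<Omega> \<inter> ball x\<^sub>0 s|lebesgue. (norm (Du x))\<^sup>2)))"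

definition property_BH ::
    "('n::finite, 'N::finite) coeffs \<Rightarrow> (real^'n) set \<Rightarrow> ereal \<Rightarrow> real \<Rightarrow> real \<Rightarrow> bool" where
  "property_BH A \<Omega> R\<^sub>a \<mu>\<^sub>1 H\<^sub>1 \<longleftrightarrow> (\<forall>x\<in>frontier \<Omega>. property_BH_at A \<Omega> R\<^sub>a \<mu>\<^sub>1 H\<^sub>1 x)"

subsection \<open>The Green's matrix\<close>

text \<open>
  When the operator and its transpose satisfy (H), these properties determine \<open>G\<close> uniquely off the
  diagonal of \<open>\<Omega> \<times> \<Omega>\<close>. The values elsewhere play no role.
\<close>

definition is_green_matrix ::
    "('n::finite, 'N::finite) coeffs \<Rightarrow> (real^'n) set \<Rightarrow>
     (real^'n \<Rightarrow> real^'n \<Rightarrow> real^'N^'N) \<Rightarrow> bool" where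
  "is_green_matrix A \<Omega> G \<longleftrightarrow>
     continuous_on {(x, y). x \<in> \<Omega> \<and> y \<in> \<Omega> \<and> x \<noteq> y} (\<lambda>(x, y). G x y) \<and>
     (\<forall>x\<in>\<Omega>. locally_integrable \<Omega> (G x)) \<and>
     (\<forall>f :: real^'n \<Rightarrow> real^'N. test_function \<Omega> f \<longrightarrow>
        (\<exists>Du. in_Y12_0 \<Omega> (\<lambda>x. LINT y:\<Omega>|lebesgue. G x y *v f y) Du \<and>
              weak_equation A \<Omega> Du f))"

text \<open>
  The distance to the boundary. It is infinite for the whole space, whose boundary is empty;
  \<^const>\<open>infdist\<close> alone would give \<open>0\<close> there.
\<close>

definition bdry_dist :: "'a::metric_space set \<Rightarrow> 'a \<Rightarrow> ereal" where
  "bdry_dist \<Omega> x = (if frontier \<Omega> = {} then \<infinity> else ereal (infdist x (frontier \<Omega>)))"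

definition R_dist :: "ereal \<Rightarrow> 'a::metric_space \<Rightarrow> 'a \<Rightarrow> real" where
  "R_dist R\<^sub>a x y = real_of_ereal (min (ereal (dist x y)) (4 * R\<^sub>a))"

end

(* For a test function f supported near y, the solution u = integral of G(.,z) f(z) dz of L u = f solves
   the homogeneous equation near x. Close to the boundary (BH) and the Poincare inequality that (S)
   provides, and inside the domain (H), make the Dirichlet integral of u decay on balls; following
   the weighted averages of u over balls as the radius varies then bounds |u(x)| by a multiple of
   d_x^mu R^(1-n/2-mu) ||Du||_2.
   Dually, G(x,.) is a solution of the transposed equation near y whose pairing with every such f has
   this bound. Its energy is therefore controlled on a ball of radius comparable to d_y (with the Hardy
   inequality in the role of Sobolev's), and (H) for the transpose turns this into the pointwise factor
   d_y^(1-n/2). The second estimate is the first one for the transposed operator, whose Green's matrix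
   is, off the diagonal, the transpose of G. *)

theory Submission
  imports Defs
begin

section \<open>Preliminaries: smooth functions, cut-offs and the space L2\<close>

subsection \<open>Smooth functions\<close>

text \<open>Two obstacles shape the argument. G is known only through its integrals against test
  functions and its continuity off the diagonal, so that nothing is known about a single column, and
  a column with a point source need not have finite energy. All estimates are therefore made for
  smooth right-hand sides: a mollified source \<delta>^(-n) bump at x replaces the pole, and
  \<delta> -> 0 uses the continuity of G. This is why the boundary estimate is proved uniformly on a
  small ball around x. Moreover no Green's matrix of the transpose is given, so transposed solutions
  have to be constructed. They are limits of a contracting iteration of test functions; the Hardy
  inequality makes the energy closure complete. The scales come from (S) and (BH), which allow only
  radii below \<open>R\<^sub>a\<close>, while R_{x,y} may reach 4 \<open>R\<^sub>a\<close>. The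
  radius R_{x,y}/5 is admissible, and since d_x <= R_{x,y}/8 the ball of this radius about the
  boundary point nearest to x misses the ball of radius d_y/2 that carries f. Hence the constants do
  not involve \<open>R\<^sub>a\<close>.\<close>

lemma frechet_derivative_eqI:
  "(f has_derivative f') (at x) \<Longrightarrow> frechet_derivative f (at x) v = f' v"
  by (metis frechet_derivative_at)

text \<open>The recursion for \<open>C_k\<close> never asks for \<open>C_k k f\<close> itself. It is
  recovered from differentiability at the bottom and, higher up, by induction applied to the
  directional derivatives.\<close>

lemma C_k_Suc_D: "C_k (Suc k) f \<Longrightarrow> C_k k f"
proof (induction k arbitrary: f)
  case 0
  then show ?case
    by (auto simp: differentiable_imp_continuous_within continuous_on_eq_continuous_within)
next
  case (Suc k)
  then show ?case by (metis C_k.simps(2))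
qed

lemma C_k_const: "C_k k (\<lambda>_. c)"
  by (induction k arbitrary: c) auto

lemma C_k_bounded_linear:
  assumes "bounded_linear f"
  shows "C_k k f"
proof (cases k)
  case 0
  then show ?thesis using assms by (simp add: linear_continuous_on)
next
  case (Suc k)
  have "frechet_derivative f (at x) v = f v" for x v
    using assms by (metis bounded_linear_imp_has_derivative frechet_derivative_at)
  moreover have "f differentiable at x" for x
    using assms bounded_linear_imp_differentiable by blast
  ultimately show ?thesis using Suc by (simp add: C_k_const)
qed

lemma C_k_add: "C_k k f \<Longrightarrow> C_k k g \<Longrightarrow> C_k k (\<lambda>x. f x + g x)"
proof (induction k arbitrary: f g)
  case 0
  then show ?case by (auto intro: continuous_on_add)
next
  case (Suc k)
  have "frechet_derivative (\<lambda>x. f x + g x) (at x) v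
      = frechet_derivative f (at x) v + frechet_derivative g (at x) v" for x v
  proof -
    have "((\<lambda>x. f x + g x) has_derivative
        (\<lambda>v. frechet_derivative f (at x) v + frechet_derivative g (at x) v)) (at x)"
      using Suc.prems by (auto intro!: has_derivative_add simp: frechet_derivative_works[symmetric])
    then show ?thesis by (rule frechet_derivative_eqI)
  qed
  then show ?case using Suc by (auto intro: differentiable_add)
qed

text \<open>The product rule yields two products of the same kind, so the induction has to vary both
  factors. Scalar multiples, products and inner products are all instances.\<close>

lemma C_k_bilinear:
  assumes "bounded_bilinear bop"
  shows "C_k k f \<Longrightarrow> C_k k g \<Longrightarrow> C_k k (\<lambda>x. bop (f x) (g x))"
proof (induction k arbitrary: f g)
  case 0
  then show ?case using bounded_bilinear.continuous_on[OF assms] by auto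
next
  case (Suc k)
  have D: "((\<lambda>x. bop (f x) (g x)) has_derivative
      (\<lambda>v. bop (f x) (frechet_derivative g (at x) v) + bop (frechet_derivative f (at x) v) (g x))) (at x)" for x
    using Suc.prems
    by (auto intro!: bounded_bilinear.FDERIV[OF assms] simp: frechet_derivative_works[symmetric])
  then have "frechet_derivative (\<lambda>x. bop (f x) (g x)) (at x) v
     = bop (f x) (frechet_derivative g (at x) v) + bop (frechet_derivative f (at x) v) (g x)" for x v
    by (rule frechet_derivative_eqI)
  moreover have "C_k k f" "C_k k g"
    using Suc.prems C_k_Suc_D by blast+
  moreover have "(\<lambda>x. bop (f x) (g x)) differentiable at x" for x
    using D differentiable_def by blast
  ultimately show ?case using Suc by (auto intro!: C_k_add)
qed

text \<open>With a real outer function, a directional derivative of the composite is one composite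
  times one derivative of q, so the induction closes when h varies.\<close>

lemma C_k_compose_real:
  fixes h :: "real \<Rightarrow> real" and q :: "'a::real_normed_vector \<Rightarrow> real"
  shows "C_k k h \<Longrightarrow> C_k k q \<Longrightarrow> C_k k (\<lambda>x. h (q x))"
proof (induction k arbitrary: h q)
  case 0
  then show ?case
    by (auto intro: continuous_on_compose2)
next
  case (Suc k)
  have D: "((\<lambda>x. h (q x)) has_derivative
      (\<lambda>v. frechet_derivative h (at (q x)) 1 * frechet_derivative q (at x) v)) (at x)" for x
  proof -
    have h: "(h has_derivative frechet_derivative h (at (q x))) (at (q x))"
      using Suc.prems by (simp add: frechet_derivative_works)
    have q: "(q has_derivative frechet_derivative q (at x)) (at x)"
      using Suc.prems by (simp add: frechet_derivative_works)
    have "frechet_derivative h (at (q x)) t = frechet_derivative h (at (q x)) 1 * t" for t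
      using linear_scale[OF has_derivative_linear[OF h], of t 1] by simp
    then show ?thesis by (intro has_derivative_eq_rhs[OF has_derivative_compose[OF q h]] ext)
  qed
  have "frechet_derivative (\<lambda>x. h (q x)) (at x) v =
      frechet_derivative h (at (q x)) 1 * frechet_derivative q (at x) v" for x v
    by (rule frechet_derivative_eqI[OF D])
  moreover have "C_k k q" using Suc.prems C_k_Suc_D by blast
  moreover have "(\<lambda>x. h (q x)) differentiable at x" for x
    using D differentiable_def by blast
  moreover have "C_k k (\<lambda>x. frechet_derivative h (at (q x)) 1)"
    using Suc.prems \<open>C_k k q\<close> Suc.IH[of "\<lambda>t. frechet_derivative h (at t) 1" q] by simp
  ultimately show ?case using Suc.prems by (auto intro!: C_k_bilinear[OF bounded_bilinear_mult])
qed

lemma smooth_const [simp]: "smooth (\<lambda>_. c)"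
  by (simp add: smooth_def C_k_const)

lemma smooth_bounded_linear: "bounded_linear f \<Longrightarrow> smooth f"
  by (simp add: smooth_def C_k_bounded_linear)

lemma smooth_add: "smooth f \<Longrightarrow> smooth g \<Longrightarrow> smooth (\<lambda>x. f x + g x)"
  by (simp add: smooth_def C_k_add)

lemma smooth_bilinear:
  "bounded_bilinear bop \<Longrightarrow> smooth f \<Longrightarrow> smooth g \<Longrightarrow> smooth (\<lambda>x. bop (f x) (g x))"
  by (simp add: smooth_def C_k_bilinear)

lemmas smooth_scaleR = smooth_bilinear[OF bounded_bilinear_scaleR]
lemmas smooth_mult = smooth_bilinear[OF bounded_bilinear_mult]
lemmas smooth_inner = smooth_bilinear[OF bounded_bilinear_inner]

lemma smooth_cmult: "smooth f \<Longrightarrow> smooth (\<lambda>x. (c::real) *\<^sub>R f x)"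
  by (intro smooth_scaleR) auto

lemma smooth_diff: "smooth f \<Longrightarrow> smooth g \<Longrightarrow> smooth (\<lambda>x. f x - g x)"
  using smooth_add[OF _ smooth_cmult[of g "-1"], of f] by simp

lemma smooth_sum: "(\<And>i. i \<in> I \<Longrightarrow> smooth (f i)) \<Longrightarrow> smooth (\<lambda>x. \<Sum>i\<in>I. f i x)"
  by (induction I rule: infinite_finite_induct) (auto intro: smooth_add)

lemma smooth_compose_real:
  fixes h :: "real \<Rightarrow> real"
  shows "smooth h \<Longrightarrow> smooth q \<Longrightarrow> smooth (\<lambda>x. h (q x))"
  by (simp add: smooth_def C_k_compose_real)

lemma smooth_linear_compose:
  assumes "bounded_linear l" "smooth f"
  shows "smooth (\<lambda>x. l (f x))"
proof -
  have "C_k k f \<Longrightarrow> C_k k (\<lambda>x. l (f x))" for k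
  proof (induction k arbitrary: f)
    case 0
    then show ?case
      using bounded_linear.continuous_on[OF assms(1), of UNIV f] by simp
  next
    case (Suc k)
    have D: "((\<lambda>x. l (f x)) has_derivative (\<lambda>v. l (frechet_derivative f (at x) v))) (at x)" for x
      using Suc.prems by (auto intro!: bounded_linear.has_derivative[OF assms(1)]
          simp: frechet_derivative_works[symmetric])
    have "frechet_derivative (\<lambda>x. l (f x)) (at x) v = l (frechet_derivative f (at x) v)" for x v
      by (rule frechet_derivative_eqI[OF D])
    moreover have "(\<lambda>x. l (f x)) differentiable at x" for x
      using D differentiable_def by blast
    ultimately show ?case using Suc by simp
  qed
  then show ?thesis using assms by (auto simp: smooth_def)
qed

lemma smooth_id: "smooth (\<lambda>x. x)"
  by (rule smooth_bounded_linear) (rule bounded_linear_ident)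

lemma smooth_frechet_derivative:
  "smooth f \<Longrightarrow> smooth (\<lambda>x. frechet_derivative f (at x) v)"
  unfolding smooth_def by (metis C_k.simps(2))

lemma smooth_differentiable: "smooth f \<Longrightarrow> f differentiable (at x)"
  unfolding smooth_def by (metis C_k.simps(2))

lemma smooth_has_derivative: "smooth f \<Longrightarrow> (f has_derivative frechet_derivative f (at x)) (at x)"
  using smooth_differentiable frechet_derivative_works by blast

lemma smooth_continuous_on: "smooth f \<Longrightarrow> continuous_on S f"
  unfolding smooth_def by (metis C_k.simps(1) continuous_on_subset subset_UNIV)

lemma smooth_real_polynomial_function: "real_polynomial_function p \<Longrightarrow> smooth p"
  by (induction p rule: real_polynomial_function.induct)
     (auto intro: smooth_add smooth_mult smooth_bounded_linear)

subsection \<open>A bump function\<close>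

text \<open>The exponent m makes the family stable under differentiation up to linear combinations,
  so that all its members are proved smooth by a single induction.\<close>

definition flat_exp :: "nat \<Rightarrow> real \<Rightarrow> real" where
  "flat_exp m t = (if t > 0 then (1 / t) ^ m * exp (- (1 / t)) else 0)"

lemma flat_exp_tendsto_0: "(flat_exp m \<longlongrightarrow> 0) (at 0)"
proof (rule filterlim_split_at)
  show "(flat_exp m \<longlongrightarrow> 0) (at_left 0)"
    by (rule tendsto_eventually) (auto simp: flat_exp_def eventually_at_filter)
  have "((\<lambda>t. (1/t) ^ m / exp (1/t)) \<longlongrightarrow> (0::real)) (at_right 0)"
    by (rule filterlim_compose[OF tendsto_power_div_exp_0])
       (use filterlim_inverse_at_top_right in \<open>simp add: inverse_eq_divide\<close>)
  then show "(flat_exp m \<longlongrightarrow> 0) (at_right 0)"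
    by (rule Lim_transform_eventually)
       (auto simp: flat_exp_def eventually_at_filter exp_minus field_simps)
qed

lemma flat_exp_DERIV:
  "(flat_exp m has_real_derivative (flat_exp (m + 2) t - real m * flat_exp (m + 1) t)) (at t)"
proof -
  consider "t < 0" | "t = 0" | "t > 0" by linarith
  then show ?thesis
  proof cases
    case 1
    have "((\<lambda>_. 0) has_real_derivative 0) (at t)" by simp
    then have "(flat_exp m has_real_derivative 0) (at t)"
      by (rule has_field_derivative_transform_within_open[where S="{..<0}"])
         (use 1 in \<open>auto simp: flat_exp_def\<close>)
    then show ?thesis using 1 by (simp add: flat_exp_def)
  next
    case 2
    \<comment> \<open>Away from h = 0 this difference quotient is \<open>flat_exp (Suc m)\<close>
      itself.\<close>
    have "((\<lambda>h. (flat_exp m (0 + h) - flat_exp m 0) / h) \<longlongrightarrow> 0) (at 0)"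
      by (rule Lim_transform_eventually[OF flat_exp_tendsto_0[of "Suc m"]])
         (auto simp: flat_exp_def eventually_at_filter field_simps)
    then show ?thesis using 2 by (simp add: DERIV_def flat_exp_def)
  next
    case 3
    have "((\<lambda>t. (1 / t) ^ m * exp (- (1 / t))) has_real_derivative
       (flat_exp (m + 2) t - real m * flat_exp (m + 1) t)) (at t)"
      using 3
      by (auto intro!: derivative_eq_intros simp: flat_exp_def)
         (cases m; auto simp: field_simps power2_eq_square power_add)
    then show ?thesis
      by (rule has_field_derivative_transform_within_open[where S="{0<..}"])
         (use 3 in \<open>auto simp: flat_exp_def\<close>)
  qed
qed

lemma smooth_flat_exp: "smooth (flat_exp m)"
proof -
  \<comment> \<open>The derivative is phrased as a sum of \<open>scaleR\<close> products, the shapes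
    handled by \<open>C_k_add\<close> and \<open>C_k_bilinear\<close>.\<close>
  have D: "(flat_exp m has_derivative (\<lambda>v. v *\<^sub>R flat_exp (m+2) t + (v * - real m) *\<^sub>R flat_exp (m+1) t)) (at t)" for t m
  proof -
    have "(\<lambda>v. v *\<^sub>R flat_exp (m+2) t + (v * - real m) *\<^sub>R flat_exp (m+1) t)
        = (*) (flat_exp (m + 2) t - real m * flat_exp (m + 1) t)"
      by (auto simp: algebra_simps)
    then show ?thesis using flat_exp_DERIV[of m t] by (simp only: has_field_derivative_def)
  qed
  have F: "frechet_derivative (flat_exp m) (at t) v
      = v *\<^sub>R flat_exp (m+2) t + (v * - real m) *\<^sub>R flat_exp (m+1) t" for t m v
    by (rule frechet_derivative_eqI[OF D])
  have "C_k k (flat_exp m)" for k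
  proof (induction k arbitrary: m)
    case 0
    show ?case unfolding C_k.simps
      by (intro continuous_at_imp_continuous_on ballI has_derivative_continuous[OF D])
  next
    case (Suc k)
    have "C_k k (\<lambda>t. v *\<^sub>R flat_exp (m+2) t + (v * - real m) *\<^sub>R flat_exp (m+1) t)" for v
      by (intro C_k_add C_k_bilinear[OF bounded_bilinear_scaleR] C_k_const Suc)
    moreover have "flat_exp m differentiable at t" for t
      using D differentiable_def by blast
    ultimately show ?case unfolding C_k.simps F by simp
  qed
  then show ?thesis by (simp add: smooth_def)
qed

text \<open>The standard mollifier without normalisation, so that its values lie between 0 and 1 for
  every radius. The squared distance keeps it smooth at the centre.\<close>

definition bump :: "'a::real_inner \<Rightarrow> real \<Rightarrow> 'a \<Rightarrow> real" where
  "bump x r z = flat_exp 0 (1 - ((z - x) \<bullet> (z - x)) / r\<^sup>2)"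

lemma smooth_bump: "smooth (bump x r)"
  unfolding bump_def
  apply (intro smooth_compose_real[OF smooth_flat_exp] smooth_diff smooth_const)
  apply (simp only: divide_inverse)
  apply (intro smooth_mult smooth_const smooth_inner smooth_diff smooth_id)
  done

lemma bump_nonneg: "0 \<le> bump x r z"
  by (simp add: bump_def flat_exp_def)

lemma bump_le_1: "bump x r z \<le> 1"
  by (simp add: bump_def flat_exp_def)

lemma bump_pos_iff:
  assumes "r > 0"
  shows "bump x r z > 0 \<longleftrightarrow> z \<in> ball x r"
proof -
  have "bump x r z > 0 \<longleftrightarrow> (norm (z - x))\<^sup>2 < r\<^sup>2"
    using assms by (simp add: bump_def flat_exp_def dot_square_norm divide_less_eq)
  also have "\<dots> \<longleftrightarrow> norm (z - x) < r"
    using assms power_mono_iff[of r "norm (z - x)" 2] by (simp flip: not_le)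
  finally show ?thesis by (simp add: dist_norm norm_minus_commute)
qed

lemma bump_nonzero: "r > 0 \<Longrightarrow> bump x r z \<noteq> 0 \<longleftrightarrow> z \<in> ball x r"
  using bump_pos_iff[of r x z] bump_nonneg[of x r z] by linarith

text \<open>On the half ball the argument of \<open>flat_exp\<close> is at least 1 - 1/4 = 3/4; its
  reciprocal gives the exponent -4/3.\<close>

lemma bump_ge_half:
  assumes "r > 0" "z \<in> ball x (r / 2)"
  shows "exp (- 4 / 3) \<le> bump x r z"
proof -
  have "(norm (z - x))\<^sup>2 \<le> (r/2)\<^sup>2"
    using assms by (intro power_mono) (auto simp: dist_norm norm_minus_commute)
  then have q: "((z - x) \<bullet> (z - x)) / r\<^sup>2 \<le> 1/4"
    using assms(1) by (simp add: dot_square_norm field_simps power2_eq_square)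
  then have "1 / (1 - ((z - x) \<bullet> (z - x)) / r\<^sup>2) \<le> 1 / (3/4)"
    by (intro divide_left_mono) auto
  moreover have "((z - x) \<bullet> (z - x)) / r\<^sup>2 < 1" using q by linarith
  ultimately show ?thesis by (simp add: bump_def flat_exp_def)
qed

lemma bump_scale: "r > 0 \<Longrightarrow> bump x r (x + r *\<^sub>R z) = bump 0 1 z"
  by (simp add: bump_def power2_eq_square)

subsection \<open>Test functions\<close>

lemma test_function_smooth: "test_function U \<phi> \<Longrightarrow> smooth \<phi>"
  by (simp add: test_function_def)

lemma test_functionI:
  fixes \<phi> :: "'a::real_normed_vector \<Rightarrow> 'b::real_normed_vector"
  assumes "smooth \<phi>" "compact K" "K \<subseteq> U" "\<And>x. x \<notin> K \<Longrightarrow> \<phi> x = 0"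
  shows "test_function U \<phi>"
proof -
  have "closure {x. \<phi> x \<noteq> 0} \<subseteq> K"
    using assms(2,4) by (intro closure_minimal compact_imp_closed) auto
  moreover from this have "compact (closure {x. \<phi> x \<noteq> 0})"
    using assms(2) by (metis closed_closure compact_Int_closed inf.absorb_iff2 inf.commute)
  ultimately show ?thesis
    using assms by (auto simp: test_function_def)
qed

lemma test_functionE:
  assumes "test_function U \<phi>"
  obtains K where "compact K" "K \<subseteq> U" "\<And>x. x \<notin> K \<Longrightarrow> \<phi> x = 0" "smooth \<phi>"
proof -
  have "\<phi> x = 0" if "x \<notin> closure {x. \<phi> x \<noteq> 0}" for x
    using that closure_subset[of "{x. \<phi> x \<noteq> 0}"] by auto
  then show ?thesis
    using that assms unfolding test_function_def by metis
qed

lemma test_function_mono: "test_function U \<phi> \<Longrightarrow> U \<subseteq> V \<Longrightarrow> test_function V \<phi>"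
  unfolding test_function_def by (metis order_trans)

lemma test_function_off_U: "test_function U \<phi> \<Longrightarrow> x \<notin> U \<Longrightarrow> \<phi> x = 0"
  by (erule test_functionE) blast

lemma frechet_derivative_off_support:
  assumes "x \<notin> closure {x. \<phi> x \<noteq> 0}"
  shows "frechet_derivative \<phi> (at x) v = 0"
proof -
  have "((\<lambda>_. 0) has_derivative (\<lambda>_. 0)) (at x)" by simp
  then have "(\<phi> has_derivative (\<lambda>_. 0)) (at x)"
    by (rule has_derivative_transform_within_open[where s="- closure {x. \<phi> x \<noteq> 0}"])
       (use assms closure_subset[of "{x. \<phi> x \<noteq> 0}"] in auto)
  then show ?thesis by (rule frechet_derivative_eqI)
qed

lemma test_function_frechet:
  assumes "test_function U \<phi>"
  shows "test_function U (\<lambda>x. frechet_derivative \<phi> (at x) v)"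
proof -
  have K: "compact (closure {x. \<phi> x \<noteq> 0})" "closure {x. \<phi> x \<noteq> 0} \<subseteq> U" "smooth \<phi>"
    using assms by (simp_all add: test_function_def)
  show ?thesis
    by (rule test_functionI[OF smooth_frechet_derivative[OF K(3)] K(1,2)])
       (rule frechet_derivative_off_support)
qed

lemma test_function_bilinear1:
  assumes "bounded_bilinear bop" "test_function U f" "smooth g"
  shows "test_function U (\<lambda>x. bop (f x) (g x))"
proof -
  from assms(2) obtain K where K: "compact K" "K \<subseteq> U" "\<And>x. x \<notin> K \<Longrightarrow> f x = 0" "smooth f"
    by (rule test_functionE) blast
  show ?thesis
    by (rule test_functionI[OF smooth_bilinear[OF assms(1) K(4) assms(3)] K(1,2)])
       (simp add: K(3) bounded_bilinear.zero_left[OF assms(1)])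
qed

lemma test_function_add:
  assumes "test_function U f" "test_function U g"
  shows "test_function U (\<lambda>x. f x + g x)"
proof -
  from assms(1) obtain K where K: "compact K" "K \<subseteq> U" "\<And>x. x \<notin> K \<Longrightarrow> f x = 0" "smooth f"
    by (rule test_functionE) blast
  from assms(2) obtain L where L: "compact L" "L \<subseteq> U" "\<And>x. x \<notin> L \<Longrightarrow> g x = 0" "smooth g"
    by (rule test_functionE) blast
  show ?thesis
    by (rule test_functionI[where K="K \<union> L"]) (use K L in \<open>auto intro: smooth_add\<close>)
qed

lemma test_function_linear:
  assumes "bounded_linear l" "test_function U f"
  shows "test_function U (\<lambda>x. l (f x))"
proof -
  from assms(2) obtain K where K: "compact K" "K \<subseteq> U" "\<And>x. x \<notin> K \<Longrightarrow> f x = 0" "smooth f"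
    by (rule test_functionE) blast
  show ?thesis
    by (rule test_functionI[OF smooth_linear_compose[OF assms(1) K(4)] K(1,2)])
       (simp add: K(3) linear_0 bounded_linear.linear[OF assms(1)])
qed

lemma test_function_scaleR: "test_function U f \<Longrightarrow> test_function U (\<lambda>x. c *\<^sub>R f x)"
  by (rule test_function_linear[OF bounded_linear_scaleR_right])

lemma test_function_uminus: "test_function U f \<Longrightarrow> test_function U (\<lambda>x. - f x)"
  using test_function_scaleR[of U f "-1"] by simp

lemma test_function_diff: "test_function U f \<Longrightarrow> test_function U g \<Longrightarrow> test_function U (\<lambda>x. f x - g x)"
  using test_function_add[OF _ test_function_uminus] by fastforce

lemma test_function_zero [simp]: "test_function U (\<lambda>_. 0)"
  by (simp add: test_function_def)

lemma test_function_sum: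
  "(\<And>i. i \<in> I \<Longrightarrow> test_function U (f i)) \<Longrightarrow> test_function U (\<lambda>x. \<Sum>i\<in>I. f i x)"
  by (induction I rule: infinite_finite_induct) (auto intro: test_function_add)

lemma test_function_bump:
  fixes x :: "'a::euclidean_space"
  assumes "0 < r" "cball x r \<subseteq> U"
  shows "test_function U (bump x r)"
proof (rule test_functionI[OF smooth_bump compact_cball assms(2)])
  fix z assume "z \<notin> cball x r"
  then show "bump x r z = 0" using bump_nonzero[OF assms(1), of x z] by auto
qed

subsection \<open>Square integrable functions\<close>

text \<open>An arbitrary measure is allowed because the Hardy inequality is integrated over
  \<open>lborel\<close>, while solutions live on \<open>lebesgue_on U\<close>.\<close>

definition L2 :: "'a measure \<Rightarrow> ('a \<Rightarrow> 'b::euclidean_space) \<Rightarrow> bool" where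
  "L2 M f \<longleftrightarrow> f \<in> borel_measurable M \<and> integrable M (\<lambda>x. (norm (f x))\<^sup>2)"

definition l2norm :: "'a measure \<Rightarrow> ('a \<Rightarrow> 'b::euclidean_space) \<Rightarrow> real" where
  "l2norm M f = sqrt (\<integral>x. (norm (f x))\<^sup>2 \<partial>M)"

lemma L2_measurable: "L2 M f \<Longrightarrow> f \<in> borel_measurable M"
  and L2_integrable: "L2 M f \<Longrightarrow> integrable M (\<lambda>x. (norm (f x))\<^sup>2)"
  by (simp_all add: L2_def)

lemma l2norm_nonneg [simp]: "0 \<le> l2norm M f"
  by (simp add: l2norm_def)

lemma l2norm_square: "(l2norm M f)\<^sup>2 = (\<integral>x. (norm (f x))\<^sup>2 \<partial>M)"
  by (simp add: l2norm_def)

lemma L2_prod_integrable: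
  assumes "L2 M f" "L2 M g"
  shows "integrable M (\<lambda>x. norm (f x) * norm (g x))"
proof (rule Bochner_Integration.integrable_bound)
  show "integrable M (\<lambda>x. (norm (f x))\<^sup>2 + (norm (g x))\<^sup>2)"
    using assms by (auto simp: L2_def)
  have "norm (f x) * norm (g x) \<le> (norm (f x))\<^sup>2 + (norm (g x))\<^sup>2" for x
  proof -
    have "2 * (norm (f x) * norm (g x)) \<le> (norm (f x))\<^sup>2 + (norm (g x))\<^sup>2"
      using sum_squares_bound[of "norm (f x)" "norm (g x)"] by (simp add: mult.assoc)
    moreover have "0 \<le> norm (f x) * norm (g x)" by simp
    ultimately show ?thesis by linarith
  qed
  then show "AE x in M. norm (norm (f x) * norm (g x)) \<le> norm ((norm (f x))\<^sup>2 + (norm (g x))\<^sup>2)"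
    by auto
  show "(\<lambda>x. norm (f x) * norm (g x)) \<in> borel_measurable M"
    using assms[THEN L2_measurable] by simp
qed

lemma L2_bounded_prod:
  assumes "L2 M f" "L2 M g" "h \<in> borel_measurable M" "\<And>x. x \<in> space M \<Longrightarrow> \<bar>h x\<bar> \<le> norm (f x) * norm (g x)"
  shows "integrable M h"
  by (rule Bochner_Integration.integrable_bound[OF L2_prod_integrable[OF assms(1,2)] assms(3)])
     (use assms(4) in auto)

text \<open>A quadratic polynomial without sign change has nonpositive discriminant, including the
  degenerate case A = 0. It serves the Cauchy-Schwarz inequality and, later, the first variation of
  an almost minimiser.\<close>

lemma discriminant_bound:
  fixes A B P :: real
  assumes "\<And>s. 0 \<le> s\<^sup>2 * A - 2 * s * P + B" "0 \<le> A"
  shows "P\<^sup>2 \<le> A * B"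
proof (cases "A = 0")
  case True
  have "P = 0"
  proof (rule ccontr)
    assume "P \<noteq> 0"
    \<comment> \<open>At this s the affine function B - 2 s P takes the value -1.\<close>
    then show False using assms(1)[of "(B + 1) / (2 * P)"] True by simp
  qed
  then show ?thesis using True by simp
next
  case False
  then have "A > 0" using assms by simp
  then have "0 \<le> A * ((P / A)\<^sup>2 * A - 2 * (P / A) * P + B)"
    using assms(1)[of "P / A"] by (intro mult_nonneg_nonneg) auto
  also have "\<dots> = A * B - P\<^sup>2" using \<open>A > 0\<close> by (simp add: field_simps power2_eq_square)
  finally show ?thesis by simp
qed

lemma l2_Cauchy_Schwarz:
  assumes "L2 M f" "L2 M g"
  shows "(\<integral>x. norm (f x) * norm (g x) \<partial>M) \<le> l2norm M f * l2norm M g"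
proof -
  let ?P = "\<integral>x. norm (f x) * norm (g x) \<partial>M"
  have "0 \<le> s\<^sup>2 * (l2norm M f)\<^sup>2 - 2 * s * ?P + (l2norm M g)\<^sup>2" for s
  proof -
    have "0 \<le> (\<integral>x. (s * norm (f x) - norm (g x))\<^sup>2 \<partial>M)" by simp
    also have "\<dots> = (\<integral>x. s\<^sup>2 * (norm (f x))\<^sup>2 - 2 * s * (norm (f x) * norm (g x)) + (norm (g x))\<^sup>2 \<partial>M)"
      by (simp add: power2_diff power_mult_distrib algebra_simps)
    also have "\<dots> = s\<^sup>2 * (l2norm M f)\<^sup>2 - 2 * s * ?P + (l2norm M g)\<^sup>2"
      using L2_prod_integrable[OF assms] assms[THEN L2_integrable] by (simp add: l2norm_square)
    finally show ?thesis .
  qed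
  then have "?P\<^sup>2 \<le> (l2norm M f)\<^sup>2 * (l2norm M g)\<^sup>2"
    by (rule discriminant_bound) simp
  then have "?P\<^sup>2 \<le> (l2norm M f * l2norm M g)\<^sup>2" by (simp add: power_mult_distrib)
  then show ?thesis by (rule power2_le_imp_le) simp
qed

text \<open>Measurability of h need not be checked: the integral of a function that is not
  integrable is 0 by convention, and the bound is then trivial.\<close>

lemma l2_bounded_prod_le:
  assumes "L2 M f" "L2 M g" "\<And>x. x \<in> space M \<Longrightarrow> \<bar>h x\<bar> \<le> norm (f x) * norm (g x)"
  shows "\<bar>\<integral>x. h x \<partial>M\<bar> \<le> l2norm M f * l2norm M g"
proof (cases "integrable M h")
  case True
  have "\<bar>\<integral>x. h x \<partial>M\<bar> \<le> (\<integral>x. \<bar>h x\<bar> \<partial>M)"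
    using integral_norm_bound[of M h] by simp
  also have "\<dots> \<le> (\<integral>x. norm (f x) * norm (g x) \<partial>M)"
    using True L2_prod_integrable[OF assms(1,2)] assms(3) by (intro integral_mono) auto
  also have "\<dots> \<le> l2norm M f * l2norm M g" by (rule l2_Cauchy_Schwarz[OF assms(1,2)])
  finally show ?thesis .
qed (simp add: not_integrable_integral_eq)

lemma L2_inner_integrable: "L2 M f \<Longrightarrow> L2 M g \<Longrightarrow> integrable M (\<lambda>x. f x \<bullet> g x)"
  by (rule L2_bounded_prod[of M f g]) (auto simp: L2_def Cauchy_Schwarz_ineq2)

lemma l2_inner_le: "L2 M f \<Longrightarrow> L2 M g \<Longrightarrow> \<bar>\<integral>x. f x \<bullet> g x \<partial>M\<bar> \<le> l2norm M f * l2norm M g"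
  by (rule l2_bounded_prod_le[of M f g]) (auto simp: Cauchy_Schwarz_ineq2)

lemma L2_bound:
  assumes "L2 M f" "g \<in> borel_measurable M" "\<And>x. x \<in> space M \<Longrightarrow> norm (g x) \<le> c * norm (f x)"
  shows "L2 M g"
  unfolding L2_def
proof
  show "integrable M (\<lambda>x. (norm (g x))\<^sup>2)"
  proof (rule Bochner_Integration.integrable_bound)
    show "integrable M (\<lambda>x. c\<^sup>2 * (norm (f x))\<^sup>2)" using assms by (simp add: L2_def)
    have "(norm (g x))\<^sup>2 \<le> c\<^sup>2 * (norm (f x))\<^sup>2" if "x \<in> space M" for x
      using power_mono[OF assms(3)[OF that], of 2] by (simp add: power_mult_distrib)
    then show "AE x in M. norm ((norm (g x))\<^sup>2) \<le> norm (c\<^sup>2 * (norm (f x))\<^sup>2)"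
      by (auto intro!: AE_I2)
  qed (use assms in measurable)
qed fact

lemma l2norm_mono:
  assumes "L2 M f" "c \<ge> 0" "\<And>x. x \<in> space M \<Longrightarrow> norm (g x) \<le> c * norm (f x)"
  shows "l2norm M g \<le> c * l2norm M f"
proof -
  have "(\<integral>x. (norm (g x))\<^sup>2 \<partial>M) \<le> (\<integral>x. c\<^sup>2 * (norm (f x))\<^sup>2 \<partial>M)"
  proof (rule integral_mono')
    show "integrable M (\<lambda>x. c\<^sup>2 * (norm (f x))\<^sup>2)" using assms by (simp add: L2_def)
    show "(norm (g x))\<^sup>2 \<le> c\<^sup>2 * (norm (f x))\<^sup>2" if "x \<in> space M" for x
      using power_mono[OF assms(3)[OF that], of 2] by (simp add: power_mult_distrib)
  qed auto
  also have "\<dots> = (c * l2norm M f)\<^sup>2"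
    by (simp add: power_mult_distrib l2norm_square)
  finally show ?thesis unfolding l2norm_def[of M g]
    using assms(2) by (intro real_le_lsqrt) auto
qed

lemma L2_scaleR: "L2 M f \<Longrightarrow> L2 M (\<lambda>x. c *\<^sub>R f x)"
  by (rule L2_bound[where c="\<bar>c\<bar>"]) (auto simp: L2_def)

lemma l2norm_scaleR: "l2norm M (\<lambda>x. c *\<^sub>R f x) = \<bar>c\<bar> * l2norm M f"
  by (simp add: l2norm_def power_mult_distrib real_sqrt_mult)

lemma L2_add:
  assumes "L2 M f" "L2 M g"
  shows "L2 M (\<lambda>x. f x + g x)"
  unfolding L2_def
proof
  have [measurable]: "f \<in> borel_measurable M" "g \<in> borel_measurable M"
    using assms L2_measurable by auto
  show "integrable M (\<lambda>x. (norm (f x + g x))\<^sup>2)"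
  proof (rule Bochner_Integration.integrable_bound)
    show "integrable M (\<lambda>x. 2 * (norm (f x))\<^sup>2 + 2 * (norm (g x))\<^sup>2)" using assms by (simp add: L2_def)
    have "(norm (f x + g x))\<^sup>2 \<le> 2 * (norm (f x))\<^sup>2 + 2 * (norm (g x))\<^sup>2" for x
    proof -
      have "(norm (f x + g x))\<^sup>2 \<le> (norm (f x) + norm (g x))\<^sup>2"
        by (intro power_mono norm_triangle_ineq) auto
      then show ?thesis using sum_squares_bound[of "norm (f x)" "norm (g x)"]
        by (simp add: power2_sum)
    qed
    then show "AE x in M. norm ((norm (f x + g x))\<^sup>2) \<le> norm (2 * (norm (f x))\<^sup>2 + 2 * (norm (g x))\<^sup>2)"
      by (auto intro!: AE_I2)
    show "(\<lambda>x. (norm (f x + g x))\<^sup>2) \<in> borel_measurable M" by measurable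
  qed
  show "(\<lambda>x. f x + g x) \<in> borel_measurable M" by measurable
qed

lemma L2_uminus: "L2 M f \<Longrightarrow> L2 M (\<lambda>x. - f x)"
  using L2_scaleR[of M f "-1"] by simp

lemma L2_diff: "L2 M f \<Longrightarrow> L2 M g \<Longrightarrow> L2 M (\<lambda>x. f x - g x)"
  using L2_add[OF _ L2_uminus] by fastforce

lemma l2norm_minus_commute: "l2norm M (\<lambda>x. f x - g x) = l2norm M (\<lambda>x. g x - f x)"
  by (simp add: l2norm_def norm_minus_commute)

lemma l2norm_triangle:
  assumes "L2 M f" "L2 M g"
  shows "l2norm M (\<lambda>x. f x + g x) \<le> l2norm M f + l2norm M g"
proof -
  have "(l2norm M (\<lambda>x. f x + g x))\<^sup>2 = (\<integral>x. (norm (f x))\<^sup>2 + 2 * (f x \<bullet> g x) + (norm (g x))\<^sup>2 \<partial>M)"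
    unfolding l2norm_square
    by (simp add: power2_norm_eq_inner inner_add inner_commute algebra_simps)
  also have "\<dots> = (l2norm M f)\<^sup>2 + 2 * (\<integral>x. f x \<bullet> g x \<partial>M) + (l2norm M g)\<^sup>2"
    using L2_inner_integrable[OF assms] assms[THEN L2_integrable] by (simp add: l2norm_square)
  also have "\<dots> \<le> (l2norm M f + l2norm M g)\<^sup>2"
    using l2_inner_le[OF assms] by (simp add: power2_sum)
  finally show ?thesis by (rule power2_le_imp_le) simp
qed

lemma l2norm_abs_diff_le:
  assumes "L2 M f" "L2 M g"
  shows "\<bar>l2norm M f - l2norm M g\<bar> \<le> l2norm M (\<lambda>x. f x - g x)"
proof -
  have "l2norm M f \<le> l2norm M (\<lambda>x. f x - g x) + l2norm M g"
    using l2norm_triangle[OF L2_diff[OF assms] assms(2)] by simp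
  moreover have "l2norm M g \<le> l2norm M (\<lambda>x. f x - g x) + l2norm M f"
    using l2norm_triangle[OF L2_diff[OF assms(2,1)] assms(1)] l2norm_minus_commute[of M f g] by simp
  ultimately show ?thesis by linarith
qed

lemma l2norm_tendsto:
  assumes "\<And>k. L2 M (f k)" "L2 M g" "(\<lambda>k. l2norm M (\<lambda>x. g x - f k x)) \<longlonglongrightarrow> 0"
  shows "(\<lambda>k. l2norm M (f k)) \<longlonglongrightarrow> l2norm M g"
proof (rule LIM_zero_cancel, rule Lim_null_comparison[OF _ assms(3)])
  show "\<forall>\<^sub>F k in sequentially. norm (l2norm M (f k) - l2norm M g) \<le> l2norm M (\<lambda>x. g x - f k x)"
    using l2norm_abs_diff_le[OF assms(1,2)] by (auto simp: l2norm_minus_commute[of M g])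
qed

lemma l2_inner_tendsto:
  assumes "\<And>k. L2 M (f k)" "L2 M g" "L2 M h" "(\<lambda>k. l2norm M (\<lambda>x. g x - f k x)) \<longlonglongrightarrow> 0"
  shows "(\<lambda>k. \<integral>x. f k x \<bullet> h x \<partial>M) \<longlonglongrightarrow> (\<integral>x. g x \<bullet> h x \<partial>M)"
proof (rule LIM_zero_cancel, rule Lim_null_comparison)
  show "(\<lambda>k. l2norm M (\<lambda>x. g x - f k x) * l2norm M h) \<longlonglongrightarrow> 0"
    using tendsto_mult_right[OF assms(4), of "l2norm M h"] by simp
  have "norm ((\<integral>x. f k x \<bullet> h x \<partial>M) - (\<integral>x. g x \<bullet> h x \<partial>M)) \<le> l2norm M (\<lambda>x. g x - f k x) * l2norm M h" for k
  proof -
    have "(\<integral>x. f k x \<bullet> h x \<partial>M) - (\<integral>x. g x \<bullet> h x \<partial>M) = (\<integral>x. (f k x - g x) \<bullet> h x \<partial>M)"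
      using assms by (simp add: L2_inner_integrable inner_diff_left)
    then show ?thesis
      using l2_inner_le[OF L2_diff[OF assms(1)[of k] assms(2)] assms(3)] by (simp add: l2norm_minus_commute)
  qed
  then show "\<forall>\<^sub>F k in sequentially. norm ((\<integral>x. f k x \<bullet> h x \<partial>M) - (\<integral>x. g x \<bullet> h x \<partial>M))
      \<le> l2norm M (\<lambda>x. g x - f k x) * l2norm M h" by simp
qed

lemma L2_nn_integral:
  assumes "f \<in> borel_measurable M" "(\<integral>\<^sup>+x. ennreal ((norm (f x))\<^sup>2) \<partial>M) \<le> ennreal (c\<^sup>2)" "c \<ge> 0"
  shows "L2 M f" "l2norm M f \<le> c"
proof -
  have "(\<integral>\<^sup>+x. ennreal ((norm (f x))\<^sup>2) \<partial>M) < \<infinity>"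
    using assms(2) by (auto simp: less_top[symmetric] top_unique)
  then have int: "integrable M (\<lambda>x. (norm (f x))\<^sup>2)"
    using assms(1) by (intro integrableI_bounded) auto
  then show "L2 M f" using assms(1) by (simp add: L2_def)
  have "ennreal (\<integral>x. (norm (f x))\<^sup>2 \<partial>M) \<le> ennreal (c\<^sup>2)"
    using assms(2) nn_integral_eq_integral[OF int] by simp
  then have "(\<integral>x. (norm (f x))\<^sup>2 \<partial>M) \<le> c\<^sup>2"
    by (simp add: ennreal_le_iff)
  then show "l2norm M f \<le> c"
    unfolding l2norm_def using assms(3) by (intro real_le_lsqrt) auto
qed

lemma L2_nn_integral_eq: "L2 M f \<Longrightarrow> (\<integral>\<^sup>+x. ennreal ((norm (f x))\<^sup>2) \<partial>M) = ennreal ((l2norm M f)\<^sup>2)"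
  by (simp add: l2norm_square nn_integral_eq_integral L2_integrable)

text \<open>Fatou's lemma for the squared norms of f - h j. It turns uniform closeness to a sequence
  into closeness to its almost everywhere limit.\<close>

lemma L2_fatou:
  assumes h: "\<And>j. L2 M (h j)" and f: "L2 M f" and g: "g \<in> borel_measurable M"
    and lim: "AE x in M. (\<lambda>j. h j x) \<longlonglongrightarrow> g x"
    and bound: "\<forall>\<^sub>F j in sequentially. l2norm M (\<lambda>x. f x - h j x) \<le> c"
  shows "L2 M (\<lambda>x. f x - g x)" "l2norm M (\<lambda>x. f x - g x) \<le> c"
proof -
  have c: "c \<ge> 0" using bound eventually_sequentially l2norm_nonneg order_trans by (metis (no_types, lifting) order_refl)
  have "(\<integral>\<^sup>+x. ennreal ((norm (f x - g x))\<^sup>2) \<partial>M)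
      = (\<integral>\<^sup>+x. liminf (\<lambda>j. ennreal ((norm (f x - h j x))\<^sup>2)) \<partial>M)"
  proof (rule nn_integral_cong_AE)
    show "AE x in M. ennreal ((norm (f x - g x))\<^sup>2) = liminf (\<lambda>j. ennreal ((norm (f x - h j x))\<^sup>2))"
      using lim
    proof eventually_elim
      case (elim x)
      have "(\<lambda>j. ennreal ((norm (f x - h j x))\<^sup>2)) \<longlonglongrightarrow> ennreal ((norm (f x - g x))\<^sup>2)"
        by (intro tendsto_intros elim)
      from lim_imp_Liminf[OF _ this] show ?case by simp
    qed
  qed
  also have "\<dots> \<le> liminf (\<lambda>j. \<integral>\<^sup>+x. ennreal ((norm (f x - h j x))\<^sup>2) \<partial>M)"
    using h[THEN L2_measurable] f[THEN L2_measurable] by (intro nn_integral_liminf) measurable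
  also have "\<dots> \<le> liminf (\<lambda>j. ennreal (c\<^sup>2))"
  proof (rule Liminf_mono)
    show "\<forall>\<^sub>F j in sequentially. (\<integral>\<^sup>+x. ennreal ((norm (f x - h j x))\<^sup>2) \<partial>M) \<le> ennreal (c\<^sup>2)"
      using bound
    proof eventually_elim
      case (elim j)
      then show ?case using L2_diff[OF f h] by (simp add: L2_nn_integral_eq power_mono ennreal_leI)
    qed
  qed
  also have "\<dots> = ennreal (c\<^sup>2)" by (simp add: Liminf_const)
  finally have *: "(\<integral>\<^sup>+x. ennreal ((norm (f x - g x))\<^sup>2) \<partial>M) \<le> ennreal (c\<^sup>2)" .
  have m: "(\<lambda>x. f x - g x) \<in> borel_measurable M" using f[THEN L2_measurable] g by measurable
  show "L2 M (\<lambda>x. f x - g x)" "l2norm M (\<lambda>x. f x - g x) \<le> c"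
    using L2_nn_integral[OF m * c] by auto
qed

text \<open>The sum of 2^k |h (k+1) - h k|^2 has finite integral, bounded by the series of 8^(-k),
  hence is finite almost everywhere. The weight 2^k then makes the increments decay like 2^(-k/2),
  so they are summable. Only squares are integrated, so the measure may be infinite.\<close>

lemma rapidly_Cauchy_AE_convergent:
  fixes h :: "nat \<Rightarrow> 'a \<Rightarrow> 'b::euclidean_space"
  assumes h: "\<And>k. L2 M (h k)" and fast: "\<And>k. l2norm M (\<lambda>x. h (Suc k) x - h k x) \<le> (1/4) ^ k"
  shows "AE x in M. convergent (\<lambda>k. h k x)"
proof -
  define d where "d k x = 2 ^ k * (norm (h (Suc k) x - h k x))\<^sup>2" for k x
  have hm [measurable]: "h k \<in> borel_measurable M" for k using h L2_measurable by blast
  have dm [measurable]: "d k \<in> borel_measurable M" for k unfolding d_def by measurable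
  have "(\<integral>\<^sup>+x. (\<Sum>k. ennreal (d k x)) \<partial>M) = (\<Sum>k. \<integral>\<^sup>+x. ennreal (d k x) \<partial>M)"
    by (intro nn_integral_suminf) measurable
  also have "\<dots> \<le> (\<Sum>k. ennreal ((1/8) ^ k))"
  proof (rule suminf_le)
    fix k
    have "(\<integral>\<^sup>+x. ennreal (d k x) \<partial>M) = ennreal (2^k) * (\<integral>\<^sup>+x. ennreal ((norm (h (Suc k) x - h k x))\<^sup>2) \<partial>M)"
      unfolding d_def by (subst nn_integral_cmult[symmetric]) (auto simp: ennreal_mult)
    also have "\<dots> = ennreal (2^k * (l2norm M (\<lambda>x. h (Suc k) x - h k x))\<^sup>2)"
      using L2_nn_integral_eq[OF L2_diff[OF h h]] by (simp add: ennreal_mult)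
    also have "\<dots> \<le> ennreal (2^k * ((1/4)^k)\<^sup>2)"
      by (intro ennreal_leI mult_left_mono power_mono fast) auto
    also have "2^k * ((1/4)^k)\<^sup>2 = ((1/8)^k :: real)"
      by (simp add: power2_eq_square flip: power_mult_distrib)
    finally show "(\<integral>\<^sup>+x. ennreal (d k x) \<partial>M) \<le> ennreal ((1/8) ^ k)" .
  qed auto
  also have "\<dots> = ennreal (\<Sum>k. (1/8) ^ k)"
    by (intro suminf_ennreal2) (auto intro: summable_geometric)
  also have "\<dots> < \<infinity>" by simp
  finally have "AE x in M. (\<Sum>k. ennreal (d k x)) \<noteq> \<infinity>"
    by (intro nn_integral_PInf_AE) auto
  then show ?thesis
  proof eventually_elim
    case (elim x)
    then have "summable (\<lambda>k. d k x)"
      by (intro summable_suminf_not_top) (auto simp: d_def top_neq_ennreal)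
    then have "Bseq (\<lambda>k. d k x)"
      using summable_LIMSEQ_zero convergent_imp_Bseq convergentI by blast
    then obtain S where S: "S > 0" "\<And>k. norm (d k x) \<le> S" by (auto simp: Bseq_def)
    have "norm (h (Suc k) x - h k x) \<le> sqrt S * (sqrt (1/2)) ^ k" for k
    proof -
      have "(norm (h (Suc k) x - h k x))\<^sup>2 = d k x * (1/2)^k" by (simp add: d_def power_one_over)
      also have "\<dots> \<le> S * (1/2)^k" using S(2)[of k] by (intro mult_right_mono) auto
      finally have "norm (h (Suc k) x - h k x) \<le> sqrt (S * (1/2)^k)" by (rule real_le_rsqrt)
      then show ?thesis by (simp add: real_sqrt_mult real_sqrt_power real_sqrt_divide)
    qed
    moreover have "summable (\<lambda>k. sqrt S * (sqrt (1/2)) ^ k)"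
      by (intro summable_mult summable_geometric) simp
    ultimately have "summable (\<lambda>k. h (Suc k) x - h k x)"
      using summable_comparison_test'[of "\<lambda>k. sqrt S * (sqrt (1/2)) ^ k" 0 "\<lambda>k. h (Suc k) x - h k x"] by blast
    then have "convergent (\<lambda>n. \<Sum>k<n. h (Suc k) x - h k x)" by (simp add: summable_iff_convergent)
    then have "convergent (\<lambda>n. (h n x - h 0 x) + h 0 x)"
      by (intro convergent_add convergent_const) (simp add: sum_lessThan_telescope[of "\<lambda>k. h k x"])
    then show ?case by simp
  qed
qed

text \<open>The Riesz-Fischer argument: a rapidly Cauchy subsequence converges almost everywhere,
  and \<open>L2_fatou\<close> converts the Cauchy condition into convergence of the full sequence in
  norm.\<close>

lemma L2_complete:
  fixes f :: "nat \<Rightarrow> 'a \<Rightarrow> 'b::euclidean_space"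
  assumes f: "\<And>k. L2 M (f k)"
    and cauchy: "\<And>e. e > 0 \<Longrightarrow> \<exists>N. \<forall>m\<ge>N. \<forall>n\<ge>N. l2norm M (\<lambda>x. f m x - f n x) < e"
  shows "\<exists>g. L2 M g \<and> (\<lambda>k. l2norm M (\<lambda>x. g x - f k x)) \<longlonglongrightarrow> 0"
proof -
  have "\<forall>k. \<exists>N. \<forall>m\<ge>N. \<forall>n\<ge>N. l2norm M (\<lambda>x. f m x - f n x) < (1/4) ^ k"
    using cauchy by simp
  then obtain N where N: "\<And>k m n. m \<ge> N k \<Longrightarrow> n \<ge> N k \<Longrightarrow> l2norm M (\<lambda>x. f m x - f n x) < (1/4) ^ k"
    by metis
  \<comment> \<open>Partial sums give a nondecreasing index sequence that dominates N.\<close>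
  define r where "r k = (\<Sum>j\<le>k. N j)" for k
  have r: "r j \<ge> N k" if "j \<ge> k" for j k
    unfolding r_def using that by (intro member_le_sum) auto
  define h where "h k = f (r k)" for k
  define g where "g x = lim (\<lambda>k. h k x)" for x
  have h: "L2 M (h k)" for k by (simp add: h_def f)
  have hm [measurable]: "h k \<in> borel_measurable M" for k using h L2_measurable by blast
  have gm: "g \<in> borel_measurable M" unfolding g_def by measurable
  have lim: "AE x in M. (\<lambda>k. h k x) \<longlonglongrightarrow> g x"
    using rapidly_Cauchy_AE_convergent[OF h] N[OF r r]
    unfolding g_def h_def by (simp add: convergent_LIMSEQ_iff less_imp_le)
  have est: "L2 M (\<lambda>x. f n x - g x)" "l2norm M (\<lambda>x. f n x - g x) \<le> (1/4)^k" if "n \<ge> N k" for n k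
  proof -
    have "\<forall>\<^sub>F j in sequentially. l2norm M (\<lambda>x. f n x - h j x) \<le> (1/4) ^ k"
      unfolding eventually_sequentially h_def using N[OF that r] by (intro exI[of _ k]) (auto intro: less_imp_le)
    from L2_fatou[OF h f gm lim this]
    show "L2 M (\<lambda>x. f n x - g x)" "l2norm M (\<lambda>x. f n x - g x) \<le> (1/4)^k" by auto
  qed
  have "L2 M g" using L2_diff[OF f[of "N 0"] est(1)[of 0 "N 0"]] by simp
  moreover have "(\<lambda>k. l2norm M (\<lambda>x. g x - f k x)) \<longlonglongrightarrow> 0"
  proof (rule LIMSEQ_I)
    fix e :: real assume "e > 0"
    then obtain k where k: "(1/4::real)^k < e" using real_arch_pow_inv[of e "1/4"] by auto
    show "\<exists>no. \<forall>n\<ge>no. norm (l2norm M (\<lambda>x. g x - f n x) - 0) < e"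
      using est(2)[of k] k by (intro exI[of _ "N k"]) (auto simp: l2norm_minus_commute[of M g] intro: order_le_less_trans)
  qed
  ultimately show ?thesis by blast
qed

section \<open>Integral calculus; the Hardy and Poincare inequalities\<close>

subsection \<open>Integration of smooth functions\<close>

text \<open>By the mean value bound, B dominates all difference quotients near t0 and not only the
  derivatives, so dominated convergence applies along every sequence of increments.\<close>

lemma has_real_derivative_integral:
  fixes k :: "real \<Rightarrow> 'a \<Rightarrow> real"
  assumes t0: "t0 \<in> {a<..<b}"
    and int: "\<And>s. s \<in> {a<..<b} \<Longrightarrow> integrable M (k s)"
    and der: "\<And>s x. s \<in> {a<..<b} \<Longrightarrow> x \<in> space M \<Longrightarrow> ((\<lambda>s. k s x) has_real_derivative k' s x) (at s)"
    and bound: "\<And>s x. s \<in> {a<..<b} \<Longrightarrow> x \<in> space M \<Longrightarrow> \<bar>k' s x\<bar> \<le> B x"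
    and B: "integrable M B"
    and meas: "k' t0 \<in> borel_measurable M"
  shows "((\<lambda>s. \<integral>x. k s x \<partial>M) has_real_derivative (\<integral>x. k' t0 x \<partial>M)) (at t0)"
  unfolding DERIV_def tendsto_at_iff_sequentially
proof (intro allI impI)
  fix X :: "nat \<Rightarrow> real" assume X: "\<forall>i. X i \<in> UNIV - {0}" and X0: "X \<longlonglongrightarrow> 0"
  have "(\<lambda>i. t0 + X i) \<longlonglongrightarrow> t0" using tendsto_add[OF tendsto_const[of t0] X0] by simp
  then have "\<forall>\<^sub>F i in sequentially. t0 + X i \<in> {a<..<b}"
    using t0 by (intro topological_tendstoD) auto
  then obtain N where N: "\<And>i. i \<ge> N \<Longrightarrow> t0 + X i \<in> {a<..<b}" by (auto simp: eventually_sequentially)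
  have "(\<lambda>i. \<integral>x. (k (t0 + X (i + N)) x - k t0 x) / X (i + N) \<partial>M) \<longlonglongrightarrow> (\<integral>x. k' t0 x \<partial>M)"
  proof (rule integral_dominated_convergence[OF meas _ B])
    show "(\<lambda>x. (k (t0 + X (i + N)) x - k t0 x) / X (i + N)) \<in> borel_measurable M" for i
      using int[OF N[of "i+N"]] int[OF t0] by auto
    show "AE x in M. (\<lambda>i. (k (t0 + X (i + N)) x - k t0 x) / X (i + N)) \<longlonglongrightarrow> k' t0 x"
    proof (rule AE_I2)
      fix x assume "x \<in> space M"
      then have "(\<lambda>i. (k (t0 + X i) x - k t0 x) / X i) \<longlonglongrightarrow> k' t0 x"
        using der[OF t0] X X0 unfolding DERIV_def tendsto_at_iff_sequentially comp_def by auto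
      then show "(\<lambda>i. (k (t0 + X (i + N)) x - k t0 x) / X (i + N)) \<longlonglongrightarrow> k' t0 x"
        by (rule LIMSEQ_ignore_initial_segment)
    qed
    show "AE x in M. norm ((k (t0 + X (i + N)) x - k t0 x) / X (i + N)) \<le> B x" for i
    proof (rule AE_I2)
      fix x assume x: "x \<in> space M"
      have "norm (k (t0 + X (i + N)) x - k t0 x) \<le> B x * norm (t0 + X (i + N) - t0)"
        using der bound x t0 N[of "i+N"]
        by (intro field_differentiable_bound[of "{a<..<b}" _ "\<lambda>s. k' s x"])
           (auto intro: has_field_derivative_at_within)
      then show "norm ((k (t0 + X (i + N)) x - k t0 x) / X (i + N)) \<le> B x"
        using X by (simp add: divide_le_eq)
    qed
  qed
  also have "(\<lambda>i. \<integral>x. (k (t0 + X (i + N)) x - k t0 x) / X (i + N) \<partial>M)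
      = (\<lambda>i. ((\<integral>x. k (t0 + X (i + N)) x \<partial>M) - (\<integral>x. k t0 x \<partial>M)) / X (i + N))"
    using int[OF N] int[OF t0] by (auto simp: Bochner_Integration.integral_diff)
  finally show "((\<lambda>h. ((\<integral>x. k (t0 + h) x \<partial>M) - (\<integral>x. k t0 x \<partial>M)) / h) \<circ> X) \<longlonglongrightarrow> (\<integral>x. k' t0 x \<partial>M)"
    unfolding comp_def by (rule LIMSEQ_offset)
qed

lemma continuous_compact_support_bounded:
  fixes f :: "'a::euclidean_space \<Rightarrow> 'b::euclidean_space"
  assumes "continuous_on UNIV f" "compact K" "\<And>x. x \<notin> K \<Longrightarrow> f x = 0"
  obtains C where "C > 0" "\<And>x. norm (f x) \<le> C"
proof -
  have "bounded (f ` K)"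
    using assms by (intro compact_imp_bounded compact_continuous_image) (auto intro: continuous_on_subset)
  then obtain C where C: "C > 0" "\<And>x. x \<in> K \<Longrightarrow> norm (f x) \<le> C"
    by (auto simp: bounded_pos)
  have "norm (f x) \<le> C" for x
    using C assms(3)[of x] by (cases "x \<in> K") auto
  then show ?thesis using that C by blast
qed

lemma continuous_compact_support_integrable:
  fixes f :: "'a::euclidean_space \<Rightarrow> 'b::euclidean_space"
  assumes "continuous_on UNIV f" "compact K" "\<And>x. x \<notin> K \<Longrightarrow> f x = 0"
  shows "integrable lborel f"
proof -
  have "integrable lborel (\<lambda>x. indicator K x *\<^sub>R f x)"
    using assms by (intro borel_integrable_compact) (auto intro: continuous_on_subset)
  also have "(\<lambda>x. indicator K x *\<^sub>R f x) = f"
    using assms(3) by (auto simp: indicator_def)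
  finally show ?thesis .
qed

lemma lborel_integral_translate:
  fixes f :: "'a::euclidean_space \<Rightarrow> real"
  assumes "f \<in> borel_measurable borel"
  shows "(\<integral>x. f (x + c) \<partial>lborel) = (\<integral>x. f x \<partial>lborel)"
proof -
  have "(\<integral>x. f x \<partial>lborel) = (\<integral>x. f x \<partial>distr lborel borel ((+) c))"
    by (simp add: lborel_distr_plus)
  also have "\<dots> = (\<integral>x. f (c + x) \<partial>lborel)"
    using assms by (subst integral_distr) auto
  finally show ?thesis by (simp add: add.commute)
qed

text \<open>The integral of h(x + s v) does not depend on s by translation invariance;
  differentiating it at s = 0 under the integral gives the claim. This is the only source of
  integration by parts in the development.\<close>

lemma integral_derivative_zero:
  fixes h :: "'a::euclidean_space \<Rightarrow> real"
  assumes der: "\<And>x. (h has_derivative h' x) (at x)" and cont: "continuous_on UNIV (\<lambda>x. h' x v)"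
    and K: "compact K" "\<And>x. x \<notin> K \<Longrightarrow> h x = 0" "\<And>x. x \<notin> K \<Longrightarrow> h' x v = 0"
  shows "(\<integral>x. h' x v \<partial>lborel) = 0"
proof -
  have ch: "continuous_on UNIV h"
    by (intro continuous_at_imp_continuous_on ballI has_derivative_continuous[OF der])
  then have hm [measurable]: "h \<in> borel_measurable borel" by (rule borel_measurable_continuous_onI)
  obtain C where C: "C > 0" "\<And>x. norm (h' x v) \<le> C"
    by (rule continuous_compact_support_bounded[OF cont K(1,3)]) auto
  obtain R where R: "\<And>x. x \<in> K \<Longrightarrow> norm x \<le> R" using compact_imp_bounded[OF K(1)] by (auto simp: bounded_iff)
  \<comment> \<open>For |s| < 1 the translated supports stay in this ball, so a multiple of its
    indicator dominates all derivatives.\<close>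
  let ?B = "cball (0::'a) (R + norm v)"
  have "((\<lambda>s. \<integral>x. h (x + s *\<^sub>R v) \<partial>lborel) has_real_derivative (\<integral>x. h' (x + 0 *\<^sub>R v) v \<partial>lborel)) (at 0)"
  proof (rule has_real_derivative_integral[where a="-1" and b=1 and B="\<lambda>x. indicator ?B x * C"])
    show "integrable lborel (\<lambda>x. h (x + s *\<^sub>R v))" for s
    proof (rule continuous_compact_support_integrable)
      show "continuous_on UNIV (\<lambda>x. h (x + s *\<^sub>R v))"
        by (intro continuous_on_compose2[OF ch] continuous_intros) auto
      show "compact ((\<lambda>x. - (s *\<^sub>R v) + x) ` K)" by (intro compact_translation K)
      show "h (x + s *\<^sub>R v) = 0" if "x \<notin> (\<lambda>x. - (s *\<^sub>R v) + x) ` K" for x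
        using that by (intro K(2)) (auto simp: image_iff algebra_simps)
    qed
    show "((\<lambda>s. h (x + s *\<^sub>R v)) has_real_derivative h' (x + s *\<^sub>R v) v) (at s)" for s x
    proof -
      have "((\<lambda>s. x + s *\<^sub>R v) has_derivative (\<lambda>t. t *\<^sub>R v)) (at s)"
        by (auto intro!: derivative_eq_intros)
      then have "((\<lambda>s. h (x + s *\<^sub>R v)) has_derivative (\<lambda>t. h' (x + s *\<^sub>R v) (t *\<^sub>R v))) (at s)"
        by (rule has_derivative_compose[OF _ der])
      moreover have "h' (x + s *\<^sub>R v) (t *\<^sub>R v) = h' (x + s *\<^sub>R v) v * t" for t
        using linear_scale[OF has_derivative_linear[OF der]] by simp
      ultimately show ?thesis by (simp add: has_field_derivative_def)
    qed
    show "\<bar>h' (x + s *\<^sub>R v) v\<bar> \<le> indicator ?B x * C" if "s \<in> {- 1<..<1}" for s x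
    proof (cases "x \<in> ?B")
      case False
      have "norm (x + s *\<^sub>R v) > R"
      proof -
        have "norm (s *\<^sub>R v) \<le> norm v"
          using that mult_right_mono[of "\<bar>s\<bar>" 1 "norm v"] by auto
        then show ?thesis using False norm_triangle_ineq4[of "x + s *\<^sub>R v" "s *\<^sub>R v"] by auto
      qed
      then have "x + s *\<^sub>R v \<notin> K" using R by force
      then show ?thesis using K(3) False by simp
    qed (use C in auto)
    show "integrable lborel (\<lambda>x. indicator ?B x * C)"
      by (intro integrable_mult_left) (auto intro!: integrable_real_indicator emeasure_bounded_finite)
    show "(\<lambda>x. h' (x + 0 *\<^sub>R v) v) \<in> borel_measurable lborel"
      using cont by (simp add: borel_measurable_continuous_onI)
  qed auto
  then have "((\<lambda>s::real. \<integral>x. h x \<partial>lborel) has_real_derivative (\<integral>x. h' x v \<partial>lborel)) (at 0)"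
    by (simp add: lborel_integral_translate[OF hm])
  then show ?thesis using DERIV_unique DERIV_const by blast
qed

lemma jacobian_nth: "jacobian f (at x) $ i $ \<alpha> = frechet_derivative f (at x) (axis \<alpha> 1) $ i"
  by (simp add: jacobian_def matrix_def)

lemma jacobian_zero_off:
  assumes "x \<notin> closure {x. \<phi> x \<noteq> 0}"
  shows "jacobian \<phi> (at x) = 0"
  by (simp add: vec_eq_iff jacobian_nth frechet_derivative_off_support[OF assms])

lemma jacobian_works':
  fixes \<phi> :: "real^'n \<Rightarrow> real^'m"
  assumes "smooth \<phi>"
  shows "(\<phi> has_derivative (\<lambda>v. jacobian \<phi> (at x) *v v)) (at x)"
  using smooth_differentiable[OF assms, of x] by (simp only: jacobian_works)

lemma continuous_on_jacobian:
  assumes "smooth \<phi>"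
  shows "continuous_on S (\<lambda>x. jacobian \<phi> (at x))"
proof -
  have "continuous_on S (\<lambda>x. \<chi> i \<alpha>. frechet_derivative \<phi> (at x) (axis \<alpha> 1) $ i)"
    by (intro continuous_on_vec_lambda continuous_intros smooth_continuous_on smooth_frechet_derivative assms)
  also have "(\<lambda>x. \<chi> i \<alpha>. frechet_derivative \<phi> (at x) (axis \<alpha> 1) $ i) = (\<lambda>x. jacobian \<phi> (at x))"
    by (simp add: fun_eq_iff vec_eq_iff jacobian_nth)
  finally show ?thesis .
qed

lemma norm_vector_square: "(norm (b::real^'n))\<^sup>2 = (\<Sum>i\<in>UNIV. (b $ i)\<^sup>2)"
  unfolding power2_norm_eq_inner inner_vec_def by (simp add: power2_eq_square)

lemma norm_matrix_square: "(norm (A::real^'n^'m))\<^sup>2 = (\<Sum>i\<in>UNIV. \<Sum>j\<in>UNIV. (A $ i $ j)\<^sup>2)"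
  unfolding power2_norm_eq_inner inner_vec_def by (simp add: power2_eq_square)

lemma inner_matrix: "(A::real^'n^'m) \<bullet> B = (\<Sum>i\<in>UNIV. \<Sum>j\<in>UNIV. A $ i $ j * B $ i $ j)"
  by (simp add: inner_vec_def)

text \<open>Cauchy-Schwarz in the space of matrices against the rank-one matrix b c^T, whose norm is
  |b| |c|. The trivial bound would lose a dimensional factor.\<close>

lemma sum_bilinear_le_norms:
  fixes A :: "real^'n^'m"
  shows "\<bar>\<Sum>j\<in>UNIV. \<Sum>i\<in>UNIV. b $ i * A $ i $ j * c $ j\<bar> \<le> norm b * norm A * norm c"
proof -
  have "(\<Sum>j\<in>UNIV. \<Sum>i\<in>UNIV. b $ i * A $ i $ j * c $ j) = A \<bullet> (\<chi> i j. b $ i * c $ j)"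
    unfolding inner_matrix by (subst sum.swap) (simp add: ac_simps)
  also have "\<bar>\<dots>\<bar> \<le> norm A * norm (\<chi> i j. b $ i * c $ j)" by (rule Cauchy_Schwarz_ineq2)
  also have "norm (\<chi> i j. b $ i * c $ j) = norm b * norm c"
  proof (rule power2_eq_imp_eq)
    show "(norm (\<chi> i j. b $ i * c $ j))\<^sup>2 = (norm b * norm c)\<^sup>2"
      unfolding norm_matrix_square power_mult_distrib norm_vector_square
      by (simp add: sum_product power_mult_distrib)
  qed auto
  finally show ?thesis by (simp add: ac_simps)
qed

subsection \<open>A Hardy inequality\<close>

text \<open>The field |\<phi>|^2 (x - y) / w has integral of divergence zero. The divergence of (x -
  y) / w is n/w - 2|x - y|^2/w^2 \<ge> (n - 2)/w \<ge> 1/w, as n \<ge> 3, and the remaining term is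
  at most 2 |\<phi>| |D\<phi>| / sqrt w. Cauchy-Schwarz and cancelling one factor give the constant
  2. The summand \<rho>^2 in w removes the singularity at y, so every integrand is
  continuous.\<close>

lemma hardy_inequality:
  fixes \<phi> :: "real^'n \<Rightarrow> real^'N" and y :: "real^'n"
  assumes n: "CARD('n) \<ge> 3" and \<phi>: "test_function UNIV \<phi>" and \<rho>: "\<rho> > 0"
  defines "w \<equiv> \<lambda>x. (x - y) \<bullet> (x - y) + \<rho>\<^sup>2"
  shows "l2norm lborel (\<lambda>x. (1 / sqrt (w x)) *\<^sub>R \<phi> x) \<le> 2 * l2norm lborel (\<lambda>x. jacobian \<phi> (at x))"
    and "L2 lborel (\<lambda>x. (1 / sqrt (w x)) *\<^sub>R \<phi> x)" and "L2 lborel (\<lambda>x. jacobian \<phi> (at x))"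
proof -
  define K where "K = closure {x. \<phi> x \<noteq> 0}"
  have K: "compact K" "smooth \<phi>" using \<phi> by (auto simp: test_function_def K_def)
  have K0: "\<phi> x = 0" if "x \<notin> K" for x
    using that closure_subset[of "{x. \<phi> x \<noteq> 0}"] by (auto simp: K_def)
  have KD: "frechet_derivative \<phi> (at x) v = 0" "jacobian \<phi> (at x) = 0" if "x \<notin> K" for x v
    using that frechet_derivative_off_support[of x \<phi>] jacobian_zero_off[of x \<phi>] by (auto simp: K_def)
  have w: "w x > 0" for x using \<rho> by (simp add: w_def add_nonneg_pos)
  have cw: "continuous_on UNIV w" unfolding w_def by (intro continuous_intros)
  have c\<phi>: "continuous_on UNIV \<phi>" using K smooth_continuous_on by blast
  have cD: "continuous_on UNIV (\<lambda>x. frechet_derivative \<phi> (at x) v)" for v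
    using K smooth_continuous_on smooth_frechet_derivative by blast
  have w0: "w x \<noteq> 0" for x using w[of x] by simp
  have "continuous_on UNIV (\<lambda>x. (1 / sqrt (w x)) *\<^sub>R \<phi> x)"
    using w0 by (intro continuous_intros c\<phi> cw) auto
  note ca = this
  have "L2 lborel f" if "continuous_on UNIV f" "\<And>x. x \<notin> K \<Longrightarrow> f x = 0" for f :: "real^'n \<Rightarrow> 'z::euclidean_space"
  proof -
    have "integrable lborel (\<lambda>x. (norm (f x))\<^sup>2)"
      by (rule continuous_compact_support_integrable[OF _ K(1)]) (use that in \<open>auto intro!: continuous_intros\<close>)
    then show ?thesis using that(1) by (simp add: L2_def borel_measurable_continuous_onI)
  qed note L2K = this
  show La: "L2 lborel (\<lambda>x. (1 / sqrt (w x)) *\<^sub>R \<phi> x)" by (rule L2K[OF ca]) (simp add: K0)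
  show Lb: "L2 lborel (\<lambda>x. jacobian \<phi> (at x))" by (rule L2K[OF continuous_on_jacobian[OF K(2)]]) (simp add: KD)
  \<comment> \<open>The derivative in direction v of the \<alpha>-th component of |\<phi>|^2 (x - y)
    / w, so summing over v = \<open>axis \<alpha> 1\<close> gives the divergence.\<close>
  define h' where "h' \<alpha> x v = (\<phi> x \<bullet> frechet_derivative \<phi> (at x) v + frechet_derivative \<phi> (at x) v \<bullet> \<phi> x) * ((x - y) $ \<alpha> / w x)
      + (\<phi> x \<bullet> \<phi> x) * (v $ \<alpha> / w x - (x - y) $ \<alpha> * (2 * ((x - y) \<bullet> v)) / (w x)\<^sup>2)" for \<alpha> x v
  have int0: "integrable lborel (\<lambda>x. h' \<alpha> x (axis \<alpha> 1))" "(\<integral>x. h' \<alpha> x (axis \<alpha> 1) \<partial>lborel) = 0" for \<alpha> :: 'n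
  proof -
    have c: "continuous_on UNIV (\<lambda>x. h' \<alpha> x v)" for v
      unfolding h'_def using w0 by (intro continuous_intros c\<phi> cw cD) auto
    show "integrable lborel (\<lambda>x. h' \<alpha> x (axis \<alpha> 1))"
      by (rule continuous_compact_support_integrable[OF c K(1)]) (simp add: h'_def K0)
    have "(\<phi> has_derivative frechet_derivative \<phi> (at x)) (at x)" for x
      using smooth_has_derivative[OF K(2)] .
    note [derivative_intros] = this
    show "(\<integral>x. h' \<alpha> x (axis \<alpha> 1) \<partial>lborel) = 0"
    proof (rule integral_derivative_zero[OF _ c K(1)])
      show "((\<lambda>x. (\<phi> x \<bullet> \<phi> x) * ((x - y) $ \<alpha> / w x)) has_derivative h' \<alpha> x) (at x)" for x
      proof -
        have dw: "(w has_derivative (\<lambda>v. 2 * ((x - y) \<bullet> v))) (at x)"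
          unfolding w_def by (auto intro!: derivative_eq_intros simp: inner_commute)
        have dl: "((\<lambda>x. (x - y) $ \<alpha>) has_derivative (\<lambda>v. v $ \<alpha>)) (at x)"
          by (rule has_derivative_eq_rhs[OF bounded_linear.has_derivative[OF bounded_linear_vec_nth]])
             (auto intro!: derivative_eq_intros)
        have d1: "((\<lambda>x. (x - y) $ \<alpha> / w x) has_derivative
            (\<lambda>v. v $ \<alpha> / w x - (x - y) $ \<alpha> * (2 * ((x - y) \<bullet> v)) / (w x)\<^sup>2)) (at x)"
          by (rule has_derivative_eq_rhs[OF has_derivative_divide[OF dl dw w0]])
             (use w0[of x] in \<open>simp add: fun_eq_iff field_simps power2_eq_square\<close>)
        have d2: "((\<lambda>x. \<phi> x \<bullet> \<phi> x) has_derivative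
            (\<lambda>v. \<phi> x \<bullet> frechet_derivative \<phi> (at x) v + frechet_derivative \<phi> (at x) v \<bullet> \<phi> x)) (at x)"
          by (intro has_derivative_inner smooth_has_derivative K(2))
        show ?thesis
          by (rule has_derivative_eq_rhs[OF has_derivative_mult[OF d2 d1]]) (simp add: h'_def fun_eq_iff)
      qed
    qed (auto simp: h'_def K0)
  qed
  have key: "(norm ((1 / sqrt (w x)) *\<^sub>R \<phi> x))\<^sup>2 \<le> (\<Sum>\<alpha>\<in>UNIV. h' \<alpha> x (axis \<alpha> 1))
      + 2 * (norm ((1 / sqrt (w x)) *\<^sub>R \<phi> x) * norm (jacobian \<phi> (at x)))" for x
  proof -
    have sq: "(\<Sum>\<alpha>\<in>UNIV. ((x - y) $ \<alpha>)\<^sup>2) = (x - y) \<bullet> (x - y)"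
      by (simp add: inner_vec_def power2_eq_square)
    have "(\<Sum>\<alpha>\<in>UNIV. 1 / w x - (x - y) $ \<alpha> * (2 * ((x - y) \<bullet> axis \<alpha> 1)) / (w x)\<^sup>2)
       = real CARD('n) / w x - 2 * ((x - y) \<bullet> (x - y)) / (w x)\<^sup>2"
      by (simp add: sum_subtractf inner_axis sum_distrib_left sum_divide_distrib flip: sq)
         (auto intro!: sum.cong simp: power2_eq_square algebra_simps)
    also have "\<dots> \<ge> 1 / w x"
    proof -
      have "2 * ((x - y) \<bullet> (x - y)) / (w x)\<^sup>2 \<le> 2 * w x / (w x)\<^sup>2"
        by (intro divide_right_mono mult_left_mono) (auto simp: w_def)
      also have "\<dots> = 2 / w x" using w0 by (simp add: power2_eq_square)
      finally have "real CARD('n) / w x - 2 * ((x - y) \<bullet> (x - y)) / (w x)\<^sup>2 \<ge> (real CARD('n) - 2) / w x"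
        by (simp add: diff_divide_distrib)
      moreover have "(real CARD('n) - 2) / w x \<ge> 1 / w x"
        using n w[of x] by (intro divide_right_mono) auto
      ultimately show ?thesis by linarith
    qed
    finally have div: "1 / w x \<le> (\<Sum>\<alpha>\<in>UNIV. 1 / w x - (x - y) $ \<alpha> * (2 * ((x - y) \<bullet> axis \<alpha> 1)) / (w x)\<^sup>2)" .
    have cross: "\<bar>\<Sum>\<alpha>\<in>UNIV. \<Sum>i\<in>UNIV. \<phi> x $ i * jacobian \<phi> (at x) $ i $ \<alpha> * ((1 / w x) *\<^sub>R (x - y)) $ \<alpha>\<bar>
        \<le> norm (\<phi> x) * norm (jacobian \<phi> (at x)) * norm ((1 / w x) *\<^sub>R (x - y))"
      by (rule sum_bilinear_le_norms)
    have "norm ((1 / w x) *\<^sub>R (x - y)) \<le> 1 / sqrt (w x)"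
    proof -
      have "norm (x - y) \<le> sqrt (w x)"
        by (rule real_le_rsqrt) (simp add: w_def power2_norm_eq_inner)
      then have "norm (x - y) / w x \<le> sqrt (w x) / w x"
        using w[of x] by (intro divide_right_mono) auto
      also have "\<dots> = 1 / sqrt (w x)" using w[of x] by (simp add: real_div_sqrt field_simps)
      finally show ?thesis using w[of x] by (simp add: norm_divide)
    qed
    then have "norm (\<phi> x) * norm (jacobian \<phi> (at x)) * norm ((1 / w x) *\<^sub>R (x - y))
        \<le> norm (\<phi> x) * norm (jacobian \<phi> (at x)) * (1 / sqrt (w x))"
      by (intro mult_left_mono) auto
    with cross have cross': "\<bar>\<Sum>\<alpha>\<in>UNIV. \<Sum>i\<in>UNIV. \<phi> x $ i * jacobian \<phi> (at x) $ i $ \<alpha> * ((1 / w x) *\<^sub>R (x - y)) $ \<alpha>\<bar>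
        \<le> norm ((1 / sqrt (w x)) *\<^sub>R \<phi> x) * norm (jacobian \<phi> (at x))"
      using w[of x] by (simp add: ac_simps)
    have h'_eq: "h' \<alpha> x (axis \<alpha> 1)
        = 2 * (\<Sum>i\<in>UNIV. \<phi> x $ i * jacobian \<phi> (at x) $ i $ \<alpha> * ((1 / w x) *\<^sub>R (x - y)) $ \<alpha>)
          + (\<phi> x \<bullet> \<phi> x) * (1 / w x - (x - y) $ \<alpha> * (2 * ((x - y) \<bullet> axis \<alpha> 1)) / (w x)\<^sup>2)" for \<alpha>
    proof -
      have "(\<Sum>i\<in>UNIV. \<phi> x $ i * jacobian \<phi> (at x) $ i $ \<alpha> * ((1 / w x) *\<^sub>R (x - y)) $ \<alpha>)
          = (\<phi> x \<bullet> frechet_derivative \<phi> (at x) (axis \<alpha> 1)) * ((x - y) $ \<alpha> / w x)"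
        by (simp add: jacobian_nth inner_vec_def sum_distrib_right sum_divide_distrib)
      then show ?thesis
        by (simp add: h'_def inner_commute[of "frechet_derivative \<phi> (at x) (axis \<alpha> 1)"])
    qed
    have "(\<Sum>\<alpha>\<in>UNIV. h' \<alpha> x (axis \<alpha> 1))
      = 2 * (\<Sum>\<alpha>\<in>UNIV. \<Sum>i\<in>UNIV. \<phi> x $ i * jacobian \<phi> (at x) $ i $ \<alpha> * ((1 / w x) *\<^sub>R (x - y)) $ \<alpha>)
        + (\<phi> x \<bullet> \<phi> x) * (\<Sum>\<alpha>\<in>UNIV. 1 / w x - (x - y) $ \<alpha> * (2 * ((x - y) \<bullet> axis \<alpha> 1)) / (w x)\<^sup>2)"
      by (simp only: h'_eq sum.distrib sum_distrib_left)
    moreover have "(norm ((1 / sqrt (w x)) *\<^sub>R \<phi> x))\<^sup>2 = (\<phi> x \<bullet> \<phi> x) * (1 / w x)"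
      using w[of x] by (simp add: power_divide flip: power2_norm_eq_inner)
    moreover have "(\<phi> x \<bullet> \<phi> x) * (1 / w x) \<le> (\<phi> x \<bullet> \<phi> x)
        * (\<Sum>\<alpha>\<in>UNIV. 1 / w x - (x - y) $ \<alpha> * (2 * ((x - y) \<bullet> axis \<alpha> 1)) / (w x)\<^sup>2)"
      using div by (intro mult_left_mono) auto
    ultimately show ?thesis using cross' by linarith
  qed
  let ?a = "l2norm lborel (\<lambda>x. (1 / sqrt (w x)) *\<^sub>R \<phi> x)" and ?b = "l2norm lborel (\<lambda>x. jacobian \<phi> (at x))"
  have "?a\<^sup>2 \<le> (\<integral>x. (\<Sum>\<alpha>\<in>UNIV. h' \<alpha> x (axis \<alpha> 1))
      + 2 * (norm ((1 / sqrt (w x)) *\<^sub>R \<phi> x) * norm (jacobian \<phi> (at x))) \<partial>lborel)"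
    unfolding l2norm_square
    by (intro integral_mono key L2_integrable La Bochner_Integration.integrable_add
        Bochner_Integration.integrable_sum int0 integrable_mult_right L2_prod_integrable Lb)
  also have "\<dots> = 2 * (\<integral>x. norm ((1 / sqrt (w x)) *\<^sub>R \<phi> x) * norm (jacobian \<phi> (at x)) \<partial>lborel)"
    by (subst Bochner_Integration.integral_add)
       (auto simp: int0 Bochner_Integration.integral_sum simp del: norm_scaleR
          intro!: integrable_mult_right L2_prod_integrable La Lb)
  also have "\<dots> \<le> 2 * (?a * ?b)"
    by (intro mult_left_mono l2_Cauchy_Schwarz La Lb) auto
  finally have "?a * ?a \<le> ?a * (2 * ?b)" by (simp add: power2_eq_square ac_simps)
  then show "?a \<le> 2 * ?b"
    by (cases "?a = 0") (auto simp: less_le intro: mult_left_le_imp_le)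
qed

subsection \<open>A Poincare inequality\<close>

text \<open>The fundamental theorem along the segment is tested with the increment u itself; the
  elementary inequality 2ab \<le> a^2 + b^2 leaves half of |u|^2 on the right, which is absorbed.
  The bound is stated in \<open>ennreal\<close> so that integrals in s and x can later be exchanged
  without integrability proofs.\<close>

lemma segment_increment_bound:
  fixes \<phi> :: "real^'n \<Rightarrow> real^'N"
  assumes \<phi>: "smooth \<phi>" and r: "norm (b - a) \<le> r"
  shows "ennreal ((norm (\<phi> b - \<phi> a))\<^sup>2)
    \<le> ennreal (r\<^sup>2) * (\<integral>\<^sup>+s. ennreal ((norm (jacobian \<phi> (at (a + s *\<^sub>R (b - a)))))\<^sup>2) * indicator {0..1} s \<partial>lborel)"
proof -
  define u where "u = \<phi> b - \<phi> a"
  define N where "N s = norm (jacobian \<phi> (at (a + s *\<^sub>R (b - a))))" for s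
  define q where "q s = r\<^sup>2 * (N s)\<^sup>2" for s
  have cJ: "continuous_on UNIV (\<lambda>x. jacobian \<phi> (at x))" by (rule continuous_on_jacobian[OF \<phi>])
  have cJ': "continuous_on UNIV (\<lambda>s::real. jacobian \<phi> (at (a + s *\<^sub>R (b - a))))"
    by (intro continuous_on_compose2[OF cJ] continuous_intros) auto
  have cN: "continuous_on UNIV N" unfolding N_def by (intro continuous_intros cJ')
  have Nm [measurable]: "N \<in> borel_measurable borel" using cN by (rule borel_measurable_continuous_onI)
  have r0: "r \<ge> 0" using r norm_ge_zero order_trans by blast
  have FTC: "(\<integral>s. indicator {0..1} s *\<^sub>R ((jacobian \<phi> (at (a + s *\<^sub>R (b - a))) *v (b - a)) \<bullet> u) \<partial>lborel)
      = \<phi> (a + 1 *\<^sub>R (b - a)) \<bullet> u - \<phi> (a + 0 *\<^sub>R (b - a)) \<bullet> u"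
  proof (rule integral_FTC_atLeastAtMost)
    show "((\<lambda>s. \<phi> (a + s *\<^sub>R (b - a)) \<bullet> u) has_vector_derivative
        (jacobian \<phi> (at (a + s *\<^sub>R (b - a))) *v (b - a)) \<bullet> u) (at s within {0..1})" for s :: real
    proof -
      have "((\<lambda>s. a + s *\<^sub>R (b - a)) has_derivative (\<lambda>t. t *\<^sub>R (b - a))) (at s)"
        by (auto intro!: derivative_eq_intros)
      then have "((\<lambda>s. \<phi> (a + s *\<^sub>R (b - a))) has_derivative
          (\<lambda>t. jacobian \<phi> (at (a + s *\<^sub>R (b - a))) *v (t *\<^sub>R (b - a)))) (at s)"
        by (rule has_derivative_compose[OF _ jacobian_works'[OF \<phi>]])
      then have "((\<lambda>s. \<phi> (a + s *\<^sub>R (b - a)) \<bullet> u) has_derivative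
          (\<lambda>t. (jacobian \<phi> (at (a + s *\<^sub>R (b - a))) *v (t *\<^sub>R (b - a))) \<bullet> u)) (at s)"
        by (rule has_derivative_inner_left)
      then show ?thesis
        by (simp add: has_vector_derivative_def has_derivative_at_withinI matrix_vector_mult_scaleR)
    qed
    show "continuous_on {0..1} (\<lambda>s. (jacobian \<phi> (at (a + s *\<^sub>R (b - a))) *v (b - a)) \<bullet> u)"
    proof -
      have "continuous_on {0..1} (\<lambda>s. jacobian \<phi> (at (a + s *\<^sub>R (b - a))) *v (b - a))"
        unfolding matrix_vector_mult_def
        by (intro continuous_on_vec_lambda continuous_on_sum continuous_intros continuous_on_subset[OF cJ']) auto
      then show ?thesis by (intro continuous_intros)
    qed
  qed simp
  have iq: "integrable lborel (\<lambda>s. indicator {0..1} s *\<^sub>R q s)"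
    unfolding q_def by (intro borel_integrable_compact continuous_intros continuous_on_subset[OF cN]) auto
  have ic: "integrable lborel (\<lambda>s::real. indicator {0..1} s *\<^sub>R (norm u)\<^sup>2)"
    by (intro borel_integrable_compact continuous_intros) auto
  have "(norm u)\<^sup>2 = (\<integral>s. indicator {0..1} s *\<^sub>R ((jacobian \<phi> (at (a + s *\<^sub>R (b - a))) *v (b - a)) \<bullet> u) \<partial>lborel)"
    unfolding FTC by (simp add: u_def power2_norm_eq_inner inner_diff_left)
  also have "\<dots> \<le> (\<integral>s. (1/2) * (indicator {0..1} s *\<^sub>R q s) + (1/2) * (indicator {0..1} s *\<^sub>R (norm u)\<^sup>2) \<partial>lborel)"
  proof (rule integral_mono')
    show "integrable lborel (\<lambda>s. (1/2) * (indicator {0..1} s *\<^sub>R q s) + (1/2) * (indicator {0..1} s *\<^sub>R (norm u)\<^sup>2))"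
      using iq ic by (intro Bochner_Integration.integrable_add integrable_mult_right)
    have "(jacobian \<phi> (at (a + s *\<^sub>R (b - a))) *v (b - a)) \<bullet> u \<le> (1/2) * q s + (1/2) * (norm u)\<^sup>2" for s
    proof -
      have "(jacobian \<phi> (at (a + s *\<^sub>R (b - a))) *v (b - a)) \<bullet> u
          = (\<Sum>j\<in>UNIV. \<Sum>i\<in>UNIV. u $ i * jacobian \<phi> (at (a + s *\<^sub>R (b - a))) $ i $ j * (b - a) $ j)"
        by (subst sum.swap) (simp add: inner_vec_def matrix_vector_mult_def sum_distrib_left sum_distrib_right ac_simps)
      also have "\<dots> \<le> norm u * N s * norm (b - a)"
        using sum_bilinear_le_norms[of u "jacobian \<phi> (at (a + s *\<^sub>R (b - a)))" "b - a"] by (simp add: N_def)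
      also have "\<dots> \<le> norm u * N s * r" using r by (intro mult_left_mono) (auto simp: N_def)
      also have "\<dots> \<le> (1/2) * q s + (1/2) * (norm u)\<^sup>2"
        using sum_squares_bound[of "r * N s" "norm u"] by (simp add: q_def power_mult_distrib ac_simps)
      finally show ?thesis .
    qed
    then show "indicator {0..1} s *\<^sub>R ((jacobian \<phi> (at (a + s *\<^sub>R (b - a))) *v (b - a)) \<bullet> u)
        \<le> (1/2) * (indicator {0..1} s *\<^sub>R q s) + (1/2) * (indicator {0..1} s *\<^sub>R (norm u)\<^sup>2)" for s
      by (auto simp: indicator_def)
    show "0 \<le> (1/2) * (indicator {0..1} s *\<^sub>R q s) + (1/2) * (indicator {0..1} s *\<^sub>R (norm u)\<^sup>2)" for s
      by (auto simp: indicator_def q_def)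
  qed
  also have "\<dots> = (1/2) * (\<integral>s. indicator {0..1} s *\<^sub>R q s \<partial>lborel) + (1/2) * (\<integral>s. indicator {0..1} s *\<^sub>R (norm u)\<^sup>2 \<partial>(lborel :: real measure))"
    using iq ic by (subst Bochner_Integration.integral_add) auto
  also have "(\<integral>s. indicator {0..1} s *\<^sub>R (norm u)\<^sup>2 \<partial>(lborel :: real measure)) = (norm u)\<^sup>2"
    by simp
  finally have "(norm u)\<^sup>2 \<le> (\<integral>s. indicator {0..1} s *\<^sub>R q s \<partial>lborel)" by simp
  then have "ennreal ((norm u)\<^sup>2) \<le> ennreal (\<integral>s. indicator {0..1} s *\<^sub>R q s \<partial>lborel)" by (rule ennreal_leI)
  also have "\<dots> = (\<integral>\<^sup>+s. ennreal (indicator {0..1} s *\<^sub>R q s) \<partial>lborel)"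
    by (rule nn_integral_eq_integral[symmetric, OF iq]) (auto simp: q_def)
  also have "\<dots> = (\<integral>\<^sup>+s. ennreal (r\<^sup>2) * (ennreal ((N s)\<^sup>2) * indicator {0..1} s) \<partial>lborel)"
    by (intro nn_integral_cong) (auto simp: q_def indicator_def ennreal_mult)
  also have "\<dots> = ennreal (r\<^sup>2) * (\<integral>\<^sup>+s. ennreal ((N s)\<^sup>2) * indicator {0..1} s \<partial>lborel)"
    by (rule nn_integral_cmult) measurable
  finally show ?thesis by (simp add: u_def N_def)
qed

lemma nn_integral_lborel_affine:
  fixes t :: "'a::euclidean_space"
  assumes [measurable]: "f \<in> borel_measurable borel" and c: "c > 0"
  shows "ennreal (c ^ DIM('a)) * (\<integral>\<^sup>+x. f (t + c *\<^sub>R x) \<partial>lborel) = (\<integral>\<^sup>+x. f x \<partial>lborel)"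
proof -
  have "(\<integral>\<^sup>+x. f x \<partial>lborel) = (\<integral>\<^sup>+x. f x \<partial>density (distr lborel borel (\<lambda>x. t + c *\<^sub>R x)) (\<lambda>_. \<bar>c\<bar>^DIM('a)))"
    using lborel_affine[of c t] c by simp
  also have "\<dots> = (\<integral>\<^sup>+x. ennreal (c ^ DIM('a)) * f (t + c *\<^sub>R x) \<partial>lborel)"
    using c by (subst nn_integral_density) (auto simp: nn_integral_distr)
  also have "\<dots> = ennreal (c ^ DIM('a)) * (\<integral>\<^sup>+x. f (t + c *\<^sub>R x) \<partial>lborel)"
    by (rule nn_integral_cmult) measurable
  finally show ?thesis by simp
qed

lemma nn_integral_lborel_swap:
  fixes f :: "'a::euclidean_space \<Rightarrow> 'b::euclidean_space \<Rightarrow> ennreal"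
  assumes "case_prod f \<in> borel_measurable borel"
  shows "(\<integral>\<^sup>+x. \<integral>\<^sup>+y. f x y \<partial>lborel \<partial>lborel) = (\<integral>\<^sup>+y. \<integral>\<^sup>+x. f x y \<partial>lborel \<partial>lborel)"
proof -
  have "pair_sigma_finite (lborel :: 'a measure) (lborel :: 'b measure)" ..
  moreover have "case_prod f \<in> borel_measurable (lborel \<Otimes>\<^sub>M lborel)"
    using assms by (simp add: lborel_prod)
  ultimately show ?thesis by (rule pair_sigma_finite.Fubini'[symmetric])
qed

text \<open>Travelling from x only to the midpoint of x and y keeps the factor 1 - s/2 of x in the
  moving point at least 1/2. The change of variables in x is therefore uniformly nondegenerate, at
  the cost 2^n; going all the way to y would make the Jacobian vanish at the end. Convexity keeps
  the path inside the ball, and the path has length at most r.\<close>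

lemma Poincare_midpoint:
  fixes \<phi> :: "real^'n \<Rightarrow> real^'N" and c :: "real^'n"
  assumes \<phi>: "smooth \<phi>" and r: "r > 0"
  defines "B \<equiv> ball c r"
  shows "(\<integral>\<^sup>+y. \<integral>\<^sup>+x. ennreal ((norm (\<phi> ((1/2) *\<^sub>R (x + y)) - \<phi> x))\<^sup>2) * indicator B x * indicator B y \<partial>lborel \<partial>lborel)
    \<le> ennreal (2 ^ CARD('n) * r\<^sup>2) * emeasure lborel B
       * (\<integral>\<^sup>+x. ennreal ((norm (jacobian \<phi> (at x)))\<^sup>2) * indicator B x \<partial>lborel)" (is "?L \<le> _ * _ * ?G")
proof -
  define g where "g x = ennreal ((norm (jacobian \<phi> (at x)))\<^sup>2)" for x
  have cJ: "continuous_on UNIV (\<lambda>x. jacobian \<phi> (at x))" by (rule continuous_on_jacobian[OF \<phi>])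
  have Jm [measurable]: "(\<lambda>x. jacobian \<phi> (at x)) \<in> borel_measurable borel"
    using cJ by (rule borel_measurable_continuous_onI)
  have gm [measurable]: "g \<in> borel_measurable borel" unfolding g_def by measurable
  have Bm [measurable]: "B \<in> sets borel" by (simp add: B_def)
  have conv: "convex B" by (simp add: B_def)
  define p where "p s y x = (s / 2) *\<^sub>R y + (1 - s / 2) *\<^sub>R x" for s :: real and x y :: "real^'n"
  have pm [measurable]: "(\<lambda>(x, z). p (fst z) (snd z) x) \<in> borel_measurable borel"
    unfolding p_def case_prod_beta
    by (intro borel_measurable_continuous_onI continuous_intros) auto
  have pin: "p s y x \<in> B" if "x \<in> B" "y \<in> B" "s \<in> {0..1}" for s x y
    using convexD[OF conv that(1,2), of "1 - s/2" "s/2"] that(3) by (auto simp: p_def add.commute)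
  have 1: "ennreal ((norm (\<phi> ((1/2) *\<^sub>R (x + y)) - \<phi> x))\<^sup>2) * indicator B x * indicator B y
      \<le> (\<integral>\<^sup>+s. ennreal (r\<^sup>2) * (g (p s y x) * indicator B (p s y x) * indicator B y * indicator {0..1} s) \<partial>lborel)" for x y
  proof (cases "x \<in> B \<and> y \<in> B")
    case True
    have "dist y x < 2 * r"
      using True dist_triangle[of y x c] by (simp add: B_def dist_commute)
    moreover have "(1/2) *\<^sub>R (x + y) - x = (1/2) *\<^sub>R (y - x)"
      by (simp add: vec_eq_iff field_simps)
    ultimately have nxy: "norm ((1/2) *\<^sub>R (x + y) - x) \<le> r"
      by (simp add: dist_norm)
    have pe: "x + s *\<^sub>R ((1/2) *\<^sub>R (x + y) - x) = p s y x" for s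
      by (simp add: p_def vec_eq_iff field_simps)
    have "ennreal ((norm (\<phi> ((1/2) *\<^sub>R (x + y)) - \<phi> x))\<^sup>2)
        \<le> ennreal (r\<^sup>2) * (\<integral>\<^sup>+s. g (p s y x) * indicator {0..1} s \<partial>lborel)"
      using segment_increment_bound[OF \<phi> nxy] unfolding pe g_def by simp
    also have "\<dots> = (\<integral>\<^sup>+s. ennreal (r\<^sup>2) * (g (p s y x) * indicator {0..1} s) \<partial>lborel)"
      unfolding p_def by (intro nn_integral_cmult[symmetric]) measurable
    also have "\<dots> = (\<integral>\<^sup>+s. ennreal (r\<^sup>2) * (g (p s y x) * indicator B (p s y x) * indicator B y * indicator {0..1} s) \<partial>lborel)"
      using pin True by (intro nn_integral_cong) (auto simp: indicator_def)
    finally show ?thesis using True by simp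
  qed auto
  \<comment> \<open>With s and y frozen, the point moves affinely in x with Jacobian (1 - s/2)^n
    \<ge> 2^(-n).\<close>
  have 2: "(\<integral>\<^sup>+x. g (p s y x) * indicator B (p s y x) \<partial>lborel) \<le> ennreal (2 ^ CARD('n)) * ?G" if s: "s \<in> {0..1}" for s y
  proof -
    let ?c = "1 - s / 2"
    have "?c > 0" using s by auto
    from nn_integral_lborel_affine[OF _ this, of "\<lambda>x. g x * indicator B x" "(s/2) *\<^sub>R y"]
    have e: "ennreal (?c ^ CARD('n)) * (\<integral>\<^sup>+x. g (p s y x) * indicator B (p s y x) \<partial>lborel) = ?G"
      by (simp add: p_def g_def)
    have "1 \<le> 2 * ?c" using s by auto
    then have "1 \<le> (2 * ?c) ^ CARD('n)" by (rule one_le_power)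
    then have "ennreal 1 \<le> ennreal (2 ^ CARD('n) * ?c ^ CARD('n))"
      by (intro ennreal_leI) (simp only: power_mult_distrib)
    also have "\<dots> = ennreal (2 ^ CARD('n)) * ennreal (?c ^ CARD('n))"
      using s by (subst ennreal_mult) auto
    finally have "ennreal 1 * (\<integral>\<^sup>+x. g (p s y x) * indicator B (p s y x) \<partial>lborel)
      \<le> ennreal (2 ^ CARD('n)) * ennreal (?c ^ CARD('n)) * (\<integral>\<^sup>+x. g (p s y x) * indicator B (p s y x) \<partial>lborel)"
      by (rule mult_right_mono) simp
    then show ?thesis using e by (simp add: mult.assoc)
  qed
  define F where "F y x s = ennreal (r\<^sup>2) * (g (p s y x) * indicator B (p s y x) * indicator B y * indicator {0..1} s)" for y x s
  have Fm [measurable]: "(\<lambda>z. F y (fst z) (snd z)) \<in> borel_measurable borel" for y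
  proof -
    have c: "(\<lambda>z::(real^'n) \<times> real. p (snd z) y (fst z)) \<in> borel_measurable borel"
      unfolding p_def by (intro borel_measurable_continuous_onI continuous_intros) auto
    have [measurable]: "snd \<in> borel_measurable (borel :: ((real^'n) \<times> real) measure)"
      by (intro borel_measurable_continuous_onI continuous_intros)
    note c [measurable]
    show ?thesis unfolding F_def by measurable
  qed
  have "?L \<le> (\<integral>\<^sup>+y. \<integral>\<^sup>+x. \<integral>\<^sup>+s. F y x s \<partial>lborel \<partial>lborel \<partial>lborel)"
    unfolding F_def by (intro nn_integral_mono 1)
  also have "\<dots> = (\<integral>\<^sup>+y. \<integral>\<^sup>+s. \<integral>\<^sup>+x. F y x s \<partial>lborel \<partial>lborel \<partial>lborel)"
    by (intro nn_integral_cong nn_integral_lborel_swap) (use Fm in \<open>simp add: case_prod_beta'\<close>)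
  also have "\<dots> \<le> (\<integral>\<^sup>+y. \<integral>\<^sup>+s. (ennreal (r\<^sup>2) * (ennreal (2 ^ CARD('n)) * ?G)) * indicator B y * indicator {0..1::real} s \<partial>lborel \<partial>lborel)"
  proof (intro nn_integral_mono)
    fix y :: "real^'n" and s :: real
    have "(\<integral>\<^sup>+x. F y x s \<partial>lborel) = ennreal (r\<^sup>2) * indicator B y * indicator {0..1::real} s * (\<integral>\<^sup>+x. g (p s y x) * indicator B (p s y x) \<partial>lborel)"
      unfolding F_def p_def by (subst nn_integral_cmult[symmetric]) (auto simp: ac_simps intro!: nn_integral_cong)
    also have "\<dots> \<le> ennreal (r\<^sup>2) * indicator B y * indicator {0..1::real} s * (ennreal (2 ^ CARD('n)) * ?G)"
      using 2[of s y] by (cases "s \<in> {0..1}") (auto intro!: mult_left_mono)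
    finally show "(\<integral>\<^sup>+x. F y x s \<partial>lborel) \<le> (ennreal (r\<^sup>2) * (ennreal (2 ^ CARD('n)) * ?G)) * indicator B y * indicator {0..1::real} s"
      by (simp add: ac_simps)
  qed
  also have "\<dots> = (ennreal (r\<^sup>2) * (ennreal (2 ^ CARD('n)) * ?G)) * emeasure lborel B"
    by (simp add: nn_integral_cmult)
  also have "\<dots> = ennreal (2 ^ CARD('n) * r\<^sup>2) * emeasure lborel B * ?G"
    by (simp add: ennreal_mult ac_simps)
  finally show ?thesis .
qed

lemma nn_integral_lebesgue_on:
  assumes "f \<in> borel_measurable borel" "U \<in> sets borel"
  shows "(\<integral>\<^sup>+x. f x \<partial>lebesgue_on U) = (\<integral>\<^sup>+x. f x * indicator U x \<partial>lborel)"
proof -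
  have [measurable]: "f \<in> borel_measurable lborel" "U \<in> sets lborel" using assms by auto
  have "(\<integral>\<^sup>+x. f x \<partial>lebesgue_on U) = (\<integral>\<^sup>+x. f x * indicator U x \<partial>lebesgue)"
    using assms by (subst nn_integral_restrict_space) auto
  also have "\<dots> = (\<integral>\<^sup>+x. f x * indicator U x \<partial>lborel)"
    by (rule nn_integral_completion) measurable
  finally show ?thesis .
qed

lemma borel_measurable_lebesgue_on_continuous:
  fixes f :: "'a::euclidean_space \<Rightarrow> 'b::euclidean_space"
  assumes "continuous_on UNIV f"
  shows "f \<in> borel_measurable (lebesgue_on U)"
  using borel_measurable_continuous_onI[OF assms]
  by (intro measurable_restrict_space1 measurable_completion) simp

lemma L2_continuous_bounded:
  fixes f :: "'a::euclidean_space \<Rightarrow> 'b::euclidean_space"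
  assumes f: "continuous_on UNIV f" and U: "U \<in> sets borel" "bounded U"
  shows "L2 (lebesgue_on U) f"
  unfolding L2_def
proof
  show fm: "f \<in> borel_measurable (lebesgue_on U)"
    by (rule borel_measurable_lebesgue_on_continuous[OF f])
  have "compact (f ` closure U)"
    using U by (intro compact_continuous_image continuous_on_subset[OF f]) auto
  then have "bounded (f ` closure U)" by (rule compact_imp_bounded)
  then obtain C where C: "\<And>x. x \<in> U \<Longrightarrow> norm (f x) \<le> C"
    using closure_subset[of U] unfolding bounded_iff by fast
  show "integrable (lebesgue_on U) (\<lambda>x. (norm (f x))\<^sup>2)"
  proof (rule Bochner_Integration.integrable_bound)
    have "emeasure lebesgue U < \<infinity>" using U emeasure_bounded_finite[OF U(2)] by simp
    then have "finite_measure (lebesgue_on U)"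
      using U by (intro finite_measureI) (simp add: emeasure_restrict_space)
    then show "integrable (lebesgue_on U) (\<lambda>_. C\<^sup>2)" by (simp add: finite_measure.integrable_const)
    have "(norm (f x))\<^sup>2 \<le> C\<^sup>2" if "x \<in> U" for x using C[OF that] by (intro power_mono) auto
    then show "AE x in lebesgue_on U. norm ((norm (f x))\<^sup>2) \<le> norm (C\<^sup>2)"
      by (intro AE_I2) simp
  qed (use fm in simp)
qed

text \<open>Every y in the ball outside \<Omega> has \<phi> y = 0, so |\<phi> x| is at most the sum
  of the increments from x and from y to their common midpoint. Integrating the square over all such
  y produces the measure of the missing part, bounded below by \<theta>, on the left. The factor 4 =
  2 + 2, from the square of a sum and the two equal halves, turns 2^n into 2^(n+2).\<close>

lemma Poincare_zero_set:
  fixes \<phi> :: "real^'n \<Rightarrow> real^'N" and c :: "real^'n"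
  assumes \<phi>: "smooth \<phi>" and r: "r > 0" and \<Omega>: "open \<Omega>" "\<And>x. x \<notin> \<Omega> \<Longrightarrow> \<phi> x = 0"
    and \<theta>: "\<theta> > 0" "measure lebesgue (ball c r - \<Omega>) \<ge> \<theta> * measure lebesgue (ball c r)"
  shows "\<theta> * (l2norm (lebesgue_on (ball c r)) \<phi>)\<^sup>2
      \<le> 2 ^ (CARD('n) + 2) * r\<^sup>2 * (l2norm (lebesgue_on (ball c r)) (\<lambda>x. jacobian \<phi> (at x)))\<^sup>2"
proof -
  define B where "B = ball c r"
  define m where "m x y = (1/2) *\<^sub>R (x + y)" for x y :: "real^'n"
  have [measurable]: "B \<in> sets borel" "\<Omega> \<in> sets borel" using \<Omega> by (simp_all add: B_def)
  have c\<phi>: "continuous_on UNIV \<phi>" by (rule smooth_continuous_on[OF \<phi>])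
  then have [measurable]: "\<phi> \<in> borel_measurable borel" by (rule borel_measurable_continuous_onI)
  have cJ: "continuous_on UNIV (\<lambda>x. jacobian \<phi> (at x))" by (rule continuous_on_jacobian[OF \<phi>])
  then have [measurable]: "(\<lambda>x. jacobian \<phi> (at x)) \<in> borel_measurable borel" by (rule borel_measurable_continuous_onI)
  have LB: "L2 (lebesgue_on B) \<phi>" "L2 (lebesgue_on B) (\<lambda>x. jacobian \<phi> (at x))"
    by (auto intro!: L2_continuous_bounded c\<phi> cJ simp: B_def)
  define P where "P = (\<integral>\<^sup>+x. ennreal ((norm (\<phi> x))\<^sup>2) * indicator B x \<partial>lborel)"
  define Q where "Q = (\<integral>\<^sup>+x. ennreal ((norm (jacobian \<phi> (at x)))\<^sup>2) * indicator B x \<partial>lborel)"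
  have P: "P = ennreal ((l2norm (lebesgue_on B) \<phi>)\<^sup>2)"
    unfolding P_def by (subst nn_integral_lebesgue_on[symmetric]) (auto simp: L2_nn_integral_eq LB)
  have Q: "Q = ennreal ((l2norm (lebesgue_on B) (\<lambda>x. jacobian \<phi> (at x)))\<^sup>2)"
    unfolding Q_def by (subst nn_integral_lebesgue_on[symmetric]) (auto simp: L2_nn_integral_eq LB)
  define M where "M = (\<integral>\<^sup>+y. \<integral>\<^sup>+x. ennreal ((norm (\<phi> (m x y) - \<phi> x))\<^sup>2) * indicator B x * indicator B y \<partial>lborel \<partial>lborel)"
  have M: "M \<le> ennreal (2 ^ CARD('n) * r\<^sup>2) * emeasure lborel B * Q"
    unfolding M_def m_def Q_def B_def by (rule Poincare_midpoint[OF \<phi> r])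
  have cm: "continuous_on UNIV (\<lambda>z. \<phi> (m (fst z) (snd z)))"
    unfolding m_def by (intro continuous_on_compose2[OF c\<phi>] continuous_intros) auto
  then have [measurable]: "(\<lambda>z. \<phi> (m (fst z) (snd z))) \<in> borel_measurable borel" by (rule borel_measurable_continuous_onI)
  have [measurable]: "fst \<in> borel_measurable (borel :: ((real^'n) \<times> (real^'n)) measure)"
     "snd \<in> borel_measurable (borel :: ((real^'n) \<times> (real^'n)) measure)"
    by (intro borel_measurable_continuous_onI continuous_intros)+
  \<comment> \<open>The midpoint is symmetric in x and y, so exchanging the integrals exchanges the
    two increments.\<close>
  have M': "M = (\<integral>\<^sup>+y. \<integral>\<^sup>+x. ennreal ((norm (\<phi> (m x y) - \<phi> y))\<^sup>2) * indicator B x * indicator B y \<partial>lborel \<partial>lborel)"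
  proof -
    have "M = (\<integral>\<^sup>+x. \<integral>\<^sup>+y. ennreal ((norm (\<phi> (m x y) - \<phi> x))\<^sup>2) * indicator B x * indicator B y \<partial>lborel \<partial>lborel)"
      unfolding M_def by (rule nn_integral_lborel_swap[symmetric]) (simp add: case_prod_beta')
    then show ?thesis by (simp add: m_def add.commute ac_simps)
  qed
  have mm: "(\<lambda>x. \<phi> (m x y)) \<in> borel_measurable borel" for y
    unfolding m_def by (intro borel_measurable_continuous_onI continuous_on_compose2[OF c\<phi>] continuous_intros) auto
  note mm [measurable]
  have "emeasure lborel (B - \<Omega>) * P = (\<integral>\<^sup>+y. \<integral>\<^sup>+x. ennreal ((norm (\<phi> x))\<^sup>2) * indicator B x * indicator (B - \<Omega>) y \<partial>lborel \<partial>lborel)"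
    unfolding P_def by (simp add: nn_integral_multc nn_integral_cmult mult.commute)
  also have "\<dots> \<le> (\<integral>\<^sup>+y. \<integral>\<^sup>+x. 2 * (ennreal ((norm (\<phi> (m x y) - \<phi> x))\<^sup>2) * indicator B x * indicator B y)
      + 2 * (ennreal ((norm (\<phi> (m x y) - \<phi> y))\<^sup>2) * indicator B x * indicator B y) \<partial>lborel \<partial>lborel)"
  proof (intro nn_integral_mono)
    fix y x
    show "ennreal ((norm (\<phi> x))\<^sup>2) * indicator B x * indicator (B - \<Omega>) y
      \<le> 2 * (ennreal ((norm (\<phi> (m x y) - \<phi> x))\<^sup>2) * indicator B x * indicator B y)
      + 2 * (ennreal ((norm (\<phi> (m x y) - \<phi> y))\<^sup>2) * indicator B x * indicator B y)"
    proof (cases "x \<in> B \<and> y \<in> B - \<Omega>")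
      case True
      have "norm (\<phi> x) = norm ((\<phi> (m x y) - \<phi> y) - (\<phi> (m x y) - \<phi> x))" using \<Omega>(2)[of y] True by simp
      also have "\<dots> \<le> norm (\<phi> (m x y) - \<phi> y) + norm (\<phi> (m x y) - \<phi> x)" by (rule norm_triangle_ineq4)
      finally have "(norm (\<phi> x))\<^sup>2 \<le> (norm (\<phi> (m x y) - \<phi> y) + norm (\<phi> (m x y) - \<phi> x))\<^sup>2"
        by (intro power_mono) auto
      also have "\<dots> \<le> 2 * (norm (\<phi> (m x y) - \<phi> x))\<^sup>2 + 2 * (norm (\<phi> (m x y) - \<phi> y))\<^sup>2"
        using sum_squares_bound[of "norm (\<phi> (m x y) - \<phi> y)" "norm (\<phi> (m x y) - \<phi> x)"] by (simp add: power2_sum)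
      finally have "ennreal ((norm (\<phi> x))\<^sup>2) \<le> ennreal (2 * (norm (\<phi> (m x y) - \<phi> x))\<^sup>2 + 2 * (norm (\<phi> (m x y) - \<phi> y))\<^sup>2)"
        by (rule ennreal_leI)
      then show ?thesis using True by (simp add: ennreal_mult)
    qed auto
  qed
  also have "\<dots> = 2 * M + 2 * (\<integral>\<^sup>+y. \<integral>\<^sup>+x. ennreal ((norm (\<phi> (m x y) - \<phi> y))\<^sup>2) * indicator B x * indicator B y \<partial>lborel \<partial>lborel)"
  proof -
    have "(\<lambda>y. \<integral>\<^sup>+x. ennreal ((norm (\<phi> (m x y) - \<phi> x))\<^sup>2) * indicator B x * indicator B y \<partial>lborel) \<in> borel_measurable lborel"
      by (rule lborel.borel_measurable_nn_integral) (simp add: case_prod_beta' borel_prod m_def add.commute, measurable)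
    moreover have "(\<lambda>y. \<integral>\<^sup>+x. ennreal ((norm (\<phi> (m x y) - \<phi> y))\<^sup>2) * indicator B x * indicator B y \<partial>lborel) \<in> borel_measurable lborel"
      by (rule lborel.borel_measurable_nn_integral) (simp add: case_prod_beta' borel_prod m_def add.commute, measurable)
    ultimately show ?thesis unfolding M_def
      by (simp add: nn_integral_add nn_integral_cmult)
  qed
  also have "\<dots> = 4 * M" unfolding M'[symmetric] by (simp flip: distrib_right)
  also have "\<dots> \<le> 4 * (ennreal (2 ^ CARD('n) * r\<^sup>2) * emeasure lborel B * Q)"
    by (intro mult_left_mono M) auto
  finally have *: "emeasure lborel (B - \<Omega>) * P \<le> 4 * (ennreal (2 ^ CARD('n) * r\<^sup>2) * emeasure lborel B * Q)" .
  have fB: "emeasure lborel B = ennreal (measure lborel B)" "emeasure lborel (B - \<Omega>) = ennreal (measure lborel (B - \<Omega>))"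
    using emeasure_bounded_finite[of B] emeasure_bounded_finite[of "B - \<Omega>"] bounded_ball[of c r] bounded_diff[of B \<Omega>]
    by (auto simp: B_def intro!: emeasure_eq_ennreal_measure)
  have "ennreal (measure lborel (B - \<Omega>) * (l2norm (lebesgue_on B) \<phi>)\<^sup>2)
      \<le> ennreal (4 * (2 ^ CARD('n) * r\<^sup>2 * measure lborel B * (l2norm (lebesgue_on B) (\<lambda>x. jacobian \<phi> (at x)))\<^sup>2))"
    using * unfolding fB P Q by (simp add: ennreal_mult)
  then have "measure lborel (B - \<Omega>) * (l2norm (lebesgue_on B) \<phi>)\<^sup>2
      \<le> 4 * (2 ^ CARD('n) * r\<^sup>2 * measure lborel B * (l2norm (lebesgue_on B) (\<lambda>x. jacobian \<phi> (at x)))\<^sup>2)"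
    by (simp add: ennreal_le_iff)
  moreover have "\<theta> * measure lborel B \<le> measure lborel (B - \<Omega>)"
    using \<theta>(2) by (simp add: B_def)
  then have "\<theta> * measure lborel B * (l2norm (lebesgue_on B) \<phi>)\<^sup>2 \<le> measure lborel (B - \<Omega>) * (l2norm (lebesgue_on B) \<phi>)\<^sup>2"
    by (rule mult_right_mono) simp
  ultimately have "measure lborel B * (\<theta> * (l2norm (lebesgue_on B) \<phi>)\<^sup>2)
    \<le> measure lborel B * (2 ^ (CARD('n) + 2) * r\<^sup>2 * (l2norm (lebesgue_on B) (\<lambda>x. jacobian \<phi> (at x)))\<^sup>2)"
    by (simp add: ac_simps)
  moreover have "measure lborel B > 0"
    using r content_ball_pos[of r c] by (simp add: B_def)
  ultimately show ?thesis unfolding B_def[symmetric] by simp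
qed

section \<open>Restricted measures, divergence and the coefficient form\<close>

subsection \<open>Integrals over subsets\<close>

lemma set_integral_lebesgue_on:
  "U \<in> sets lebesgue \<Longrightarrow> (LINT x:U|lebesgue. f x) = (\<integral>x. f x \<partial>lebesgue_on U)"
  for f :: "'a::euclidean_space \<Rightarrow> 'b::{banach, second_countable_topology}"
  by (simp add: set_lebesgue_integral_def integral_restrict_space)

lemma set_integrable_lebesgue_on:
  "U \<in> sets lebesgue \<Longrightarrow> set_integrable lebesgue U f \<longleftrightarrow> integrable (lebesgue_on U) f"
  for f :: "'a::euclidean_space \<Rightarrow> 'b::{banach, second_countable_topology}"
  by (simp add: set_integrable_def integrable_restrict_space)

lemma set_borel_measurable_lebesgue_on:
  "U \<in> sets lebesgue \<Longrightarrow> set_borel_measurable lebesgue U f \<longleftrightarrow> f \<in> borel_measurable (lebesgue_on U)"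
  for f :: "'a::euclidean_space \<Rightarrow> 'b::real_normed_vector"
  by (simp add: set_borel_measurable_def borel_measurable_restrict_space_iff)

lemma in_Lp_2: "U \<in> sets lebesgue \<Longrightarrow> in_Lp 2 U f \<longleftrightarrow> L2 (lebesgue_on U) f"
  by (simp add: in_Lp_def L2_def set_borel_measurable_lebesgue_on set_integrable_lebesgue_on)

lemma Lp_norm_2: "U \<in> sets lebesgue \<Longrightarrow> Lp_norm 2 U f = l2norm (lebesgue_on U) f"
  by (simp add: Lp_norm_def l2norm_def set_integral_lebesgue_on powr_half_sqrt)

lemma integral_lebesgue_on_mono_set:
  fixes f :: "'a::euclidean_space \<Rightarrow> 'b::{banach, second_countable_topology}"
  assumes "U \<in> sets lebesgue" "V \<in> sets lebesgue" "U \<subseteq> V" "\<And>x. x \<in> V - U \<Longrightarrow> f x = 0"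
  shows "(\<integral>x. f x \<partial>lebesgue_on V) = (\<integral>x. f x \<partial>lebesgue_on U)"
  using assms by (auto simp: integral_restrict_space indicator_def intro!: Bochner_Integration.integral_cong)

lemma integrable_lebesgue_on_subset:
  fixes f :: "'a::euclidean_space \<Rightarrow> 'b::{banach, second_countable_topology}"
  assumes "integrable (lebesgue_on V) f" "U \<in> sets lebesgue" "V \<in> sets lebesgue" "U \<subseteq> V"
  shows "integrable (lebesgue_on U) f"
proof -
  have "set_integrable lebesgue V f" using assms by (simp add: set_integrable_lebesgue_on)
  then have "set_integrable lebesgue U f" using assms by (intro set_integrable_subset[of lebesgue V f U])
  then show ?thesis using assms by (simp add: set_integrable_lebesgue_on)
qed

lemma borel_measurable_lebesgue_on_subset:
  fixes f :: "'a::euclidean_space \<Rightarrow> 'b::topological_space"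
  assumes "f \<in> borel_measurable (lebesgue_on V)" "U \<subseteq> V"
  shows "f \<in> borel_measurable (lebesgue_on U)"
  by (rule measurable_restrict_mono[OF assms])

lemma L2_subset:
  assumes "L2 (lebesgue_on V) f" "U \<in> sets lebesgue" "V \<in> sets lebesgue" "U \<subseteq> V"
  shows "L2 (lebesgue_on U) f"
  unfolding L2_def
proof
  show "f \<in> borel_measurable (lebesgue_on U)"
    by (rule borel_measurable_lebesgue_on_subset[OF L2_measurable[OF assms(1)] assms(4)])
  show "integrable (lebesgue_on U) (\<lambda>x. (norm (f x))\<^sup>2)"
    by (rule integrable_lebesgue_on_subset[OF L2_integrable[OF assms(1)] assms(2-4)])
qed

lemma l2norm_subset:
  assumes "L2 (lebesgue_on V) f" "U \<in> sets lebesgue" "V \<in> sets lebesgue" "U \<subseteq> V"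
  shows "l2norm (lebesgue_on U) f \<le> l2norm (lebesgue_on V) f"
proof -
  have "(\<integral>x. (norm (f x))\<^sup>2 \<partial>lebesgue_on U) \<le> (\<integral>x. (norm (f x))\<^sup>2 \<partial>lebesgue_on V)"
  proof -
    have i: "integrable lebesgue (\<lambda>x. indicator V x *\<^sub>R (norm (f x))\<^sup>2)"
      using L2_integrable[OF assms(1)] assms(3) by (simp add: integrable_restrict_space)
    have "(\<integral>x. indicator U x *\<^sub>R (norm (f x))\<^sup>2 \<partial>lebesgue) \<le> (\<integral>x. indicator V x *\<^sub>R (norm (f x))\<^sup>2 \<partial>lebesgue)"
      by (rule integral_mono'[OF i]) (use assms(4) in \<open>auto simp: indicator_def\<close>)
    then show ?thesis using assms(2,3) by (simp add: integral_restrict_space)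
  qed
  then show ?thesis by (simp add: l2norm_def)
qed

lemma finite_measure_lebesgue_on:
  assumes "U \<in> sets lebesgue" "bounded U"
  shows "finite_measure (lebesgue_on U)"
proof (rule finite_measureI)
  have "emeasure lebesgue U \<noteq> \<infinity>"
    using fmeasurableD2[OF bounded_set_imp_lmeasurable[OF assms(2,1)]] by simp
  then show "emeasure (lebesgue_on U) (space (lebesgue_on U)) \<noteq> \<infinity>"
    using assms by (simp add: emeasure_restrict_space)
qed

lemma L2_const: "U \<in> sets lebesgue \<Longrightarrow> bounded U \<Longrightarrow> L2 (lebesgue_on U) (\<lambda>_. c)"
  using finite_measure.integrable_const[OF finite_measure_lebesgue_on] by (auto simp: L2_def)

lemma L2_imp_integrable:
  assumes "L2 (lebesgue_on U) f" "U \<in> sets lebesgue" "bounded U"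
  shows "integrable (lebesgue_on U) f"
proof -
  have "integrable (lebesgue_on U) (\<lambda>x. norm (f x) * norm (1::real))"
    by (intro L2_prod_integrable assms L2_const)
  then have "integrable (lebesgue_on U) (\<lambda>x. norm (f x))" by simp
  then show ?thesis by (rule integrable_norm_cancel[OF _ L2_measurable[OF assms(1)]])
qed

lemma integral_lebesgue_on_lborel:
  fixes f :: "'a::euclidean_space \<Rightarrow> real"
  assumes "f \<in> borel_measurable borel" "U \<in> sets borel" "\<And>x. x \<notin> U \<Longrightarrow> f x = 0"
  shows "(\<integral>x. f x \<partial>lebesgue_on U) = (\<integral>x. f x \<partial>lborel)"
proof -
  have "(\<integral>x. f x \<partial>lebesgue_on U) = (\<integral>x. f x \<partial>lebesgue)"
    using assms by (auto simp: integral_restrict_space indicator_def intro!: Bochner_Integration.integral_cong)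
  also have "\<dots> = (\<integral>x. f x \<partial>lborel)" using assms by (intro integral_completion) auto
  finally show ?thesis .
qed

lemma integrable_lebesgue_on_lborel:
  fixes f :: "'a::euclidean_space \<Rightarrow> 'b::euclidean_space"
  assumes "integrable lborel f" "U \<in> sets borel"
  shows "integrable (lebesgue_on U) f"
proof -
  have "f \<in> borel_measurable lborel" using assms by auto
  then have "integrable lebesgue f" using assms by (subst integrable_completion) auto
  then have "integrable lebesgue (\<lambda>x. indicator U x *\<^sub>R f x)"
    using assms(2) by (intro integrable_mult_indicator) auto
  then show ?thesis using assms(2) by (simp add: integrable_restrict_space)
qed

lemma test_function_continuous: "test_function U \<phi> \<Longrightarrow> continuous_on S \<phi>"
  using smooth_continuous_on test_function_smooth by blast

lemma test_function_integrable:
  fixes \<phi> :: "'a::euclidean_space \<Rightarrow> 'b::euclidean_space"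
  assumes "test_function U \<phi>"
  shows "integrable lborel \<phi>"
proof -
  from assms obtain K where K: "compact K" "K \<subseteq> U" "\<And>x. x \<notin> K \<Longrightarrow> \<phi> x = 0"
    by (rule test_functionE) blast
  show ?thesis
    by (rule continuous_compact_support_integrable[OF test_function_continuous[OF assms] K(1,3)])
qed

lemma test_function_L2_lborel:
  fixes \<phi> :: "'a::euclidean_space \<Rightarrow> 'b::euclidean_space"
  assumes "test_function U \<phi>"
  shows "L2 lborel \<phi>"
proof -
  from assms obtain K where K: "compact K" "K \<subseteq> U" "\<And>x. x \<notin> K \<Longrightarrow> \<phi> x = 0"
    by (rule test_functionE) blast
  have "integrable lborel (\<lambda>x. (norm (\<phi> x))\<^sup>2)"
    by (rule continuous_compact_support_integrable[OF _ K(1)])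
       (use K test_function_continuous[OF assms] in \<open>auto intro!: continuous_intros\<close>)
  then show ?thesis
    using test_function_continuous[OF assms] by (simp add: L2_def borel_measurable_continuous_onI)
qed

lemma L2_lebesgue_on_lborel:
  fixes f :: "'a::euclidean_space \<Rightarrow> 'b::euclidean_space"
  assumes "L2 lborel f" "U \<in> sets borel"
  shows "L2 (lebesgue_on U) f"
  unfolding L2_def
proof
  show "f \<in> borel_measurable (lebesgue_on U)"
    using assms by (intro measurable_restrict_space1 measurable_completion) (auto simp: L2_def)
  show "integrable (lebesgue_on U) (\<lambda>x. (norm (f x))\<^sup>2)"
    by (intro integrable_lebesgue_on_lborel L2_integrable assms)
qed

lemma l2norm_lebesgue_on_lborel:
  fixes f :: "'a::euclidean_space \<Rightarrow> 'b::euclidean_space"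
  assumes "L2 lborel f" "U \<in> sets borel"
  shows "l2norm (lebesgue_on U) f \<le> l2norm lborel f"
    and "(\<And>x. x \<notin> U \<Longrightarrow> f x = 0) \<Longrightarrow> l2norm (lebesgue_on U) f = l2norm lborel f"
proof -
  have m: "(\<lambda>x. (norm (f x))\<^sup>2) \<in> borel_measurable borel" using L2_integrable[OF assms(1)] by auto
  have "(\<integral>x. (norm (f x))\<^sup>2 \<partial>lborel) = (\<integral>x. (norm (f x))\<^sup>2 \<partial>lebesgue_on UNIV)"
    by (rule integral_lebesgue_on_lborel[symmetric, OF m]) auto
  then have "l2norm lborel f = l2norm (lebesgue_on UNIV) f" by (simp add: l2norm_def)
  then show "l2norm (lebesgue_on U) f \<le> l2norm lborel f"
    using assms l2norm_subset[OF L2_lebesgue_on_lborel[OF assms(1)], of UNIV U] by simp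
  show "l2norm (lebesgue_on U) f = l2norm lborel f" if "\<And>x. x \<notin> U \<Longrightarrow> f x = 0"
    unfolding l2norm_def by (subst integral_lebesgue_on_lborel[OF m assms(2)]) (use that in auto)
qed

lemma test_function_L2:
  fixes \<phi> :: "'a::euclidean_space \<Rightarrow> 'b::euclidean_space"
  shows "test_function U \<phi> \<Longrightarrow> V \<in> sets borel \<Longrightarrow> L2 (lebesgue_on V) \<phi>"
  by (intro L2_lebesgue_on_lborel test_function_L2_lborel)

lemma test_function_jacobian:
  fixes \<phi> :: "real^'n \<Rightarrow> real^'N"
  assumes "test_function U \<phi>"
  shows "test_function U (\<lambda>x. jacobian \<phi> (at x))"
proof -
  have "test_function U (\<lambda>x. \<Sum>\<alpha>\<in>UNIV. (\<chi> i. axis \<alpha> (frechet_derivative \<phi> (at x) (axis \<alpha> 1) $ i)))"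
  proof (intro test_function_sum test_function_linear[OF _ test_function_frechet[OF assms]])
    show "bounded_linear (\<lambda>v::real^'N. \<chi> i. axis \<alpha> (v $ i) :: real^'n^'N)" for \<alpha> :: 'n
      by (rule linear_conv_bounded_linear[THEN iffD1], rule linearI) (simp_all add: vec_eq_iff axis_def)
  qed
  also have "(\<lambda>x. \<Sum>\<alpha>\<in>UNIV. (\<chi> i. axis \<alpha> (frechet_derivative \<phi> (at x) (axis \<alpha> 1) $ i)))
      = (\<lambda>x. jacobian \<phi> (at x))"
    by (simp add: fun_eq_iff vec_eq_iff jacobian_nth axis_def if_distrib if_distribR cong: if_cong)
  finally show ?thesis .
qed

lemma jacobian_add_scaleR:
  fixes \<phi> \<psi> :: "real^'n \<Rightarrow> real^'N"
  assumes "smooth \<phi>" "smooth \<psi>"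
  shows "jacobian (\<lambda>x. \<phi> x + c *\<^sub>R \<psi> x) (at x) = jacobian \<phi> (at x) + c *\<^sub>R jacobian \<psi> (at x)"
proof -
  have "((\<lambda>x. \<phi> x + c *\<^sub>R \<psi> x) has_derivative
      (\<lambda>v. frechet_derivative \<phi> (at x) v + c *\<^sub>R frechet_derivative \<psi> (at x) v)) (at x)"
    by (intro has_derivative_add has_derivative_scaleR_right smooth_has_derivative assms)
  then show ?thesis
    by (simp add: vec_eq_iff jacobian_nth frechet_derivative_eqI)
qed

lemma jacobian_diff:
  fixes \<phi> \<psi> :: "real^'n \<Rightarrow> real^'N"
  assumes "smooth \<phi>" "smooth \<psi>"
  shows "jacobian (\<lambda>x. \<phi> x - \<psi> x) (at x) = jacobian \<phi> (at x) - jacobian \<psi> (at x)"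
  using jacobian_add_scaleR[OF assms, of "-1"] by simp

subsection \<open>Divergence\<close>

text \<open>Row by row divergence, the formal adjoint of minus the Jacobian. Weak gradients are
  tested with whole matrix fields through it, instead of entry by entry.\<close>

definition vdiv :: "(real^'n \<Rightarrow> real^'n^'N) \<Rightarrow> real^'n \<Rightarrow> real^'N" where
  "vdiv F x = (\<chi> i. \<Sum>\<alpha>\<in>UNIV. frechet_derivative F (at x) (axis \<alpha> 1) $ i $ \<alpha>)"

lemma test_function_vdiv:
  assumes "test_function U F"
  shows "test_function U (vdiv F)"
proof -
  have "test_function U (\<lambda>x. \<Sum>\<alpha>\<in>UNIV. (\<chi> i. frechet_derivative F (at x) (axis \<alpha> 1) $ i $ \<alpha>))"
  proof (intro test_function_sum test_function_linear[OF _ test_function_frechet[OF assms]])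
    show "bounded_linear (\<lambda>v::real^'a^'b. (\<chi> i. v $ i $ \<alpha>))" for \<alpha>
      by (rule linear_conv_bounded_linear[THEN iffD1], rule linearI) (simp_all add: vec_eq_iff)
  qed
  also have "(\<lambda>x. \<Sum>\<alpha>\<in>UNIV. (\<chi> i. frechet_derivative F (at x) (axis \<alpha> 1) $ i $ \<alpha>)) = vdiv F"
    by (simp add: fun_eq_iff vec_eq_iff vdiv_def)
  finally show ?thesis .
qed

lemma integral_by_parts_vdiv:
  fixes \<phi> :: "real^'n \<Rightarrow> real^'N"
  assumes \<phi>: "smooth \<phi>" and F: "test_function UNIV F"
  shows "(\<integral>x. \<phi> x \<bullet> vdiv F x \<partial>lborel) = - (\<integral>x. jacobian \<phi> (at x) \<bullet> F x \<partial>lborel)"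
proof -
  define K where "K = closure {x. F x \<noteq> 0}"
  have K: "compact K" "smooth F"
    using F by (simp_all add: test_function_def K_def)
  define h' where "h' i \<alpha> x v = \<phi> x $ i * (frechet_derivative F (at x) v $ i $ \<alpha>)
      + (frechet_derivative \<phi> (at x) v $ i) * F x $ i $ \<alpha>" for i \<alpha> x v
  have c: "continuous_on UNIV (\<lambda>x. h' i \<alpha> x v)" for i \<alpha> v
    unfolding h'_def
    by (intro continuous_intros smooth_continuous_on smooth_frechet_derivative \<phi> K)
  have FD: "frechet_derivative F (at x) v = 0" if "x \<notin> K" for x v
    using that frechet_derivative_off_support[of x F] by (simp add: K_def)
  have F0: "F x = 0" if "x \<notin> K" for x
    using that closure_subset[of "{x. F x \<noteq> 0}"] unfolding K_def by blast
  have z: "h' i \<alpha> x v = 0" if "x \<notin> K" for i \<alpha> x v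
    using that FD F0 by (simp add: h'_def)
  have int: "integrable lborel (\<lambda>x. h' i \<alpha> x v)" for i \<alpha> v
    by (rule continuous_compact_support_integrable[OF c K(1) z])
  have 0: "(\<integral>x. h' i \<alpha> x (axis \<alpha> 1) \<partial>lborel) = 0" for i \<alpha>
  proof (rule integral_derivative_zero[OF _ c K(1) _ z])
    show "((\<lambda>x. \<phi> x $ i * F x $ i $ \<alpha>) has_derivative h' i \<alpha> x) (at x)" for x
    proof -
      have 1: "((\<lambda>x. \<phi> x $ i) has_derivative (\<lambda>v. frechet_derivative \<phi> (at x) v $ i)) (at x)"
        by (intro bounded_linear.has_derivative[OF bounded_linear_vec_nth] smooth_has_derivative \<phi>)
      have 2: "((\<lambda>x. F x $ i $ \<alpha>) has_derivative (\<lambda>v. frechet_derivative F (at x) v $ i $ \<alpha>)) (at x)"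
        by (intro bounded_linear.has_derivative[OF bounded_linear_vec_nth] smooth_has_derivative K)
      show ?thesis
        by (rule has_derivative_eq_rhs[OF has_derivative_mult[OF 1 2]]) (simp add: h'_def fun_eq_iff)
    qed
    show "\<phi> x $ i * F x $ i $ \<alpha> = 0" if "x \<notin> K" for x using that F0 by simp
  qed
  have "\<phi> x \<bullet> vdiv F x + jacobian \<phi> (at x) \<bullet> F x = (\<Sum>i\<in>UNIV. \<Sum>\<alpha>\<in>UNIV. h' i \<alpha> x (axis \<alpha> 1))" for x
    by (simp add: inner_vec_def vdiv_def h'_def jacobian_nth sum.distrib sum_distrib_left)
  then have "(\<integral>x. \<phi> x \<bullet> vdiv F x + jacobian \<phi> (at x) \<bullet> F x \<partial>lborel) = 0"
    by (simp add: Bochner_Integration.integral_sum Bochner_Integration.integrable_sum int 0)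
  moreover have "integrable lborel (\<lambda>x. \<phi> x \<bullet> vdiv F x)"
  proof (rule continuous_compact_support_integrable[OF _ K(1)])
    show "continuous_on UNIV (\<lambda>x. \<phi> x \<bullet> vdiv F x)"
      by (intro continuous_intros smooth_continuous_on \<phi> test_function_continuous[OF test_function_vdiv[OF F]])
    show "\<phi> x \<bullet> vdiv F x = 0" if "x \<notin> K" for x
      using that FD by (simp add: vdiv_def inner_vec_def)
  qed
  moreover have "integrable lborel (\<lambda>x. jacobian \<phi> (at x) \<bullet> F x)"
  proof (rule continuous_compact_support_integrable[OF _ K(1)])
    show "continuous_on UNIV (\<lambda>x. jacobian \<phi> (at x) \<bullet> F x)"
      by (intro continuous_on_inner continuous_on_jacobian[OF \<phi>] smooth_continuous_on[OF K(2)])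
    show "jacobian \<phi> (at x) \<bullet> F x = 0" if "x \<notin> K" for x
      using F0[OF that] by simp
  qed
  ultimately show ?thesis by simp
qed

subsection \<open>The coefficients as linear maps\<close>

text \<open>The flux A Du. It writes the coefficient form as an inner product, to which the L2
  lemmas apply directly.\<close>

definition cmul :: "('n::finite, 'N::finite) coeffs \<Rightarrow> real^'n \<Rightarrow> real^'n^'N \<Rightarrow> real^'n^'N" where
  "cmul A x p = (\<chi> i \<alpha>. \<Sum>\<beta>\<in>UNIV. \<Sum>j\<in>UNIV. A \<alpha> \<beta> i j x * p $ j $ \<beta>)"

lemma coeff_form_cmul: "coeff_form A x p q = cmul A x p \<bullet> q"
proof -
  have "cmul A x p \<bullet> q = (\<Sum>i\<in>UNIV. \<Sum>\<alpha>\<in>UNIV. \<Sum>\<beta>\<in>UNIV. \<Sum>j\<in>UNIV. A \<alpha> \<beta> i j x * p $ j $ \<beta> * q $ i $ \<alpha>)"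
    by (simp add: inner_matrix cmul_def sum_distrib_right)
  also have "\<dots> = (\<Sum>\<alpha>\<in>UNIV. \<Sum>i\<in>UNIV. \<Sum>\<beta>\<in>UNIV. \<Sum>j\<in>UNIV. A \<alpha> \<beta> i j x * p $ j $ \<beta> * q $ i $ \<alpha>)"
    by (rule sum.swap)
  also have "\<dots> = coeff_form A x p q"
    unfolding coeff_form_def by (intro sum.cong refl sum.swap)
  finally show ?thesis by simp
qed

lemma coeff_form_transpose: "coeff_form (transpose_coeffs A) x p q = coeff_form A x q p"
proof -
  have "coeff_form (transpose_coeffs A) x p q
      = (\<Sum>\<alpha>\<in>UNIV. \<Sum>\<beta>\<in>UNIV. \<Sum>i\<in>UNIV. \<Sum>j\<in>UNIV. A \<beta> \<alpha> j i x * q $ i $ \<alpha> * p $ j $ \<beta>)"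
    by (simp add: coeff_form_def transpose_coeffs_def ac_simps)
  also have "\<dots> = (\<Sum>\<beta>\<in>UNIV. \<Sum>\<alpha>\<in>UNIV. \<Sum>i\<in>UNIV. \<Sum>j\<in>UNIV. A \<beta> \<alpha> j i x * q $ i $ \<alpha> * p $ j $ \<beta>)"
    by (rule sum.swap)
  also have "\<dots> = (\<Sum>\<beta>\<in>UNIV. \<Sum>\<alpha>\<in>UNIV. \<Sum>j\<in>UNIV. \<Sum>i\<in>UNIV. A \<beta> \<alpha> j i x * q $ i $ \<alpha> * p $ j $ \<beta>)"
    by (intro sum.cong refl sum.swap)
  finally show ?thesis by (simp add: coeff_form_def)
qed

lemma transpose_transpose [simp]: "transpose_coeffs (transpose_coeffs A) = A"
  by (simp add: transpose_coeffs_def)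

lemma strongly_elliptic_transpose: "strongly_elliptic lam A \<Longrightarrow> strongly_elliptic lam (transpose_coeffs A)"
  by (simp add: strongly_elliptic_def coeff_form_transpose)

lemma measurable_coeffs_transpose: "measurable_coeffs A \<Longrightarrow> measurable_coeffs (transpose_coeffs A)"
  by (simp add: measurable_coeffs_def transpose_coeffs_def)

lemma bounded_coeffs_transpose:
  assumes "bounded_coeffs Lam A"
  shows "bounded_coeffs Lam (transpose_coeffs A)"
proof -
  have "(\<Sum>i\<in>UNIV. \<Sum>j\<in>UNIV. \<Sum>\<alpha>\<in>UNIV. \<Sum>\<beta>\<in>UNIV. \<bar>A \<beta> \<alpha> j i x\<bar>\<^sup>2)
      = (\<Sum>j\<in>UNIV. \<Sum>i\<in>UNIV. \<Sum>\<beta>\<in>UNIV. \<Sum>\<alpha>\<in>UNIV. \<bar>A \<beta> \<alpha> j i x\<bar>\<^sup>2)" for x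
    by (subst sum.swap) (intro sum.cong refl sum.swap)
  then show ?thesis using assms by (simp add: bounded_coeffs_def transpose_coeffs_def)
qed

text \<open>Cauchy-Schwarz for four-index tensors: the coefficients have norm at most Lam, and the
  tensor product of p and q has norm |p| |q|. The rearrangements only bring the sums into the order
  of \<open>bounded_coeffs\<close>.\<close>

lemma coeff_form_bound:
  assumes "bounded_coeffs Lam A" "Lam \<ge> 0"
  shows "\<bar>coeff_form A x p q\<bar> \<le> Lam * norm p * norm q"
proof -
  define a where "a = (\<chi> i j \<alpha> \<beta>. A \<alpha> \<beta> i j x)"
  define b where "b = (\<chi> i j \<alpha> \<beta>. p $ j $ \<beta> * q $ i $ \<alpha>)"
  have "coeff_form A x p q = (\<Sum>\<alpha>\<in>UNIV. \<Sum>i\<in>UNIV. \<Sum>\<beta>\<in>UNIV. \<Sum>j\<in>UNIV. A \<alpha> \<beta> i j x * p $ j $ \<beta> * q $ i $ \<alpha>)"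
    unfolding coeff_form_def by (intro sum.cong refl sum.swap)
  also have "\<dots> = (\<Sum>i\<in>UNIV. \<Sum>\<alpha>\<in>UNIV. \<Sum>j\<in>UNIV. \<Sum>\<beta>\<in>UNIV. A \<alpha> \<beta> i j x * p $ j $ \<beta> * q $ i $ \<alpha>)"
    by (subst sum.swap) (intro sum.cong refl sum.swap)
  also have "\<dots> = (\<Sum>i\<in>UNIV. \<Sum>j\<in>UNIV. \<Sum>\<alpha>\<in>UNIV. \<Sum>\<beta>\<in>UNIV. A \<alpha> \<beta> i j x * p $ j $ \<beta> * q $ i $ \<alpha>)"
    by (intro sum.cong refl sum.swap)
  also have "\<dots> = a \<bullet> b"
    by (simp add: a_def b_def inner_vec_def mult.assoc)
  also have "\<bar>\<dots>\<bar> \<le> norm a * norm b" by (rule Cauchy_Schwarz_ineq2)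
  also have "norm a \<le> Lam"
  proof (rule power2_le_imp_le[OF _ assms(2)])
    have "(norm a)\<^sup>2 = (\<Sum>i\<in>UNIV. \<Sum>j\<in>UNIV. \<Sum>\<alpha>\<in>UNIV. \<Sum>\<beta>\<in>UNIV. \<bar>A \<alpha> \<beta> i j x\<bar>\<^sup>2)"
      unfolding power2_norm_eq_inner inner_vec_def by (simp add: a_def power2_eq_square)
    also have "\<dots> \<le> Lam\<^sup>2" using assms(1) by (simp add: bounded_coeffs_def)
    finally show "(norm a)\<^sup>2 \<le> Lam\<^sup>2" .
  qed
  also have "norm b = norm p * norm q"
  proof (rule power2_eq_imp_eq)
    have "(norm b)\<^sup>2 = (\<Sum>i\<in>UNIV. \<Sum>j\<in>UNIV. \<Sum>\<alpha>\<in>UNIV. \<Sum>\<beta>\<in>UNIV. (p $ j $ \<beta>)\<^sup>2 * (q $ i $ \<alpha>)\<^sup>2)"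
      unfolding power2_norm_eq_inner inner_vec_def by (simp add: b_def power2_eq_square ac_simps)
    also have "\<dots> = (\<Sum>i\<in>UNIV. \<Sum>j\<in>UNIV. (\<Sum>\<beta>\<in>UNIV. (p $ j $ \<beta>)\<^sup>2) * (\<Sum>\<alpha>\<in>UNIV. (q $ i $ \<alpha>)\<^sup>2))"
      by (intro sum.cong refl) (subst sum.swap, simp add: sum_product)
    also have "\<dots> = (\<Sum>j\<in>UNIV. \<Sum>\<beta>\<in>UNIV. (p $ j $ \<beta>)\<^sup>2) * (\<Sum>i\<in>UNIV. \<Sum>\<alpha>\<in>UNIV. (q $ i $ \<alpha>)\<^sup>2)"
      by (subst sum.swap) (simp add: sum_product)
    also have "\<dots> = (norm p * norm q)\<^sup>2" by (simp add: norm_matrix_square power_mult_distrib)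
    finally show "(norm b)\<^sup>2 = (norm p * norm q)\<^sup>2" .
  qed auto
  finally show ?thesis using mult_right_mono[of "norm a" Lam "norm p * norm q"] by (simp add: mult.assoc mult_right_mono)
qed

lemma norm_cmul:
  assumes "bounded_coeffs Lam A" "Lam \<ge> 0"
  shows "norm (cmul A x p) \<le> Lam * norm p"
proof (cases "cmul A x p = 0")
  case False
  have "norm (cmul A x p) * norm (cmul A x p) = coeff_form A x p (cmul A x p)"
    by (simp add: coeff_form_cmul power2_norm_eq_inner flip: power2_eq_square)
  also have "\<dots> \<le> Lam * norm p * norm (cmul A x p)"
    using coeff_form_bound[OF assms, of x p "cmul A x p"] by linarith
  finally show ?thesis using False by simp
qed (use assms in simp)

lemma coeff_form_elliptic:
  assumes "strongly_elliptic lam A"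
  shows "lam * (norm p)\<^sup>2 \<le> coeff_form A x p p"
  using assms by (simp add: strongly_elliptic_def norm_matrix_square)

lemma borel_measurable_nth:
  fixes f :: "'a \<Rightarrow> ('b::euclidean_space)^'n"
  assumes "f \<in> borel_measurable M"
  shows "(\<lambda>x. f x $ i) \<in> borel_measurable M"
  by (rule measurable_compose[OF assms borel_measurable_continuous_onI]) (intro continuous_intros)

lemma borel_measurable_vec_lambda:
  fixes f :: "'a \<Rightarrow> ('b::euclidean_space)^'n"
  assumes "\<And>i. (\<lambda>x. f x $ i) \<in> borel_measurable M"
  shows "f \<in> borel_measurable M"
proof (subst borel_measurable_euclidean_space, intro ballI)
  fix b :: "'b^'n" assume "b \<in> Basis"
  have "(\<lambda>x. \<Sum>i\<in>UNIV. f x $ i \<bullet> b $ i) \<in> borel_measurable M"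
    by (intro borel_measurable_sum borel_measurable_inner assms borel_measurable_const)
  then show "(\<lambda>x. f x \<bullet> b) \<in> borel_measurable M" by (simp add: inner_vec_def)
qed

lemma cmul_measurable:
  assumes "measurable_coeffs A" "f \<in> borel_measurable (lebesgue_on U)"
  shows "(\<lambda>x. cmul A x (f x)) \<in> borel_measurable (lebesgue_on U)"
proof (intro borel_measurable_vec_lambda)
  have "A \<alpha> \<beta> i j \<in> borel_measurable (lebesgue_on U)" for \<alpha> \<beta> i j
    using assms(1) by (simp add: measurable_coeffs_def measurable_restrict_space1)
  moreover have "(\<lambda>x. f x $ j $ \<beta>) \<in> borel_measurable (lebesgue_on U)" for j \<beta>
    by (intro borel_measurable_nth assms)
  ultimately show "(\<lambda>x. cmul A x (f x) $ i $ \<alpha>) \<in> borel_measurable (lebesgue_on U)" for i \<alpha>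
    unfolding cmul_def by (simp add: borel_measurable_sum borel_measurable_times)
qed

lemma L2_cmul:
  assumes "measurable_coeffs A" "bounded_coeffs Lam A" "Lam \<ge> 0" "L2 (lebesgue_on U) f"
  shows "L2 (lebesgue_on U) (\<lambda>x. cmul A x (f x))"
  by (rule L2_bound[OF assms(4) cmul_measurable[OF assms(1) L2_measurable[OF assms(4)]]])
     (rule norm_cmul[OF assms(2,3)])

section \<open>The energy space and energy estimates\<close>

subsection \<open>Closure of the test functions in the energy norm\<close>

text \<open>Membership in this space needs only local convergence of the functions themselves, so that,
  unlike for \<^const>\<open>in_Y12_0\<close>, completeness follows from the Hardy inequality.\<close>

definition energy_closure ::
    "(real^'n) set \<Rightarrow> (real^'n \<Rightarrow> real^'N) \<Rightarrow> (real^'n \<Rightarrow> real^'n^'N) \<Rightarrow> (nat \<Rightarrow> real^'n \<Rightarrow> real^'N) \<Rightarrow> bool" where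
  "energy_closure \<Omega> u Du \<phi> \<longleftrightarrow>
     L2 (lebesgue_on \<Omega>) Du \<and> (\<forall>R. L2 (lebesgue_on (\<Omega> \<inter> ball 0 R)) u) \<and>
     (\<forall>k. test_function \<Omega> (\<phi> k)) \<and>
     (\<forall>R. (\<lambda>k. l2norm (lebesgue_on (\<Omega> \<inter> ball 0 R)) (\<lambda>x. u x - \<phi> k x)) \<longlonglongrightarrow> 0) \<and>
     (\<lambda>k. l2norm (lebesgue_on \<Omega>) (\<lambda>x. Du x - jacobian (\<phi> k) (at x))) \<longlonglongrightarrow> 0"

lemma energy_closureD:
  assumes "energy_closure \<Omega> u Du \<phi>"
  shows "L2 (lebesgue_on \<Omega>) Du" "test_function \<Omega> (\<phi> k)"
    "(\<lambda>k. l2norm (lebesgue_on \<Omega>) (\<lambda>x. Du x - jacobian (\<phi> k) (at x))) \<longlonglongrightarrow> 0"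
  using assms by (auto simp: energy_closure_def)

lemma l2norm_tendsto_subset:
  assumes "(\<lambda>k. l2norm (lebesgue_on V) (f k)) \<longlonglongrightarrow> 0" "\<And>k. L2 (lebesgue_on V) (f k)"
    and "U \<in> sets lebesgue" "V \<in> sets lebesgue" "U \<subseteq> V"
  shows "(\<lambda>k. l2norm (lebesgue_on U) (f k)) \<longlonglongrightarrow> 0"
  by (rule Lim_null_comparison[OF _ assms(1)])
     (simp add: always_eventually l2norm_subset[OF assms(2-5)])

lemma energy_closure_bounded:
  assumes E: "energy_closure \<Omega> u Du \<phi>" and "open \<Omega>" "U \<in> sets lebesgue" "bounded U" "U \<subseteq> \<Omega>"
  shows "L2 (lebesgue_on U) u" "(\<lambda>k. l2norm (lebesgue_on U) (\<lambda>x. u x - \<phi> k x)) \<longlonglongrightarrow> 0"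
    "L2 (lebesgue_on U) Du" "(\<lambda>k. l2norm (lebesgue_on U) (\<lambda>x. Du x - jacobian (\<phi> k) (at x))) \<longlonglongrightarrow> 0"
proof -
  obtain R where R: "U \<subseteq> ball 0 R" using \<open>bounded U\<close> bounded_subset_ballD by blast
  then have sub: "U \<subseteq> \<Omega> \<inter> ball 0 R" using assms by auto
  have [simp]: "\<Omega> \<in> sets lebesgue" "\<Omega> \<inter> ball 0 R \<in> sets lebesgue" "\<Omega> \<in> sets borel" "\<Omega> \<inter> ball 0 R \<in> sets borel"
    using \<open>open \<Omega>\<close> by auto
  have \<phi>: "test_function \<Omega> (\<phi> k)" for k using E by (simp add: energy_closure_def)
  have u: "L2 (lebesgue_on (\<Omega> \<inter> ball 0 R)) u" using E by (simp add: energy_closure_def)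
  show "L2 (lebesgue_on U) u" by (rule L2_subset[OF u]) (use assms sub in auto)
  show "L2 (lebesgue_on U) Du" by (rule L2_subset[OF energy_closureD(1)[OF E]]) (use assms in auto)
  have lim: "(\<lambda>k. l2norm (lebesgue_on (\<Omega> \<inter> ball 0 R)) (\<lambda>x. u x - \<phi> k x)) \<longlonglongrightarrow> 0"
    using E by (simp add: energy_closure_def)
  have du: "L2 (lebesgue_on (\<Omega> \<inter> ball 0 R)) (\<lambda>x. u x - \<phi> k x)" for k
    by (rule L2_diff[OF u test_function_L2[OF \<phi>]]) simp
  have dDu: "L2 (lebesgue_on \<Omega>) (\<lambda>x. Du x - jacobian (\<phi> k) (at x))" for k
    by (rule L2_diff[OF energy_closureD(1)[OF E] test_function_L2[OF test_function_jacobian[OF \<phi>]]]) simp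
  show "(\<lambda>k. l2norm (lebesgue_on U) (\<lambda>x. u x - \<phi> k x)) \<longlonglongrightarrow> 0"
    by (rule l2norm_tendsto_subset[OF lim du assms(3) _ sub]) simp
  show "(\<lambda>k. l2norm (lebesgue_on U) (\<lambda>x. Du x - jacobian (\<phi> k) (at x))) \<longlonglongrightarrow> 0"
    by (rule l2norm_tendsto_subset[OF energy_closureD(3)[OF E] dDu assms(3) _ assms(5)]) simp
qed

text \<open>Integration by parts passes to the limit along the approximating test functions.
  Gradients converge in L2 on all of \<Omega>, the functions themselves only on bounded parts, so
  the left side is first cut down to a compact set carrying \<open>vdiv F\<close>.\<close>

lemma energy_closure_vdiv:
  assumes E: "energy_closure \<Omega> u Du \<phi>" and \<Omega>: "open \<Omega>" and F: "test_function \<Omega> F"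
  shows "(\<integral>x. u x \<bullet> vdiv F x \<partial>lebesgue_on \<Omega>) = - (\<integral>x. Du x \<bullet> F x \<partial>lebesgue_on \<Omega>)"
proof -
  from F obtain K where K: "compact K" "K \<subseteq> \<Omega>" "\<And>x. x \<notin> K \<Longrightarrow> F x = 0"
    by (rule test_functionE) blast
  define d where "d = vdiv F"
  have d: "test_function \<Omega> d" unfolding d_def by (rule test_function_vdiv[OF F])
  from d obtain L where L: "compact L" "L \<subseteq> \<Omega>" "\<And>x. x \<notin> L \<Longrightarrow> d x = 0"
    by (rule test_functionE) blast
  have m: "L \<in> sets lebesgue" "\<Omega> \<in> sets lebesgue" "\<Omega> \<in> sets borel" "L \<in> sets borel"
    using \<Omega> borel_compact[OF L(1)] by (auto intro: sets_completionI_sets)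
  note EL = energy_closure_bounded[OF E \<Omega> m(1) compact_imp_bounded[OF L(1)] L(2)]
  have \<phi>: "test_function \<Omega> (\<phi> k)" for k using E by (simp add: energy_closure_def)
  have lim1: "(\<lambda>k. \<integral>x. \<phi> k x \<bullet> d x \<partial>lebesgue_on L) \<longlonglongrightarrow> (\<integral>x. u x \<bullet> d x \<partial>lebesgue_on L)"
    by (rule l2_inner_tendsto[OF _ EL(1) _ EL(2)]; rule test_function_L2[OF _ m(4)], rule \<phi> d)
  have lim2: "(\<lambda>k. \<integral>x. jacobian (\<phi> k) (at x) \<bullet> F x \<partial>lebesgue_on \<Omega>) \<longlonglongrightarrow> (\<integral>x. Du x \<bullet> F x \<partial>lebesgue_on \<Omega>)"
    by (rule l2_inner_tendsto[OF test_function_L2[OF test_function_jacobian[OF \<phi>] m(3)]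
          energy_closureD(1)[OF E] test_function_L2[OF F m(3)] energy_closureD(3)[OF E]])
  have "(\<integral>x. \<phi> k x \<bullet> d x \<partial>lebesgue_on L) = - (\<integral>x. jacobian (\<phi> k) (at x) \<bullet> F x \<partial>lebesgue_on \<Omega>)" for k
  proof -
    have c1: "continuous_on UNIV (\<lambda>x. \<phi> k x \<bullet> d x)"
      by (intro continuous_on_inner test_function_continuous[OF \<phi>] test_function_continuous[OF d])
    have c2: "continuous_on UNIV (\<lambda>x. jacobian (\<phi> k) (at x) \<bullet> F x)"
      by (intro continuous_on_inner test_function_continuous[OF test_function_jacobian[OF \<phi>]] test_function_continuous[OF F])
    have "(\<integral>x. \<phi> k x \<bullet> d x \<partial>lebesgue_on L) = (\<integral>x. \<phi> k x \<bullet> d x \<partial>lborel)"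
      by (rule integral_lebesgue_on_lborel[OF borel_measurable_continuous_onI[OF c1] m(4)]) (simp add: L)
    moreover have "(\<integral>x. jacobian (\<phi> k) (at x) \<bullet> F x \<partial>lebesgue_on \<Omega>) = (\<integral>x. jacobian (\<phi> k) (at x) \<bullet> F x \<partial>lborel)"
      by (rule integral_lebesgue_on_lborel[OF borel_measurable_continuous_onI[OF c2] m(3)])
         (simp add: test_function_off_U[OF F])
    ultimately show ?thesis
      using integral_by_parts_vdiv[OF test_function_smooth[OF \<phi>] test_function_mono[OF F subset_UNIV], of k]
      by (simp add: d_def)
  qed
  then have "(\<integral>x. u x \<bullet> d x \<partial>lebesgue_on L) = - (\<integral>x. Du x \<bullet> F x \<partial>lebesgue_on \<Omega>)"
    using LIMSEQ_unique[OF lim1] tendsto_minus[OF lim2] by simp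
  moreover have "(\<integral>x. u x \<bullet> d x \<partial>lebesgue_on \<Omega>) = (\<integral>x. u x \<bullet> d x \<partial>lebesgue_on L)"
    by (rule integral_lebesgue_on_mono_set) (use m L in auto)
  ultimately show ?thesis by (simp add: d_def)
qed

lemma vdiv_single:
  fixes \<psi> :: "real^'n \<Rightarrow> real"
  assumes "smooth \<psi>"
  shows "vdiv (\<lambda>x. \<psi> x *\<^sub>R axis i (axis \<alpha> 1) :: real^'n^'N) x = axis i (frechet_derivative \<psi> (at x) (axis \<alpha> 1))"
proof -
  have "((\<lambda>x. \<psi> x *\<^sub>R (axis i (axis \<alpha> 1) :: real^'n^'N)) has_derivative
      (\<lambda>v. frechet_derivative \<psi> (at x) v *\<^sub>R axis i (axis \<alpha> 1))) (at x)"
    by (intro has_derivative_scaleR_left smooth_has_derivative assms)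
  note D = frechet_derivative_eqI[OF this]
  have ax: "(axis i (axis \<alpha> 1) :: real^'n^'N) $ j $ \<beta> = (if \<beta> = \<alpha> then of_bool (j = i) else 0)" for j \<beta>
    by (simp add: axis_def)
  show ?thesis
  proof (subst vec_eq_iff, intro allI)
    fix j
    have "vdiv (\<lambda>x. \<psi> x *\<^sub>R axis i (axis \<alpha> 1) :: real^'n^'N) x $ j
        = (\<Sum>\<beta>\<in>UNIV. if \<beta> = \<alpha> then frechet_derivative \<psi> (at x) (axis \<beta> 1) * of_bool (j = i) else 0)"
      unfolding vdiv_def D vec_lambda_beta by (intro sum.cong refl) (simp add: ax)
    also have "\<dots> = axis i (frechet_derivative \<psi> (at x) (axis \<alpha> 1)) $ j"
      by (simp add: axis_def)
    finally show "vdiv (\<lambda>x. \<psi> x *\<^sub>R axis i (axis \<alpha> 1) :: real^'n^'N) x $ j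
        = axis i (frechet_derivative \<psi> (at x) (axis \<alpha> 1)) $ j" .
  qed
qed

text \<open>The definition of a weak gradient is \<open>energy_closure_vdiv\<close> for fields with
  the single entry \<psi> at position (i, \<alpha>), because their divergence is the
  \<alpha>-derivative of \<psi> in component i.\<close>

lemma energy_closure_weak_gradient:
  assumes E: "energy_closure \<Omega> u Du \<phi>" and \<Omega>: "open \<Omega>" and U: "open U" "U \<subseteq> \<Omega>"
  shows "weak_gradient U u Du"
  unfolding weak_gradient_def
proof (intro conjI allI impI)
  have "integrable (lebesgue_on K) u \<and> integrable (lebesgue_on K) Du" if "compact K" "K \<subseteq> U" for K
  proof -
    have K: "K \<in> sets lebesgue" "bounded K" "K \<subseteq> \<Omega>"
      using that U borel_compact[OF that(1)] compact_imp_bounded by (auto intro: sets_completionI_sets)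
    show ?thesis
      using energy_closure_bounded[OF E \<Omega> K] K by (auto intro!: L2_imp_integrable)
  qed
  then show "locally_integrable U u" "locally_integrable U Du"
    unfolding locally_integrable_def
    by (auto simp: set_integrable_lebesgue_on borel_compact sets_completionI_sets)
next
  fix \<psi> :: "real^'a \<Rightarrow> real" and i :: 'b and \<alpha> :: 'a assume \<psi>: "test_function U \<psi>"
  define F where "F x = \<psi> x *\<^sub>R (axis i (axis \<alpha> 1) :: real^'a^'b)" for x
  have \<psi>\<Omega>: "test_function \<Omega> \<psi>" by (rule test_function_mono[OF \<psi> U(2)])
  have F: "test_function \<Omega> F" unfolding F_def
    by (rule test_function_linear[OF bounded_linear_scaleR_left \<psi>\<Omega>])
  have m: "U \<in> sets lebesgue" "\<Omega> \<in> sets lebesgue" using U \<Omega> by auto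
  have v: "vdiv F x = axis i (frechet_derivative \<psi> (at x) (axis \<alpha> 1))" for x
    unfolding F_def by (rule vdiv_single[OF test_function_smooth[OF \<psi>]])
  have "(LINT x:U|lebesgue. u x $ i * frechet_derivative \<psi> (at x) (axis \<alpha> 1)) = (\<integral>x. u x \<bullet> vdiv F x \<partial>lebesgue_on U)"
    using m by (simp add: set_integral_lebesgue_on v inner_axis)
  also have "\<dots> = (\<integral>x. u x \<bullet> vdiv F x \<partial>lebesgue_on \<Omega>)"
    by (rule integral_lebesgue_on_mono_set[symmetric, OF m U(2)])
       (simp add: v inner_axis test_function_off_U[OF test_function_frechet[OF \<psi>]])
  also have "\<dots> = - (\<integral>x. Du x \<bullet> F x \<partial>lebesgue_on \<Omega>)" by (rule energy_closure_vdiv[OF E \<Omega> F])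
  also have "(\<integral>x. Du x \<bullet> F x \<partial>lebesgue_on \<Omega>) = (\<integral>x. Du x \<bullet> F x \<partial>lebesgue_on U)"
    by (rule integral_lebesgue_on_mono_set[OF m U(2)]) (simp add: F_def test_function_off_U[OF \<psi>])
  also have "\<dots> = (LINT x:U|lebesgue. Du x $ i $ \<alpha> * \<psi> x)"
    using m by (simp add: set_integral_lebesgue_on F_def inner_axis mult.commute)
  finally show "(LINT x:U|lebesgue. u x $ i * frechet_derivative \<psi> (at x) (axis \<alpha> 1))
      = - (LINT x:U|lebesgue. Du x $ i $ \<alpha> * \<psi> x)" .
qed

lemma energy_closure_in_W12:
  assumes E: "energy_closure \<Omega> u Du \<phi>" and \<Omega>: "open \<Omega>" and U: "open U" "bounded U" "U \<subseteq> \<Omega>"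
  shows "in_W12 U u Du"
  using energy_closure_weak_gradient[OF E \<Omega> U(1,3)] energy_closure_bounded[OF E \<Omega> _ U(2,3)] U(1)
  by (simp add: in_W12_def in_Lp_2)

text \<open>The same test functions approximate u near the boundary: their supports are compact in
  \<Omega> and so miss the frontier of the open set \<Omega>. This makes every element of the energy
  closure admissible in (BH).\<close>

lemma energy_closure_vanishing:
  assumes E: "energy_closure \<Omega> u Du \<phi>" and \<Omega>: "open \<Omega>"
  shows "in_W12_vanishing (\<Omega> \<inter> ball c R) (frontier \<Omega> \<inter> ball c R) u Du"
proof -
  let ?U = "\<Omega> \<inter> ball c R"
  have U: "open ?U" "bounded ?U" "?U \<subseteq> \<Omega>" "?U \<in> sets lebesgue" using \<Omega> by auto
  note EB = energy_closure_bounded[OF E \<Omega> U(4,2,3)]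
  have off: "test_function_off ?U (frontier \<Omega> \<inter> ball c R) \<psi>" if \<psi>: "test_function \<Omega> \<psi>" for \<psi> :: "real^'a \<Rightarrow> real^'b"
  proof -
    define S where "S = closure {x \<in> closure ?U. \<psi> x \<noteq> 0}"
    define T where "T = closure {x. \<psi> x \<noteq> 0}"
    have 1: "S \<subseteq> T" unfolding S_def T_def by (intro closure_mono) auto
    have 2: "S \<subseteq> closure ?U" unfolding S_def by (intro closure_minimal) auto
    have 3: "T \<subseteq> \<Omega>" "compact T" "smooth \<psi>"
      using \<psi> by (auto simp: test_function_def T_def)
    have "compact (T \<inter> S)" by (rule compact_Int_closed[OF 3(2)]) (simp add: S_def)
    moreover have "T \<inter> S = S" using 1 by blast
    ultimately have 4: "compact S" by simp
    have "S \<inter> frontier \<Omega> = {}"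
      using 1 3(1) \<Omega> by (auto simp: frontier_def interior_open)
    then have "S \<subseteq> closure ?U - (frontier \<Omega> \<inter> ball c R)" using 2 by blast
    then show ?thesis using 3(3) 4 unfolding test_function_off_def S_def by blast
  qed
  have "(\<lambda>k. Lp_norm 2 ?U (\<lambda>x. u x - \<phi> k x) + Lp_norm 2 ?U (\<lambda>x. Du x - jacobian (\<phi> k) (at x))) \<longlonglongrightarrow> 0"
    using tendsto_add[OF EB(2,4)] U(4) by (simp add: Lp_norm_2)
  then show ?thesis
    unfolding in_W12_vanishing_def
    by (intro conjI exI[of _ \<phi>] allI energy_closure_in_W12[OF E \<Omega> U(1-3)] off[OF energy_closureD(2)[OF E]])
qed

subsection \<open>Embedding into the energy closure\<close>

text \<open>A substitute for the Hoelder inequality on bounded sets: values up to \<delta>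
  contribute at most \<delta>^2, larger ones are compared with the higher power.\<close>

lemma square_le_powr:
  fixes a \<delta> p :: real
  assumes "a \<ge> 0" "\<delta> > 0" "p > 2"
  shows "a\<^sup>2 \<le> \<delta>\<^sup>2 + \<delta> powr (2 - p) * a powr p"
proof (cases "a \<le> \<delta>")
  case True
  then have "a\<^sup>2 \<le> \<delta>\<^sup>2" using assms by (intro power_mono)
  then show ?thesis by (simp add: add_increasing2)
next
  case False
  then have a: "a > 0" "\<delta> \<le> a" using assms by auto
  have "a\<^sup>2 = a powr (2 - p) * a powr p" using a by (simp flip: powr_add)
  also have "\<dots> \<le> \<delta> powr (2 - p) * a powr p"
    using a assms by (intro mult_right_mono powr_mono2') auto
  finally show ?thesis by (simp add: add_increasing)
qed

lemma powr_add_le: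
  fixes a b p :: real
  assumes "a \<ge> 0" "b \<ge> 0" "p \<ge> 0"
  shows "(a + b) powr p \<le> 2 powr p * (a powr p + b powr p)"
proof -
  have "(a + b) powr p \<le> (2 * max a b) powr p" using assms by (intro powr_mono2) auto
  also have "\<dots> = 2 powr p * max a b powr p" using assms by (simp add: powr_mult)
  also have "\<dots> \<le> 2 powr p * (a powr p + b powr p)"
    by (intro mult_left_mono) (auto simp: max_def)
  finally show ?thesis .
qed

lemma test_function_powr_integrable:
  fixes \<phi> :: "'a::euclidean_space \<Rightarrow> 'b::euclidean_space"
  assumes "test_function U \<phi>" "p > 0" "V \<in> sets borel"
  shows "integrable (lebesgue_on V) (\<lambda>x. norm (\<phi> x) powr p)"
proof -
  from assms(1) obtain K where K: "compact K" "K \<subseteq> U" "\<And>x. x \<notin> K \<Longrightarrow> \<phi> x = 0"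
    by (rule test_functionE) blast
  have "continuous_on UNIV (\<lambda>x. norm (\<phi> x) powr p)"
    using assms(2) test_function_continuous[OF assms(1)] by (intro continuous_on_powr' continuous_intros) auto
  from continuous_compact_support_integrable[OF this K(1)] K(3)
  show ?thesis by (intro integrable_lebesgue_on_lborel assms(3)) simp
qed

lemma sobolev_exponent_gt_2: "CARD('n::finite) \<ge> 3 \<Longrightarrow> sobolev_exponent TYPE('n) > 2"
  by (simp add: sobolev_exponent_def field_simps)

text \<open>Convergence in L^p with p = 2n/(n-2) > 2 implies convergence in L2 on bounded sets:
  integrate \<open>square_le_powr\<close> over the set, make \<delta>^2 times its measure small, and
  only then let k grow.\<close>

lemma Y12_0_energy_closure:
  fixes u :: "real^'n \<Rightarrow> real^'N"
  assumes n: "CARD('n) \<ge> 3" and \<Omega>: "open \<Omega>" and Y: "in_Y12_0 \<Omega> u Du"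
  shows "\<exists>\<phi>. energy_closure \<Omega> u Du \<phi>"
proof -
  define p where "p = sobolev_exponent TYPE('n)"
  have p: "p > 2" unfolding p_def by (rule sobolev_exponent_gt_2[OF n])
  from Y obtain \<phi> where \<phi>: "\<And>k. test_function \<Omega> (\<phi> k)"
    and lim: "(\<lambda>k. Lp_norm p \<Omega> (\<lambda>x. u x - \<phi> k x) + Lp_norm 2 \<Omega> (\<lambda>x. Du x - jacobian (\<phi> k) (at x))) \<longlonglongrightarrow> 0"
    and u: "in_Lp p \<Omega> u" and Du: "in_Lp 2 \<Omega> Du"
    unfolding in_Y12_0_def in_Y12_def p_def by blast
  have m: "\<Omega> \<in> sets lebesgue" "\<Omega> \<in> sets borel" using \<Omega> by auto
  have um: "u \<in> borel_measurable (lebesgue_on \<Omega>)" and ui: "integrable (lebesgue_on \<Omega>) (\<lambda>x. norm (u x) powr p)"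
    using u m by (simp_all add: in_Lp_def set_borel_measurable_lebesgue_on set_integrable_lebesgue_on)
  have LDu: "L2 (lebesgue_on \<Omega>) Du" using Du m by (simp add: in_Lp_2)
  have nn: "Lp_norm q U (f :: real^'n \<Rightarrow> 'z::euclidean_space) \<ge> 0" for q U f by (simp add: Lp_norm_def)
  have lim1: "(\<lambda>k. Lp_norm p \<Omega> (\<lambda>x. u x - \<phi> k x)) \<longlonglongrightarrow> 0"
    by (rule Lim_null_comparison[OF _ lim]) (simp add: nn always_eventually)
  have lim2: "(\<lambda>k. Lp_norm 2 \<Omega> (\<lambda>x. Du x - jacobian (\<phi> k) (at x))) \<longlonglongrightarrow> 0"
    by (rule Lim_null_comparison[OF _ lim]) (simp add: nn always_eventually)
  define P where "P k = (\<integral>x. norm (u x - \<phi> k x) powr p \<partial>lebesgue_on \<Omega>)" for k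
  have wm: "(\<lambda>x. u x - \<phi> k x) \<in> borel_measurable (lebesgue_on \<Omega>)" for k
    by (intro borel_measurable_diff um L2_measurable[OF test_function_L2[OF \<phi> m(2)]])
  have wi: "integrable (lebesgue_on \<Omega>) (\<lambda>x. norm (u x - \<phi> k x) powr p)" for k
  proof (rule Bochner_Integration.integrable_bound)
    show "integrable (lebesgue_on \<Omega>) (\<lambda>x. 2 powr p * (norm (u x) powr p + norm (\<phi> k x) powr p))"
      using p by (intro integrable_mult_right Bochner_Integration.integrable_add ui test_function_powr_integrable[OF \<phi> _ m(2)]) auto
    show "(\<lambda>x. norm (u x - \<phi> k x) powr p) \<in> borel_measurable (lebesgue_on \<Omega>)"
      using wm[of k] by measurable
    have "norm (u x - \<phi> k x) powr p \<le> 2 powr p * (norm (u x) powr p + norm (\<phi> k x) powr p)" for x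
    proof -
      have "norm (u x - \<phi> k x) powr p \<le> (norm (u x) + norm (\<phi> k x)) powr p"
        using p by (intro powr_mono2 norm_triangle_ineq4) auto
      also have "\<dots> \<le> 2 powr p * (norm (u x) powr p + norm (\<phi> k x) powr p)"
        using p by (intro powr_add_le) auto
      finally show ?thesis .
    qed
    then show "AE x in lebesgue_on \<Omega>. norm (norm (u x - \<phi> k x) powr p)
        \<le> norm (2 powr p * (norm (u x) powr p + norm (\<phi> k x) powr p))" by (intro AE_I2) simp
  qed
  have P0: "P k \<ge> 0" for k by (simp add: P_def)
  have Plim: "P \<longlonglongrightarrow> 0"
  proof -
    have "(\<lambda>k. (P k powr (1/p)) powr p) \<longlonglongrightarrow> 0 powr p"
    proof (intro tendsto_powr2 tendsto_const)
      show "(\<lambda>k. P k powr (1/p)) \<longlonglongrightarrow> 0"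
        using lim1 m by (simp add: Lp_norm_def P_def set_integral_lebesgue_on)
    qed (use p in auto)
    then show ?thesis using p P0 by (simp add: powr_powr)
  qed
  have LV: "L2 (lebesgue_on (\<Omega> \<inter> ball 0 R)) u \<and> (\<lambda>k. l2norm (lebesgue_on (\<Omega> \<inter> ball 0 R)) (\<lambda>x. u x - \<phi> k x)) \<longlonglongrightarrow> 0" for R
  proof -
    define V where "V = \<Omega> \<inter> ball 0 R"
    have V: "V \<in> sets lebesgue" "V \<subseteq> \<Omega>" "bounded V" "V \<in> sets borel" using \<Omega> by (auto simp: V_def)
    interpret fV: finite_measure "lebesgue_on V" by (rule finite_measure_lebesgue_on[OF V(1,3)])
    define v where "v = measure (lebesgue_on V) (space (lebesgue_on V))"
    \<comment> \<open>One bound serves w = u, for membership in L2, and w = u - \<phi> k, for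
      convergence.\<close>
    have LL: "L2 (lebesgue_on V) w \<and> (l2norm (lebesgue_on V) w)\<^sup>2 \<le> \<delta>\<^sup>2 * v + \<delta> powr (2 - p) * (\<integral>x. norm (w x) powr p \<partial>lebesgue_on \<Omega>)"
      if w: "w \<in> borel_measurable (lebesgue_on \<Omega>)" "integrable (lebesgue_on \<Omega>) (\<lambda>x. norm (w x) powr p)" and \<delta>: "\<delta> > 0"
      for w :: "real^'n \<Rightarrow> real^'N" and \<delta>
    proof -
      have wV: "w \<in> borel_measurable (lebesgue_on V)" by (rule borel_measurable_lebesgue_on_subset[OF w(1) V(2)])
      have iV: "integrable (lebesgue_on V) (\<lambda>x. norm (w x) powr p)"
        by (rule integrable_lebesgue_on_subset[OF w(2) V(1) m(1) V(2)])
      have bd: "(norm (w x))\<^sup>2 \<le> \<delta>\<^sup>2 + \<delta> powr (2 - p) * norm (w x) powr p" for x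
        by (rule square_le_powr) (use \<delta> p in auto)
      have ib: "integrable (lebesgue_on V) (\<lambda>x. \<delta>\<^sup>2 + \<delta> powr (2 - p) * norm (w x) powr p)"
        by (intro Bochner_Integration.integrable_add integrable_mult_right iV fV.integrable_const)
      have i2: "integrable (lebesgue_on V) (\<lambda>x. (norm (w x))\<^sup>2)"
      proof (rule Bochner_Integration.integrable_bound[OF ib])
        show "(\<lambda>x. (norm (w x))\<^sup>2) \<in> borel_measurable (lebesgue_on V)"
          using wV by measurable
        show "AE x in lebesgue_on V. norm ((norm (w x))\<^sup>2) \<le> norm (\<delta>\<^sup>2 + \<delta> powr (2 - p) * norm (w x) powr p)"
          using bd by (intro AE_I2) (simp add: abs_of_nonneg)
      qed
      have "(l2norm (lebesgue_on V) w)\<^sup>2 \<le> (\<integral>x. \<delta>\<^sup>2 + \<delta> powr (2 - p) * norm (w x) powr p \<partial>lebesgue_on V)"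
        unfolding l2norm_square by (rule integral_mono[OF i2 ib bd])
      also have "\<dots> = \<delta>\<^sup>2 * v + \<delta> powr (2 - p) * (\<integral>x. norm (w x) powr p \<partial>lebesgue_on V)"
        using iV by (subst Bochner_Integration.integral_add) (simp_all add: v_def fV.integrable_const)
      also have "\<dots> \<le> \<delta>\<^sup>2 * v + \<delta> powr (2 - p) * (\<integral>x. norm (w x) powr p \<partial>lebesgue_on \<Omega>)"
      proof -
        have "(\<integral>x. indicator V x *\<^sub>R norm (w x) powr p \<partial>lebesgue) \<le> (\<integral>x. indicator \<Omega> x *\<^sub>R norm (w x) powr p \<partial>lebesgue)"
          using w(2) m V(2) by (intro integral_mono') (auto simp: integrable_restrict_space indicator_def)
        then have "(\<integral>x. norm (w x) powr p \<partial>lebesgue_on V) \<le> (\<integral>x. norm (w x) powr p \<partial>lebesgue_on \<Omega>)"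
          using m V(1) by (simp add: integral_restrict_space)
        then show ?thesis by (simp add: mult_left_mono)
      qed
      finally show ?thesis using wV i2 by (simp add: L2_def)
    qed
    have v0: "v \<ge> 0" by (simp add: v_def)
    have "(\<lambda>k. l2norm (lebesgue_on V) (\<lambda>x. u x - \<phi> k x)) \<longlonglongrightarrow> 0"
    proof (rule LIMSEQ_I)
      fix e :: real assume e: "e > 0"
      \<comment> \<open>Chosen so that \<delta>^2 v \<le> e^2 / 4; the summand 1 covers the case v =
        0.\<close>
      define \<delta> where "\<delta> = e / (2 * sqrt (v + 1))"
      have \<delta>: "\<delta> > 0" using e v0 by (simp add: \<delta>_def)
      have dv: "\<delta>\<^sup>2 * v \<le> e\<^sup>2 / 4"
      proof -
        have "\<delta>\<^sup>2 * v \<le> \<delta>\<^sup>2 * (v + 1)" by (intro mult_left_mono) auto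
        also have "\<dots> = e\<^sup>2 / 4" using v0 by (simp add: \<delta>_def power_divide power_mult_distrib field_simps)
        finally show ?thesis .
      qed
      define c where "c = \<delta> powr (2 - p)"
      have c: "c > 0" using \<delta> by (simp add: c_def)
      have "\<forall>\<^sub>F k in sequentially. P k < e\<^sup>2 / (4 * c)"
        using order_tendstoD(2)[OF Plim, of "e\<^sup>2 / (4 * c)"] e c by simp
      then obtain N where N: "\<And>k. k \<ge> N \<Longrightarrow> P k < e\<^sup>2 / (4 * c)" by (auto simp: eventually_sequentially)
      have "l2norm (lebesgue_on V) (\<lambda>x. u x - \<phi> k x) < e" if "k \<ge> N" for k
      proof -
        have "(l2norm (lebesgue_on V) (\<lambda>x. u x - \<phi> k x))\<^sup>2 \<le> \<delta>\<^sup>2 * v + c * P k"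
          using LL[OF wm wi \<delta>] by (simp add: P_def c_def)
        also have "c * P k \<le> c * (e\<^sup>2 / (4 * c))" using N[OF that] c by (intro mult_left_mono) auto
        also have "\<dots> = e\<^sup>2 / 4" using c by simp
        finally have "(l2norm (lebesgue_on V) (\<lambda>x. u x - \<phi> k x))\<^sup>2 \<le> e\<^sup>2 / 4 + e\<^sup>2 / 4" using dv by simp
        also have "\<dots> < e\<^sup>2" using e by simp
        finally show ?thesis using e by (simp add: power2_less_imp_less)
      qed
      then show "\<exists>no. \<forall>k\<ge>no. norm (l2norm (lebesgue_on V) (\<lambda>x. u x - \<phi> k x) - 0) < e"
        by (intro exI[of _ N]) simp
    qed
    moreover have "L2 (lebesgue_on V) u" using LL[OF um ui, of 1] by simp
    ultimately show ?thesis by (simp add: V_def)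
  qed
  have "energy_closure \<Omega> u Du \<phi>"
    unfolding energy_closure_def using LDu \<phi> LV lim2 m by (simp add: Lp_norm_2)
  then show ?thesis by blast
qed

subsection \<open>Energy estimates\<close>

lemma energy_closure_inner_tendsto:
  assumes E: "energy_closure \<Omega> u Du \<phi>" and \<Omega>: "open \<Omega>" and f: "test_function \<Omega> f"
  shows "(\<lambda>k. \<integral>x. f x \<bullet> \<phi> k x \<partial>lebesgue_on \<Omega>) \<longlonglongrightarrow> (\<integral>x. f x \<bullet> u x \<partial>lebesgue_on \<Omega>)"
proof -
  from f obtain L where L: "compact L" "L \<subseteq> \<Omega>" "\<And>x. x \<notin> L \<Longrightarrow> f x = 0"
    by (rule test_functionE) blast
  have m: "L \<in> sets lebesgue" "\<Omega> \<in> sets lebesgue" "L \<in> sets borel"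
    using \<Omega> borel_compact[OF L(1)] by (auto intro: sets_completionI_sets)
  note EL = energy_closure_bounded[OF E \<Omega> m(1) compact_imp_bounded[OF L(1)] L(2)]
  have "(\<lambda>k. \<integral>x. \<phi> k x \<bullet> f x \<partial>lebesgue_on L) \<longlonglongrightarrow> (\<integral>x. u x \<bullet> f x \<partial>lebesgue_on L)"
    by (rule l2_inner_tendsto[OF test_function_L2[OF energy_closureD(2)[OF E] m(3)] EL(1) test_function_L2[OF f m(3)] EL(2)])
  moreover have "(\<integral>x. g x \<bullet> f x \<partial>lebesgue_on L) = (\<integral>x. f x \<bullet> g x \<partial>lebesgue_on \<Omega>)" for g
    by (subst integral_lebesgue_on_mono_set[OF m(1,2) L(2)]) (simp_all add: L(3) inner_commute)
  ultimately show ?thesis by simp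
qed

text \<open>Both sides are continuous along the test functions that approximate v. With v = u this
  is the energy identity, and with v a solution of the transposed equation it is the reciprocity
  between two solutions.\<close>

lemma weak_equation_extend:
  assumes A: "measurable_coeffs A" "bounded_coeffs Lam A" "Lam \<ge> 0"
    and \<Omega>: "open \<Omega>" and eq: "weak_equation A \<Omega> Du f" and f: "test_function \<Omega> f" and Du: "L2 (lebesgue_on \<Omega>) Du"
    and E: "energy_closure \<Omega> v Dv \<phi>"
  shows "(\<integral>x. coeff_form A x (Du x) (Dv x) \<partial>lebesgue_on \<Omega>) = (\<integral>x. f x \<bullet> v x \<partial>lebesgue_on \<Omega>)"
proof -
  have m: "\<Omega> \<in> sets lebesgue" "\<Omega> \<in> sets borel" using \<Omega> by auto
  note \<phi> = energy_closureD(2)[OF E]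
  have "(\<lambda>k. \<integral>x. jacobian (\<phi> k) (at x) \<bullet> cmul A x (Du x) \<partial>lebesgue_on \<Omega>) \<longlonglongrightarrow> (\<integral>x. Dv x \<bullet> cmul A x (Du x) \<partial>lebesgue_on \<Omega>)"
    by (rule l2_inner_tendsto[OF test_function_L2[OF test_function_jacobian[OF \<phi>] m(2)] energy_closureD(1)[OF E] L2_cmul[OF A Du] energy_closureD(3)[OF E]])
  moreover have "(\<integral>x. jacobian (\<phi> k) (at x) \<bullet> cmul A x (Du x) \<partial>lebesgue_on \<Omega>) = (\<integral>x. f x \<bullet> \<phi> k x \<partial>lebesgue_on \<Omega>)" for k
    using eq \<phi>[of k] m unfolding inner_commute[of "jacobian (\<phi> k) (at _)"]
    by (simp add: weak_equation_def set_integral_lebesgue_on coeff_form_cmul)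
  ultimately show ?thesis
    using LIMSEQ_unique[OF _ energy_closure_inner_tendsto[OF E \<Omega> f]]
    unfolding coeff_form_cmul inner_commute[of "Dv _"] by simp
qed

lemma energy_lower_bound:
  assumes A: "measurable_coeffs A" "bounded_coeffs Lam A" "Lam \<ge> 0" "strongly_elliptic lam A"
    and Du: "L2 (lebesgue_on \<Omega>) Du"
  shows "lam * (l2norm (lebesgue_on \<Omega>) Du)\<^sup>2 \<le> (\<integral>x. coeff_form A x (Du x) (Du x) \<partial>lebesgue_on \<Omega>)"
  unfolding l2norm_square Bochner_Integration.integral_mult_right_zero[symmetric]
proof (rule integral_mono)
  show "integrable (lebesgue_on \<Omega>) (\<lambda>x. lam * (norm (Du x))\<^sup>2)"
    by (intro integrable_mult_right L2_integrable Du)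
  show "integrable (lebesgue_on \<Omega>) (\<lambda>x. coeff_form A x (Du x) (Du x))"
    unfolding coeff_form_cmul by (intro L2_inner_integrable L2_cmul[OF A(1-3)] Du)
qed (rule coeff_form_elliptic[OF A(4)])

text \<open>On the ball the Hardy weight satisfies sqrt w \<le> sqrt 2 \<rho> \<le> (3/2) \<rho>,
  and the Hardy constant is 2; their product explains 3 \<rho>. The ball may reach beyond \<Omega>,
  since \<phi> is extended by zero.\<close>

lemma test_function_hardy_ball:
  fixes \<phi> f :: "real^'n \<Rightarrow> real^'N"
  assumes n: "CARD('n) \<ge> 3" and \<phi>: "test_function \<Omega> \<phi>" and \<Omega>: "open \<Omega>"
    and f: "L2 (lebesgue_on \<Omega>) f" "\<And>x. x \<notin> ball y \<rho> \<Longrightarrow> f x = 0" and \<rho>: "\<rho> > 0"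
  shows "\<bar>\<integral>x. f x \<bullet> \<phi> x \<partial>lebesgue_on \<Omega>\<bar> \<le> 3 * \<rho> * l2norm (lebesgue_on \<Omega>) f * l2norm (lebesgue_on \<Omega>) (\<lambda>x. jacobian \<phi> (at x))"
proof -
  define w where "w x = (x - y) \<bullet> (x - y) + \<rho>\<^sup>2" for x
  have m: "\<Omega> \<in> sets borel" using \<Omega> by auto
  have w: "w x > 0" for x using \<rho> by (simp add: w_def add_nonneg_pos)
  define g where "g x = (1 / sqrt (w x)) *\<^sub>R \<phi> x" for x
  have \<phi>U: "test_function UNIV \<phi>" by (rule test_function_mono[OF \<phi> subset_UNIV])
  have h: "l2norm lborel g \<le> 2 * l2norm lborel (\<lambda>x. jacobian \<phi> (at x))" "L2 lborel g" "L2 lborel (\<lambda>x. jacobian \<phi> (at x))"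
    using hardy_inequality(1,2)[OF n \<phi>U \<rho>, of y] hardy_inequality(3)[OF n \<phi>U \<rho>]
    by (simp_all add: g_def[abs_def] w_def)
  have g\<Omega>: "L2 (lebesgue_on \<Omega>) g" by (rule L2_lebesgue_on_lborel[OF h(2) m])
  have eqJ: "l2norm (lebesgue_on \<Omega>) (\<lambda>x. jacobian \<phi> (at x)) = l2norm lborel (\<lambda>x. jacobian \<phi> (at x))"
    by (rule l2norm_lebesgue_on_lborel(2)[OF h(3) m]) (rule test_function_off_U[OF test_function_jacobian[OF \<phi>]])
  have sq2: "sqrt 2 \<le> 3 / 2" by (rule real_le_lsqrt) (auto simp: power2_eq_square)
  have "\<bar>\<integral>x. f x \<bullet> \<phi> x \<partial>lebesgue_on \<Omega>\<bar> \<le> l2norm (lebesgue_on \<Omega>) (\<lambda>x. (3 / 2 * \<rho>) *\<^sub>R f x) * l2norm (lebesgue_on \<Omega>) g"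
  proof (rule l2_bounded_prod_le[OF L2_scaleR[OF f(1)] g\<Omega>])
    fix x
    show "\<bar>f x \<bullet> \<phi> x\<bar> \<le> norm ((3 / 2 * \<rho>) *\<^sub>R f x) * norm (g x)"
    proof (cases "x \<in> ball y \<rho>")
      case True
      then have "(norm (x - y))\<^sup>2 \<le> \<rho>\<^sup>2" by (intro power_mono) (auto simp: dist_norm norm_minus_commute)
      then have "w x \<le> 2 * \<rho>\<^sup>2" by (simp add: w_def dot_square_norm)
      then have "sqrt (w x) \<le> sqrt 2 * \<rho>" using \<rho> by (simp add: real_sqrt_mult flip: real_sqrt_le_iff[of "w x"])
      also have "\<dots> \<le> 3 / 2 * \<rho>" using sq2 \<rho> by (intro mult_right_mono) auto
      finally have "1 \<le> 3 / 2 * \<rho> / sqrt (w x)" using w[of x] by (simp add: le_divide_eq)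
      then have "norm (f x) * norm (\<phi> x) * 1 \<le> norm (f x) * norm (\<phi> x) * (3 / 2 * \<rho> / sqrt (w x))"
        by (intro mult_left_mono) auto
      moreover have "\<bar>f x \<bullet> \<phi> x\<bar> \<le> norm (f x) * norm (\<phi> x)" by (rule Cauchy_Schwarz_ineq2)
      ultimately show ?thesis using \<rho> w[of x] by (simp add: g_def ac_simps)
    qed (simp add: f(2))
  qed
  also have "\<dots> = (3 / 2 * \<rho>) * l2norm (lebesgue_on \<Omega>) f * l2norm (lebesgue_on \<Omega>) g"
    using \<rho> by (simp add: l2norm_scaleR)
  also have "\<dots> \<le> (3 / 2 * \<rho>) * l2norm (lebesgue_on \<Omega>) f * (2 * l2norm (lebesgue_on \<Omega>) (\<lambda>x. jacobian \<phi> (at x)))"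
    using \<rho> h(1) l2norm_lebesgue_on_lborel(1)[OF h(2) m] unfolding eqJ
    by (intro mult_left_mono) auto
  finally show ?thesis by (simp add: ac_simps)
qed

lemma energy_closure_hardy_ball:
  fixes u f :: "real^'n \<Rightarrow> real^'N"
  assumes n: "CARD('n) \<ge> 3" and E: "energy_closure \<Omega> u Du \<phi>" and \<Omega>: "open \<Omega>"
    and f: "test_function \<Omega> f" "\<And>x. x \<notin> ball y \<rho> \<Longrightarrow> f x = 0" and \<rho>: "\<rho> > 0"
  shows "\<bar>\<integral>x. f x \<bullet> u x \<partial>lebesgue_on \<Omega>\<bar> \<le> 3 * \<rho> * l2norm (lebesgue_on \<Omega>) f * l2norm (lebesgue_on \<Omega>) Du"
proof (rule LIMSEQ_le)
  have m: "\<Omega> \<in> sets borel" using \<Omega> by auto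
  note \<phi> = energy_closureD(2)[OF E]
  show "(\<lambda>k. \<bar>\<integral>x. f x \<bullet> \<phi> k x \<partial>lebesgue_on \<Omega>\<bar>) \<longlonglongrightarrow> \<bar>\<integral>x. f x \<bullet> u x \<partial>lebesgue_on \<Omega>\<bar>"
    by (intro tendsto_rabs energy_closure_inner_tendsto[OF E \<Omega> f(1)])
  show "(\<lambda>k. 3 * \<rho> * l2norm (lebesgue_on \<Omega>) f * l2norm (lebesgue_on \<Omega>) (\<lambda>x. jacobian (\<phi> k) (at x)))
      \<longlonglongrightarrow> 3 * \<rho> * l2norm (lebesgue_on \<Omega>) f * l2norm (lebesgue_on \<Omega>) Du"
    by (intro tendsto_mult_left l2norm_tendsto[OF test_function_L2[OF test_function_jacobian[OF \<phi>] m] energy_closureD(1,3)[OF E]])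
  show "\<exists>N. \<forall>k\<ge>N. \<bar>\<integral>x. f x \<bullet> \<phi> k x \<partial>lebesgue_on \<Omega>\<bar>
      \<le> 3 * \<rho> * l2norm (lebesgue_on \<Omega>) f * l2norm (lebesgue_on \<Omega>) (\<lambda>x. jacobian (\<phi> k) (at x))"
    using test_function_hardy_ball[OF n \<phi> \<Omega> test_function_L2[OF f(1) m] f(2) \<rho>] by blast
qed

text \<open>Testing the equation with its own solution bounds lam times the squared norm by c times
  the norm; one factor cancels unless it is 0.\<close>

lemma energy_estimate:
  assumes A: "measurable_coeffs A" "bounded_coeffs Lam A" "Lam \<ge> 0" "strongly_elliptic lam A" and lam: "lam > 0"
    and \<Omega>: "open \<Omega>" and eq: "weak_equation A \<Omega> Du f" and f: "test_function \<Omega> f"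
    and E: "energy_closure \<Omega> u Du \<phi>"
    and bound: "(\<integral>x. f x \<bullet> u x \<partial>lebesgue_on \<Omega>) \<le> c * l2norm (lebesgue_on \<Omega>) Du" and c: "c \<ge> 0"
  shows "l2norm (lebesgue_on \<Omega>) Du \<le> c / lam"
proof (cases "l2norm (lebesgue_on \<Omega>) Du = 0")
  case False
  note L = energy_closureD(1)[OF E]
  have "lam * (l2norm (lebesgue_on \<Omega>) Du)\<^sup>2 \<le> c * l2norm (lebesgue_on \<Omega>) Du"
    using energy_lower_bound[OF A L] weak_equation_extend[OF A(1-3) \<Omega> eq f L E] bound by linarith
  then have "l2norm (lebesgue_on \<Omega>) Du * (lam * l2norm (lebesgue_on \<Omega>) Du) \<le> l2norm (lebesgue_on \<Omega>) Du * c"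
    by (simp add: power2_eq_square ac_simps)
  then have "lam * l2norm (lebesgue_on \<Omega>) Du \<le> c"
    using False by (simp add: less_le)
  then show ?thesis using lam by (simp add: le_divide_eq mult.commute)
qed (use c lam in simp)

lemma weak_equation_subset:
  fixes A :: "('n::finite, 'N::finite) coeffs"
  assumes eq: "weak_equation A \<Omega> Du f" and \<Omega>: "open \<Omega>" and U: "open U" "U \<subseteq> \<Omega>" and f: "\<And>x. x \<in> U \<Longrightarrow> f x = 0"
  shows "weak_equation A U Du (\<lambda>_. 0)"
  unfolding weak_equation_def
proof (intro allI impI)
  fix \<psi> :: "real^'n \<Rightarrow> real^'N" assume \<psi>: "test_function U \<psi>"
  have m: "U \<in> sets lebesgue" "\<Omega> \<in> sets lebesgue" using U \<Omega> by auto
  have "(LINT x:\<Omega>|lebesgue. coeff_form A x (Du x) (jacobian \<psi> (at x))) = (LINT x:\<Omega>|lebesgue. f x \<bullet> \<psi> x)"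
    using eq test_function_mono[OF \<psi> U(2)] by (simp add: weak_equation_def)
  moreover have "(LINT x:\<Omega>|lebesgue. f x \<bullet> \<psi> x) = 0"
  proof -
    have "f x \<bullet> \<psi> x = 0" for x using f[of x] test_function_off_U[OF \<psi>, of x] by (cases "x \<in> U") auto
    then show ?thesis by (simp add: set_lebesgue_integral_def)
  qed
  moreover have "(LINT x:\<Omega>|lebesgue. coeff_form A x (Du x) (jacobian \<psi> (at x)))
      = (LINT x:U|lebesgue. coeff_form A x (Du x) (jacobian \<psi> (at x)))"
    unfolding set_integral_lebesgue_on[OF m(1)] set_integral_lebesgue_on[OF m(2)]
    by (rule integral_lebesgue_on_mono_set[OF m U(2)])
       (simp add: test_function_off_U[OF test_function_jacobian[OF \<psi>]] coeff_form_cmul)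
  ultimately show "(LINT x:U|lebesgue. coeff_form A x (Du x) (jacobian \<psi> (at x))) = (LINT x:U|lebesgue. 0 \<bullet> \<psi> x)"
    by (simp add: set_lebesgue_integral_def)
qed

section \<open>From decay of the Dirichlet integral to pointwise bounds\<close>

subsection \<open>Integrals with parameters\<close>

lemma continuous_on_parametric_integral:
  fixes h :: "'a::euclidean_space \<Rightarrow> 'b::euclidean_space \<Rightarrow> 'c::euclidean_space"
  assumes K: "compact K" and c: "continuous_on (S \<times> K) (\<lambda>(x, y). h x y)"
  shows "continuous_on S (\<lambda>x. \<integral>y. h x y \<partial>lebesgue_on K)"
  unfolding continuous_on_sequentially
proof (intro allI ballI impI)
  fix X and a assume a: "a \<in> S" and X: "(\<forall>n. X n \<in> S) \<and> X \<longlonglongrightarrow> a"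
  have mK: "K \<in> sets lebesgue" using borel_compact[OF K] by (auto intro: sets_completionI_sets)
  \<comment> \<open>S itself need not be compact, but a convergent sequence together with its limit
    is, and this yields one bound for all the integrands involved.\<close>
  define C where "C = insert a (range X)"
  have C: "compact C" unfolding C_def using X compact_sequence_with_limit[of X a] by simp
  have CS: "C \<subseteq> S" using a X by (auto simp: C_def)
  have "compact ((\<lambda>(x, y). h x y) ` (C \<times> K))"
    using CS by (intro compact_continuous_image compact_Times C K continuous_on_subset[OF c]) auto
  then have "bounded ((\<lambda>(x, y). h x y) ` (C \<times> K))" by (rule compact_imp_bounded)
  then obtain M where M: "\<And>x y. x \<in> C \<Longrightarrow> y \<in> K \<Longrightarrow> norm (h x y) \<le> M"
    unfolding bounded_iff by fast
  have cy: "continuous_on K (h x)" if "x \<in> S" for x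
  proof -
    have "continuous_on K (\<lambda>y. (\<lambda>(x, y). h x y) (x, y))"
      by (rule continuous_on_compose2[OF c]) (use that in \<open>auto intro!: continuous_intros\<close>)
    then show ?thesis by simp
  qed
  have meas: "h x \<in> borel_measurable (lebesgue_on K)" if "x \<in> S" for x
    by (rule continuous_imp_measurable_on_sets_lebesgue[OF cy[OF that] mK])
  interpret fK: finite_measure "lebesgue_on K" by (rule finite_measure_lebesgue_on[OF mK compact_imp_bounded[OF K]])
  have "(\<lambda>n. \<integral>y. h (X n) y \<partial>lebesgue_on K) \<longlonglongrightarrow> (\<integral>y. h a y \<partial>lebesgue_on K)"
  proof (rule integral_dominated_convergence[where w="\<lambda>_. M"])
    show "h a \<in> borel_measurable (lebesgue_on K)" "h (X n) \<in> borel_measurable (lebesgue_on K)" for n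
      using meas a X by auto
    show "AE y in lebesgue_on K. (\<lambda>n. h (X n) y) \<longlonglongrightarrow> h a y"
    proof (rule AE_I2)
      fix y assume "y \<in> space (lebesgue_on K)"
      then have y: "y \<in> K" by simp
      have "continuous_on S (\<lambda>x. (\<lambda>(x, y). h x y) (x, y))"
        by (rule continuous_on_compose2[OF c]) (use y in \<open>auto intro!: continuous_intros\<close>)
      then have "continuous_on S (\<lambda>x. h x y)" by simp
      then show "(\<lambda>n. h (X n) y) \<longlonglongrightarrow> h a y"
        using a X unfolding continuous_on_sequentially comp_def by blast
    qed
    show "AE y in lebesgue_on K. norm (h (X n) y) \<le> M" for n
      using M by (intro AE_I2) (simp add: C_def)
  qed (rule fK.integrable_const)
  then show "((\<lambda>x. \<integral>y. h x y \<partial>lebesgue_on K) \<circ> X) \<longlonglongrightarrow> (\<integral>y. h a y \<partial>lebesgue_on K)"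
    by (simp add: comp_def)
qed

subsection \<open>Averages against bump functions\<close>

definition bump_integral :: "'n::finite itself \<Rightarrow> real" where
  "bump_integral _ = (\<integral>z. bump (0::real^'n) 1 z \<partial>lborel)"

lemma bump_measurable: "bump (x::'a::euclidean_space) r \<in> borel_measurable borel"
  by (intro borel_measurable_continuous_onI smooth_continuous_on smooth_bump)

lemma bump_outside: "r > 0 \<Longrightarrow> z \<notin> ball x r \<Longrightarrow> bump x r z = 0"
  using bump_nonzero[of r x z] by blast

lemma bump_integrable:
  fixes x :: "'a::euclidean_space"
  shows "r > 0 \<Longrightarrow> integrable lborel (bump x r)"
  by (rule test_function_integrable[OF test_function_bump]) auto

lemma integral_bump:
  fixes x :: "real^'n"
  assumes "r > 0"
  shows "(\<integral>z. bump x r z \<partial>lborel) = r ^ CARD('n) * bump_integral TYPE('n)"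
proof -
  have "ennreal (\<integral>z. bump x r z \<partial>lborel) = (\<integral>\<^sup>+z. ennreal (bump x r z) \<partial>lborel)"
    by (rule nn_integral_eq_integral[symmetric, OF bump_integrable[OF assms]]) (simp add: bump_nonneg)
  also have "\<dots> = ennreal (r ^ CARD('n)) * (\<integral>\<^sup>+z. ennreal (bump x r (x + r *\<^sub>R z)) \<partial>lborel)"
    using nn_integral_lborel_affine[OF measurable_compose[OF bump_measurable measurable_ennreal] assms, of x r x] by simp
  also have "(\<integral>\<^sup>+z. ennreal (bump x r (x + r *\<^sub>R z)) \<partial>lborel) = ennreal (bump_integral TYPE('n))"
    unfolding bump_scale[OF assms] bump_integral_def
    by (rule nn_integral_eq_integral[OF bump_integrable]) (simp_all add: bump_nonneg)
  also have "ennreal (r ^ CARD('n)) * ennreal (bump_integral TYPE('n)) = ennreal (r ^ CARD('n) * bump_integral TYPE('n))"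
    using assms by (simp add: ennreal_mult' bump_integral_def bump_nonneg)
  finally show ?thesis
    using assms by (subst (asm) ennreal_inj) (auto simp: bump_integral_def bump_nonneg)
qed

lemma bump_integral_pos: "bump_integral TYPE('n::finite) > 0"
proof -
  have "0 < exp (- 4 / 3) * measure lborel (ball (0::real^'n) (1/2))"
    using content_ball_pos[of "1/2" "0::real^'n"] by simp
  also have "\<dots> = (\<integral>z. exp (- 4 / 3) * indicator (ball (0::real^'n) (1/2)) z \<partial>lborel)" by simp
  also have "\<dots> \<le> (\<integral>z. bump (0::real^'n) 1 z \<partial>lborel)"
    by (rule integral_mono'[OF bump_integrable])
       (use bump_ge_half[of 1 _ "0::real^'n"] bump_nonneg in \<open>auto simp: indicator_def\<close>)
  finally show ?thesis by (simp add: bump_integral_def)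
qed

lemma integral_bump_lebesgue_on:
  fixes x :: "real^'n"
  assumes "0 < r" "U \<in> sets borel" "ball x r \<subseteq> U"
  shows "(\<integral>z. bump x r z \<partial>lebesgue_on U) = r ^ CARD('n) * bump_integral TYPE('n)"
proof -
  have "bump x r z = 0" if "z \<notin> U" for z
    using bump_outside[OF assms(1)] assms(3) that by blast
  from integral_lebesgue_on_lborel[OF bump_measurable assms(2) this] show ?thesis
    by (simp add: integral_bump[OF assms(1)])
qed

text \<open>By continuity f may be replaced by f x on small balls; the constant in the limit is the
  total mass of the unnormalised bump, which scales like r^n.\<close>

lemma bump_average_tendsto:
  fixes x :: "real^'n" and f :: "real^'n \<Rightarrow> real"
  assumes U: "open U" "x \<in> U" and f: "integrable (lebesgue_on U) f"
    and cont: "continuous_on U f"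
  shows "((\<lambda>r. r powr - real CARD('n) * (\<integral>z. f z * bump x r z \<partial>lebesgue_on U)) \<longlongrightarrow> bump_integral TYPE('n) * f x) (at_right 0)"
proof (rule tendstoI)
  fix e :: real assume e: "e > 0"
  let ?c = "bump_integral TYPE('n)"
  have c: "?c > 0" by (rule bump_integral_pos)
  have Um: "U \<in> sets borel" using U by auto
  define e' where "e' = e / (2 * ?c)"
  have e': "e' > 0" using e c by (simp add: e'_def)
  have "isCont f x" using cont U by (simp add: continuous_on_eq_continuous_at)
  then obtain d where d: "d > 0" "\<And>z. dist z x < d \<Longrightarrow> dist (f z) (f x) < e'"
    using e' unfolding continuous_at_eps_delta by blast
  obtain d' where d': "d' > 0" "ball x d' \<subseteq> U" using U openE by blast
  have "dist (r powr - real CARD('n) * (\<integral>z. f z * bump x r z \<partial>lebesgue_on U)) (?c * f x) < e"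
    if r: "r \<in> {0<..<min d d'}" for r
  proof -
    have r0: "r > 0" and sub: "ball x r \<subseteq> U" using r d' subset_ball[of r d' x] by auto
    have bm: "bump x r \<in> borel_measurable (lebesgue_on U)"
      by (intro borel_measurable_lebesgue_on_continuous smooth_continuous_on smooth_bump)
    have i1: "integrable (lebesgue_on U) (\<lambda>z. f z * bump x r z)"
    proof (rule Bochner_Integration.integrable_bound[OF f])
      show "(\<lambda>z. f z * bump x r z) \<in> borel_measurable (lebesgue_on U)" using f bm by auto
      show "AE z in lebesgue_on U. norm (f z * bump x r z) \<le> norm (f z)"
        using bump_nonneg[of x r] bump_le_1[of x r] by (intro AE_I2) (simp add: abs_mult mult_left_le)
    qed
    have i2: "integrable (lebesgue_on U) (bump x r)"
      by (rule integrable_lebesgue_on_lborel[OF bump_integrable[OF r0] Um])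
    have mass: "(\<integral>z. bump x r z \<partial>lebesgue_on U) = r ^ CARD('n) * ?c"
      by (rule integral_bump_lebesgue_on[OF r0 Um sub])
    have "\<bar>(\<integral>z. f z * bump x r z \<partial>lebesgue_on U) - f x * (r ^ CARD('n) * ?c)\<bar>
        = \<bar>\<integral>z. (f z - f x) * bump x r z \<partial>lebesgue_on U\<bar>"
      using i1 i2 by (simp add: mass[symmetric] left_diff_distrib)
    also have "\<dots> \<le> (\<integral>z. \<bar>(f z - f x) * bump x r z\<bar> \<partial>lebesgue_on U)"
      using integral_norm_bound[of "lebesgue_on U" "\<lambda>z. (f z - f x) * bump x r z"] by simp
    also have "\<dots> \<le> (\<integral>z. e' * bump x r z \<partial>lebesgue_on U)"
    proof (rule integral_mono')
      show "\<bar>(f z - f x) * bump x r z\<bar> \<le> e' * bump x r z" for z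
      proof (cases "z \<in> ball x r")
        case True
        then have "dist (f z) (f x) < e'" using r by (intro d(2)) (auto simp: dist_commute)
        then show ?thesis using bump_nonneg[of x r z] by (simp add: abs_mult dist_real_def mult_right_mono)
      qed (simp add: bump_outside[OF r0])
      show "0 \<le> e' * bump x r z" for z using e' bump_nonneg[of x r z] by simp
    qed (use i2 in simp)
    also have "\<dots> = r ^ CARD('n) * (e' * ?c)" by (simp add: mass)
    also have "e' * ?c = e / 2" using c by (simp add: e'_def)
    finally have "\<bar>(\<integral>z. f z * bump x r z \<partial>lebesgue_on U) - f x * (r ^ CARD('n) * ?c)\<bar> \<le> r ^ CARD('n) * (e / 2)" .
    then have "r powr - real CARD('n) * \<bar>(\<integral>z. f z * bump x r z \<partial>lebesgue_on U) - f x * (r ^ CARD('n) * ?c)\<bar>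
        \<le> r powr - real CARD('n) * (r ^ CARD('n) * (e / 2))"
      by (rule mult_left_mono) simp
    also have "r powr - real CARD('n) * (r ^ CARD('n) * (e / 2)) = e / 2"
      using r0 by (simp add: powr_minus powr_realpow)
    finally have "\<bar>r powr - real CARD('n) * ((\<integral>z. f z * bump x r z \<partial>lebesgue_on U) - f x * (r ^ CARD('n) * ?c))\<bar> \<le> e / 2"
      by (simp add: abs_mult)
    moreover have "r powr - real CARD('n) * ((\<integral>z. f z * bump x r z \<partial>lebesgue_on U) - f x * (r ^ CARD('n) * ?c))
        = r powr - real CARD('n) * (\<integral>z. f z * bump x r z \<partial>lebesgue_on U) - ?c * f x"
      using r0 by (simp add: right_diff_distrib powr_minus powr_realpow field_simps)
    ultimately show ?thesis using e by (simp add: dist_real_def)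
  qed
  then show "\<forall>\<^sub>F r in at_right 0. dist (r powr - real CARD('n) * (\<integral>z. f z * bump x r z \<partial>lebesgue_on U)) (?c * f x) < e"
    unfolding eventually_at_right_field using d(1) d'(1) by (intro exI[of _ "min d d'"]) auto
qed

text \<open>From exp s \<ge> s^2 / 2 with s = 1/t.\<close>

lemma flat_exp_2_bounds: "0 \<le> flat_exp 2 t" "flat_exp 2 t \<le> 2"
proof -
  show "0 \<le> flat_exp 2 t" by (simp add: flat_exp_def)
  show "flat_exp 2 t \<le> 2"
  proof (cases "t > 0")
    case True
    have "1 + 1/t + (1/t)\<^sup>2 / 2 \<le> exp (1/t)" using True by (intro exp_lower_Taylor_quadratic) simp
    then have "(1/t)\<^sup>2 \<le> 2 * exp (1/t)" using True by (smt (verit) divide_nonneg_pos field_sum_of_halves)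
    then have "(1/t)\<^sup>2 / exp (1/t) \<le> 2" by (simp add: divide_le_eq)
    then show ?thesis using True by (simp add: flat_exp_def exp_minus divide_inverse)
  qed (simp add: flat_exp_def)
qed

lemma bump_radius_derivative:
  assumes "s > 0"
  shows "((\<lambda>s. bump x s z) has_real_derivative
    flat_exp 2 (1 - ((z - x) \<bullet> (z - x)) / s\<^sup>2) * (2 * ((z - x) \<bullet> (z - x)) / s ^ 3)) (at s)"
proof -
  have 1: "((\<lambda>s. 1 - ((z - x) \<bullet> (z - x)) / s\<^sup>2) has_real_derivative (2 * ((z - x) \<bullet> (z - x)) / s ^ 3)) (at s)"
    using assms by (auto intro!: derivative_eq_intros simp: field_simps power2_eq_square power3_eq_cube)
  have "(flat_exp 0 has_real_derivative flat_exp 2 t) (at t)" for t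
    using flat_exp_DERIV[of 0 t] by (simp add: numeral_2_eq_2)
  from DERIV_chain2[OF this 1] show ?thesis by (simp add: bump_def)
qed

lemma bump_has_derivative:
  "(bump x s has_derivative (\<lambda>v. flat_exp 2 (1 - ((z - x) \<bullet> (z - x)) / s\<^sup>2) * (- (2 * ((z - x) \<bullet> v)) / s\<^sup>2))) (at z)"
proof -
  have 1: "((\<lambda>z. 1 - ((z - x) \<bullet> (z - x)) / s\<^sup>2) has_derivative (\<lambda>v. - (2 * ((z - x) \<bullet> v)) / s\<^sup>2)) (at z)"
    by (auto intro!: derivative_eq_intros simp: inner_commute divide_inverse)
  have "(flat_exp 0 has_derivative (\<lambda>t. flat_exp 2 y * t)) (at y)" for y
    using flat_exp_DERIV[of 0 y] by (simp add: numeral_2_eq_2 has_field_derivative_def)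
  from has_derivative_compose[OF 1 this] show ?thesis by (simp add: bump_def[abs_def])
qed

text \<open>The field whose divergence is the derivative of the scaled bump in its radius.\<close>

definition bump_field :: "real^'n \<Rightarrow> real \<Rightarrow> 'N \<Rightarrow> real^'n \<Rightarrow> real^'n^'N::finite" where
  "bump_field x s i z = bump x s z *\<^sub>R axis i (z - x)"

lemma bounded_linear_axis: "bounded_linear (\<lambda>v::'a::euclidean_space. axis i v :: 'a^'N)"
  by (rule linear_conv_bounded_linear[THEN iffD1], rule linearI) (simp_all add: vec_eq_iff axis_def)

lemma norm_axis: "norm (axis i v :: ('a::euclidean_space)^'N) = norm v"
  by (simp add: norm_eq_sqrt_inner inner_axis)

lemma smooth_bump_field: "smooth (bump_field x s i)"
  unfolding bump_field_def
  by (intro smooth_scaleR smooth_bump smooth_linear_compose[OF bounded_linear_axis] smooth_diff smooth_id smooth_const)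

lemma test_function_bump_field:
  assumes "s > 0" "cball x s \<subseteq> U"
  shows "test_function U (bump_field x s i)"
proof (rule test_functionI[OF smooth_bump_field compact_cball assms(2)])
  show "bump_field x s i z = 0" if "z \<notin> cball x s" for z
    using that bump_outside[OF assms(1), of z x] by (auto simp: bump_field_def)
qed

text \<open>The bracket is n times the bump minus s times its derivative in s, as a comparison with
  \<open>bump_radius_derivative\<close> shows. In other words, the divergence is -s^(n+1) times the
  radius derivative of s^(-n) times the bump.\<close>

lemma vdiv_bump_field:
  fixes x :: "real^'n"
  shows "vdiv (bump_field x s i :: real^'n \<Rightarrow> real^'n^'N) z = axis i (real CARD('n) * bump x s z
    - flat_exp 2 (1 - ((z - x) \<bullet> (z - x)) / s\<^sup>2) * (2 * ((z - x) \<bullet> (z - x)) / s\<^sup>2))"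
proof -
  let ?k = "flat_exp 2 (1 - ((z - x) \<bullet> (z - x)) / s\<^sup>2)"
  have 1: "((\<lambda>z. axis i (z - x) :: real^'n^'N) has_derivative (\<lambda>v. axis i v)) (at z)"
    by (rule has_derivative_eq_rhs[OF bounded_linear.has_derivative[OF bounded_linear_axis]])
       (auto intro!: derivative_eq_intros)
  have "(bump_field x s i has_derivative
      (\<lambda>v. bump x s z *\<^sub>R (axis i v :: real^'n^'N) + (?k * (- (2 * ((z - x) \<bullet> v)) / s\<^sup>2)) *\<^sub>R axis i (z - x))) (at z)"
    unfolding bump_field_def by (rule has_derivative_scaleR[OF bump_has_derivative 1])
  note D = frechet_derivative_eqI[OF this]
  show ?thesis
  proof (subst vec_eq_iff, intro allI)
    fix j
    have "vdiv (bump_field x s i :: real^'n \<Rightarrow> real^'n^'N) z $ j =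
       (\<Sum>\<alpha>\<in>UNIV. (bump x s z - ?k * (2 * ((z - x) $ \<alpha> * (z - x) $ \<alpha>) / s\<^sup>2)) * of_bool (j = i))"
      unfolding vdiv_def D vec_lambda_beta inner_axis
      by (intro sum.cong refl) (simp add: axis_def algebra_simps add_divide_distrib diff_divide_distrib)
    also have "\<dots> = (real CARD('n) * bump x s z - (\<Sum>\<alpha>\<in>UNIV. ?k * (2 * ((z - x) $ \<alpha> * (z - x) $ \<alpha>) / s\<^sup>2))) * of_bool (j = i)"
      unfolding sum_distrib_right[symmetric] sum_subtractf by simp
    also have "(\<Sum>\<alpha>\<in>UNIV. ?k * (2 * ((z - x) $ \<alpha> * (z - x) $ \<alpha>) / s\<^sup>2)) = ?k * (2 * ((z - x) \<bullet> (z - x)) / s\<^sup>2)"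
      unfolding inner_vec_def sum_distrib_left[symmetric] sum_divide_distrib[symmetric] by simp
    also have "(real CARD('n) * bump x s z - ?k * (2 * ((z - x) \<bullet> (z - x)) / s\<^sup>2)) * of_bool (j = i)
       = axis i (real CARD('n) * bump x s z - ?k * (2 * ((z - x) \<bullet> (z - x)) / s\<^sup>2)) $ j"
      by (simp add: axis_def)
    finally show "vdiv (bump_field x s i :: real^'n \<Rightarrow> real^'n^'N) z $ j
       = axis i (real CARD('n) * bump x s z - ?k * (2 * ((z - x) \<bullet> (z - x)) / s\<^sup>2)) $ j" .
  qed
qed

lemma norm_bump_field:
  assumes "s > 0"
  shows "norm (bump_field x s i z) \<le> s"
proof (cases "z \<in> ball x s")
  case True
  have "norm (bump_field x s i z) = bump x s z * norm (z - x)"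
    by (simp add: bump_field_def norm_axis bump_nonneg)
  also have "\<dots> \<le> 1 * s"
    using True bump_le_1[of x s z] bump_nonneg[of x s z]
    by (intro mult_mono) (auto simp: dist_norm norm_minus_commute)
  finally show ?thesis by simp
next
  case False
  then show ?thesis using assms by (simp add: bump_field_def bump_outside)
qed

text \<open>Let N(s) be s^(-n) times the integral of u $ i against the bump of radius s. Its
  derivative is s^(-n-1) times an integral of Du against a field of size at most s, so the decay of
  Du gives |N'(s)| \<le> c s^(\<mu> - 1), which is integrable at 0. As s -> 0, N tends to a multiple
  of u x $ i by continuity. This plays the part of Morrey's embedding, with a continuous radius in
  place of dyadic balls.\<close>

lemma bump_average_bound:
  fixes u :: "real^'n \<Rightarrow> real^'N" and x :: "real^'n"
  assumes E: "energy_closure \<Omega> u Du \<phi>" and \<Omega>: "open \<Omega>"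
    and \<rho>: "\<rho> > 0" "ball x \<rho> \<subseteq> \<Omega>" and cont: "continuous_on (ball x \<rho>) u"
    and decay: "\<And>r. 0 < r \<Longrightarrow> r < \<rho> \<Longrightarrow> l2norm (lebesgue_on (ball x r)) Du \<le> D * r powr (real CARD('n) / 2 - 1 + \<mu>)"
    and D: "D \<ge> 0" and \<mu>: "\<mu> > 0" and b: "0 < b" "b < \<rho>"
  shows "\<bar>bump_integral TYPE('n) * u x $ i - b powr - real CARD('n) * (\<integral>z. u z $ i * bump x b z \<partial>lebesgue_on (ball x \<rho>))\<bar>
    \<le> sqrt (unit_ball_vol (real CARD('n))) * D / \<mu> * b powr \<mu>"
proof -
  define n where "n = real CARD('n)"
  define U where "U = ball x \<rho>"
  define c where "c = sqrt (unit_ball_vol n) * D"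
  have c: "c \<ge> 0" using D by (simp add: c_def n_def)
  have U: "U \<in> sets lebesgue" "U \<in> sets borel" "bounded U" "U \<subseteq> \<Omega>" using \<rho> by (auto simp: U_def)
  have \<Omega>m: "\<Omega> \<in> sets lebesgue" using \<Omega> by auto
  have LU: "L2 (lebesgue_on U) u" by (rule energy_closure_bounded(1)[OF E \<Omega> U(1,3,4)])
  have iu: "integrable (lebesgue_on U) (\<lambda>z. u z $ i)"
    by (rule integrable_bounded_linear[OF bounded_linear_vec_nth L2_imp_integrable[OF LU U(1,3)]])
  define q where "q z = (z - x) \<bullet> (z - x)" for z
  define k' where "k' s z = u z $ i * (flat_exp 2 (1 - q z / s\<^sup>2) * (2 * q z / s ^ 3))" for s z
  define I where "I s = (\<integral>z. u z $ i * bump x s z \<partial>lebesgue_on U)" for s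
  have ib: "integrable (lebesgue_on U) (\<lambda>z. u z $ i * bump x t z)" for t
  proof (rule Bochner_Integration.integrable_bound[OF iu])
    have "bump x t \<in> borel_measurable (lebesgue_on U)"
      by (intro borel_measurable_lebesgue_on_continuous smooth_continuous_on smooth_bump)
    then show "(\<lambda>z. u z $ i * bump x t z) \<in> borel_measurable (lebesgue_on U)" using iu by auto
    show "AE z in lebesgue_on U. norm (u z $ i * bump x t z) \<le> norm (u z $ i)"
      using bump_nonneg[of x t] bump_le_1[of x t] by (intro AE_I2) (simp add: abs_mult mult_left_le)
  qed
  have dI: "(I has_real_derivative (\<integral>z. k' s z \<partial>lebesgue_on U)) (at s)" if s: "0 < s" "s < \<rho>" for s
    unfolding I_def
  proof (rule has_real_derivative_integral[where a="s/2" and b=\<rho> and B="\<lambda>z. 8 / s * \<bar>u z $ i\<bar>"])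
    show "s \<in> {s / 2<..<\<rho>}" using s by auto
    show "integrable (lebesgue_on U) (\<lambda>z. u z $ i * bump x t z)" for t by (rule ib)
    show "((\<lambda>t. u z $ i * bump x t z) has_real_derivative k' t z) (at t)" if "t \<in> {s / 2<..<\<rho>}" for t z
      unfolding k'_def q_def using that s by (intro DERIV_cmult bump_radius_derivative) auto
    \<comment> \<open>Inside the ball of radius t, \<open>flat_exp 2\<close> is at most 2 and 2 q /
      t^3 \<le> 2 / t \<le> 4 / s because t > s / 2; outside, \<open>flat_exp\<close>
      vanishes.\<close>
    show "\<bar>k' t z\<bar> \<le> 8 / s * \<bar>u z $ i\<bar>" if t: "t \<in> {s / 2<..<\<rho>}" for t z
    proof (cases "q z \<le> t\<^sup>2")
      case True
      have t0: "t > 0" using t s by auto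
      have q0: "q z \<ge> 0" by (simp add: q_def)
      have "2 * q z / t ^ 3 \<le> 2 * t\<^sup>2 / t ^ 3" using True t0 by (intro divide_right_mono) auto
      also have "\<dots> = 2 / t" using t0 by (simp add: power2_eq_square power3_eq_cube)
      also have "\<dots> \<le> 4 / s" using t s by (simp add: field_simps)
      finally have "flat_exp 2 (1 - q z / t\<^sup>2) * (2 * q z / t ^ 3) \<le> 2 * (4 / s)"
        using q0 t0 by (intro mult_mono flat_exp_2_bounds) auto
      then have "\<bar>u z $ i\<bar> * \<bar>flat_exp 2 (1 - q z / t\<^sup>2) * (2 * q z / t ^ 3)\<bar> \<le> \<bar>u z $ i\<bar> * (2 * (4 / s))"
        using q0 t0 flat_exp_2_bounds(1) by (intro mult_left_mono) auto
      then show ?thesis by (simp add: k'_def abs_mult mult.commute)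
    next
      case False
      have "t > 0" using t s by auto
      then have "1 - q z / t\<^sup>2 \<le> 0" using False by (simp add: le_divide_eq)
      then show ?thesis using s by (simp add: k'_def flat_exp_def)
    qed
    show "integrable (lebesgue_on U) (\<lambda>z. 8 / s * \<bar>u z $ i\<bar>)"
      by (intro integrable_mult_right integrable_abs iu)
    have "continuous_on UNIV (\<lambda>z. flat_exp 2 (1 - q z / s\<^sup>2) * (2 * q z / s ^ 3))"
      unfolding q_def using s
      by (intro continuous_intros continuous_on_compose2[OF smooth_continuous_on[OF smooth_flat_exp, of UNIV]]) auto
    then have "(\<lambda>z. flat_exp 2 (1 - q z / s\<^sup>2) * (2 * q z / s ^ 3)) \<in> borel_measurable (lebesgue_on U)"
      by (rule borel_measurable_lebesgue_on_continuous)
    then show "k' s \<in> borel_measurable (lebesgue_on U)"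
      unfolding k'_def by (rule borel_measurable_times[OF borel_measurable_integrable[OF iu]])
  qed
  \<comment> \<open>The left side is s^(n+1) times the derivative of s^(-n) I(s), which
    \<open>energy_closure_vdiv\<close> for the bump field converts into an integral of the
    gradient.\<close>
  have ident: "s * (\<integral>z. k' s z \<partial>lebesgue_on U) - n * I s = (\<integral>z. Du z \<bullet> bump_field x s i z \<partial>lebesgue_on (ball x s))"
    if s: "0 < s" "s < \<rho>" for s
  proof -
    let ?F = "bump_field x s i :: real^'n \<Rightarrow> real^'n^'N"
    have sub: "cball x s \<subseteq> U" using s by (auto simp: U_def)
    have F: "test_function \<Omega> ?F" by (rule test_function_bump_field) (use s sub U in auto)
    have FU: "test_function U ?F" by (rule test_function_bump_field) (use s sub in auto)
    have iv: "integrable (lebesgue_on U) (\<lambda>z. u z \<bullet> vdiv ?F z)"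
      by (intro L2_inner_integrable LU test_function_L2[OF test_function_vdiv[OF F] U(2)])
    have "k' s = (\<lambda>z. (1 / s) * (n * (u z $ i * bump x s z) - u z \<bullet> vdiv ?F z))"
      using s by (simp add: fun_eq_iff vdiv_bump_field inner_axis k'_def q_def n_def power2_eq_square power3_eq_cube field_simps)
    then have ik: "integrable (lebesgue_on U) (k' s)" using ib[of s] iv by simp
    have pt: "u z \<bullet> vdiv ?F z = n * (u z $ i * bump x s z) - s * k' s z" for z
      using s by (simp add: vdiv_bump_field inner_axis k'_def q_def n_def power2_eq_square power3_eq_cube right_diff_distrib)
    have "(\<integral>z. u z \<bullet> vdiv ?F z \<partial>lebesgue_on \<Omega>) = (\<integral>z. u z \<bullet> vdiv ?F z \<partial>lebesgue_on U)"
      by (rule integral_lebesgue_on_mono_set[OF U(1) \<Omega>m U(4)])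
         (simp add: test_function_off_U[OF test_function_vdiv[OF FU]])
    also have "\<dots> = n * I s - s * (\<integral>z. k' s z \<partial>lebesgue_on U)"
      unfolding pt I_def using ik ib[of s] by simp
    finally have "s * (\<integral>z. k' s z \<partial>lebesgue_on U) - n * I s = (\<integral>z. Du z \<bullet> ?F z \<partial>lebesgue_on \<Omega>)"
      using energy_closure_vdiv[OF E \<Omega> F] by simp
    also have "\<dots> = (\<integral>z. Du z \<bullet> ?F z \<partial>lebesgue_on (ball x s))"
    proof (rule integral_lebesgue_on_mono_set[OF _ \<Omega>m])
      show "ball x s \<subseteq> \<Omega>" using sub U(4) ball_subset_cball[of x s] by blast
      show "Du z \<bullet> bump_field x s i z = 0" if "z \<in> \<Omega> - ball x s" for z
        using that bump_outside[OF s(1), of z x] by (simp add: bump_field_def)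
    qed simp
    finally show ?thesis .
  qed
  define N where "N s = s powr - n * I s" for s
  define N' where "N' s = s powr (- n - 1) * (\<integral>z. Du z \<bullet> bump_field x s i z \<partial>lebesgue_on (ball x s))" for s
  have dN: "(N has_real_derivative N' s) (at s)" if s: "0 < s" "s < \<rho>" for s
  proof -
    have "(N has_real_derivative (- n * s powr (- n - 1)) * I s + (\<integral>z. k' s z \<partial>lebesgue_on U) * s powr - n) (at s)"
      unfolding N_def using s by (intro DERIV_mult dI has_real_derivative_powr) auto
    moreover have "(- n * s powr (- n - 1)) * I s + (\<integral>z. k' s z \<partial>lebesgue_on U) * s powr - n = N' s"
      unfolding N'_def ident[OF s, symmetric] using s by (simp add: powr_diff field_simps)
    ultimately show ?thesis by simp
  qed
  \<comment> \<open>Cauchy-Schwarz contributes s * s^(n/2) from the field and s^(n/2 - 1 + \<mu>)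
    from the decay, in total s^(n + \<mu>).\<close>
  have bN: "\<bar>N' s\<bar> \<le> c * s powr (\<mu> - 1)" if s: "0 < s" "s < \<rho>" for s
  proof -
    let ?B = "ball x s"
    have B: "?B \<in> sets lebesgue" "bounded ?B" "?B \<subseteq> \<Omega>" using s \<rho> by (auto intro: order_trans[OF subset_ball])
    have "\<bar>\<integral>z. Du z \<bullet> bump_field x s i z \<partial>lebesgue_on ?B\<bar> \<le> l2norm (lebesgue_on ?B) Du * l2norm (lebesgue_on ?B) (\<lambda>_. s)"
    proof (rule l2_bounded_prod_le)
      show "L2 (lebesgue_on ?B) Du" by (rule L2_subset[OF energy_closureD(1)[OF E] B(1) \<Omega>m B(3)])
      show "L2 (lebesgue_on ?B) (\<lambda>_. s)" by (rule L2_const[OF B(1,2)])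
      show "\<bar>Du z \<bullet> bump_field x s i z\<bar> \<le> norm (Du z) * norm s" for z
        using norm_bump_field[OF s(1), of x i z] s Cauchy_Schwarz_ineq2[of "Du z" "bump_field x s i z"]
        by (smt (verit) mult_left_mono norm_ge_zero real_norm_def)
    qed
    also have "l2norm (lebesgue_on ?B) (\<lambda>_. s) = s * sqrt (unit_ball_vol n * s powr n)"
    proof -
      have "measure (lebesgue_on ?B) ?B = unit_ball_vol n * s powr n"
        using s by (simp add: measure_restrict_space content_ball n_def powr_realpow)
      then show ?thesis using s by (simp add: l2norm_def real_sqrt_mult)
    qed
    also have "sqrt (unit_ball_vol n * s powr n) = sqrt (unit_ball_vol n) * s powr (n / 2)"
      using s by (simp add: real_sqrt_mult powr_half_sqrt[symmetric] powr_powr)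
    finally have "\<bar>\<integral>z. Du z \<bullet> bump_field x s i z \<partial>lebesgue_on ?B\<bar>
        \<le> l2norm (lebesgue_on ?B) Du * (s * (sqrt (unit_ball_vol n) * s powr (n / 2)))" .
    also have "\<dots> \<le> (D * s powr (n / 2 - 1 + \<mu>)) * (s * (sqrt (unit_ball_vol n) * s powr (n / 2)))"
      using decay[OF s] s by (intro mult_right_mono) (auto simp: n_def)
    also have "\<dots> = c * (s powr (n / 2 - 1 + \<mu>) * s powr 1 * s powr (n / 2))" using s by (simp add: c_def)
    also have "s powr (n / 2 - 1 + \<mu>) * s powr 1 * s powr (n / 2) = s powr (n + \<mu>)"
      by (simp only: powr_add[symmetric], rule arg_cong[where f="\<lambda>t. s powr t"], linarith)
    finally have "s powr (- n - 1) * \<bar>\<integral>z. Du z \<bullet> bump_field x s i z \<partial>lebesgue_on ?B\<bar> \<le> s powr (- n - 1) * (c * s powr (n + \<mu>))"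
      by (rule mult_left_mono) simp
    also have "\<dots> = c * (s powr (- n - 1) * s powr (n + \<mu>))" by simp
    also have "s powr (- n - 1) * s powr (n + \<mu>) = s powr (\<mu> - 1)" by (simp flip: powr_add)
    finally show ?thesis by (simp add: N'_def abs_mult)
  qed
  have dP: "((\<lambda>s. c / \<mu> * s powr \<mu>) has_real_derivative c * s powr (\<mu> - 1)) (at s)" if "0 < s" for s
    using DERIV_cmult[OF has_real_derivative_powr[OF that, of \<mu>], of "c / \<mu>"] \<mu> by simp
  \<comment> \<open>Both c/\<mu> s^\<mu> - N and c/\<mu> s^\<mu> + N are nondecreasing; this bounds
    the increment without integrating N'.\<close>
  have incr: "\<bar>N b - N a\<bar> \<le> c / \<mu> * b powr \<mu>" if a: "0 < a" "a < b" for a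
  proof -
    have "c / \<mu> * a powr \<mu> - N a \<le> c / \<mu> * b powr \<mu> - N b"
    proof (rule DERIV_nonneg_imp_nondecreasing[where f="\<lambda>s. c / \<mu> * s powr \<mu> - N s"])
      fix s assume "a \<le> s" "s \<le> b"
      then have s: "0 < s" "s < \<rho>" using a b by auto
      show "\<exists>y. ((\<lambda>s. c / \<mu> * s powr \<mu> - N s) has_real_derivative y) (at s) \<and> y \<ge> 0"
        using DERIV_diff[OF dP[OF s(1)] dN[OF s]] bN[OF s] by (intro exI[of _ "c * s powr (\<mu> - 1) - N' s"]) auto
    qed (use a in simp)
    moreover have "c / \<mu> * a powr \<mu> + N a \<le> c / \<mu> * b powr \<mu> + N b"
    proof (rule DERIV_nonneg_imp_nondecreasing[where f="\<lambda>s. c / \<mu> * s powr \<mu> + N s"])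
      fix s assume "a \<le> s" "s \<le> b"
      then have s: "0 < s" "s < \<rho>" using a b by auto
      show "\<exists>y. ((\<lambda>s. c / \<mu> * s powr \<mu> + N s) has_real_derivative y) (at s) \<and> y \<ge> 0"
        using DERIV_add[OF dP[OF s(1)] dN[OF s]] bN[OF s] by (intro exI[of _ "c * s powr (\<mu> - 1) + N' s"]) auto
    qed (use a in simp)
    moreover have "0 \<le> c / \<mu> * a powr \<mu>" using c \<mu> by simp
    ultimately show ?thesis by linarith
  qed
  have lim: "(N \<longlongrightarrow> bump_integral TYPE('n) * u x $ i) (at_right 0)"
    unfolding N_def I_def n_def
    by (rule bump_average_tendsto) (use \<rho> cont iu in \<open>auto simp: U_def intro!: continuous_intros\<close>)
  have "\<bar>N b - bump_integral TYPE('n) * u x $ i\<bar> \<le> c / \<mu> * b powr \<mu>"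
  proof (rule tendsto_upperbound)
    show "((\<lambda>a. \<bar>N b - N a\<bar>) \<longlongrightarrow> \<bar>N b - bump_integral TYPE('n) * u x $ i\<bar>) (at_right 0)"
      by (intro tendsto_intros lim)
    show "\<forall>\<^sub>F a in at_right 0. \<bar>N b - N a\<bar> \<le> c / \<mu> * b powr \<mu>"
      unfolding eventually_at_right_field using b incr by (intro exI[of _ b]) auto
  qed simp
  then show ?thesis by (simp add: N_def I_def U_def c_def n_def abs_minus_commute)
qed

subsection \<open>Pointwise estimates of solutions\<close>

lemma powr_quotient: "0 < a \<Longrightarrow> 0 < b \<Longrightarrow> (a / b) powr t = a powr t * b powr - t" for a b t :: real
  by (simp only: powr_divide powr_minus) (rule divide_inverse)

lemma l2norm_const_ball:
  fixes x :: "real^'n"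
  assumes "r > 0" "s \<ge> 0"
  shows "l2norm (lebesgue_on (ball x r)) (\<lambda>_. s) = s * sqrt (unit_ball_vol (real CARD('n))) * r powr (real CARD('n) / 2)"
proof -
  have "measure (lebesgue_on (ball x r)) (ball x r) = unit_ball_vol (real CARD('n)) * r powr real CARD('n)"
    using assms by (simp add: measure_restrict_space content_ball powr_realpow)
  moreover have "sqrt (r powr real CARD('n)) = r powr (real CARD('n) / 2)"
    by (simp add: powr_half_sqrt[symmetric] powr_powr)
  ultimately show ?thesis using assms by (simp add: l2norm_def real_sqrt_mult)
qed

lemma property_H_l2norm:
  fixes u :: "real^'n \<Rightarrow> real^'N" and x :: "real^'n"
  assumes H: "property_H A \<mu>\<^sub>0 H\<^sub>0" "H\<^sub>0 \<ge> 0" and W: "in_W12 (ball x \<rho>) u Du" and eq: "weak_equation A (ball x \<rho>) Du (\<lambda>_. 0)"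
    and r: "0 < r" "r < \<rho>"
  shows "l2norm (lebesgue_on (ball x r)) Du
    \<le> sqrt H\<^sub>0 * (r / \<rho>) powr (real CARD('n) / 2 - 1 + \<mu>\<^sub>0) * l2norm (lebesgue_on (ball x \<rho>)) Du"
proof -
  have "(l2norm (lebesgue_on (ball x r)) Du)\<^sup>2
      \<le> H\<^sub>0 * (r / \<rho>) powr (real CARD('n) - 2 + 2 * \<mu>\<^sub>0) * (l2norm (lebesgue_on (ball x \<rho>)) Du)\<^sup>2"
    using H(1)[unfolded property_H_def, rule_format, of \<rho> x u Du r \<rho>] W eq r
    unfolding l2norm_square by (simp add: set_integral_lebesgue_on)
  also have "\<dots> = (sqrt H\<^sub>0 * (r / \<rho>) powr (real CARD('n) / 2 - 1 + \<mu>\<^sub>0) * l2norm (lebesgue_on (ball x \<rho>)) Du)\<^sup>2"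
  proof -
    have "((r / \<rho>) powr (real CARD('n) / 2 - 1 + \<mu>\<^sub>0))\<^sup>2 = (r / \<rho>) powr (real CARD('n) - 2 + 2 * \<mu>\<^sub>0)"
      by (simp add: power2_eq_square flip: powr_add) (simp add: algebra_simps)
    then show ?thesis using H(2) by (simp add: power_mult_distrib)
  qed
  finally show ?thesis by (rule power2_le_imp_le) (use H(2) in simp)
qed

text \<open>Since r / R < 1, the exponent may be lowered from \<open>\<mu>\<^sub>1\<close> to \<mu>,
  which allows for the minimum of the two exponents; passing to norms halves it.\<close>

lemma property_BH_l2norm:
  fixes u :: "real^'n \<Rightarrow> real^'N" and x :: "real^'n"
  assumes H: "property_BH_at A \<Omega> R\<^sub>a \<mu>\<^sub>1 H\<^sub>1 x" "H\<^sub>1 \<ge> 0" and R: "ereal R < R\<^sub>a"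
    and W: "in_W12_vanishing (\<Omega> \<inter> ball x R) (frontier \<Omega> \<inter> ball x R) u Du"
    and eq: "weak_equation A (\<Omega> \<inter> ball x R) Du (\<lambda>_. 0)"
    and r: "0 < r" "r < R" and \<Omega>: "open \<Omega>" and \<mu>: "\<mu> \<le> \<mu>\<^sub>1"
  shows "l2norm (lebesgue_on (\<Omega> \<inter> ball x r)) Du
    \<le> sqrt H\<^sub>1 * (r / R) powr (real CARD('n) / 2 - 1 + \<mu>) * l2norm (lebesgue_on (\<Omega> \<inter> ball x R)) Du"
proof -
  have m: "\<Omega> \<inter> ball x t \<in> sets lebesgue" for t using \<Omega> by auto
  have "(l2norm (lebesgue_on (\<Omega> \<inter> ball x r)) Du)\<^sup>2
      \<le> H\<^sub>1 * (r / R) powr (real CARD('n) - 2 + 2 * \<mu>\<^sub>1) * (l2norm (lebesgue_on (\<Omega> \<inter> ball x R)) Du)\<^sup>2"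
    using H(1)[unfolded property_BH_at_def, rule_format, of R u Du r R] W eq r R m
    unfolding l2norm_square by (simp add: set_integral_lebesgue_on)
  also have "\<dots> \<le> H\<^sub>1 * (r / R) powr (real CARD('n) - 2 + 2 * \<mu>) * (l2norm (lebesgue_on (\<Omega> \<inter> ball x R)) Du)\<^sup>2"
    using \<mu> r H(2) by (intro mult_right_mono mult_left_mono powr_mono') auto
  also have "\<dots> = (sqrt H\<^sub>1 * (r / R) powr (real CARD('n) / 2 - 1 + \<mu>) * l2norm (lebesgue_on (\<Omega> \<inter> ball x R)) Du)\<^sup>2"
  proof -
    have "((r / R) powr (real CARD('n) / 2 - 1 + \<mu>))\<^sup>2 = (r / R) powr (real CARD('n) - 2 + 2 * \<mu>)"
      by (simp add: power2_eq_square flip: powr_add) (simp add: algebra_simps)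
    then show ?thesis using H(2) by (simp add: power_mult_distrib)
  qed
  finally show ?thesis by (rule power2_le_imp_le) (use H(2) in simp)
qed

text \<open>(H) supplies the decay needed by \<open>bump_average_bound\<close>, taken at radius
  \<rho>/2. The average is left standing on the right because it is estimated in two ways: by the L2
  norm of u in \<open>local_boundedness\<close>, and by duality in
  \<open>dual_solution_bound\<close>.\<close>

lemma interior_estimate:
  fixes u :: "real^'n \<Rightarrow> real^'N" and x :: "real^'n"
  assumes H: "property_H A \<mu>\<^sub>0 H\<^sub>0" "H\<^sub>0 \<ge> 0" "\<mu>\<^sub>0 > 0"
    and E: "energy_closure \<Omega> u Du \<phi>" and \<Omega>: "open \<Omega>"
    and \<rho>: "\<rho> > 0" "ball x \<rho> \<subseteq> \<Omega>" and cont: "continuous_on (ball x \<rho>) u"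
    and eq: "weak_equation A \<Omega> Du f" and f: "\<And>z. z \<in> ball x \<rho> \<Longrightarrow> f z = 0"
  shows "bump_integral TYPE('n) * \<bar>u x $ i\<bar> \<le>
      (\<rho> / 2) powr - real CARD('n) * \<bar>\<integral>z. u z $ i * bump x (\<rho> / 2) z \<partial>lebesgue_on (ball x \<rho>)\<bar>
      + sqrt (unit_ball_vol (real CARD('n))) * sqrt H\<^sub>0 / \<mu>\<^sub>0 * \<rho> powr (1 - real CARD('n) / 2) * l2norm (lebesgue_on (ball x \<rho>)) Du"
proof -
  define n where "n = real CARD('n)"
  define L where "L = l2norm (lebesgue_on (ball x \<rho>)) Du"
  define D where "D = sqrt H\<^sub>0 * \<rho> powr - (n / 2 - 1 + \<mu>\<^sub>0) * L"
  define S where "S = sqrt (unit_ball_vol n)"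
  have D: "D \<ge> 0" using H by (simp add: D_def L_def)
  have S: "S \<ge> 0" by (simp add: S_def n_def)
  have W: "in_W12 (ball x \<rho>) u Du"
    by (rule energy_closure_in_W12[OF E \<Omega> open_ball bounded_ball \<rho>(2)])
  have eqB: "weak_equation A (ball x \<rho>) Du (\<lambda>_. 0)"
    by (rule weak_equation_subset[OF eq \<Omega> open_ball \<rho>(2) f])
  have decay: "l2norm (lebesgue_on (ball x r)) Du \<le> D * r powr (real CARD('n) / 2 - 1 + \<mu>\<^sub>0)" if r: "0 < r" "r < \<rho>" for r
  proof -
    have "l2norm (lebesgue_on (ball x r)) Du \<le> sqrt H\<^sub>0 * (r / \<rho>) powr (n / 2 - 1 + \<mu>\<^sub>0) * L"
      using property_H_l2norm[OF H(1,2) W eqB r] by (simp add: n_def L_def)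
    also have "(r / \<rho>) powr (n / 2 - 1 + \<mu>\<^sub>0) = r powr (n / 2 - 1 + \<mu>\<^sub>0) * \<rho> powr - (n / 2 - 1 + \<mu>\<^sub>0)"
      using r by (intro powr_quotient) auto
    finally show ?thesis by (simp add: D_def n_def mult.assoc mult.commute mult.left_commute)
  qed
  have "\<bar>bump_integral TYPE('n) * u x $ i - (\<rho> / 2) powr - n * (\<integral>z. u z $ i * bump x (\<rho> / 2) z \<partial>lebesgue_on (ball x \<rho>))\<bar>
    \<le> S * D / \<mu>\<^sub>0 * (\<rho> / 2) powr \<mu>\<^sub>0"
    unfolding S_def n_def by (rule bump_average_bound[OF E \<Omega> \<rho> cont decay D H(3)]) (use \<rho> in auto)
  also have "\<dots> \<le> S * D / \<mu>\<^sub>0 * \<rho> powr \<mu>\<^sub>0"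
    using \<rho> H S D by (intro mult_left_mono powr_mono2) auto
  also have "\<dots> = S * sqrt H\<^sub>0 / \<mu>\<^sub>0 * (\<rho> powr - (n / 2 - 1 + \<mu>\<^sub>0) * \<rho> powr \<mu>\<^sub>0) * L"
    by (simp add: D_def)
  also have "\<rho> powr - (n / 2 - 1 + \<mu>\<^sub>0) * \<rho> powr \<mu>\<^sub>0 = \<rho> powr (1 - n / 2)"
    by (simp flip: powr_add)
  finally have "\<bar>bump_integral TYPE('n) * u x $ i - (\<rho> / 2) powr - n * (\<integral>z. u z $ i * bump x (\<rho> / 2) z \<partial>lebesgue_on (ball x \<rho>))\<bar>
    \<le> S * sqrt H\<^sub>0 / \<mu>\<^sub>0 * \<rho> powr (1 - n / 2) * L" .
  moreover have "\<bar>(\<rho> / 2) powr - n * (\<integral>z. u z $ i * bump x (\<rho> / 2) z \<partial>lebesgue_on (ball x \<rho>))\<bar>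
     = (\<rho> / 2) powr - n * \<bar>\<integral>z. u z $ i * bump x (\<rho> / 2) z \<partial>lebesgue_on (ball x \<rho>)\<bar>" by (simp add: abs_mult)
  moreover have "\<bar>bump_integral TYPE('n) * u x $ i\<bar> = bump_integral TYPE('n) * \<bar>u x $ i\<bar>"
    using bump_integral_pos[where 'n='n] by (simp add: abs_mult)
  ultimately show ?thesis unfolding S_def n_def L_def by linarith
qed

text \<open>The power of 2 comes from averaging over radius \<rho>/2, the other summand from the
  decay under (H).\<close>

definition local_bound_const :: "'n::finite itself \<Rightarrow> real \<Rightarrow> real \<Rightarrow> real" where
  "local_bound_const t \<mu>\<^sub>0 H\<^sub>0 = sqrt (unit_ball_vol (real CARD('n))) * (2 powr real CARD('n) + sqrt H\<^sub>0 / \<mu>\<^sub>0) / bump_integral t"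

lemma local_bound_const_nonneg: "H\<^sub>0 \<ge> 0 \<Longrightarrow> \<mu>\<^sub>0 > 0 \<Longrightarrow> local_bound_const TYPE('n::finite) \<mu>\<^sub>0 H\<^sub>0 \<ge> 0"
  using bump_integral_pos[where 'n='n] by (simp add: local_bound_const_def)

lemma local_boundedness:
  fixes u :: "real^'n \<Rightarrow> real^'N" and x :: "real^'n"
  assumes H: "property_H A \<mu>\<^sub>0 H\<^sub>0" "H\<^sub>0 \<ge> 0" "\<mu>\<^sub>0 > 0"
    and E: "energy_closure \<Omega> u Du \<phi>" and \<Omega>: "open \<Omega>"
    and \<rho>: "\<rho> > 0" "ball x \<rho> \<subseteq> \<Omega>" and cont: "continuous_on (ball x \<rho>) u"
    and eq: "weak_equation A \<Omega> Du f" and f: "\<And>z. z \<in> ball x \<rho> \<Longrightarrow> f z = 0"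
  shows "\<bar>u x $ i\<bar> \<le> local_bound_const TYPE('n) \<mu>\<^sub>0 H\<^sub>0 *
      (\<rho> powr - (real CARD('n) / 2) * l2norm (lebesgue_on (ball x \<rho>)) u
      + \<rho> powr (1 - real CARD('n) / 2) * l2norm (lebesgue_on (ball x \<rho>)) Du)"
proof -
  define n where "n = real CARD('n)"
  define S where "S = sqrt (unit_ball_vol n)"
  define c where "c = bump_integral TYPE('n)"
  define l where "l = l2norm (lebesgue_on (ball x \<rho>)) u"
  define L where "L = l2norm (lebesgue_on (ball x \<rho>)) Du"
  have c: "c > 0" unfolding c_def by (rule bump_integral_pos)
  have S: "S \<ge> 0" by (simp add: S_def n_def)
  have lL: "l \<ge> 0" "L \<ge> 0" by (simp_all add: l_def L_def)
  have "\<bar>\<integral>z. u z $ i * bump x (\<rho> / 2) z \<partial>lebesgue_on (ball x \<rho>)\<bar> \<le> l * l2norm (lebesgue_on (ball x \<rho>)) (\<lambda>_. 1::real)"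
    unfolding l_def
  proof (rule l2_bounded_prod_le)
    show "L2 (lebesgue_on (ball x \<rho>)) u"
      by (rule energy_closure_bounded(1)[OF E \<Omega> _ bounded_ball \<rho>(2)]) simp
    show "L2 (lebesgue_on (ball x \<rho>)) (\<lambda>_. 1::real)" by (rule L2_const) auto
    show "\<bar>u z $ i * bump x (\<rho> / 2) z\<bar> \<le> norm (u z) * norm (1::real)" for z
    proof -
      have "\<bar>u z $ i\<bar> * \<bar>bump x (\<rho> / 2) z\<bar> \<le> norm (u z) * norm (1::real)"
        using component_le_norm_cart[of "u z" i] bump_nonneg[of x "\<rho>/2" z] bump_le_1[of x "\<rho>/2" z]
        by (intro mult_mono) auto
      then show ?thesis by (simp add: abs_mult)
    qed
  qed
  also have "l2norm (lebesgue_on (ball x \<rho>)) (\<lambda>_. 1::real) = S * \<rho> powr (n / 2)"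
    using l2norm_const_ball[OF \<rho>(1), of 1 x] by (simp add: S_def n_def)
  finally have "(\<rho> / 2) powr - n * \<bar>\<integral>z. u z $ i * bump x (\<rho> / 2) z \<partial>lebesgue_on (ball x \<rho>)\<bar>
     \<le> (\<rho> / 2) powr - n * (l * (S * \<rho> powr (n / 2)))"
    by (rule mult_left_mono) simp
  also have "\<dots> = S * 2 powr n * (\<rho> powr - n * \<rho> powr (n / 2)) * l"
    using \<rho> by (simp add: powr_quotient)
  also have "\<rho> powr - n * \<rho> powr (n / 2) = \<rho> powr - (n / 2)"
    by (simp flip: powr_add)
  finally have 1: "(\<rho> / 2) powr - n * \<bar>\<integral>z. u z $ i * bump x (\<rho> / 2) z \<partial>lebesgue_on (ball x \<rho>)\<bar>
     \<le> S * 2 powr n * \<rho> powr - (n / 2) * l" .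
  have "c * \<bar>u x $ i\<bar> \<le> S * 2 powr n * \<rho> powr - (n / 2) * l + S * sqrt H\<^sub>0 / \<mu>\<^sub>0 * \<rho> powr (1 - n / 2) * L"
    using interior_estimate[OF H E \<Omega> \<rho> cont eq f, of i] 1 by (simp add: n_def S_def c_def l_def L_def)
  also have "\<dots> \<le> S * (2 powr n + sqrt H\<^sub>0 / \<mu>\<^sub>0) * (\<rho> powr - (n / 2) * l) + S * (2 powr n + sqrt H\<^sub>0 / \<mu>\<^sub>0) * (\<rho> powr (1 - n / 2) * L)"
  proof (rule add_mono)
    have "S * (\<rho> powr - (n / 2) * l) * 2 powr n \<le> S * (\<rho> powr - (n / 2) * l) * (2 powr n + sqrt H\<^sub>0 / \<mu>\<^sub>0)"
      using S lL H by (intro mult_left_mono) auto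
    then show "S * 2 powr n * \<rho> powr - (n / 2) * l \<le> S * (2 powr n + sqrt H\<^sub>0 / \<mu>\<^sub>0) * (\<rho> powr - (n / 2) * l)"
      by (simp add: ac_simps)
    have "S * (\<rho> powr (1 - n / 2) * L) * (sqrt H\<^sub>0 / \<mu>\<^sub>0) \<le> S * (\<rho> powr (1 - n / 2) * L) * (2 powr n + sqrt H\<^sub>0 / \<mu>\<^sub>0)"
      using S lL H by (intro mult_left_mono) auto
    then show "S * sqrt H\<^sub>0 / \<mu>\<^sub>0 * \<rho> powr (1 - n / 2) * L \<le> S * (2 powr n + sqrt H\<^sub>0 / \<mu>\<^sub>0) * (\<rho> powr (1 - n / 2) * L)"
      by (simp add: ac_simps)
  qed
  also have "\<dots> = S * (2 powr n + sqrt H\<^sub>0 / \<mu>\<^sub>0) * (\<rho> powr - (n / 2) * l + \<rho> powr (1 - n / 2) * L)"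
    by (simp add: distrib_left)
  finally have "\<bar>u x $ i\<bar> \<le> S * (2 powr n + sqrt H\<^sub>0 / \<mu>\<^sub>0) * (\<rho> powr - (n / 2) * l + \<rho> powr (1 - n / 2) * L) / c"
    using c by (simp add: le_divide_eq mult.commute)
  then show ?thesis by (simp add: local_bound_const_def S_def n_def c_def l_def L_def)
qed

text \<open>The approximating test functions vanish outside \<Omega>, so the inequality on the full
  ball applies to each of them, and both sides pass to the limit. The constant is the square root of
  2^(n+2) / \<theta>.\<close>

lemma energy_closure_Poincare:
  fixes u :: "real^'n \<Rightarrow> real^'N" and c :: "real^'n"
  assumes E: "energy_closure \<Omega> u Du \<phi>" and \<Omega>: "open \<Omega>" and r: "r > 0"
    and \<theta>: "\<theta> > 0" "measure lebesgue (ball c r - \<Omega>) \<ge> \<theta> * measure lebesgue (ball c r)"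
  shows "l2norm (lebesgue_on (\<Omega> \<inter> ball c r)) u
      \<le> 2 powr (real CARD('n) / 2 + 1) * r / sqrt \<theta> * l2norm (lebesgue_on (\<Omega> \<inter> ball c r)) Du"
proof (rule LIMSEQ_le)
  let ?V = "\<Omega> \<inter> ball c r" and ?B = "ball c r"
  have V: "?V \<in> sets lebesgue" "bounded ?V" "?V \<subseteq> \<Omega>" "?V \<in> sets borel" using \<Omega> by auto
  note EB = energy_closure_bounded[OF E \<Omega> V(1-3)]
  note \<phi> = energy_closureD(2)[OF E]
  show "(\<lambda>k. l2norm (lebesgue_on ?V) (\<phi> k)) \<longlonglongrightarrow> l2norm (lebesgue_on ?V) u"
    by (rule l2norm_tendsto[OF test_function_L2[OF \<phi> V(4)] EB(1,2)])
  show "(\<lambda>k. 2 powr (real CARD('n) / 2 + 1) * r / sqrt \<theta> * l2norm (lebesgue_on ?V) (\<lambda>x. jacobian (\<phi> k) (at x)))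
      \<longlonglongrightarrow> 2 powr (real CARD('n) / 2 + 1) * r / sqrt \<theta> * l2norm (lebesgue_on ?V) Du"
    by (intro tendsto_mult_left l2norm_tendsto[OF test_function_L2[OF test_function_jacobian[OF \<phi>] V(4)] EB(3,4)])
  have "l2norm (lebesgue_on ?V) (\<phi> k)
      \<le> 2 powr (real CARD('n) / 2 + 1) * r / sqrt \<theta> * l2norm (lebesgue_on ?V) (\<lambda>x. jacobian (\<phi> k) (at x))" for k
  proof -
    let ?J = "\<lambda>x. jacobian (\<phi> k) (at x)"
    have "?V \<subseteq> ?B" by auto
    have "l2norm (lebesgue_on ?V) (\<phi> k) \<le> l2norm (lebesgue_on ?B) (\<phi> k)"
      by (rule l2norm_subset[OF test_function_L2[OF \<phi>] V(1)]) auto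
    then have "\<theta> * (l2norm (lebesgue_on ?V) (\<phi> k))\<^sup>2 \<le> \<theta> * (l2norm (lebesgue_on ?B) (\<phi> k))\<^sup>2"
      using \<theta> by (intro mult_left_mono power_mono) auto
    also have "\<dots> \<le> 2 ^ (CARD('n) + 2) * r\<^sup>2 * (l2norm (lebesgue_on ?B) ?J)\<^sup>2"
      by (rule Poincare_zero_set[OF test_function_smooth[OF \<phi>] r \<Omega> test_function_off_U[OF \<phi>] \<theta>])
    also have "(l2norm (lebesgue_on ?B) ?J)\<^sup>2 = (l2norm (lebesgue_on ?V) ?J)\<^sup>2"
      unfolding l2norm_square
      by (rule integral_lebesgue_on_mono_set) (use V in \<open>auto simp: test_function_off_U[OF test_function_jacobian[OF \<phi>]]\<close>)
    finally have "(l2norm (lebesgue_on ?V) (\<phi> k))\<^sup>2 \<le> 2 ^ (CARD('n) + 2) * r\<^sup>2 * (l2norm (lebesgue_on ?V) ?J)\<^sup>2 / \<theta>"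
      using \<theta> by (simp add: le_divide_eq mult.commute)
    also have "\<dots> = (2 powr (real CARD('n) / 2 + 1) * r / sqrt \<theta> * l2norm (lebesgue_on ?V) ?J)\<^sup>2"
    proof -
      have "(2 powr (real CARD('n) / 2 + 1))\<^sup>2 = (2::real) powr real (CARD('n) + 2)"
        by (simp add: power2_eq_square add.commute flip: powr_add)
      also have "\<dots> = 2 ^ (CARD('n) + 2)" by (subst powr_realpow) auto
      finally show ?thesis using \<theta> by (simp add: power_mult_distrib power_divide)
    qed
    finally show ?thesis by (rule power2_le_imp_le) (use r \<theta> in simp)
  qed
  then show "\<exists>N. \<forall>k\<ge>N. l2norm (lebesgue_on ?V) (\<phi> k)
      \<le> 2 powr (real CARD('n) / 2 + 1) * r / sqrt \<theta> * l2norm (lebesgue_on ?V) (\<lambda>x. jacobian (\<phi> k) (at x))" by blast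
qed

text \<open>Powers of 4 come from local boundedness on balls of radius d/4, powers of 3/2 from the
  boundary ball of radius 3d/2, and \<theta> from the Poincare inequality there.\<close>

definition boundary_const :: "'n::finite itself \<Rightarrow> real \<Rightarrow> real \<Rightarrow> real \<Rightarrow> real \<Rightarrow> real \<Rightarrow> real" where
  "boundary_const t \<theta> \<mu> \<mu>\<^sub>0 H\<^sub>0 H\<^sub>1 = local_bound_const t \<mu>\<^sub>0 H\<^sub>0 *
    (4 powr (real CARD('n) / 2) * 2 powr (real CARD('n) / 2 + 1) * (3 / 2) / sqrt \<theta> + 4 powr (real CARD('n) / 2 - 1))
    * sqrt H\<^sub>1 * (3 / 2) powr (real CARD('n) / 2 - 1 + \<mu>)"

lemma boundary_const_nonneg:
  "H\<^sub>0 \<ge> 0 \<Longrightarrow> H\<^sub>1 \<ge> 0 \<Longrightarrow> \<mu>\<^sub>0 > 0 \<Longrightarrow> \<theta> > 0 \<Longrightarrow> boundary_const TYPE('n::finite) \<theta> \<mu> \<mu>\<^sub>0 H\<^sub>0 H\<^sub>1 \<ge> 0"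
  using local_bound_const_nonneg[where 'n='n] by (simp add: boundary_const_def)

text \<open>Local boundedness near x costs d^(-n/2) ||u|| + d^(1-n/2) ||Du||; the Poincare
  inequality on the boundary ball reduces the first term to the second. (BH) between the radii 3d/2
  and R then gains (d/R)^(n/2 - 1 + \<mu>), and the powers of d combine to d^\<mu>. The point x'
  varies in a ball so that the bound can be integrated against a mollifier.\<close>

lemma boundary_estimate:
  fixes u :: "real^'n \<Rightarrow> real^'N" and x :: "real^'n"
  assumes H: "property_H A \<mu>\<^sub>0 H\<^sub>0" "H\<^sub>0 \<ge> 0" "\<mu>\<^sub>0 > 0"
    and BH: "property_BH_at A \<Omega> R\<^sub>a \<mu>\<^sub>1 H\<^sub>1 p" "H\<^sub>1 \<ge> 0" "\<mu> \<le> \<mu>\<^sub>1"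
    and S: "condition_S_at \<Omega> \<theta> R\<^sub>a p" "\<theta> > 0"
    and E: "energy_closure \<Omega> u Du \<phi>" and \<Omega>: "open \<Omega>"
    and d: "d > 0" "dist x p \<le> d" "ball x d \<subseteq> \<Omega>" and R: "3 * d / 2 < R" "ereal R < R\<^sub>a"
    and cont: "continuous_on (\<Omega> \<inter> ball p R) u"
    and eq: "weak_equation A \<Omega> Du f" and f: "\<And>z. z \<in> \<Omega> \<inter> ball p R \<Longrightarrow> f z = 0"
    and x': "dist x' x < d / 4"
  shows "\<bar>u x' $ i\<bar> \<le> boundary_const TYPE('n) \<theta> \<mu> \<mu>\<^sub>0 H\<^sub>0 H\<^sub>1 * d powr \<mu> * R powr (1 - real CARD('n) / 2 - \<mu>)
      * l2norm (lebesgue_on \<Omega>) Du"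
proof -
  define n where "n = real CARD('n)"
  \<comment> \<open>A point within d/4 of x' is within d/2 of x, hence within 3d/2 of p.\<close>
  define r where "r = 3 * d / 2"
  define V where "V = \<Omega> \<inter> ball p r"
  have r: "0 < r" "r < R" using d R by (auto simp: r_def)
  have rRa: "ereal r < R\<^sub>a" using r(2) R(2) by (metis ereal_less_eq(3) less_imp_le order_le_less_trans)
  have V: "V \<in> sets lebesgue" "V \<subseteq> \<Omega>" using \<Omega> by (auto simp: V_def)
  have \<Omega>m: "\<Omega> \<in> sets lebesgue" using \<Omega> by auto
  let ?B = "ball x' (d / 4)"
  have BV: "?B \<subseteq> V"
  proof
    fix z assume z: "z \<in> ?B"
    have "dist x z \<le> dist x x' + dist x' z" by (rule dist_triangle)
    then have xz: "dist x z < d / 2" using z x' by (simp add: dist_commute)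
    have "dist p z \<le> dist p x + dist x z" by (rule dist_triangle)
    then have "dist p z < r" using xz d by (simp add: r_def dist_commute)
    moreover have "z \<in> ball x d" using xz d by simp
    ultimately show "z \<in> V" using d(3) by (auto simp: V_def)
  qed
  have VR: "V \<subseteq> \<Omega> \<inter> ball p R" using r by (auto simp: V_def)
  have LDu: "L2 (lebesgue_on \<Omega>) Du" by (rule energy_closureD(1)[OF E])
  have LV: "L2 (lebesgue_on V) Du" by (rule L2_subset[OF LDu V(1) \<Omega>m V(2)])
  have LuV: "L2 (lebesgue_on V) u"
    by (rule energy_closure_bounded(1)[OF E \<Omega> V(1) _ V(2)]) (simp add: V_def bounded_Int)
  define C1 where "C1 = local_bound_const TYPE('n) \<mu>\<^sub>0 H\<^sub>0"
  have C1: "C1 \<ge> 0" unfolding C1_def by (rule local_bound_const_nonneg[OF H(2,3)])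
  define LL where "LL = l2norm (lebesgue_on V) Du"
  have LL: "LL \<ge> 0" by (simp add: LL_def)
  have "\<bar>u x' $ i\<bar> \<le> C1 * ((d / 4) powr - (n / 2) * l2norm (lebesgue_on ?B) u + (d / 4) powr (1 - n / 2) * l2norm (lebesgue_on ?B) Du)"
    unfolding C1_def n_def
  proof (rule local_boundedness[OF H E \<Omega>])
    show "ball x' (d / 4) \<subseteq> \<Omega>" using BV V by auto
    show "continuous_on (ball x' (d / 4)) u" using BV VR by (intro continuous_on_subset[OF cont]) auto
    show "weak_equation A \<Omega> Du f" by (rule eq)
    show "f z = 0" if "z \<in> ball x' (d / 4)" for z using that BV VR by (intro f) blast
  qed (use d in simp)
  also have "\<dots> \<le> C1 * ((d / 4) powr - (n / 2) * (2 powr (n / 2 + 1) * r / sqrt \<theta> * LL) + (d / 4) powr (1 - n / 2) * LL)"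
  proof (intro mult_left_mono add_mono C1)
    have "l2norm (lebesgue_on ?B) u \<le> l2norm (lebesgue_on V) u"
      by (rule l2norm_subset[OF LuV _ V(1) BV]) simp
    also have "\<dots> \<le> 2 powr (n / 2 + 1) * r / sqrt \<theta> * LL"
      unfolding V_def LL_def n_def
      using S rRa r by (intro energy_closure_Poincare[OF E \<Omega> r(1) S(2)]) (simp add: condition_S_at_def)
    finally show "l2norm (lebesgue_on ?B) u \<le> 2 powr (n / 2 + 1) * r / sqrt \<theta> * LL" .
    show "l2norm (lebesgue_on ?B) Du \<le> LL"
      unfolding LL_def by (rule l2norm_subset[OF LV _ V(1) BV]) simp
  qed auto
  also have "\<dots> = C1 * (4 powr (n / 2) * 2 powr (n / 2 + 1) * (3 / 2) / sqrt \<theta> + 4 powr (n / 2 - 1)) * d powr (1 - n / 2) * LL"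
  proof -
    have "(d / 4) powr - (n / 2) * r = 4 powr (n / 2) * (3 / 2) * (d powr - (n / 2) * d powr 1)"
      using d by (simp add: powr_quotient r_def)
    also have "d powr - (n / 2) * d powr 1 = d powr (1 - n / 2)"
      by (simp only: powr_add[symmetric], rule arg_cong[where f="\<lambda>t. d powr t"], linarith)
    finally have 1: "(d / 4) powr - (n / 2) * r = 4 powr (n / 2) * (3 / 2) * d powr (1 - n / 2)" .
    have "(d / 4) powr (1 - n / 2) = 4 powr - (1 - n / 2) * d powr (1 - n / 2)"
      using d by (simp add: powr_quotient mult.commute)
    then have 2: "(d / 4) powr (1 - n / 2) = 4 powr (n / 2 - 1) * d powr (1 - n / 2)" by simp
    have "(d / 4) powr - (n / 2) * (2 powr (n / 2 + 1) * r / sqrt \<theta> * LL)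
        = ((d / 4) powr - (n / 2) * r) * (2 powr (n / 2 + 1) / sqrt \<theta> * LL)" by simp
    then show ?thesis unfolding 1 2 by (simp add: algebra_simps)
  qed
  also have "\<dots> \<le> C1 * (4 powr (n / 2) * 2 powr (n / 2 + 1) * (3 / 2) / sqrt \<theta> + 4 powr (n / 2 - 1)) * d powr (1 - n / 2)
      * (sqrt H\<^sub>1 * (r / R) powr (n / 2 - 1 + \<mu>) * l2norm (lebesgue_on \<Omega>) Du)"
  proof (rule mult_left_mono)
    have "LL \<le> sqrt H\<^sub>1 * (r / R) powr (n / 2 - 1 + \<mu>) * l2norm (lebesgue_on (\<Omega> \<inter> ball p R)) Du"
      unfolding LL_def V_def n_def
    proof (rule property_BH_l2norm[OF BH(1,2) R(2) energy_closure_vanishing[OF E \<Omega>] _ r \<Omega> BH(3)])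
      show "weak_equation A (\<Omega> \<inter> ball p R) Du (\<lambda>_. 0)"
        by (rule weak_equation_subset[OF eq \<Omega> _ _ f]) (use \<Omega> in auto)
    qed
    also have "\<dots> \<le> sqrt H\<^sub>1 * (r / R) powr (n / 2 - 1 + \<mu>) * l2norm (lebesgue_on \<Omega>) Du"
      using BH(2) \<Omega> by (intro mult_left_mono l2norm_subset[OF LDu _ \<Omega>m]) auto
    finally show "LL \<le> sqrt H\<^sub>1 * (r / R) powr (n / 2 - 1 + \<mu>) * l2norm (lebesgue_on \<Omega>) Du" .
    show "0 \<le> C1 * (4 powr (n / 2) * 2 powr (n / 2 + 1) * (3 / 2) / sqrt \<theta> + 4 powr (n / 2 - 1)) * d powr (1 - n / 2)"
      using C1 S by simp
  qed
  also have "\<dots> = boundary_const TYPE('n) \<theta> \<mu> \<mu>\<^sub>0 H\<^sub>0 H\<^sub>1 * d powr \<mu> * R powr (1 - n / 2 - \<mu>) * l2norm (lebesgue_on \<Omega>) Du"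
  proof -
    have "(r / R) powr (n / 2 - 1 + \<mu>) = (3 / 2) powr (n / 2 - 1 + \<mu>) * d powr (n / 2 - 1 + \<mu>) * R powr - (n / 2 - 1 + \<mu>)"
    proof -
      have "r / R = (3 / 2) * (d / R)" by (simp add: r_def)
      then have "(r / R) powr (n / 2 - 1 + \<mu>) = (3 / 2) powr (n / 2 - 1 + \<mu>) * (d / R) powr (n / 2 - 1 + \<mu>)"
        using d r by (simp only: powr_mult)
      also have "(d / R) powr (n / 2 - 1 + \<mu>) = d powr (n / 2 - 1 + \<mu>) * R powr - (n / 2 - 1 + \<mu>)"
        using d r by (intro powr_quotient) auto
      finally show ?thesis by simp
    qed
    moreover have "d powr (1 - n / 2) * d powr (n / 2 - 1 + \<mu>) = d powr \<mu>" by (simp flip: powr_add)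
    moreover have "- (n / 2 - 1 + \<mu>) = 1 - n / 2 - \<mu>" by simp
    ultimately show ?thesis
      unfolding boundary_const_def C1_def[symmetric] n_def[symmetric] by (simp add: ac_simps)
  qed
  finally show ?thesis by (simp add: n_def)
qed

section \<open>Duality for the Green's matrix\<close>

subsection \<open>The Green's matrix away from the diagonal\<close>

lemma integrable_continuous_compact:
  fixes f :: "'a::euclidean_space \<Rightarrow> 'b::euclidean_space"
  assumes "compact K" "continuous_on K f"
  shows "integrable (lebesgue_on K) f"
proof -
  have mK: "K \<in> sets lebesgue" using borel_compact[OF assms(1)] by (auto intro: sets_completionI_sets)
  have "bounded (f ` K)" by (rule compact_imp_bounded[OF compact_continuous_image[OF assms(2,1)]])
  then obtain M where M: "\<And>y. y \<in> K \<Longrightarrow> norm (f y) \<le> M" unfolding bounded_iff by fast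
  show ?thesis
    by (rule finite_measure.integrable_const_bound[OF finite_measure_lebesgue_on[OF mK compact_imp_bounded[OF assms(1)]]])
       (use M continuous_imp_measurable_on_sets_lebesgue[OF assms(2) mK] in \<open>auto intro!: AE_I2\<close>)
qed

text \<open>This weakening of \<^const>\<open>is_green_matrix\<close> constrains the representation only off the support of
  \<open>f\<close>, which makes it stable under passing to the transpose (lemma \<open>green_off_diagonal_transpose\<close>).\<close>

definition green_off_diagonal ::
    "('n::finite, 'N::finite) coeffs \<Rightarrow> (real^'n) set \<Rightarrow> (real^'n \<Rightarrow> real^'n \<Rightarrow> real^'N^'N) \<Rightarrow> bool" where
  "green_off_diagonal A \<Omega> G \<longleftrightarrow>
     continuous_on {(x, y). x \<in> \<Omega> \<and> y \<in> \<Omega> \<and> x \<noteq> y} (\<lambda>(x, y). G x y) \<and>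
     (\<forall>f. test_function \<Omega> f \<longrightarrow> (\<exists>u Du \<phi>. energy_closure \<Omega> u Du \<phi> \<and> weak_equation A \<Omega> Du f \<and>
        (\<forall>x \<in> \<Omega> - closure {y. f y \<noteq> 0}.
           u x = (\<integral>y. G x y *v f y \<partial>lebesgue_on (closure {y. f y \<noteq> 0})))))"

lemma is_green_matrix_off_diagonal:
  fixes G :: "real^'n \<Rightarrow> real^'n \<Rightarrow> real^'N^'N"
  assumes n: "CARD('n) \<ge> 3" and \<Omega>: "open \<Omega>" and G: "is_green_matrix A \<Omega> G"
  shows "green_off_diagonal A \<Omega> G"
  unfolding green_off_diagonal_def
proof (intro conjI allI impI)
  show "continuous_on {(x, y). x \<in> \<Omega> \<and> y \<in> \<Omega> \<and> x \<noteq> y} (\<lambda>(x, y). G x y)"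
    using G by (simp add: is_green_matrix_def)
  fix f :: "real^'n \<Rightarrow> real^'N" assume f: "test_function \<Omega> f"
  define K where "K = closure {y. f y \<noteq> 0}"
  have K: "K \<subseteq> \<Omega>" "compact K" using f by (auto simp: test_function_def K_def)
  have m: "K \<in> sets lebesgue" "\<Omega> \<in> sets lebesgue"
    using \<Omega> borel_compact[OF K(2)] by (auto intro: sets_completionI_sets)
  have K0: "f y = 0" if "y \<notin> K" for y
    using that closure_subset[of "{y. f y \<noteq> 0}"] unfolding K_def by blast
  define u where "u x = (LINT y:\<Omega>|lebesgue. G x y *v f y)" for x
  obtain Du where Y: "in_Y12_0 \<Omega> u Du" and eq: "weak_equation A \<Omega> Du f"
    using G f unfolding is_green_matrix_def u_def by blast
  obtain \<phi> where E: "energy_closure \<Omega> u Du \<phi>" using Y12_0_energy_closure[OF n \<Omega> Y] by blast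
  have "u x = (\<integral>y. G x y *v f y \<partial>lebesgue_on K)" for x
    unfolding u_def set_integral_lebesgue_on[OF m(2)]
    by (rule integral_lebesgue_on_mono_set[OF m K(1)]) (simp add: K0)
  then show "\<exists>u Du \<phi>. energy_closure \<Omega> u Du \<phi> \<and> weak_equation A \<Omega> Du f \<and>
        (\<forall>x \<in> \<Omega> - closure {y. f y \<noteq> 0}. u x = (\<integral>y. G x y *v f y \<partial>lebesgue_on (closure {y. f y \<noteq> 0})))"
    unfolding K_def[symmetric] using E eq by blast
qed

lemma continuous_on_matrix_vector_mult:
  fixes M :: "'a::topological_space \<Rightarrow> real^'n^'m"
  assumes "continuous_on S M" "continuous_on S v"
  shows "continuous_on S (\<lambda>z. M z *v v z)"
  unfolding matrix_vector_mult_def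
  by (intro continuous_on_vec_lambda continuous_on_sum continuous_on_mult continuous_on_component assms)

text \<open>Off the support of f the integrand is jointly continuous, so this solution is a
  continuous function there and not merely a class modulo null sets. The pointwise estimates depend
  on this.\<close>

lemma green_solution:
  fixes G :: "real^'n \<Rightarrow> real^'n \<Rightarrow> real^'N^'N"
  assumes G: "green_off_diagonal A \<Omega> G" and f: "test_function \<Omega> f" and K: "K = closure {y. f y \<noteq> 0}"
  obtains u Du \<phi> where "energy_closure \<Omega> u Du \<phi>" "weak_equation A \<Omega> Du f" "continuous_on (\<Omega> - K) u"
    "\<And>x. x \<in> \<Omega> - K \<Longrightarrow> u x = (\<integral>y. G x y *v f y \<partial>lebesgue_on K)"
    "\<And>x. x \<in> \<Omega> - K \<Longrightarrow> integrable (lebesgue_on K) (\<lambda>y. G x y *v f y)"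
proof -
  have Kc: "K \<subseteq> \<Omega>" "compact K" using f by (auto simp: test_function_def K)
  obtain u Du \<phi> where E: "energy_closure \<Omega> u Du \<phi>" "weak_equation A \<Omega> Du f"
    and u: "\<And>x. x \<in> \<Omega> - K \<Longrightarrow> u x = (\<integral>y. G x y *v f y \<partial>lebesgue_on K)"
    using G f unfolding green_off_diagonal_def K by blast
  have c: "continuous_on ((\<Omega> - K) \<times> K) (\<lambda>z. G (fst z) (snd z) *v f (snd z))"
  proof (rule continuous_on_matrix_vector_mult)
    have "continuous_on {(x, y). x \<in> \<Omega> \<and> y \<in> \<Omega> \<and> x \<noteq> y} (\<lambda>z. G (fst z) (snd z))"
      using G by (simp add: green_off_diagonal_def case_prod_beta')
    then show "continuous_on ((\<Omega> - K) \<times> K) (\<lambda>z. G (fst z) (snd z))"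
      by (rule continuous_on_subset) (use Kc in auto)
    show "continuous_on ((\<Omega> - K) \<times> K) (\<lambda>z. f (snd z))"
      by (rule continuous_on_compose2[OF test_function_continuous[OF f, of UNIV]]) (auto intro!: continuous_intros)
  qed
  have "continuous_on (\<Omega> - K) (\<lambda>x. \<integral>y. G x y *v f y \<partial>lebesgue_on K)"
    by (rule continuous_on_parametric_integral[OF Kc(2)]) (use c in \<open>simp add: case_prod_beta'\<close>)
  then have cu: "continuous_on (\<Omega> - K) u"
    by (rule continuous_on_eq) (rule u[symmetric])
  have "integrable (lebesgue_on K) (\<lambda>y. G x y *v f y)" if "x \<in> \<Omega> - K" for x
  proof (rule integrable_continuous_compact[OF Kc(2)])
    have "continuous_on K (\<lambda>y. (\<lambda>z. G (fst z) (snd z) *v f (snd z)) (x, y))"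
      by (rule continuous_on_compose2[OF c]) (use that in \<open>auto intro!: continuous_intros\<close>)
    then show "continuous_on K (\<lambda>y. G x y *v f y)" by simp
  qed
  then show ?thesis using that[OF E cu u] by blast
qed

text \<open>Each side equals the coefficient form of A at (Du, Dw): each equation is tested with the
  solution of the other.\<close>

lemma green_adjoint:
  assumes A: "measurable_coeffs A" "bounded_coeffs Lam A" "Lam \<ge> 0" and \<Omega>: "open \<Omega>"
    and E: "energy_closure \<Omega> u Du \<phi>" "weak_equation A \<Omega> Du f" "test_function \<Omega> f"
    and E': "energy_closure \<Omega> w Dw \<psi>" "weak_equation (transpose_coeffs A) \<Omega> Dw g" "test_function \<Omega> g"
  shows "(\<integral>x. f x \<bullet> w x \<partial>lebesgue_on \<Omega>) = (\<integral>x. g x \<bullet> u x \<partial>lebesgue_on \<Omega>)"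
proof -
  have "(\<integral>x. f x \<bullet> w x \<partial>lebesgue_on \<Omega>) = (\<integral>x. coeff_form A x (Du x) (Dw x) \<partial>lebesgue_on \<Omega>)"
    by (rule weak_equation_extend[OF A \<Omega> E(2,3) energy_closureD(1)[OF E(1)] E'(1), symmetric])
  also have "\<dots> = (\<integral>x. coeff_form (transpose_coeffs A) x (Dw x) (Du x) \<partial>lebesgue_on \<Omega>)"
    by (simp add: coeff_form_transpose)
  also have "\<dots> = (\<integral>x. g x \<bullet> u x \<partial>lebesgue_on \<Omega>)"
    by (rule weak_equation_extend[OF measurable_coeffs_transpose[OF A(1)] bounded_coeffs_transpose[OF A(2)] A(3) \<Omega> E'(2,3)
        energy_closureD(1)[OF E'(1)] E(1)])
  finally show ?thesis .
qed

text \<open>The 3 is the Hardy constant on balls, exp (2/3) is the square root of the reciprocal of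
  the bound in \<open>bump_ge_half\<close>, and 6 arises from averaging over the radius
  \<rho>/6.\<close>

definition duality_const :: "'n::finite itself \<Rightarrow> real \<Rightarrow> real \<Rightarrow> real \<Rightarrow> real" where
  "duality_const t lam \<mu>\<^sub>0 H\<^sub>0 = sqrt (unit_ball_vol (real CARD('n))) * (3 + sqrt H\<^sub>0 / \<mu>\<^sub>0 * exp (2/3))
     * 6 powr (real CARD('n) / 2 - 1) / (lam * bump_integral t)"

text \<open>A field F near y is tested through f = \<open>vdiv F\<close>. The solution u with source
  f has energy at most ||F|| / lam, so the pairing hypothesis bounds the integral of Dw against F by
  M / lam ||F||. Taking F = \<eta> Dw controls the energy of w on a smaller ball; taking f a bump
  times a unit vector, with the Hardy inequality for u, controls its average.
  \<open>interior_estimate\<close> combines the two into a value at y. The hypothesis bounds w only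
  through M, so nothing is lost when the source g concentrates.\<close>

lemma dual_solution_bound:
  fixes w g :: "real^'n \<Rightarrow> real^'N" and y :: "real^'n"
  assumes n: "CARD('n) \<ge> 3"
    and A: "measurable_coeffs A" "bounded_coeffs Lam A" "Lam \<ge> 0" "strongly_elliptic lam A" "lam > 0"
    and H: "property_H (transpose_coeffs A) \<mu>\<^sub>0 H\<^sub>0" "H\<^sub>0 \<ge> 0" "\<mu>\<^sub>0 > 0"
    and \<Omega>: "open \<Omega>" and \<rho>: "\<rho> > 0" "ball y \<rho> \<subseteq> \<Omega>"
    and E: "energy_closure \<Omega> w Dw \<psi>" and eq: "weak_equation (transpose_coeffs A) \<Omega> Dw g"
    and g0: "\<And>z. z \<in> ball y \<rho> \<Longrightarrow> g z = 0" and cont: "continuous_on (ball y \<rho>) w"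
    and M: "M \<ge> 0"
    and dual: "\<And>f. test_function (ball y \<rho>) f \<Longrightarrow> \<exists>u Du \<phi>. energy_closure \<Omega> u Du \<phi> \<and> weak_equation A \<Omega> Du f \<and>
        \<bar>\<integral>x. f x \<bullet> w x \<partial>lebesgue_on \<Omega>\<bar> \<le> M * l2norm (lebesgue_on \<Omega>) Du"
  shows "\<bar>w y $ i\<bar> \<le> duality_const TYPE('n) lam \<mu>\<^sub>0 H\<^sub>0 * M * \<rho> powr (1 - real CARD('n) / 2)"
proof -
  define N where "N = real CARD('n)"
  define S where "S = sqrt (unit_ball_vol N)"
  define c where "c = bump_integral TYPE('n)"
  \<comment> \<open>The bump of radius 2 s then has its support inside the ball of radius
    \<rho>.\<close>
  define s where "s = \<rho> / 3"
  have c: "c > 0" unfolding c_def by (rule bump_integral_pos)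
  have S: "S \<ge> 0" by (simp add: S_def N_def)
  have s: "s > 0" "2 * s < \<rho>" using \<rho> by (auto simp: s_def)
  have m: "\<Omega> \<in> sets lebesgue" "\<Omega> \<in> sets borel" using \<Omega> by auto
  have LDw: "L2 (lebesgue_on \<Omega>) Dw" by (rule energy_closureD(1)[OF E])
  have field: "\<bar>\<integral>x. Dw x \<bullet> F x \<partial>lebesgue_on \<Omega>\<bar> \<le> M / lam * l2norm (lebesgue_on \<Omega>) F"
    if F: "test_function (ball y \<rho>) F" for F
  proof -
    have F\<Omega>: "test_function \<Omega> F" by (rule test_function_mono[OF F \<rho>(2)])
    have f: "test_function (ball y \<rho>) (vdiv F)" "test_function \<Omega> (vdiv F)"
      by (rule test_function_vdiv[OF F], rule test_function_vdiv[OF F\<Omega>])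
    obtain u Du \<phi> where u: "energy_closure \<Omega> u Du \<phi>" "weak_equation A \<Omega> Du (vdiv F)"
      and bd: "\<bar>\<integral>x. vdiv F x \<bullet> w x \<partial>lebesgue_on \<Omega>\<bar> \<le> M * l2norm (lebesgue_on \<Omega>) Du"
      using dual[OF f(1)] by blast
    have LF: "L2 (lebesgue_on \<Omega>) F" by (rule test_function_L2[OF F m(2)])
    have "(\<integral>x. vdiv F x \<bullet> u x \<partial>lebesgue_on \<Omega>) = - (\<integral>x. Du x \<bullet> F x \<partial>lebesgue_on \<Omega>)"
      using energy_closure_vdiv[OF u(1) \<Omega> F\<Omega>] by (simp add: inner_commute)
    also have "\<dots> \<le> l2norm (lebesgue_on \<Omega>) F * l2norm (lebesgue_on \<Omega>) Du"
      using l2_inner_le[OF energy_closureD(1)[OF u(1)] LF] by (simp add: mult.commute)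
    finally have "l2norm (lebesgue_on \<Omega>) Du \<le> l2norm (lebesgue_on \<Omega>) F / lam"
      by (rule energy_estimate[OF A \<Omega> u(2) f(2) u(1)]) simp
    then have "M * l2norm (lebesgue_on \<Omega>) Du \<le> M * (l2norm (lebesgue_on \<Omega>) F / lam)"
      using M by (rule mult_left_mono)
    moreover have "(\<integral>x. vdiv F x \<bullet> w x \<partial>lebesgue_on \<Omega>) = - (\<integral>x. Dw x \<bullet> F x \<partial>lebesgue_on \<Omega>)"
      using energy_closure_vdiv[OF E \<Omega> F\<Omega>] by (simp add: inner_commute)
    ultimately show ?thesis using bd by simp
  qed
  \<comment> \<open>The cut-off enters F = \<eta> Dw only once, and \<eta>^2 \<le> \<eta> bounds
    ||F||^2 by X, the integral of \<eta> |Dw|^2. So X \<le> M / lam sqrt X, without any derivative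
    of \<eta>. The ball of radius s is the half ball, where \<eta> is bounded below.\<close>
  define \<eta> where "\<eta> = bump y (2 * s)"
  have \<eta>: "0 \<le> \<eta> z" "\<eta> z \<le> 1" "(\<eta> z)\<^sup>2 \<le> \<eta> z" for z
    using bump_nonneg[of y "2 * s" z] bump_le_1[of y "2 * s" z]
    by (auto simp: \<eta>_def power2_eq_square mult_left_le)
  have t\<eta>: "test_function (ball y \<rho>) \<eta>"
    unfolding \<eta>_def using s by (intro test_function_bump) auto
  have \<eta>m: "\<eta> \<in> borel_measurable (lebesgue_on \<Omega>)"
    unfolding \<eta>_def by (intro borel_measurable_lebesgue_on_continuous smooth_continuous_on smooth_bump)
  have L\<eta>: "L2 (lebesgue_on \<Omega>) (\<lambda>z. \<eta> z *\<^sub>R h z)" "l2norm (lebesgue_on \<Omega>) (\<lambda>z. \<eta> z *\<^sub>R h z) \<le> l2norm (lebesgue_on \<Omega>) h"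
    if h: "L2 (lebesgue_on \<Omega>) h" for h :: "real^'n \<Rightarrow> real^'n^'N"
  proof -
    have b: "norm (\<eta> z *\<^sub>R h z) \<le> 1 * norm (h z)" for z
      using \<eta>[of z] by (simp add: mult_left_le_one_le)
    show "L2 (lebesgue_on \<Omega>) (\<lambda>z. \<eta> z *\<^sub>R h z)"
      by (rule L2_bound[OF h borel_measurable_scaleR[OF \<eta>m L2_measurable[OF h]] b])
    show "l2norm (lebesgue_on \<Omega>) (\<lambda>z. \<eta> z *\<^sub>R h z) \<le> l2norm (lebesgue_on \<Omega>) h"
      using l2norm_mono[OF h _ b] by simp
  qed
  define X where "X = (\<integral>z. Dw z \<bullet> (\<eta> z *\<^sub>R Dw z) \<partial>lebesgue_on \<Omega>)"
  have X0: "X \<ge> 0" unfolding X_def using \<eta> by (intro integral_nonneg_AE AE_I2) (simp add: inner_scaleR_right)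
  \<comment> \<open>\<eta> Dw itself is not smooth; cut-off gradients of the approximants of w are,
    and they converge to it in L2.\<close>
  define F where "F k z = \<eta> z *\<^sub>R jacobian (\<psi> k) (at z)" for k z
  note \<psi> = energy_closureD(2)[OF E]
  have LJ: "L2 (lebesgue_on \<Omega>) (\<lambda>z. jacobian (\<psi> k) (at z))" for k
    by (rule test_function_L2[OF test_function_jacobian[OF \<psi>] m(2)])
  have tF: "test_function (ball y \<rho>) (F k)" for k
    unfolding F_def
    by (rule test_function_bilinear1[OF bounded_bilinear_scaleR t\<eta> test_function_smooth[OF test_function_jacobian[OF \<psi>]]])
  have "X \<le> M / lam * l2norm (lebesgue_on \<Omega>) (\<lambda>z. \<eta> z *\<^sub>R Dw z)"
  proof (rule LIMSEQ_le)
    show "(\<lambda>k. \<integral>z. jacobian (\<psi> k) (at z) \<bullet> (\<eta> z *\<^sub>R Dw z) \<partial>lebesgue_on \<Omega>) \<longlonglongrightarrow> X"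
      unfolding X_def by (rule l2_inner_tendsto[OF LJ LDw L\<eta>(1)[OF LDw] energy_closureD(3)[OF E]])
    have "(\<lambda>k. l2norm (lebesgue_on \<Omega>) (\<lambda>z. \<eta> z *\<^sub>R Dw z - F k z)) \<longlonglongrightarrow> 0"
    proof (rule Lim_null_comparison[OF _ energy_closureD(3)[OF E]], rule always_eventually, rule allI)
      fix k
      have "l2norm (lebesgue_on \<Omega>) (\<lambda>z. \<eta> z *\<^sub>R (Dw z - jacobian (\<psi> k) (at z))) \<le> l2norm (lebesgue_on \<Omega>) (\<lambda>z. Dw z - jacobian (\<psi> k) (at z))"
        by (rule L\<eta>(2)[OF L2_diff[OF LDw LJ]])
      then show "norm (l2norm (lebesgue_on \<Omega>) (\<lambda>z. \<eta> z *\<^sub>R Dw z - F k z)) \<le> l2norm (lebesgue_on \<Omega>) (\<lambda>z. Dw z - jacobian (\<psi> k) (at z))"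
        by (simp add: F_def scaleR_diff_right)
    qed
    then have "(\<lambda>k. l2norm (lebesgue_on \<Omega>) (F k)) \<longlonglongrightarrow> l2norm (lebesgue_on \<Omega>) (\<lambda>z. \<eta> z *\<^sub>R Dw z)"
      by (rule l2norm_tendsto[OF test_function_L2[OF tF m(2)] L\<eta>(1)[OF LDw]])
    then show "(\<lambda>k. M / lam * l2norm (lebesgue_on \<Omega>) (F k)) \<longlonglongrightarrow> M / lam * l2norm (lebesgue_on \<Omega>) (\<lambda>z. \<eta> z *\<^sub>R Dw z)"
      by (rule tendsto_mult_left)
    have "(\<integral>z. jacobian (\<psi> k) (at z) \<bullet> (\<eta> z *\<^sub>R Dw z) \<partial>lebesgue_on \<Omega>) \<le> M / lam * l2norm (lebesgue_on \<Omega>) (F k)" for k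
    proof -
      have "(\<integral>z. jacobian (\<psi> k) (at z) \<bullet> (\<eta> z *\<^sub>R Dw z) \<partial>lebesgue_on \<Omega>) = (\<integral>z. Dw z \<bullet> F k z \<partial>lebesgue_on \<Omega>)"
        by (simp add: F_def inner_commute)
      then show ?thesis using field[OF tF[of k]] by linarith
    qed
    then show "\<exists>k0. \<forall>k\<ge>k0. (\<integral>z. jacobian (\<psi> k) (at z) \<bullet> (\<eta> z *\<^sub>R Dw z) \<partial>lebesgue_on \<Omega>) \<le> M / lam * l2norm (lebesgue_on \<Omega>) (F k)"
      by blast
  qed
  also have "\<dots> \<le> M / lam * sqrt X"
  proof (rule mult_left_mono)
    have "(l2norm (lebesgue_on \<Omega>) (\<lambda>z. \<eta> z *\<^sub>R Dw z))\<^sup>2 \<le> X"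
      unfolding l2norm_square X_def
    proof (rule integral_mono[OF L2_integrable[OF L\<eta>(1)[OF LDw]] L2_inner_integrable[OF LDw L\<eta>(1)[OF LDw]]])
      fix z
      have "(norm (\<eta> z *\<^sub>R Dw z))\<^sup>2 = (\<eta> z)\<^sup>2 * (Dw z \<bullet> Dw z)"
        by (simp add: power_mult_distrib power2_norm_eq_inner)
      also have "\<dots> \<le> \<eta> z * (Dw z \<bullet> Dw z)" by (intro mult_right_mono \<eta>) simp
      finally show "(norm (\<eta> z *\<^sub>R Dw z))\<^sup>2 \<le> Dw z \<bullet> (\<eta> z *\<^sub>R Dw z)" by simp
    qed
    then show "l2norm (lebesgue_on \<Omega>) (\<lambda>z. \<eta> z *\<^sub>R Dw z) \<le> sqrt X" by (rule real_le_rsqrt)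
  qed (use M A(5) in simp)
  finally have "sqrt X * sqrt X \<le> M / lam * sqrt X" using X0 by simp
  then have sX: "sqrt X \<le> M / lam"
  proof (cases "X = 0")
    case False
    then have "sqrt X > 0" using X0 by simp
    then show ?thesis by (rule mult_right_le_imp_le[OF \<open>sqrt X * sqrt X \<le> M / lam * sqrt X\<close>])
  qed (use M A(5) in simp)
  have bs: "ball y s \<subseteq> \<Omega>" "ball y s \<subseteq> ball y \<rho>" using s \<rho> by (auto intro!: subset_ball intro: order_trans[OF subset_ball])
  have Dwball: "l2norm (lebesgue_on (ball y s)) Dw \<le> exp (2/3) * (M / lam)"
  proof -
    have "exp (- 4 / 3) * (l2norm (lebesgue_on (ball y s)) Dw)\<^sup>2 \<le> X"
    proof -
      have "(\<integral>z. exp (- 4 / 3) * (indicator (ball y s) z *\<^sub>R (norm (Dw z))\<^sup>2) \<partial>lebesgue)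
          \<le> (\<integral>z. indicator \<Omega> z *\<^sub>R (Dw z \<bullet> (\<eta> z *\<^sub>R Dw z)) \<partial>lebesgue)"
      proof (rule integral_mono')
        show "integrable lebesgue (\<lambda>z. indicator \<Omega> z *\<^sub>R (Dw z \<bullet> (\<eta> z *\<^sub>R Dw z)))"
          using L2_inner_integrable[OF LDw L\<eta>(1)[OF LDw]] m(1) by (simp add: integrable_restrict_space)
        fix z
        show "0 \<le> indicator \<Omega> z *\<^sub>R (Dw z \<bullet> (\<eta> z *\<^sub>R Dw z))" using \<eta>[of z] by simp
        show "exp (- 4 / 3) * (indicator (ball y s) z *\<^sub>R (norm (Dw z))\<^sup>2) \<le> indicator \<Omega> z *\<^sub>R (Dw z \<bullet> (\<eta> z *\<^sub>R Dw z))"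
        proof (cases "z \<in> ball y s")
          case True
          then have "exp (- 4 / 3) \<le> \<eta> z"
            unfolding \<eta>_def using s by (intro bump_ge_half) auto
          then have "exp (- 4 / 3) * (norm (Dw z))\<^sup>2 \<le> \<eta> z * (norm (Dw z))\<^sup>2" by (rule mult_right_mono) simp
          moreover have "z \<in> \<Omega>" using True bs by blast
          ultimately show ?thesis using True by (simp add: power2_norm_eq_inner)
        next
          case False
          then show ?thesis using \<eta>[of z] by simp
        qed
      qed
      then show ?thesis using m(1) by (simp add: l2norm_square X_def integral_restrict_space)
    qed
    also have "X = (sqrt X)\<^sup>2" using X0 by simp
    also have "\<dots> \<le> (M / lam)\<^sup>2" using sX X0 by (intro power_mono) auto
    finally have le: "exp (- 4 / 3) * (l2norm (lebesgue_on (ball y s)) Dw)\<^sup>2 \<le> (M / lam)\<^sup>2" .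
    have e: "exp (4 / 3) * exp (- 4 / 3) = (1::real)" "exp (4 / 3) = (exp (2/3 :: real))\<^sup>2"
      by (simp_all add: exp_add[symmetric] power2_eq_square)
    have "(l2norm (lebesgue_on (ball y s)) Dw)\<^sup>2 = exp (4 / 3) * (exp (- 4 / 3) * (l2norm (lebesgue_on (ball y s)) Dw)\<^sup>2)"
      by (simp only: mult.assoc[symmetric] e(1) mult_1_left)
    also have "\<dots> \<le> exp (4 / 3) * (M / lam)\<^sup>2" by (rule mult_left_mono[OF le]) simp
    also have "\<dots> = (exp (2/3) * (M / lam))\<^sup>2" by (simp only: e(2) power_mult_distrib)
    finally have "(l2norm (lebesgue_on (ball y s)) Dw)\<^sup>2 \<le> (exp (2/3) * (M / lam))\<^sup>2" .
    then show ?thesis by (rule power2_le_imp_le) (use M A(5) in simp)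
  qed
  \<comment> \<open>Here f is the bump of radius s/2 in direction i. The Hardy inequality bounds the
    energy of its solution by the radius times ||f||, and the pairing with w is the average in
    question.\<close>
  have avg: "\<bar>\<integral>z. w z $ i * bump y (s / 2) z \<partial>lebesgue_on (ball y s)\<bar> \<le> M * (3 * (s / 2) * (S * (s / 2) powr (N / 2)) / lam)"
  proof -
    define f where "f z = bump y (s / 2) z *\<^sub>R (axis i 1 :: real^'N)" for z
    have tb: "test_function (ball y \<rho>) (bump y (s / 2))" using s by (intro test_function_bump) auto
    have f: "test_function (ball y \<rho>) f"
      unfolding f_def by (rule test_function_linear[OF bounded_linear_scaleR_left tb])
    have f\<Omega>: "test_function \<Omega> f" by (rule test_function_mono[OF f \<rho>(2)])
    have f0: "f z = 0" if "z \<notin> ball y (s / 2)" for z using that s bump_outside[of "s/2" z y] by (simp add: f_def)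
    obtain u Du \<phi> where u: "energy_closure \<Omega> u Du \<phi>" "weak_equation A \<Omega> Du f"
      and bd: "\<bar>\<integral>x. f x \<bullet> w x \<partial>lebesgue_on \<Omega>\<bar> \<le> M * l2norm (lebesgue_on \<Omega>) Du"
      using dual[OF f] by blast
    have half: "ball y (s / 2) \<subseteq> \<Omega>" using bs(1) s by (auto intro: order_trans[OF subset_ball])
    have Lf: "l2norm (lebesgue_on \<Omega>) f \<le> S * (s / 2) powr (N / 2)"
    proof -
      have "l2norm (lebesgue_on \<Omega>) f = l2norm (lebesgue_on (ball y (s / 2))) f"
        unfolding l2norm_def by (subst integral_lebesgue_on_mono_set[OF _ m(1) half]) (simp_all add: f0)
      also have "\<dots> \<le> 1 * l2norm (lebesgue_on (ball y (s / 2))) (\<lambda>_. 1::real)"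
        by (rule l2norm_mono[OF L2_const]) (simp_all add: f_def bump_nonneg bump_le_1 norm_axis)
      also have "\<dots> = S * (s / 2) powr (N / 2)"
        using l2norm_const_ball[of "s/2" 1 y] s by (simp add: S_def N_def)
      finally show ?thesis .
    qed
    have "\<bar>\<integral>x. f x \<bullet> u x \<partial>lebesgue_on \<Omega>\<bar> \<le> 3 * (s / 2) * l2norm (lebesgue_on \<Omega>) f * l2norm (lebesgue_on \<Omega>) Du"
      using s by (intro energy_closure_hardy_ball[OF n u(1) \<Omega> f\<Omega> f0]) auto
    also have "\<dots> \<le> 3 * (s / 2) * (S * (s / 2) powr (N / 2)) * l2norm (lebesgue_on \<Omega>) Du"
      using Lf s by (intro mult_right_mono mult_left_mono) auto
    finally have "(\<integral>x. f x \<bullet> u x \<partial>lebesgue_on \<Omega>) \<le> 3 * (s / 2) * (S * (s / 2) powr (N / 2)) * l2norm (lebesgue_on \<Omega>) Du" by simp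
    then have "l2norm (lebesgue_on \<Omega>) Du \<le> 3 * (s / 2) * (S * (s / 2) powr (N / 2)) / lam"
      by (rule energy_estimate[OF A \<Omega> u(2) f\<Omega> u(1)]) (use s S in simp)
    then have "M * l2norm (lebesgue_on \<Omega>) Du \<le> M * (3 * (s / 2) * (S * (s / 2) powr (N / 2)) / lam)"
      using M by (rule mult_left_mono)
    moreover have "(\<integral>x. f x \<bullet> w x \<partial>lebesgue_on \<Omega>) = (\<integral>z. w z $ i * bump y (s / 2) z \<partial>lebesgue_on (ball y s))"
    proof -
      have "(\<integral>x. f x \<bullet> w x \<partial>lebesgue_on \<Omega>) = (\<integral>x. f x \<bullet> w x \<partial>lebesgue_on (ball y s))"
        by (rule integral_lebesgue_on_mono_set[OF _ m(1) bs(1)]) (use f0 s in auto)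
      then show ?thesis by (simp add: f_def inner_axis' mult.commute)
    qed
    ultimately show ?thesis using bd by simp
  qed
  have "c * \<bar>w y $ i\<bar> \<le> (s / 2) powr - N * \<bar>\<integral>z. w z $ i * bump y (s / 2) z \<partial>lebesgue_on (ball y s)\<bar>
      + S * sqrt H\<^sub>0 / \<mu>\<^sub>0 * s powr (1 - N / 2) * l2norm (lebesgue_on (ball y s)) Dw"
    unfolding c_def N_def S_def
    by (rule interior_estimate[OF H E \<Omega> s(1) bs(1) continuous_on_subset[OF cont bs(2)] eq]) (use g0 bs(2) in blast)
  also have "\<dots> \<le> (s / 2) powr - N * (M * (3 * (s / 2) * (S * (s / 2) powr (N / 2)) / lam))
      + S * sqrt H\<^sub>0 / \<mu>\<^sub>0 * (s / 2) powr (1 - N / 2) * (exp (2/3) * (M / lam))"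
  proof (intro add_mono mult_left_mono mult_mono avg Dwball)
    \<comment> \<open>The exponent is negative, so both terms can be expressed with the radius s/2 =
      \<rho>/6.\<close>
    show "s powr (1 - N / 2) \<le> (s / 2) powr (1 - N / 2)"
      using s n by (intro powr_mono2') (auto simp: N_def)
  qed (use S H M A(5) in auto)
  also have "(s / 2) powr - N * (M * (3 * (s / 2) * (S * (s / 2) powr (N / 2)) / lam))
      = S * 3 * M / lam * ((s / 2) powr - N * (s / 2) powr 1 * (s / 2) powr (N / 2))"
    using s by (simp add: mult.assoc mult.commute mult.left_commute)
  also have "(s / 2) powr - N * (s / 2) powr 1 * (s / 2) powr (N / 2) = (s / 2) powr (1 - N / 2)"
    by (simp only: powr_add[symmetric], rule arg_cong[where f="\<lambda>t. (s / 2) powr t"], linarith)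
  also have "(s / 2) powr (1 - N / 2) = 6 powr (N / 2 - 1) * \<rho> powr (1 - N / 2)"
  proof -
    have e: "s / 2 = \<rho> / 6" by (simp add: s_def)
    have "(s / 2) powr (1 - N / 2) = \<rho> powr (1 - N / 2) * 6 powr - (1 - N / 2)"
      unfolding e by (rule powr_quotient[OF \<rho>(1)]) simp
    then show ?thesis by (simp only: minus_diff_eq mult.commute)
  qed
  also have "S * 3 * M / lam * (6 powr (N / 2 - 1) * \<rho> powr (1 - N / 2)) + S * sqrt H\<^sub>0 / \<mu>\<^sub>0 * (6 powr (N / 2 - 1) * \<rho> powr (1 - N / 2)) * (exp (2/3) * (M / lam))
     = c * (duality_const TYPE('n) lam \<mu>\<^sub>0 H\<^sub>0 * M * \<rho> powr (1 - N / 2))"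
    using c A(5) H(3) by (simp add: duality_const_def c_def[symmetric] N_def[symmetric] S_def[symmetric] field_simps)
  finally show ?thesis using c by (simp add: N_def)
qed

section \<open>Solvability, and the Green's matrix of the transpose\<close>

subsection \<open>Existence of solutions\<close>

lemma dirichlet_expand:
  fixes \<phi> \<psi> :: "real^'n \<Rightarrow> real^'N"
  assumes \<phi>: "test_function \<Omega> \<phi>" and \<psi>: "test_function \<Omega> \<psi>" and \<Omega>: "open \<Omega>"
  defines "J \<equiv> \<lambda>f x. jacobian f (at x) :: real^'n^'N"
  shows "(l2norm (lebesgue_on \<Omega>) (J (\<lambda>x. \<phi> x + t *\<^sub>R \<psi> x)))\<^sup>2
    = (l2norm (lebesgue_on \<Omega>) (J \<phi>))\<^sup>2 + 2 * t * (\<integral>x. J \<phi> x \<bullet> J \<psi> x \<partial>lebesgue_on \<Omega>) + t\<^sup>2 * (l2norm (lebesgue_on \<Omega>) (J \<psi>))\<^sup>2"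
proof -
  have m: "\<Omega> \<in> sets borel" using \<Omega> by auto
  have L: "L2 (lebesgue_on \<Omega>) (J \<phi>)" "L2 (lebesgue_on \<Omega>) (J \<psi>)"
    unfolding J_def
    by (rule test_function_L2[OF test_function_jacobian[OF \<phi>] m], rule test_function_L2[OF test_function_jacobian[OF \<psi>] m])
  have J: "J (\<lambda>x. \<phi> x + t *\<^sub>R \<psi> x) x = J \<phi> x + t *\<^sub>R J \<psi> x" for x
    unfolding J_def by (rule jacobian_add_scaleR[OF test_function_smooth[OF \<phi>] test_function_smooth[OF \<psi>]])
  have "(norm (J (\<lambda>x. \<phi> x + t *\<^sub>R \<psi> x) x))\<^sup>2 = (norm (J \<phi> x))\<^sup>2 + 2 * t * (J \<phi> x \<bullet> J \<psi> x) + t\<^sup>2 * (norm (J \<psi> x))\<^sup>2" for x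
    unfolding J power2_norm_eq_inner
    by (simp add: inner_add_left inner_add_right inner_commute power2_eq_square algebra_simps)
  then show ?thesis
    unfolding l2norm_square using L2_inner_integrable[OF L] L[THEN L2_integrable] by simp
qed

text \<open>An approximate Riesz representation that needs no completeness. Any \<delta> whose value
  of the Dirichlet functional ||D\<delta>||^2 / 2 - l \<delta> is within e^2/2 of the infimum has a
  small first variation: along each line the functional is a quadratic polynomial bounded below, and
  its discriminant yields the estimate.\<close>

lemma riesz_approximation:
  fixes l :: "(real^'n \<Rightarrow> real^'N) \<Rightarrow> real"
  assumes \<Omega>: "open \<Omega>"
    and lin: "\<And>\<phi> \<psi> c. test_function \<Omega> \<phi> \<Longrightarrow> test_function \<Omega> \<psi> \<Longrightarrow> l (\<lambda>x. \<phi> x + c *\<^sub>R \<psi> x) = l \<phi> + c * l \<psi>"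
    and bound: "\<And>\<phi>. test_function \<Omega> \<phi> \<Longrightarrow> \<bar>l \<phi>\<bar> \<le> M * l2norm (lebesgue_on \<Omega>) (\<lambda>x. jacobian \<phi> (at x))"
    and e: "e > 0"
  shows "\<exists>\<delta>. test_function \<Omega> \<delta> \<and> (\<forall>\<psi>. test_function \<Omega> \<psi> \<longrightarrow>
     \<bar>(\<integral>x. jacobian \<delta> (at x) \<bullet> jacobian \<psi> (at x) \<partial>lebesgue_on \<Omega>) - l \<psi>\<bar> \<le> e * l2norm (lebesgue_on \<Omega>) (\<lambda>x. jacobian \<psi> (at x)))"
proof -
  define d where "d \<phi> = l2norm (lebesgue_on \<Omega>) (\<lambda>x. jacobian \<phi> (at x))" for \<phi> :: "real^'n \<Rightarrow> real^'N"
  define J where "J \<phi> = (d \<phi>)\<^sup>2 / 2 - l \<phi>" for \<phi>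
  define m where "m = Inf (J ` {\<phi>. test_function \<Omega> \<phi>})"
  have lower: "- M\<^sup>2 / 2 \<le> J \<phi>" if "test_function \<Omega> \<phi>" for \<phi>
  proof -
    have "l \<phi> \<le> M * d \<phi>" using bound[OF that] by (simp add: d_def)
    moreover have "2 * M * d \<phi> \<le> M\<^sup>2 + (d \<phi>)\<^sup>2" by (rule sum_squares_bound)
    ultimately show ?thesis by (simp add: J_def)
  qed
  have bdd: "bdd_below (J ` {\<phi>. test_function \<Omega> \<phi>})" using lower by (auto intro!: bdd_belowI)
  have ne: "J ` {\<phi>. test_function \<Omega> \<phi>} \<noteq> {}" using test_function_zero by blast
  have "m < m + e\<^sup>2 / 2" using e by simp
  then obtain \<delta> where \<delta>: "test_function \<Omega> \<delta>" "J \<delta> < m + e\<^sup>2 / 2"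
    unfolding m_def using cInf_lessD[OF ne] by blast
  have "\<bar>(\<integral>x. jacobian \<delta> (at x) \<bullet> jacobian \<psi> (at x) \<partial>lebesgue_on \<Omega>) - l \<psi>\<bar> \<le> e * d \<psi>" if \<psi>: "test_function \<Omega> \<psi>" for \<psi>
  proof -
    define a where "a = (\<integral>x. jacobian \<delta> (at x) \<bullet> jacobian \<psi> (at x) \<partial>lebesgue_on \<Omega>) - l \<psi>"
    have "0 \<le> t\<^sup>2 * ((d \<psi>)\<^sup>2 / 2) - 2 * t * (- a / 2) + e\<^sup>2 / 2" for t
    proof -
      have "test_function \<Omega> (\<lambda>x. \<delta> x + t *\<^sub>R \<psi> x)" by (intro test_function_add \<delta> test_function_scaleR \<psi>)
      then have "m \<le> J (\<lambda>x. \<delta> x + t *\<^sub>R \<psi> x)" unfolding m_def using bdd by (intro cInf_lower) auto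
      also have "\<dots> = J \<delta> + t * a + t\<^sup>2 * ((d \<psi>)\<^sup>2 / 2)"
        unfolding J_def d_def dirichlet_expand[OF \<delta>(1) \<psi> \<Omega>] lin[OF \<delta>(1) \<psi>] a_def by (simp add: field_simps)
      finally show ?thesis using \<delta>(2) by simp
    qed
    then have "(- a / 2)\<^sup>2 \<le> ((d \<psi>)\<^sup>2 / 2) * (e\<^sup>2 / 2)" by (rule discriminant_bound) simp
    then have "a\<^sup>2 \<le> (e * d \<psi>)\<^sup>2" by (simp add: power_mult_distrib power_divide mult.commute)
    then show ?thesis unfolding a_def[symmetric]
      using e by (simp add: abs_le_square_iff[symmetric] d_def)
  qed
  then show ?thesis using \<delta>(1) unfolding d_def by blast
qed

text \<open>Expanding the square gives at most 1 - 2 \<tau> lam + \<tau>^2 Lam^2 times |p|^2, and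
  this \<tau> makes the last term at most \<tau> lam. The denominator Lam^2 + lam^2 also ensures
  \<tau> lam \<le> 1, so that the factor is nonnegative. The square root is taken through 1 - a
  \<le> (1 - a/2)^2.\<close>

lemma elliptic_contraction:
  assumes A: "bounded_coeffs Lam A" "Lam \<ge> 0" "strongly_elliptic lam A" "lam > 0"
  defines "\<tau> \<equiv> lam / (Lam\<^sup>2 + lam\<^sup>2)"
  shows "norm (p - \<tau> *\<^sub>R cmul A x p) \<le> (1 - \<tau> * lam / 2) * norm p"
    and "0 \<le> 1 - \<tau> * lam / 2" "1 - \<tau> * lam / 2 < 1" "\<tau> > 0"
proof -
  have pos: "Lam\<^sup>2 + lam\<^sup>2 > 0" using A(4) by (simp add: add_nonneg_pos)
  show \<tau>: "\<tau> > 0" using pos A(4) by (simp add: \<tau>_def)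
  have "\<tau> * lam \<le> 1" using pos by (simp add: \<tau>_def power2_eq_square)
  then show k: "0 \<le> 1 - \<tau> * lam / 2" by simp
  show "1 - \<tau> * lam / 2 < 1" using \<tau> A(4) by simp
  have "\<tau> * Lam\<^sup>2 \<le> lam" using pos A(4) by (simp add: \<tau>_def field_simps)
  then have t: "\<tau>\<^sup>2 * Lam\<^sup>2 \<le> \<tau> * lam" using \<tau> by (simp add: power2_eq_square)
  have c2: "(norm (cmul A x p))\<^sup>2 \<le> Lam\<^sup>2 * (norm p)\<^sup>2"
    using power_mono[OF norm_cmul[OF A(1,2), of x p], of 2] by (simp add: power_mult_distrib)
  have "(norm (p - \<tau> *\<^sub>R cmul A x p))\<^sup>2 = (norm p)\<^sup>2 - 2 * \<tau> * (cmul A x p \<bullet> p) + \<tau>\<^sup>2 * (norm (cmul A x p))\<^sup>2"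
    unfolding power2_norm_eq_inner
    by (simp add: inner_diff_left inner_diff_right inner_commute power2_eq_square algebra_simps)
  also have "\<dots> \<le> (norm p)\<^sup>2 - 2 * \<tau> * (lam * (norm p)\<^sup>2) + \<tau>\<^sup>2 * (Lam\<^sup>2 * (norm p)\<^sup>2)"
    using coeff_form_elliptic[OF A(3), of p x] \<tau> c2
    by (intro add_mono diff_mono mult_left_mono) (auto simp: coeff_form_cmul)
  also have "\<dots> \<le> (norm p)\<^sup>2 - 2 * \<tau> * (lam * (norm p)\<^sup>2) + (\<tau> * lam) * (norm p)\<^sup>2"
    using mult_right_mono[OF t, of "(norm p)\<^sup>2"] by (simp add: mult.assoc)
  also have "\<dots> = (1 - \<tau> * lam) * (norm p)\<^sup>2" by (simp add: algebra_simps)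
  also have "\<dots> \<le> (1 - \<tau> * lam / 2)\<^sup>2 * (norm p)\<^sup>2"
  proof (rule mult_right_mono)
    have "(1 - \<tau> * lam / 2)\<^sup>2 = 1 - \<tau> * lam + (\<tau> * lam / 2)\<^sup>2"
      by (simp add: power2_diff)
    then show "1 - \<tau> * lam \<le> (1 - \<tau> * lam / 2)\<^sup>2" by simp
  qed simp
  also have "\<dots> = ((1 - \<tau> * lam / 2) * norm p)\<^sup>2" by (simp add: power_mult_distrib)
  finally show "norm (p - \<tau> *\<^sub>R cmul A x p) \<le> (1 - \<tau> * lam / 2) * norm p"
    by (rule power2_le_imp_le) (use k in simp)
qed

definition bform :: "('n::finite, 'N::finite) coeffs \<Rightarrow> (real^'n) set \<Rightarrow> (real^'n \<Rightarrow> real^'N) \<Rightarrow> (real^'n \<Rightarrow> real^'N) \<Rightarrow> real" where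
  "bform A \<Omega> \<phi> \<psi> = (\<integral>x. coeff_form A x (jacobian \<phi> (at x)) (jacobian \<psi> (at x)) \<partial>lebesgue_on \<Omega>)"

lemma bform_linear:
  assumes A: "measurable_coeffs A" "bounded_coeffs Lam A" "Lam \<ge> 0" and \<Omega>: "open \<Omega>"
    and t: "test_function \<Omega> \<phi>" "test_function \<Omega> \<psi>" "test_function \<Omega> \<eta>"
  shows "bform A \<Omega> (\<lambda>x. \<phi> x + c *\<^sub>R \<psi> x) \<eta> = bform A \<Omega> \<phi> \<eta> + c * bform A \<Omega> \<psi> \<eta>"
    and "bform A \<Omega> \<eta> (\<lambda>x. \<phi> x + c *\<^sub>R \<psi> x) = bform A \<Omega> \<eta> \<phi> + c * bform A \<Omega> \<eta> \<psi>"
proof -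
  have m: "\<Omega> \<in> sets borel" using \<Omega> by auto
  have J: "jacobian (\<lambda>x. \<phi> x + c *\<^sub>R \<psi> x) (at x) = jacobian \<phi> (at x) + c *\<^sub>R jacobian \<psi> (at x)" for x
    by (rule jacobian_add_scaleR[OF test_function_smooth[OF t(1)] test_function_smooth[OF t(2)]])
  have L: "L2 (lebesgue_on \<Omega>) (\<lambda>x. jacobian \<xi> (at x))" if "test_function \<Omega> \<xi>" for \<xi> :: "real^'a \<Rightarrow> real^'b"
    by (rule test_function_L2[OF test_function_jacobian[OF that] m])
  have int: "integrable (lebesgue_on \<Omega>) (\<lambda>x. coeff_form A x (jacobian \<xi> (at x)) (jacobian \<zeta> (at x)))"
    if "test_function \<Omega> \<xi>" "test_function \<Omega> \<zeta>" for \<xi> \<zeta> :: "real^'a \<Rightarrow> real^'b"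
    unfolding coeff_form_cmul by (intro L2_inner_integrable L2_cmul[OF A] L that)
  have lin1: "coeff_form A x (p + c *\<^sub>R q) r = coeff_form A x p r + c * coeff_form A x q r" for x p q r
    by (simp add: coeff_form_def sum.distrib sum_distrib_left algebra_simps)
  have lin2: "coeff_form A x r (p + c *\<^sub>R q) = coeff_form A x r p + c * coeff_form A x r q" for x p q r
    by (simp add: coeff_form_cmul inner_add_right)
  show "bform A \<Omega> (\<lambda>x. \<phi> x + c *\<^sub>R \<psi> x) \<eta> = bform A \<Omega> \<phi> \<eta> + c * bform A \<Omega> \<psi> \<eta>"
    unfolding bform_def J lin1 using int t by simp
  show "bform A \<Omega> \<eta> (\<lambda>x. \<phi> x + c *\<^sub>R \<psi> x) = bform A \<Omega> \<eta> \<phi> + c * bform A \<Omega> \<eta> \<psi>"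
    unfolding bform_def J lin2 using int t by simp
qed

text \<open>One step of Richardson's iteration, carried out inside the space of test functions.\<close>

lemma residual_step:
  fixes A :: "('n::finite, 'N::finite) coeffs" and l :: "(real^'n \<Rightarrow> real^'N) \<Rightarrow> real"
  assumes A: "measurable_coeffs A" "bounded_coeffs Lam A" "Lam \<ge> 0" "strongly_elliptic lam A" "lam > 0"
    and \<Omega>: "open \<Omega>"
    and lin: "\<And>\<phi> \<psi> c. test_function \<Omega> \<phi> \<Longrightarrow> test_function \<Omega> \<psi> \<Longrightarrow> l (\<lambda>x. \<phi> x + c *\<^sub>R \<psi> x) = l \<phi> + c * l \<psi>"
  shows "\<exists>q. 0 \<le> q \<and> q < 1 \<and> (\<forall>\<phi> M. test_function \<Omega> \<phi> \<and> M > 0 \<and>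
      (\<forall>\<psi>. test_function \<Omega> \<psi> \<longrightarrow> \<bar>l \<psi> - bform A \<Omega> \<phi> \<psi>\<bar> \<le> M * l2norm (lebesgue_on \<Omega>) (\<lambda>x. jacobian \<psi> (at x))) \<longrightarrow>
      (\<exists>\<phi>'. test_function \<Omega> \<phi>' \<and>
      (\<forall>\<psi>. test_function \<Omega> \<psi> \<longrightarrow> \<bar>l \<psi> - bform A \<Omega> \<phi>' \<psi>\<bar> \<le> q * M * l2norm (lebesgue_on \<Omega>) (\<lambda>x. jacobian \<psi> (at x)))))"
proof -
  define \<tau> where "\<tau> = lam / (Lam\<^sup>2 + lam\<^sup>2)"
  define k where "k = 1 - \<tau> * lam / 2"
  note EC = elliptic_contraction[OF A(2-5), folded \<tau>_def, folded k_def]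
  \<comment> \<open>The error of the Riesz step must leave a contraction: e + k (1 + e) \<le> 2 e +
    k = (1 + k)/2 = q.\<close>
  define e where "e = (1 - k) / 4"
  define q where "q = (1 + k) / 2"
  have e: "e > 0" using EC(3) by (simp add: e_def)
  have ke: "e + k * (1 + e) \<le> q"
  proof -
    have "k * e \<le> 1 * e" using EC(3) e by (intro mult_right_mono) auto
    then show ?thesis by (simp add: e_def q_def algebra_simps) (simp add: field_simps)
  qed
  define D where "D \<psi> = l2norm (lebesgue_on \<Omega>) (\<lambda>x. jacobian \<psi> (at x))" for \<psi> :: "real^'n \<Rightarrow> real^'N"
  have m: "\<Omega> \<in> sets borel" using \<Omega> by auto
  have L: "L2 (lebesgue_on \<Omega>) (\<lambda>x. jacobian \<xi> (at x))" if "test_function \<Omega> \<xi>" for \<xi> :: "real^'n \<Rightarrow> real^'N"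
    by (rule test_function_L2[OF test_function_jacobian[OF that] m])
  have step: "\<exists>\<phi>'. test_function \<Omega> \<phi>' \<and> (\<forall>\<psi>. test_function \<Omega> \<psi> \<longrightarrow> \<bar>l \<psi> - bform A \<Omega> \<phi>' \<psi>\<bar> \<le> q * M * D \<psi>)"
    if \<phi>: "test_function \<Omega> \<phi>" and M: "M > 0" and res: "\<And>\<psi>. test_function \<Omega> \<psi> \<Longrightarrow> \<bar>l \<psi> - bform A \<Omega> \<phi> \<psi>\<bar> \<le> M * D \<psi>" for \<phi> M
  proof -
    define \<rho> where "\<rho> \<psi> = l \<psi> - bform A \<Omega> \<phi> \<psi>" for \<psi>
    have "\<exists>\<delta>. test_function \<Omega> \<delta> \<and> (\<forall>\<psi>. test_function \<Omega> \<psi> \<longrightarrow>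
       \<bar>(\<integral>x. jacobian \<delta> (at x) \<bullet> jacobian \<psi> (at x) \<partial>lebesgue_on \<Omega>) - \<rho> \<psi>\<bar> \<le> (e * M) * l2norm (lebesgue_on \<Omega>) (\<lambda>x. jacobian \<psi> (at x)))"
    proof (rule riesz_approximation[OF \<Omega>])
      show "\<rho> (\<lambda>x. \<phi>' x + c *\<^sub>R \<psi> x) = \<rho> \<phi>' + c * \<rho> \<psi>" if "test_function \<Omega> \<phi>'" "test_function \<Omega> \<psi>" for \<phi>' \<psi> c
        unfolding \<rho>_def lin[OF that] bform_linear(2)[OF A(1-3) \<Omega> that \<phi>] by (simp add: algebra_simps)
      show "\<bar>\<rho> \<psi>\<bar> \<le> M * l2norm (lebesgue_on \<Omega>) (\<lambda>x. jacobian \<psi> (at x))" if "test_function \<Omega> \<psi>" for \<psi>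
        using res[OF that] by (simp add: \<rho>_def D_def)
      show "e * M > 0" using e M by simp
    qed
    then obtain \<delta> where \<delta>: "test_function \<Omega> \<delta>"
      and rz: "\<And>\<psi>. test_function \<Omega> \<psi> \<Longrightarrow> \<bar>(\<integral>x. jacobian \<delta> (at x) \<bullet> jacobian \<psi> (at x) \<partial>lebesgue_on \<Omega>) - \<rho> \<psi>\<bar> \<le> (e * M) * D \<psi>"
      unfolding D_def by blast
    have D\<delta>: "D \<delta> \<le> (1 + e) * M"
    proof (cases "D \<delta> = 0")
      case False
      have "(\<integral>x. jacobian \<delta> (at x) \<bullet> jacobian \<delta> (at x) \<partial>lebesgue_on \<Omega>) = (D \<delta>)\<^sup>2"
        by (simp add: D_def l2norm_square power2_norm_eq_inner)
      then have "D \<delta> * D \<delta> \<le> D \<delta> * ((1 + e) * M)"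
        using rz[OF \<delta>] res[OF \<delta>] unfolding \<rho>_def[symmetric] by (simp add: power2_eq_square algebra_simps)
      then show ?thesis using False by (simp add: D_def less_le)
    qed (use e M in simp)
    have J: "test_function \<Omega> (\<lambda>x. \<phi> x + \<tau> *\<^sub>R \<delta> x)" by (intro test_function_add \<phi> test_function_scaleR \<delta>)
    have "\<bar>l \<psi> - bform A \<Omega> (\<lambda>x. \<phi> x + \<tau> *\<^sub>R \<delta> x) \<psi>\<bar> \<le> q * M * D \<psi>" if \<psi>: "test_function \<Omega> \<psi>" for \<psi>
    proof -
      let ?I = "\<integral>x. jacobian \<delta> (at x) \<bullet> jacobian \<psi> (at x) \<partial>lebesgue_on \<Omega>"
      \<comment> \<open>The new residual splits into the Riesz error \<rho> \<psi> - ?I and this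
        term, which the contraction of p - \<tau> A p makes smaller by the factor k.\<close>
      have "?I - \<tau> * bform A \<Omega> \<delta> \<psi> = (\<integral>x. (jacobian \<delta> (at x) - \<tau> *\<^sub>R cmul A x (jacobian \<delta> (at x))) \<bullet> jacobian \<psi> (at x) \<partial>lebesgue_on \<Omega>)"
        unfolding bform_def coeff_form_cmul
        using L2_inner_integrable[OF L[OF \<delta>] L[OF \<psi>]] L2_inner_integrable[OF L2_cmul[OF A(1-3) L[OF \<delta>]] L[OF \<psi>]]
        by (simp add: inner_diff_left)
      also have "\<bar>\<dots>\<bar> \<le> l2norm (lebesgue_on \<Omega>) (\<lambda>x. k *\<^sub>R jacobian \<delta> (at x)) * D \<psi>"
        unfolding D_def
      proof (rule l2_bounded_prod_le[OF L2_scaleR[OF L[OF \<delta>]] L[OF \<psi>]])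
        fix x
        have "\<bar>(jacobian \<delta> (at x) - \<tau> *\<^sub>R cmul A x (jacobian \<delta> (at x))) \<bullet> jacobian \<psi> (at x)\<bar>
          \<le> norm (jacobian \<delta> (at x) - \<tau> *\<^sub>R cmul A x (jacobian \<delta> (at x))) * norm (jacobian \<psi> (at x))"
          by (rule Cauchy_Schwarz_ineq2)
        also have "\<dots> \<le> (k * norm (jacobian \<delta> (at x))) * norm (jacobian \<psi> (at x))"
          by (intro mult_right_mono EC(1)) simp
        also have "k * norm (jacobian \<delta> (at x)) = norm (k *\<^sub>R jacobian \<delta> (at x))" using EC(2) by simp
        finally show "\<bar>(jacobian \<delta> (at x) - \<tau> *\<^sub>R cmul A x (jacobian \<delta> (at x))) \<bullet> jacobian \<psi> (at x)\<bar>
          \<le> norm (k *\<^sub>R jacobian \<delta> (at x)) * norm (jacobian \<psi> (at x))" .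
      qed
      also have "\<dots> = k * D \<delta> * D \<psi>" using EC(2) by (simp add: l2norm_scaleR D_def)
      also have "\<dots> \<le> k * ((1 + e) * M) * D \<psi>" using D\<delta> EC(2) by (intro mult_right_mono mult_left_mono) (auto simp: D_def)
      finally have 1: "\<bar>?I - \<tau> * bform A \<Omega> \<delta> \<psi>\<bar> \<le> k * ((1 + e) * M) * D \<psi>" .
      have "l \<psi> - bform A \<Omega> (\<lambda>x. \<phi> x + \<tau> *\<^sub>R \<delta> x) \<psi> = (\<rho> \<psi> - ?I) + (?I - \<tau> * bform A \<Omega> \<delta> \<psi>)"
        by (simp add: bform_linear(1)[OF A(1-3) \<Omega> \<phi> \<delta> \<psi>] \<rho>_def)
      then have "\<bar>l \<psi> - bform A \<Omega> (\<lambda>x. \<phi> x + \<tau> *\<^sub>R \<delta> x) \<psi>\<bar> \<le> (e * M) * D \<psi> + k * ((1 + e) * M) * D \<psi>"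
        using 1 rz[OF \<psi>] by linarith
      also have "\<dots> = (e + k * (1 + e)) * (M * D \<psi>)" by (simp add: algebra_simps)
      also have "\<dots> \<le> q * (M * D \<psi>)" using M by (intro mult_right_mono ke) (simp add: D_def)
      finally show ?thesis by (simp add: mult.assoc)
    qed
    then show ?thesis using J by blast
  qed
  have "0 \<le> q" "q < 1" using EC(2,3) by (auto simp: q_def)
  then show ?thesis
  proof (intro exI[of _ q] conjI allI impI)
    fix \<phi> M
    assume *: "test_function \<Omega> \<phi> \<and> M > 0 \<and>
      (\<forall>\<psi>. test_function \<Omega> \<psi> \<longrightarrow> \<bar>l \<psi> - bform A \<Omega> \<phi> \<psi>\<bar> \<le> M * l2norm (lebesgue_on \<Omega>) (\<lambda>x. jacobian \<psi> (at x)))"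
    show "\<exists>\<phi>'. test_function \<Omega> \<phi>' \<and>
      (\<forall>\<psi>. test_function \<Omega> \<psi> \<longrightarrow> \<bar>l \<psi> - bform A \<Omega> \<phi>' \<psi>\<bar> \<le> q * M * l2norm (lebesgue_on \<Omega>) (\<lambda>x. jacobian \<psi> (at x)))"
      by (rule step[unfolded D_def]) (use * in auto)
  qed
qed

text \<open>Cauchy gradients alone say nothing about the functions on an unbounded domain. The Hardy
  inequality shows that \<phi> k / sqrt (|x|^2 + 1) is Cauchy in L2; multiplying its limit by the
  weight, which is bounded on bounded sets, gives a limit that is attained locally in L2.\<close>

lemma energy_completeness:
  fixes \<phi> :: "nat \<Rightarrow> real^'n \<Rightarrow> real^'N"
  assumes n: "CARD('n) \<ge> 3" and \<Omega>: "open \<Omega>" and \<phi>: "\<And>k. test_function \<Omega> (\<phi> k)"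
    and cauchy: "\<And>e. e > 0 \<Longrightarrow> \<exists>N. \<forall>j\<ge>N. \<forall>k\<ge>N. l2norm (lebesgue_on \<Omega>) (\<lambda>x. jacobian (\<phi> j) (at x) - jacobian (\<phi> k) (at x)) < e"
  shows "\<exists>u Du. energy_closure \<Omega> u Du \<phi>"
proof -
  have m: "\<Omega> \<in> sets borel" "\<Omega> \<in> sets lebesgue" using \<Omega> by auto
  define w where "w x = (x - 0) \<bullet> (x - 0) + 1\<^sup>2" for x :: "real^'n"
  have w: "w x > 0" for x by (simp add: w_def add_nonneg_pos)
  define g where "g k x = (1 / sqrt (w x)) *\<^sub>R \<phi> k x" for k x
  have LJ: "L2 (lebesgue_on \<Omega>) (\<lambda>x. jacobian (\<phi> k) (at x))" for k
    by (rule test_function_L2[OF test_function_jacobian[OF \<phi>] m(1)])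
  obtain Du where Du: "L2 (lebesgue_on \<Omega>) Du" "(\<lambda>k. l2norm (lebesgue_on \<Omega>) (\<lambda>x. Du x - jacobian (\<phi> k) (at x))) \<longlonglongrightarrow> 0"
    using L2_complete[OF LJ cauchy] by blast
  have Lg: "L2 (lebesgue_on \<Omega>) (g k)" for k
    using hardy_inequality(2)[OF n test_function_mono[OF \<phi> subset_UNIV], of 1 0 k]
    unfolding g_def w_def by (intro L2_lebesgue_on_lborel m) simp
  have gd: "l2norm (lebesgue_on \<Omega>) (\<lambda>x. g j x - g k x) \<le> 2 * l2norm (lebesgue_on \<Omega>) (\<lambda>x. jacobian (\<phi> j) (at x) - jacobian (\<phi> k) (at x))" for j k
  proof -
    define \<psi> where "\<psi> x = \<phi> j x - \<phi> k x" for x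
    have \<psi>: "test_function \<Omega> \<psi>" unfolding \<psi>_def by (intro test_function_diff \<phi>)
    have \<psi>U: "test_function UNIV \<psi>" by (rule test_function_mono[OF \<psi> subset_UNIV])
    have J: "jacobian \<psi> (at x) = jacobian (\<phi> j) (at x) - jacobian (\<phi> k) (at x)" for x
      unfolding \<psi>_def by (rule jacobian_diff[OF test_function_smooth[OF \<phi>] test_function_smooth[OF \<phi>]])
    have LU: "L2 lborel (\<lambda>x. (1 / sqrt (w x)) *\<^sub>R \<psi> x)"
      using hardy_inequality(2)[OF n \<psi>U, of 1 0] by (simp add: w_def)
    have "l2norm (lebesgue_on \<Omega>) (\<lambda>x. g j x - g k x) = l2norm (lebesgue_on \<Omega>) (\<lambda>x. (1 / sqrt (w x)) *\<^sub>R \<psi> x)"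
      by (simp add: g_def \<psi>_def scaleR_diff_right)
    also have "\<dots> \<le> l2norm lborel (\<lambda>x. (1 / sqrt (w x)) *\<^sub>R \<psi> x)" by (rule l2norm_lebesgue_on_lborel(1)[OF LU m(1)])
    also have "\<dots> \<le> 2 * l2norm lborel (\<lambda>x. jacobian \<psi> (at x))"
      using hardy_inequality(1)[OF n \<psi>U, of 1 0] by (simp add: w_def)
    also have "l2norm lborel (\<lambda>x. jacobian \<psi> (at x)) = l2norm (lebesgue_on \<Omega>) (\<lambda>x. jacobian \<psi> (at x))"
      by (rule l2norm_lebesgue_on_lborel(2)[symmetric, OF test_function_L2_lborel[OF test_function_jacobian[OF \<psi>]] m(1)])
         (rule test_function_off_U[OF test_function_jacobian[OF \<psi>]])
    finally show ?thesis unfolding J .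
  qed
  have "\<exists>N. \<forall>j\<ge>N. \<forall>k\<ge>N. l2norm (lebesgue_on \<Omega>) (\<lambda>x. g j x - g k x) < e" if "e > 0" for e
  proof -
    obtain N where N: "\<And>j k. j \<ge> N \<Longrightarrow> k \<ge> N \<Longrightarrow> l2norm (lebesgue_on \<Omega>) (\<lambda>x. jacobian (\<phi> j) (at x) - jacobian (\<phi> k) (at x)) < e / 2"
      using cauchy[of "e/2"] \<open>e > 0\<close> by (auto simp: half_gt_zero_iff)
    have "l2norm (lebesgue_on \<Omega>) (\<lambda>x. g j x - g k x) < e" if "j \<ge> N" "k \<ge> N" for j k
      using N[OF that] gd[of j k] by simp
    then show ?thesis by blast
  qed
  from L2_complete[OF Lg this] obtain v where v: "L2 (lebesgue_on \<Omega>) v" "(\<lambda>k. l2norm (lebesgue_on \<Omega>) (\<lambda>x. v x - g k x)) \<longlonglongrightarrow> 0"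
    by blast
  define u where "u x = sqrt (w x) *\<^sub>R v x" for x
  have loc: "L2 (lebesgue_on (\<Omega> \<inter> ball 0 R)) u \<and> (\<lambda>k. l2norm (lebesgue_on (\<Omega> \<inter> ball 0 R)) (\<lambda>x. u x - \<phi> k x)) \<longlonglongrightarrow> 0" for R
  proof -
    define V where "V = \<Omega> \<inter> ball 0 R"
    have V: "V \<in> sets lebesgue" "V \<subseteq> \<Omega>" using \<Omega> by (auto simp: V_def)
    define c where "c = sqrt (R\<^sup>2 + 1)"
    have wc: "sqrt (w x) \<le> c" if "x \<in> V" for x
    proof -
      have "(norm x)\<^sup>2 \<le> R\<^sup>2" using that by (intro power_mono) (auto simp: V_def)
      then show ?thesis by (simp add: c_def w_def dot_square_norm)
    qed
    have c0: "c \<ge> 0" by (simp add: c_def)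
    have vV: "L2 (lebesgue_on V) v" by (rule L2_subset[OF v(1) V(1) m(2) V(2)])
    have dV: "L2 (lebesgue_on V) (\<lambda>x. v x - g k x)" for k by (rule L2_subset[OF L2_diff[OF v(1) Lg] V(1) m(2) V(2)])
    have "continuous_on UNIV (\<lambda>x. sqrt (w x))" unfolding w_def by (intro continuous_intros)
    then have sm: "(\<lambda>x. sqrt (w x)) \<in> borel_measurable (lebesgue_on V)" by (rule borel_measurable_lebesgue_on_continuous)
    have Lu: "L2 (lebesgue_on V) u"
    proof (rule L2_bound[OF vV])
      show "u \<in> borel_measurable (lebesgue_on V)" unfolding u_def by (rule borel_measurable_scaleR[OF sm L2_measurable[OF vV]])
      show "norm (u x) \<le> c * norm (v x)" if "x \<in> space (lebesgue_on V)" for x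
        using wc[of x] that w[of x] by (simp add: u_def mult_right_mono)
    qed
    have bd: "l2norm (lebesgue_on V) (\<lambda>x. u x - \<phi> k x) \<le> c * l2norm (lebesgue_on \<Omega>) (\<lambda>x. v x - g k x)" for k
    proof -
      have eq: "u x - \<phi> k x = sqrt (w x) *\<^sub>R (v x - g k x)" for x
        using w[of x] by (simp add: u_def g_def scaleR_diff_right)
      have "l2norm (lebesgue_on V) (\<lambda>x. u x - \<phi> k x) \<le> c * l2norm (lebesgue_on V) (\<lambda>x. v x - g k x)"
      proof (rule l2norm_mono[OF dV c0])
        show "norm (u x - \<phi> k x) \<le> c * norm (v x - g k x)" if "x \<in> space (lebesgue_on V)" for x
          unfolding eq using wc[of x] that w[of x] by (simp add: mult_right_mono)
      qed
      also have "\<dots> \<le> c * l2norm (lebesgue_on \<Omega>) (\<lambda>x. v x - g k x)"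
        by (intro mult_left_mono l2norm_subset[OF L2_diff[OF v(1) Lg] V(1) m(2) V(2)] c0)
      finally show ?thesis .
    qed
    have lim: "(\<lambda>k. c * l2norm (lebesgue_on \<Omega>) (\<lambda>x. v x - g k x)) \<longlonglongrightarrow> 0"
      using tendsto_mult_left[OF v(2), of c] by simp
    have "(\<lambda>k. l2norm (lebesgue_on V) (\<lambda>x. u x - \<phi> k x)) \<longlonglongrightarrow> 0"
    proof (rule Lim_null_comparison[OF _ lim], rule always_eventually, rule allI)
      show "norm (l2norm (lebesgue_on V) (\<lambda>x. u x - \<phi> k x)) \<le> c * l2norm (lebesgue_on \<Omega>) (\<lambda>x. v x - g k x)" for k
        using bd[of k] by simp
    qed
    then show ?thesis using Lu by (simp add: V_def)
  qed
  have "energy_closure \<Omega> u Du \<phi>"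
    unfolding energy_closure_def using Du \<phi> loc by blast
  then show ?thesis by blast
qed

text \<open>Lax-Milgram by iteration: \<open>residual_step\<close> shrinks the residual functional
  geometrically, ellipticity turns differences of residuals into a Cauchy estimate for the
  gradients, and completeness supplies the limit. The initial residual, that of the zero function,
  is the source itself, which is bounded in the energy norm by the Hardy inequality.\<close>

lemma weak_solution_exists:
  fixes A :: "('n::finite, 'N::finite) coeffs" and f :: "real^'n \<Rightarrow> real^'N"
  assumes n: "CARD('n) \<ge> 3"
    and A: "measurable_coeffs A" "bounded_coeffs Lam A" "Lam \<ge> 0" "strongly_elliptic lam A" "lam > 0"
    and \<Omega>: "open \<Omega>" and f: "test_function \<Omega> f"
  shows "\<exists>u Du \<phi>. energy_closure \<Omega> u Du \<phi> \<and> weak_equation A \<Omega> Du f"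
proof -
  have m: "\<Omega> \<in> sets borel" "\<Omega> \<in> sets lebesgue" using \<Omega> by auto
  define D where "D \<psi> = l2norm (lebesgue_on \<Omega>) (\<lambda>x. jacobian \<psi> (at x))" for \<psi> :: "real^'n \<Rightarrow> real^'N"
  define l where "l \<psi> = (\<integral>x. f x \<bullet> \<psi> x \<partial>lebesgue_on \<Omega>)" for \<psi>
  have Lf: "L2 (lebesgue_on \<Omega>) f" by (rule test_function_L2[OF f m(1)])
  have L: "L2 (lebesgue_on \<Omega>) (\<lambda>x. jacobian \<xi> (at x))" if "test_function \<Omega> \<xi>" for \<xi> :: "real^'n \<Rightarrow> real^'N"
    by (rule test_function_L2[OF test_function_jacobian[OF that] m(1)])
  have lin: "l (\<lambda>x. \<phi> x + c *\<^sub>R \<psi> x) = l \<phi> + c * l \<psi>" if "test_function \<Omega> \<phi>" "test_function \<Omega> \<psi>" for \<phi> \<psi> c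
    unfolding l_def using that L2_inner_integrable[OF Lf test_function_L2[OF _ m(1)]] by (simp add: inner_add_right)
  obtain r where r: "r > 0" "closure {x. f x \<noteq> 0} \<subseteq> ball 0 r"
    using f compact_imp_bounded bounded_subset_ballD unfolding test_function_def by metis
  have f0: "f x = 0" if "x \<notin> ball 0 r" for x using that r(2) closure_subset[of "{x. f x \<noteq> 0}"] by blast
  \<comment> \<open>The summand 1 makes M strictly positive, as \<open>residual_step\<close>
    requires.\<close>
  define M where "M = 3 * r * l2norm (lebesgue_on \<Omega>) f + 1"
  have M: "M > 0" using r by (simp add: M_def add_nonneg_pos)
  have lb: "\<bar>l \<psi>\<bar> \<le> M * D \<psi>" if \<psi>: "test_function \<Omega> \<psi>" for \<psi>
  proof -
    have "\<bar>l \<psi>\<bar> \<le> 3 * r * l2norm (lebesgue_on \<Omega>) f * D \<psi>"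
      unfolding l_def D_def by (rule test_function_hardy_ball[OF n \<psi> \<Omega> Lf f0 r(1)])
    also have "\<dots> \<le> M * D \<psi>" by (intro mult_right_mono) (simp_all add: M_def D_def)
    finally show ?thesis .
  qed
  obtain q where q: "0 \<le> q" "q < 1" and step: "\<And>\<phi> M. test_function \<Omega> \<phi> \<Longrightarrow> M > 0 \<Longrightarrow>
      (\<And>\<psi>. test_function \<Omega> \<psi> \<Longrightarrow> \<bar>l \<psi> - bform A \<Omega> \<phi> \<psi>\<bar> \<le> M * D \<psi>) \<Longrightarrow>
      \<exists>\<phi>'. test_function \<Omega> \<phi>' \<and> (\<forall>\<psi>. test_function \<Omega> \<psi> \<longrightarrow> \<bar>l \<psi> - bform A \<Omega> \<phi>' \<psi>\<bar> \<le> q * M * D \<psi>)"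
    using residual_step[OF A \<Omega>, of l, OF lin] unfolding D_def by metis
  \<comment> \<open>q may be 0; replacing it by p > 0 keeps every bound p^k M positive.\<close>
  define p where "p = (1 + q) / 2"
  have p: "0 < p" "p < 1" "q \<le> p" using q by (auto simp: p_def)
  define P where "P k \<phi> \<longleftrightarrow> test_function \<Omega> \<phi> \<and> (\<forall>\<psi>. test_function \<Omega> \<psi> \<longrightarrow> \<bar>l \<psi> - bform A \<Omega> \<phi> \<psi>\<bar> \<le> p ^ k * M * D \<psi>)" for k \<phi>
  have "\<exists>\<phi>. \<forall>k. P k (\<phi> k) \<and> True"
  proof (rule dependent_nat_choice)
    have "bform A \<Omega> (\<lambda>_. 0) \<psi> = 0" for \<psi>
    proof -
      have "jacobian (\<lambda>_. 0 :: real^'N) (at x) = (0 :: real^'n^'N)" for x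
        by (simp add: vec_eq_iff jacobian_nth)
      then show ?thesis by (simp add: bform_def coeff_form_def)
    qed
    then show "\<exists>\<phi>. P 0 \<phi>" using lb by (intro exI[of _ "\<lambda>_. 0"]) (simp add: P_def)
    fix \<phi> k assume "P k \<phi>"
    then have "\<exists>\<phi>'. test_function \<Omega> \<phi>' \<and> (\<forall>\<psi>. test_function \<Omega> \<psi> \<longrightarrow> \<bar>l \<psi> - bform A \<Omega> \<phi>' \<psi>\<bar> \<le> q * (p ^ k * M) * D \<psi>)"
      using p M by (intro step) (auto simp: P_def)
    then obtain \<phi>' where \<phi>': "test_function \<Omega> \<phi>'"
      and le: "\<And>\<psi>. test_function \<Omega> \<psi> \<Longrightarrow> \<bar>l \<psi> - bform A \<Omega> \<phi>' \<psi>\<bar> \<le> q * (p ^ k * M) * D \<psi>" by blast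
    have "q * (p ^ k * M) * D \<psi> \<le> p ^ Suc k * M * D \<psi>" for \<psi>
    proof -
      have "q * (p ^ k * M * D \<psi>) \<le> p * (p ^ k * M * D \<psi>)" using p M by (intro mult_right_mono) (auto simp: D_def)
      then show ?thesis by (simp add: mult.assoc)
    qed
    then have "P (Suc k) \<phi>'" unfolding P_def using \<phi>' le order_trans by blast
    then show "\<exists>\<phi>'. P (Suc k) \<phi>' \<and> True" by blast
  qed
  then obtain \<phi> where \<phi>P: "\<And>k. P k (\<phi> k)" by blast
  have \<phi>: "test_function \<Omega> (\<phi> k)" for k using \<phi>P by (simp add: P_def)
  have res: "\<bar>l \<psi> - bform A \<Omega> (\<phi> k) \<psi>\<bar> \<le> p ^ k * M * D \<psi>" if "test_function \<Omega> \<psi>" for k \<psi>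
    using \<phi>P that by (simp add: P_def)
  \<comment> \<open>Ellipticity applied to the difference \<psi> of two iterates: the form at
    (\<psi>, \<psi>) is the difference of their residuals at \<psi>, and one factor of the norm
    cancels.\<close>
  have diff: "lam * l2norm (lebesgue_on \<Omega>) (\<lambda>x. jacobian (\<phi> j) (at x) - jacobian (\<phi> k) (at x)) \<le> (p ^ j + p ^ k) * M" for j k
  proof -
    define \<psi> where "\<psi> x = \<phi> j x + (-1) *\<^sub>R \<phi> k x" for x
    have \<psi>: "test_function \<Omega> \<psi>" unfolding \<psi>_def by (intro test_function_add test_function_scaleR \<phi>)
    have J: "jacobian (\<phi> j) (at x) - jacobian (\<phi> k) (at x) = jacobian \<psi> (at x)" for x
      unfolding \<psi>_def jacobian_add_scaleR[OF test_function_smooth[OF \<phi>] test_function_smooth[OF \<phi>]] by simp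
    have "lam * (D \<psi>)\<^sup>2 \<le> bform A \<Omega> \<psi> \<psi>"
      unfolding D_def bform_def by (rule energy_lower_bound[OF A(1-4) L[OF \<psi>]])
    also have "\<dots> = (l \<psi> - bform A \<Omega> (\<phi> k) \<psi>) - (l \<psi> - bform A \<Omega> (\<phi> j) \<psi>)"
      using bform_linear(1)[OF A(1-3) \<Omega> \<phi>[of j] \<phi>[of k] \<psi>, of "-1", folded \<psi>_def] by simp
    also have "\<dots> \<le> p ^ k * M * D \<psi> + p ^ j * M * D \<psi>"
      using res[OF \<psi>, of k] res[OF \<psi>, of j] by linarith
    finally have "D \<psi> * (lam * D \<psi>) \<le> D \<psi> * ((p ^ j + p ^ k) * M)" by (simp add: power2_eq_square algebra_simps)
    moreover have "D \<psi> \<ge> 0" by (simp add: D_def)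
    ultimately have "lam * D \<psi> \<le> (p ^ j + p ^ k) * M"
      using p M by (cases "D \<psi> = 0") (auto simp: less_le intro: mult_left_le_imp_le)
    then show ?thesis by (simp add: J D_def)
  qed
  have pk: "(\<lambda>k. p ^ k) \<longlonglongrightarrow> 0" using p by (intro LIMSEQ_power_zero) auto
  have "\<exists>u Du. energy_closure \<Omega> u Du \<phi>"
  proof (rule energy_completeness[OF n \<Omega> \<phi>])
    fix e :: real assume e: "e > 0"
    then have "e * lam / (2 * M) > 0" using A(5) M by simp
    from order_tendstoD(2)[OF pk this] obtain N where N: "\<And>k. k \<ge> N \<Longrightarrow> p ^ k < e * lam / (2 * M)"
      by (auto simp: eventually_sequentially)
    have "l2norm (lebesgue_on \<Omega>) (\<lambda>x. jacobian (\<phi> j) (at x) - jacobian (\<phi> k) (at x)) < e" if "j \<ge> N" "k \<ge> N" for j k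
    proof -
      have "p ^ j + p ^ k < e * lam / (2 * M) + e * lam / (2 * M)" using N that by (intro add_strict_mono) auto
      also have "\<dots> = e * lam / M" using M by (simp add: field_simps)
      finally have "(p ^ j + p ^ k) * M < e * lam" using M by (simp add: less_divide_eq)
      then have "lam * l2norm (lebesgue_on \<Omega>) (\<lambda>x. jacobian (\<phi> j) (at x) - jacobian (\<phi> k) (at x)) < lam * e"
        using diff[of j k] by (simp add: mult.commute)
      then show ?thesis using A(5) by simp
    qed
    then show "\<exists>N. \<forall>j\<ge>N. \<forall>k\<ge>N. l2norm (lebesgue_on \<Omega>) (\<lambda>x. jacobian (\<phi> j) (at x) - jacobian (\<phi> k) (at x)) < e" by blast
  qed
  then obtain u Du where E: "energy_closure \<Omega> u Du \<phi>" by blast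
  have "weak_equation A \<Omega> Du f"
    unfolding weak_equation_def
  proof (intro allI impI)
    fix \<psi> :: "real^'n \<Rightarrow> real^'N" assume \<psi>: "test_function \<Omega> \<psi>"
    \<comment> \<open>The limit is taken in the first slot of the form, so the coefficients are
      moved to the fixed test function by transposition.\<close>
    have sw: "coeff_form A x a (jacobian \<psi> (at x)) = a \<bullet> cmul (transpose_coeffs A) x (jacobian \<psi> (at x))" for x a
      using coeff_form_transpose[of A x "jacobian \<psi> (at x)" a] by (simp add: coeff_form_cmul inner_commute)
    have "(\<lambda>k. bform A \<Omega> (\<phi> k) \<psi>) \<longlonglongrightarrow> (\<integral>x. coeff_form A x (Du x) (jacobian \<psi> (at x)) \<partial>lebesgue_on \<Omega>)"
      unfolding bform_def sw
      by (rule l2_inner_tendsto[OF L[OF \<phi>] energy_closureD(1)[OF E] _ energy_closureD(3)[OF E]])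
         (rule L2_cmul[OF measurable_coeffs_transpose[OF A(1)] bounded_coeffs_transpose[OF A(2)] A(3) L[OF \<psi>]])
    moreover have "(\<lambda>k. bform A \<Omega> (\<phi> k) \<psi>) \<longlonglongrightarrow> l \<psi>"
    proof (rule LIM_zero_cancel, rule Lim_null_comparison)
      show "\<forall>\<^sub>F k in sequentially. norm (bform A \<Omega> (\<phi> k) \<psi> - l \<psi>) \<le> p ^ k * (M * D \<psi>)"
        using res[OF \<psi>] by (intro always_eventually) (simp add: abs_minus_commute mult.assoc)
      show "(\<lambda>k. p ^ k * (M * D \<psi>)) \<longlonglongrightarrow> 0" using tendsto_mult_right[OF pk, of "M * D \<psi>"] by simp
    qed
    ultimately have "(\<integral>x. coeff_form A x (Du x) (jacobian \<psi> (at x)) \<partial>lebesgue_on \<Omega>) = l \<psi>" by (rule LIMSEQ_unique)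
    then show "(LINT x:\<Omega>|lebesgue. coeff_form A x (Du x) (jacobian \<psi> (at x))) = (LINT x:\<Omega>|lebesgue. f x \<bullet> \<psi> x)"
      using m by (simp add: set_integral_lebesgue_on l_def)
  qed
  then show ?thesis using E by blast
qed

subsection \<open>The Green's matrix of the transpose\<close>

lemma integral_lebesgue_on_indicator:
  fixes f :: "'a::euclidean_space \<Rightarrow> real"
  assumes "K \<in> sets borel" "(\<lambda>x. indicator K x *\<^sub>R f x) \<in> borel_measurable borel"
  shows "(\<integral>x. f x \<partial>lebesgue_on K) = (\<integral>x. indicator K x *\<^sub>R f x \<partial>lborel)"
proof -
  have "(\<integral>x. f x \<partial>lebesgue_on K) = (\<integral>x. indicator K x *\<^sub>R f x \<partial>lebesgue)"
    using assms(1) by (simp add: integral_restrict_space)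
  also have "\<dots> = (\<integral>x. indicator K x *\<^sub>R f x \<partial>lborel)"
    using assms(2) by (intro integral_completion) simp
  finally show ?thesis .
qed

text \<open>Fubini's theorem is applied on \<open>lborel\<close>; the continuity of the inner
  integrals provides the Borel measurability needed for passing between it and
  \<open>lebesgue_on\<close>.\<close>

lemma Fubini_compact:
  fixes k :: "'a::euclidean_space \<Rightarrow> 'b::euclidean_space \<Rightarrow> real"
  assumes K: "compact K" and L: "compact L" and c: "continuous_on (K \<times> L) (\<lambda>z. k (fst z) (snd z))"
  shows "(\<integral>x. \<integral>y. k x y \<partial>lebesgue_on L \<partial>lebesgue_on K) = (\<integral>y. \<integral>x. k x y \<partial>lebesgue_on K \<partial>lebesgue_on L)"
proof -
  have m: "K \<in> sets borel" "L \<in> sets borel" using K L borel_compact by auto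
  have cx: "continuous_on L (k x)" if "x \<in> K" for x
  proof -
    have "continuous_on L (\<lambda>y. (\<lambda>z. k (fst z) (snd z)) (x, y))"
      by (rule continuous_on_compose2[OF c]) (use that in \<open>auto intro!: continuous_intros\<close>)
    then show ?thesis by simp
  qed
  have cy: "continuous_on K (\<lambda>x. k x y)" if "y \<in> L" for y
  proof -
    have "continuous_on K (\<lambda>x. (\<lambda>z. k (fst z) (snd z)) (x, y))"
      by (rule continuous_on_compose2[OF c]) (use that in \<open>auto intro!: continuous_intros\<close>)
    then show ?thesis by simp
  qed
  have c': "continuous_on (L \<times> K) (\<lambda>z. k (snd z) (fst z))"
  proof -
    have "continuous_on (L \<times> K) (\<lambda>z. (\<lambda>z. k (fst z) (snd z)) (snd z, fst z))"
      by (rule continuous_on_compose2[OF c]) (auto intro!: continuous_intros)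
    then show ?thesis by simp
  qed
  have c1: "continuous_on K (\<lambda>x. \<integral>y. k x y \<partial>lebesgue_on L)"
    by (rule continuous_on_parametric_integral[OF L]) (use c in \<open>simp add: case_prod_beta'\<close>)
  have c2: "continuous_on L (\<lambda>y. \<integral>x. k x y \<partial>lebesgue_on K)"
    by (rule continuous_on_parametric_integral[OF K]) (use c' in \<open>simp add: case_prod_beta'\<close>)
  define h where "h x y = indicator K x * (indicator L y * k x y)" for x y
  have "integrable lborel (\<lambda>z. indicator (K \<times> L) z *\<^sub>R k (fst z) (snd z))"
    by (rule borel_integrable_compact[OF compact_Times[OF K L] c])
  also have "(\<lambda>z. indicator (K \<times> L) z *\<^sub>R k (fst z) (snd z)) = case_prod h"
    by (auto simp: h_def indicator_def fun_eq_iff)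
  finally have int: "integrable (lborel \<Otimes>\<^sub>M lborel) (case_prod h)" by (simp add: lborel_prod)
  have "pair_sigma_finite (lborel :: 'a measure) (lborel :: 'b measure)" ..
  from pair_sigma_finite.Fubini_integral[OF this int]
  have F: "(\<integral>y. \<integral>x. h x y \<partial>lborel \<partial>lborel) = (\<integral>x. \<integral>y. h x y \<partial>lborel \<partial>lborel)" .
  have "(\<integral>x. \<integral>y. k x y \<partial>lebesgue_on L \<partial>lebesgue_on K) = (\<integral>x. indicator K x *\<^sub>R (\<integral>y. k x y \<partial>lebesgue_on L) \<partial>lborel)"
    by (rule integral_lebesgue_on_indicator[OF m(1) borel_measurable_continuous_on_indicator[OF m(1) c1]])
  also have "\<dots> = (\<integral>x. \<integral>y. h x y \<partial>lborel \<partial>lborel)"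
  proof (rule Bochner_Integration.integral_cong[OF refl])
    fix x :: 'a
    show "indicator K x *\<^sub>R (\<integral>y. k x y \<partial>lebesgue_on L) = (\<integral>y. h x y \<partial>lborel)"
    proof (cases "x \<in> K")
      case True
      show ?thesis
        using integral_lebesgue_on_indicator[OF m(2) borel_measurable_continuous_on_indicator[OF m(2) cx[OF True]]] True
        by (simp add: h_def)
    qed (simp add: h_def)
  qed
  also have "\<dots> = (\<integral>y. \<integral>x. h x y \<partial>lborel \<partial>lborel)" by (rule F[symmetric])
  also have "\<dots> = (\<integral>y. indicator L y *\<^sub>R (\<integral>x. k x y \<partial>lebesgue_on K) \<partial>lborel)"
  proof (rule Bochner_Integration.integral_cong[OF refl])
    fix y :: 'b
    show "(\<integral>x. h x y \<partial>lborel) = indicator L y *\<^sub>R (\<integral>x. k x y \<partial>lebesgue_on K)"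
    proof (cases "y \<in> L")
      case True
      show ?thesis
        using integral_lebesgue_on_indicator[OF m(1) borel_measurable_continuous_on_indicator[OF m(1) cy[OF True]]] True
        by (simp add: h_def)
    qed (simp add: h_def)
  qed
  also have "\<dots> = (\<integral>y. \<integral>x. k x y \<partial>lebesgue_on K \<partial>lebesgue_on L)"
    by (rule integral_lebesgue_on_indicator[symmetric, OF m(2) borel_measurable_continuous_on_indicator[OF m(2) c2]])
  finally show ?thesis .
qed

lemma smooth_vec:
  fixes f :: "'a::real_normed_vector \<Rightarrow> real^'N"
  assumes "\<And>i. smooth (\<lambda>x. f x $ i)"
  shows "smooth f"
proof -
  have "smooth (\<lambda>x. \<Sum>i\<in>UNIV. f x $ i *\<^sub>R axis i (1::real))"
    by (intro smooth_sum smooth_scaleR assms smooth_const)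
  moreover have "(\<Sum>i\<in>UNIV. f x $ i *\<^sub>R axis i (1::real)) = f x" for x
    using basis_expansion[of "f x"] by (simp add: scalar_mult_eq_scaleR)
  ultimately show ?thesis by simp
qed

lemma smooth_polynomial_function:
  fixes p :: "'a::real_normed_vector \<Rightarrow> real^'N"
  assumes "polynomial_function p"
  shows "smooth p"
proof (rule smooth_vec)
  fix i
  have "real_polynomial_function ((\<lambda>v. v $ i) \<circ> p)"
    using assms bounded_linear_vec_nth unfolding polynomial_function_def by blast
  then show "smooth (\<lambda>x. p x $ i)"
    using smooth_real_polynomial_function by (simp add: comp_def)
qed

text \<open>The test functions used here are cut-offs of the differences between the approximants of \<open>w\<close>
  and polynomials approximating \<open>v\<close>.\<close>

lemma weak_identity_AE:
  fixes w v :: "real^'n \<Rightarrow> real^'N"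
  assumes E: "energy_closure \<Omega> w Dw \<phi>" and \<Omega>: "open \<Omega>" and U: "open U" "U \<subseteq> \<Omega>" and v: "continuous_on U v"
    and eq: "\<And>f. test_function U f \<Longrightarrow> (\<integral>x. f x \<bullet> w x \<partial>lebesgue_on \<Omega>) = (\<integral>x. f x \<bullet> v x \<partial>lebesgue_on \<Omega>)"
  shows "AE x in lebesgue. x \<in> U \<longrightarrow> w x = v x"
proof -
  have \<Omega>m: "\<Omega> \<in> sets lebesgue" using \<Omega> by auto
  have loc: "AE x in lebesgue. x \<in> ball p r \<longrightarrow> w x = v x" if r: "r > 0" "cball p r \<subseteq> U" for p r
  proof -
    define B where "B = ball p r"
    have B: "B \<in> sets lebesgue" "bounded B" "B \<subseteq> \<Omega>" "B \<subseteq> U" "B \<in> sets borel"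
      using subset_trans[OF ball_subset_cball r(2)] subset_trans[OF subset_trans[OF ball_subset_cball r(2)] U(2)]
      by (simp_all add: B_def)
    note EB = energy_closure_bounded[OF E \<Omega> B(1-3)]
    note \<phi> = energy_closureD(2)[OF E]
    have vm: "v \<in> borel_measurable (lebesgue_on B)"
      by (rule continuous_imp_measurable_on_sets_lebesgue[OF continuous_on_subset[OF v B(4)] B(1)])
    have "bounded (v ` cball p r)"
      by (rule compact_imp_bounded[OF compact_continuous_image[OF continuous_on_subset[OF v r(2)] compact_cball]])
    then obtain M where M: "\<And>x. x \<in> cball p r \<Longrightarrow> norm (v x) \<le> M" unfolding bounded_iff by fast
    have Lv: "L2 (lebesgue_on B) v"
    proof (rule L2_bound[OF L2_const[OF B(1,2), of "1::real"] vm])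
      show "norm (v x) \<le> M * norm (1::real)" if "x \<in> space (lebesgue_on B)" for x
        using that M[of x] by (simp add: B_def)
    qed
    define h where "h x = w x - v x" for x
    have Lh: "L2 (lebesgue_on B) h" unfolding h_def by (rule L2_diff[OF EB(1) Lv])
    define \<eta> where "\<eta> = bump p r"
    have t\<eta>: "test_function U \<eta>" unfolding \<eta>_def by (rule test_function_bump[OF r])
    have \<eta>m: "\<eta> \<in> borel_measurable (lebesgue_on B)"
      unfolding \<eta>_def by (intro borel_measurable_lebesgue_on_continuous smooth_continuous_on smooth_bump)
    have L\<eta>: "L2 (lebesgue_on B) (\<lambda>x. \<eta> x *\<^sub>R k x)" if k: "L2 (lebesgue_on B) k" for k :: "real^'n \<Rightarrow> real^'N"
    proof (rule L2_bound[OF k borel_measurable_scaleR[OF \<eta>m L2_measurable[OF k]]])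
      show "norm (\<eta> x *\<^sub>R k x) \<le> 1 * norm (k x)" for x
        using bump_nonneg[of p r x] bump_le_1[of p r x] by (simp add: \<eta>_def mult_left_le_one_le)
    qed
    have "\<exists>P. polynomial_function P \<and> (\<forall>x\<in>cball p r. norm (v x - P x) < 1 / real (Suc k))" for k
      by (rule Stone_Weierstrass_polynomial_function[OF compact_cball continuous_on_subset[OF v r(2)]]) simp
    then obtain P where P: "\<And>k. polynomial_function (P k)" "\<And>k x. x \<in> cball p r \<Longrightarrow> norm (v x - P k x) < 1 / real (Suc k)"
      by metis
    have sP: "smooth (P k)" for k by (rule smooth_polynomial_function[OF P(1)])
    have LP: "L2 (lebesgue_on B) (P k)" for k
      by (rule L2_continuous_bounded[OF smooth_continuous_on[OF sP] B(5,2)])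
    have L\<phi>: "L2 (lebesgue_on B) (\<phi> k)" for k by (rule test_function_L2[OF \<phi> B(5)])
    define q where "q k x = \<phi> k x - P k x" for k x
    have Lq: "L2 (lebesgue_on B) (q k)" for k unfolding q_def by (rule L2_diff[OF L\<phi> LP])
    define c where "c = l2norm (lebesgue_on B) (\<lambda>_. 1::real)"
    have qh: "(\<lambda>k. l2norm (lebesgue_on B) (\<lambda>x. h x - q k x)) \<longlonglongrightarrow> 0"
    proof (rule Lim_null_comparison, rule always_eventually, rule allI)
      fix k
      have "l2norm (lebesgue_on B) (\<lambda>x. h x - q k x) = l2norm (lebesgue_on B) (\<lambda>x. (w x - \<phi> k x) + (P k x - v x))"
        by (simp add: h_def q_def algebra_simps)
      also have "\<dots> \<le> l2norm (lebesgue_on B) (\<lambda>x. w x - \<phi> k x) + l2norm (lebesgue_on B) (\<lambda>x. P k x - v x)"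
        by (intro l2norm_triangle L2_diff EB(1) L\<phi> LP Lv)
      also have "l2norm (lebesgue_on B) (\<lambda>x. P k x - v x) \<le> 1 / real (Suc k) * c"
        unfolding c_def
      proof (rule l2norm_mono[OF L2_const[OF B(1,2)]])
        show "norm (P k x - v x) \<le> 1 / real (Suc k) * norm (1::real)" if "x \<in> space (lebesgue_on B)" for x
          using P(2)[of x k] that by (simp add: norm_minus_commute less_imp_le B_def)
      qed simp
      finally show "norm (l2norm (lebesgue_on B) (\<lambda>x. h x - q k x)) \<le> l2norm (lebesgue_on B) (\<lambda>x. w x - \<phi> k x) + 1 / real (Suc k) * c"
        by simp
    next
      have "(\<lambda>k. 1 / real (Suc k) * c) \<longlonglongrightarrow> 0"
        using tendsto_mult_right[OF lim_1_over_n[THEN LIMSEQ_Suc], of c] by simp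
      then show "(\<lambda>k. l2norm (lebesgue_on B) (\<lambda>x. w x - \<phi> k x) + 1 / real (Suc k) * c) \<longlonglongrightarrow> 0"
        using tendsto_add[OF EB(2)] by fastforce
    qed
    have zero: "(\<integral>x. q k x \<bullet> (\<eta> x *\<^sub>R h x) \<partial>lebesgue_on B) = 0" for k
    proof -
      define f where "f x = \<eta> x *\<^sub>R q k x" for x
      have sq: "smooth (q k)" unfolding q_def by (intro smooth_diff sP test_function_smooth[OF \<phi>])
      have f: "test_function U f"
        unfolding f_def by (rule test_function_bilinear1[OF bounded_bilinear_scaleR t\<eta> sq])
      have f0: "f x = 0" if "x \<notin> B" for x
        using bump_outside[OF r(1), of x p] that by (simp add: f_def \<eta>_def B_def)
      have Lf: "L2 (lebesgue_on B) f" by (rule test_function_L2[OF f B(5)])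
      have "(\<integral>x. f x \<bullet> k' x \<partial>lebesgue_on \<Omega>) = (\<integral>x. f x \<bullet> k' x \<partial>lebesgue_on B)" for k'
        by (rule integral_lebesgue_on_mono_set[OF B(1) \<Omega>m B(3)]) (simp add: f0)
      then have "(\<integral>x. f x \<bullet> w x \<partial>lebesgue_on B) = (\<integral>x. f x \<bullet> v x \<partial>lebesgue_on B)"
        using eq[OF f] by simp
      then have "(\<integral>x. f x \<bullet> h x \<partial>lebesgue_on B) = 0"
        using L2_inner_integrable[OF Lf EB(1)] L2_inner_integrable[OF Lf Lv] by (simp add: h_def inner_diff_right)
      then show ?thesis by (simp add: f_def)
    qed
    \<comment> \<open>The q k converge to h, so the vanishing pairings give integral zero for \<eta>
      |h|^2; as \<eta> > 0 on the ball, h = 0 almost everywhere there.\<close>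
    have "(\<lambda>k. \<integral>x. q k x \<bullet> (\<eta> x *\<^sub>R h x) \<partial>lebesgue_on B) \<longlonglongrightarrow> (\<integral>x. h x \<bullet> (\<eta> x *\<^sub>R h x) \<partial>lebesgue_on B)"
      by (rule l2_inner_tendsto[OF Lq Lh L\<eta>[OF Lh] qh])
    then have "(\<integral>x. h x \<bullet> (\<eta> x *\<^sub>R h x) \<partial>lebesgue_on B) = 0"
      unfolding zero using LIMSEQ_unique[OF _ tendsto_const] by fastforce
    moreover have "AE x in lebesgue_on B. 0 \<le> h x \<bullet> (\<eta> x *\<^sub>R h x)"
      by (intro AE_I2) (simp add: \<eta>_def bump_nonneg)
    ultimately have "AE x in lebesgue_on B. h x \<bullet> (\<eta> x *\<^sub>R h x) = 0"
      using integral_nonneg_eq_0_iff_AE[OF L2_inner_integrable[OF Lh L\<eta>[OF Lh]]] by simp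
    then have "AE x in lebesgue. x \<in> B \<longrightarrow> h x \<bullet> (\<eta> x *\<^sub>R h x) = 0"
      using B(1) by (simp add: AE_restrict_space_iff)
    then show ?thesis
    proof eventually_elim
      case (elim x)
      then show ?case using bump_pos_iff[OF r(1), of p x] by (auto simp: h_def \<eta>_def B_def)
    qed
  qed
  \<comment> \<open>Exceptional null sets can be united only over countably many balls, hence the
    Lindelof property.\<close>
  define \<F> where "\<F> = {ball p r |p r. r > 0 \<and> cball p r \<subseteq> U}"
  have opF: "open S" if "S \<in> \<F>" for S using that by (auto simp: \<F>_def)
  obtain \<G> where G: "\<G> \<subseteq> \<F>" "countable \<G>" "\<Union>\<G> = \<Union>\<F>" using Lindelof[OF opF] by blast
  have cover: "U \<subseteq> \<Union>\<F>"
  proof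
    fix x assume "x \<in> U"
    then obtain e where "e > 0" "cball x e \<subseteq> U" using U(1) open_contains_cball by blast
    then have "ball x e \<in> \<F>" "x \<in> ball x e" by (auto simp: \<F>_def)
    then show "x \<in> \<Union>\<F>" by blast
  qed
  have "AE x in lebesgue. \<forall>S\<in>\<G>. x \<in> S \<longrightarrow> w x = v x"
  proof (subst AE_ball_countable[OF G(2)], intro ballI)
    fix S assume "S \<in> \<G>"
    then obtain p r where "S = ball p r" "r > 0" "cball p r \<subseteq> U" using G(1) by (auto simp: \<F>_def)
    then show "AE x in lebesgue. x \<in> S \<longrightarrow> w x = v x" using loc by blast
  qed
  then show ?thesis
  proof eventually_elim
    case (elim x)
    then show ?case using cover G(3) by blast
  qed
qed

text \<open>The energy closure sees functions only up to null sets, whereas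
  \<open>green_off_diagonal\<close> asks for equality at every point. This lemma installs the
  continuous representative.\<close>

lemma energy_closure_modify:
  fixes w v :: "real^'n \<Rightarrow> real^'N"
  assumes E: "energy_closure \<Omega> w Dw \<phi>" and \<Omega>: "open \<Omega>" and U: "open U" and v: "continuous_on U v"
    and ae: "AE x in lebesgue. x \<in> U \<longrightarrow> w x = v x"
  shows "energy_closure \<Omega> (\<lambda>x. if x \<in> U then v x else w x) Dw \<phi>"
proof -
  define w' where "w' x = (if x \<in> U then v x else w x)" for x
  have loc: "L2 (lebesgue_on V) w' \<and> (\<forall>k. l2norm (lebesgue_on V) (\<lambda>x. w' x - \<phi> k x) = l2norm (lebesgue_on V) (\<lambda>x. w x - \<phi> k x))"
    if V: "V \<in> sets borel" and w: "L2 (lebesgue_on V) w" for V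
  proof -
    have Vm: "V \<in> sets lebesgue" "U \<in> sets lebesgue" "V - U \<in> sets lebesgue" using V U by auto
    have wm: "w \<in> borel_measurable (lebesgue_on V)" by (rule L2_measurable[OF w])
    have vU: "v \<in> borel_measurable (lebesgue_on U)" by (rule continuous_imp_measurable_on_sets_lebesgue[OF v Vm(2)])
    have "(\<lambda>x. indicator (V \<inter> U) x *\<^sub>R v x) \<in> borel_measurable lebesgue"
      using borel_measurable_lebesgue_on_subset[OF vU, of "V \<inter> U"] Vm by (simp add: borel_measurable_restrict_space_iff)
    moreover have "(\<lambda>x. indicator (V - U) x *\<^sub>R w x) \<in> borel_measurable lebesgue"
      using borel_measurable_lebesgue_on_subset[OF wm, of "V - U"] Vm by (simp add: borel_measurable_restrict_space_iff)
    ultimately have "(\<lambda>x. indicator (V \<inter> U) x *\<^sub>R v x + indicator (V - U) x *\<^sub>R w x) \<in> borel_measurable lebesgue"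
      by (rule borel_measurable_add)
    also have "(\<lambda>x. indicator (V \<inter> U) x *\<^sub>R v x + indicator (V - U) x *\<^sub>R w x) = (\<lambda>x. indicator V x *\<^sub>R w' x)"
      by (auto simp: fun_eq_iff w'_def indicator_def)
    finally have w'm: "w' \<in> borel_measurable (lebesgue_on V)"
      using Vm by (simp add: borel_measurable_restrict_space_iff)
    have aeV: "AE x in lebesgue_on V. w' x = w x"
      using ae Vm(1) by (simp add: AE_restrict_space_iff) (auto simp: w'_def elim: eventually_mono)
    have "integrable (lebesgue_on V) (\<lambda>x. (norm (w' x))\<^sup>2)"
    proof (subst integrable_cong_AE)
      show "AE x in lebesgue_on V. (norm (w' x))\<^sup>2 = (norm (w x))\<^sup>2" using aeV by eventually_elim simp
      show "integrable (lebesgue_on V) (\<lambda>x. (norm (w x))\<^sup>2)" by (rule L2_integrable[OF w])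
    qed (use w'm wm in auto)
    moreover have "l2norm (lebesgue_on V) (\<lambda>x. w' x - \<phi> k x) = l2norm (lebesgue_on V) (\<lambda>x. w x - \<phi> k x)" for k
    proof -
      have \<phi>m: "\<phi> k \<in> borel_measurable (lebesgue_on V)"
        by (rule L2_measurable[OF test_function_L2[OF energy_closureD(2)[OF E] V]])
      have "(\<integral>x. (norm (w' x - \<phi> k x))\<^sup>2 \<partial>lebesgue_on V) = (\<integral>x. (norm (w x - \<phi> k x))\<^sup>2 \<partial>lebesgue_on V)"
      proof (rule integral_cong_AE)
        show "AE x in lebesgue_on V. (norm (w' x - \<phi> k x))\<^sup>2 = (norm (w x - \<phi> k x))\<^sup>2" using aeV by eventually_elim simp
      qed (use w'm wm \<phi>m in auto)
      then show ?thesis by (simp add: l2norm_def)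
    qed
    ultimately show ?thesis using w'm by (simp add: L2_def)
  qed
  have Rm: "\<Omega> \<inter> ball 0 R \<in> sets borel" for R using \<Omega> by auto
  have w: "L2 (lebesgue_on (\<Omega> \<inter> ball 0 R)) w" for R using E by (simp add: energy_closure_def)
  have lim: "(\<lambda>k. l2norm (lebesgue_on (\<Omega> \<inter> ball 0 R)) (\<lambda>x. w x - \<phi> k x)) \<longlonglongrightarrow> 0" for R
    using E by (simp add: energy_closure_def)
  have "(\<lambda>k. l2norm (lebesgue_on (\<Omega> \<inter> ball 0 R)) (\<lambda>x. w' x - \<phi> k x)) \<longlonglongrightarrow> 0" for R
    using lim[of R] loc[OF Rm w, of R] by simp
  moreover have "L2 (lebesgue_on (\<Omega> \<inter> ball 0 R)) w'" for R using loc[OF Rm w] by blast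
  ultimately show ?thesis
    unfolding energy_closure_def w'_def[symmetric] using energy_closureD[OF E] by blast
qed

lemma inner_matrix_transpose:
  fixes M :: "real^'N^'N"
  shows "b \<bullet> (transpose M *v a) = a \<bullet> (M *v b)"
  by (metis dot_lmul_matrix inner_commute transpose_matrix_vector)

lemma continuous_on_transpose:
  fixes M :: "'a::topological_space \<Rightarrow> real^'n^'m"
  assumes "continuous_on S M"
  shows "continuous_on S (\<lambda>z. transpose (M z))"
  unfolding transpose_def by (intro continuous_on_vec_lambda continuous_on_component assms)

text \<open>The transposed equation is solved abstractly for the source g. Its solution w is
  compared with the integral v of the transposed kernel by pairing both with sources f supported
  away from g: for these the representation by G is available, so w = v almost everywhere off the
  support of g. There w is then replaced by the continuous v.\<close>

lemma green_off_diagonal_transpose: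
  fixes G :: "real^'n \<Rightarrow> real^'n \<Rightarrow> real^'N^'N"
  assumes n: "CARD('n) \<ge> 3"
    and A: "measurable_coeffs A" "bounded_coeffs Lam A" "Lam \<ge> 0" "strongly_elliptic lam A" "lam > 0"
    and \<Omega>: "open \<Omega>" and G: "green_off_diagonal A \<Omega> G"
  shows "green_off_diagonal (transpose_coeffs A) \<Omega> (\<lambda>x y. transpose (G y x))"
  unfolding green_off_diagonal_def
proof (intro conjI allI impI)
  have \<Omega>m: "\<Omega> \<in> sets lebesgue" using \<Omega> by auto
  have cG: "continuous_on {(x, y). x \<in> \<Omega> \<and> y \<in> \<Omega> \<and> x \<noteq> y} (\<lambda>z. G (fst z) (snd z))"
    using G by (simp add: green_off_diagonal_def case_prod_beta')
  have cG': "continuous_on T (\<lambda>z. transpose (G (snd z) (fst z)))" if "T \<subseteq> {(x, y). x \<in> \<Omega> \<and> y \<in> \<Omega> \<and> x \<noteq> y}" for T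
  proof (rule continuous_on_transpose)
    have "continuous_on T (\<lambda>z. (\<lambda>z. G (fst z) (snd z)) (snd z, fst z))"
      by (rule continuous_on_compose2[OF cG]) (use that in \<open>auto intro!: continuous_intros\<close>)
    then show "continuous_on T (\<lambda>z. G (snd z) (fst z))" by simp
  qed
  from cG'[OF order_refl] show "continuous_on {(x, y). x \<in> \<Omega> \<and> y \<in> \<Omega> \<and> x \<noteq> y} (\<lambda>(x, y). transpose (G y x))"
    by (simp add: case_prod_beta')
  fix g :: "real^'n \<Rightarrow> real^'N" assume g: "test_function \<Omega> g"
  define K where "K = closure {y. g y \<noteq> 0}"
  have K: "K \<subseteq> \<Omega>" "compact K" using g by (auto simp: test_function_def K_def)
  have Km: "K \<in> sets lebesgue" using borel_compact[OF K(2)] by (auto intro: sets_completionI_sets)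
  have g0: "g y = 0" if "y \<notin> K" for y
    using that closure_subset[of "{y. g y \<noteq> 0}"] unfolding K_def by blast
  define U where "U = \<Omega> - K"
  have U: "open U" "U \<subseteq> \<Omega>" using \<Omega> K compact_imp_closed by (auto simp: U_def)
  obtain w Dw \<phi> where E: "energy_closure \<Omega> w Dw \<phi>" and eq: "weak_equation (transpose_coeffs A) \<Omega> Dw g"
    using weak_solution_exists[OF n measurable_coeffs_transpose[OF A(1)] bounded_coeffs_transpose[OF A(2)] A(3)
        strongly_elliptic_transpose[OF A(4)] A(5) \<Omega> g] by blast
  define v where "v x = (\<integral>y. transpose (G y x) *v g y \<partial>lebesgue_on K)" for x
  have cvg: "continuous_on (U \<times> K) (\<lambda>z. transpose (G (snd z) (fst z)) *v g (snd z))"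
  proof (rule continuous_on_matrix_vector_mult)
    show "continuous_on (U \<times> K) (\<lambda>z. transpose (G (snd z) (fst z)))"
      by (rule cG') (use U K in \<open>auto simp: U_def\<close>)
    show "continuous_on (U \<times> K) (\<lambda>z. g (snd z))"
      by (rule continuous_on_compose2[OF test_function_continuous[OF g, of UNIV]]) (auto intro!: continuous_intros)
  qed
  have cv: "continuous_on U v" unfolding v_def
    by (rule continuous_on_parametric_integral[OF K(2)]) (use cvg in \<open>simp add: case_prod_beta'\<close>)
  have iv: "integrable (lebesgue_on K) (\<lambda>x. transpose (G x y) *v g x)" if "y \<in> U" for y
  proof (rule integrable_continuous_compact[OF K(2)])
    have "continuous_on K (\<lambda>x. (\<lambda>z. transpose (G (snd z) (fst z)) *v g (snd z)) (y, x))"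
      by (rule continuous_on_compose2[OF cvg]) (use that in \<open>auto intro!: continuous_intros\<close>)
    then show "continuous_on K (\<lambda>x. transpose (G x y) *v g x)" by simp
  qed
  \<comment> \<open>Reciprocity replaces w by the solution u for f. On the support of g, disjoint
    from that of f, u is given by G; exchanging the integrals then produces v.\<close>
  have "(\<integral>x. f x \<bullet> w x \<partial>lebesgue_on \<Omega>) = (\<integral>x. f x \<bullet> v x \<partial>lebesgue_on \<Omega>)" if f: "test_function U f" for f
  proof -
    have f\<Omega>: "test_function \<Omega> f" by (rule test_function_mono[OF f U(2)])
    define L where "L = closure {y. f y \<noteq> 0}"
    have L: "L \<subseteq> U" "compact L" using f by (auto simp: test_function_def L_def)
    have Lm: "L \<in> sets lebesgue" using borel_compact[OF L(2)] by (auto intro: sets_completionI_sets)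
    have f0: "f y = 0" if "y \<notin> L" for y
      using that closure_subset[of "{y. f y \<noteq> 0}"] unfolding L_def by blast
    have KL: "x \<in> \<Omega> - L" if "x \<in> K" for x using that K L U by (auto simp: U_def)
    obtain u Du \<psi> where u: "energy_closure \<Omega> u Du \<psi>" "weak_equation A \<Omega> Du f" "continuous_on (\<Omega> - L) u"
      and ur: "\<And>x. x \<in> \<Omega> - L \<Longrightarrow> u x = (\<integral>y. G x y *v f y \<partial>lebesgue_on L)"
      and ui: "\<And>x. x \<in> \<Omega> - L \<Longrightarrow> integrable (lebesgue_on L) (\<lambda>y. G x y *v f y)"
      by (rule green_solution[OF G f\<Omega> L_def]) blast
    have "(\<integral>x. f x \<bullet> w x \<partial>lebesgue_on \<Omega>) = (\<integral>x. g x \<bullet> u x \<partial>lebesgue_on \<Omega>)"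
      by (rule green_adjoint[OF A(1-3) \<Omega> u(1,2) f\<Omega> E eq g])
    also have "\<dots> = (\<integral>x. g x \<bullet> u x \<partial>lebesgue_on K)"
      by (rule integral_lebesgue_on_mono_set[OF Km \<Omega>m K(1)]) (simp add: g0)
    also have "\<dots> = (\<integral>x. \<integral>y. g x \<bullet> (G x y *v f y) \<partial>lebesgue_on L \<partial>lebesgue_on K)"
    proof (rule Bochner_Integration.integral_cong[OF refl])
      fix x assume "x \<in> space (lebesgue_on K)"
      then have "x \<in> \<Omega> - L" using KL by simp
      then show "g x \<bullet> u x = (\<integral>y. g x \<bullet> (G x y *v f y) \<partial>lebesgue_on L)"
        using ur[of x] ui[of x] by simp
    qed
    also have "\<dots> = (\<integral>y. \<integral>x. g x \<bullet> (G x y *v f y) \<partial>lebesgue_on K \<partial>lebesgue_on L)"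
    proof (rule Fubini_compact[OF K(2) L(2)])
      show "continuous_on (K \<times> L) (\<lambda>z. g (fst z) \<bullet> (G (fst z) (snd z) *v f (snd z)))"
      proof (intro continuous_on_inner continuous_on_matrix_vector_mult)
        show "continuous_on (K \<times> L) (\<lambda>z. g (fst z))"
          by (rule continuous_on_compose2[OF test_function_continuous[OF g, of UNIV]]) (auto intro!: continuous_intros)
        show "continuous_on (K \<times> L) (\<lambda>z. f (snd z))"
          by (rule continuous_on_compose2[OF test_function_continuous[OF f, of UNIV]]) (auto intro!: continuous_intros)
        show "continuous_on (K \<times> L) (\<lambda>z. G (fst z) (snd z))"
          by (rule continuous_on_subset[OF cG]) (use K KL L U in auto)
      qed
    qed
    also have "\<dots> = (\<integral>y. f y \<bullet> v y \<partial>lebesgue_on L)"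
    proof (rule Bochner_Integration.integral_cong[OF refl])
      fix y assume "y \<in> space (lebesgue_on L)"
      then have "y \<in> U" using L by auto
      then show "(\<integral>x. g x \<bullet> (G x y *v f y) \<partial>lebesgue_on K) = f y \<bullet> v y"
        using iv[of y] by (simp add: v_def inner_matrix_transpose[symmetric])
    qed
    also have "\<dots> = (\<integral>y. f y \<bullet> v y \<partial>lebesgue_on \<Omega>)"
      by (rule integral_lebesgue_on_mono_set[symmetric, OF Lm \<Omega>m]) (use L U f0 in auto)
    finally show ?thesis .
  qed
  from energy_closure_modify[OF E \<Omega> U(1) cv weak_identity_AE[OF E \<Omega> U cv this]]
  have "energy_closure \<Omega> (\<lambda>x. if x \<in> U then v x else w x) Dw \<phi>" .
  then show "\<exists>u Du \<phi>. energy_closure \<Omega> u Du \<phi> \<and> weak_equation (transpose_coeffs A) \<Omega> Du g \<and>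
      (\<forall>x \<in> \<Omega> - closure {y. g y \<noteq> 0}. u x = (\<integral>y. transpose (G y x) *v g y \<partial>lebesgue_on (closure {y. g y \<noteq> 0})))"
    unfolding K_def[symmetric] using eq
    by (intro exI[of _ "\<lambda>x. if x \<in> U then v x else w x"] exI[of _ Dw] exI[of _ \<phi>]) (simp add: U_def v_def)
qed

section \<open>The estimates for the Green's matrix\<close>

subsection \<open>Pointwise bounds by duality\<close>

text \<open>A mollified unit source at x in direction j has a transposed solution w whose i-th
  component at y is a weighted average of G z y $ j $ i over z near x. By reciprocity, pairing w
  with a source f near y is the same as averaging the j-th component of the solution for f near x,
  to which the assumed bound K applies. \<open>dual_solution_bound\<close> then bounds w at y
  uniformly in \<delta>, and continuity of G off the diagonal gives the limit \<delta> -> 0.\<close>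

lemma green_pointwise_bound:
  fixes G :: "real^'n \<Rightarrow> real^'n \<Rightarrow> real^'N^'N"
  assumes n: "CARD('n) \<ge> 3"
    and A: "measurable_coeffs A" "bounded_coeffs Lam A" "Lam \<ge> 0" "strongly_elliptic lam A" "lam > 0"
    and H: "property_H (transpose_coeffs A) \<mu>\<^sub>0 H\<^sub>0" "H\<^sub>0 \<ge> 0" "\<mu>\<^sub>0 > 0"
    and \<Omega>: "open \<Omega>" and G: "green_off_diagonal A \<Omega> G"
    and \<delta>\<^sub>0: "\<delta>\<^sub>0 > 0" "ball x \<delta>\<^sub>0 \<subseteq> \<Omega>" and \<rho>: "\<rho> > 0" "ball y \<rho> \<subseteq> \<Omega>" and disj: "ball x \<delta>\<^sub>0 \<inter> ball y \<rho> = {}"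
    and K: "K \<ge> 0"
    and bound: "\<And>f u Du \<phi> x' j. test_function (ball y \<rho>) f \<Longrightarrow> energy_closure \<Omega> u Du \<phi> \<Longrightarrow> weak_equation A \<Omega> Du f \<Longrightarrow>
       continuous_on (\<Omega> - closure {z. f z \<noteq> 0}) u \<Longrightarrow> dist x' x < \<delta>\<^sub>0 \<Longrightarrow> \<bar>u x' $ j\<bar> \<le> K * l2norm (lebesgue_on \<Omega>) Du"
  shows "\<bar>G x y $ j $ i\<bar> \<le> duality_const TYPE('n) lam \<mu>\<^sub>0 H\<^sub>0 * K * \<rho> powr (1 - real CARD('n) / 2)"
proof -
  define c where "c = bump_integral TYPE('n)"
  have c: "c > 0" unfolding c_def by (rule bump_integral_pos)
  define N where "N = real CARD('n)"
  have \<Omega>m: "\<Omega> \<in> sets lebesgue" "\<Omega> \<in> sets borel" using \<Omega> by auto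
  define U where "U = ball x (\<delta>\<^sub>0 / 2)"
  have U: "U \<in> sets lebesgue" "U \<in> sets borel" by (auto simp: U_def)
  have cU: "cball x (\<delta>\<^sub>0 / 2) \<subseteq> ball x \<delta>\<^sub>0" using \<delta>\<^sub>0 by auto
  have y: "y \<in> \<Omega>" "y \<notin> ball x \<delta>\<^sub>0" using \<rho> disj by auto
  have yball: "ball y \<rho> \<inter> cball x (\<delta>\<^sub>0 / 2) = {}" using cU disj by blast
  have GT: "green_off_diagonal (transpose_coeffs A) \<Omega> (\<lambda>x y. transpose (G y x))"
    by (rule green_off_diagonal_transpose[OF n A \<Omega> G])
  define I where "I \<delta> = \<delta> powr - N * (\<integral>z. G z y $ j $ i * bump x \<delta> z \<partial>lebesgue_on U)" for \<delta>
  define b where "b = duality_const TYPE('n) lam \<mu>\<^sub>0 H\<^sub>0 * (K * c) * \<rho> powr (1 - N / 2)"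
  have small: "\<bar>I \<delta>\<bar> \<le> b" if \<delta>: "0 < \<delta>" "\<delta> < \<delta>\<^sub>0 / 2" for \<delta>
  proof -
    define g where "g z = (\<delta> powr - N * bump x \<delta> z) *\<^sub>R (axis j 1 :: real^'N)" for z
    have c\<delta>: "cball x \<delta> \<subseteq> U" using \<delta> by (auto simp: U_def)
    have U\<Omega>: "U \<subseteq> ball x \<delta>\<^sub>0" using \<delta>\<^sub>0 by (auto simp: U_def)
    have cs: "cball x \<delta> \<subseteq> \<Omega>" using c\<delta> U\<Omega> \<delta>\<^sub>0 by blast
    have g: "test_function \<Omega> g"
    proof -
      have "test_function \<Omega> (\<lambda>z. \<delta> powr - N *\<^sub>R bump x \<delta> z)"
        by (intro test_function_scaleR test_function_bump \<delta> cs)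
      then show ?thesis unfolding g_def
        using test_function_linear[OF bounded_linear_scaleR_left] by fastforce
    qed
    define Kg where "Kg = closure {z. g z \<noteq> 0}"
    have gz: "g z = 0" if "z \<notin> ball x \<delta>" for z using bump_outside[OF \<delta>(1) that] by (simp add: g_def)
    have "{z. g z \<noteq> 0} \<subseteq> cball x \<delta>" using gz ball_subset_cball by blast
    then have Kg: "Kg \<subseteq> cball x \<delta>" unfolding Kg_def by (intro closure_minimal) auto
    have Kgm: "Kg \<in> sets lebesgue" by (simp add: Kg_def)
    have KgU: "Kg \<subseteq> U" using Kg c\<delta> by blast
    have g0: "g z = 0" if "z \<notin> Kg" for z
      using that closure_subset[of "{z. g z \<noteq> 0}"] unfolding Kg_def by blast
    have disjK: "ball y \<rho> \<inter> Kg = {}" using KgU U\<Omega> disj by blast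
    obtain w Dw \<psi> where w: "energy_closure \<Omega> w Dw \<psi>" "weak_equation (transpose_coeffs A) \<Omega> Dw g" "continuous_on (\<Omega> - Kg) w"
      and wr: "\<And>z. z \<in> \<Omega> - Kg \<Longrightarrow> w z = (\<integral>z'. transpose (G z' z) *v g z' \<partial>lebesgue_on Kg)"
      and wi: "\<And>z. z \<in> \<Omega> - Kg \<Longrightarrow> integrable (lebesgue_on Kg) (\<lambda>z'. transpose (G z' z) *v g z')"
      by (rule green_solution[OF GT g Kg_def]) blast
    have yK: "y \<in> \<Omega> - Kg" using y KgU U\<Omega> by blast
    have "w y $ i = (\<integral>z. (transpose (G z y) *v g z) $ i \<partial>lebesgue_on Kg)"
      unfolding wr[OF yK] by (rule integral_bounded_linear[OF bounded_linear_vec_nth wi[OF yK], symmetric])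
    also have "\<dots> = (\<integral>z. \<delta> powr - N * (G z y $ j $ i * bump x \<delta> z) \<partial>lebesgue_on Kg)"
    proof -
      have "(transpose M *v (a *\<^sub>R axis j 1)) $ i = a * M $ j $ i" for M :: "real^'N^'N" and a
        by (simp add: matrix_vector_mult_def transpose_def axis_def if_distrib cong: if_cong)
      then show ?thesis by (simp add: g_def mult.assoc mult.commute mult.left_commute)
    qed
    also have "\<dots> = (\<integral>z. \<delta> powr - N * (G z y $ j $ i * bump x \<delta> z) \<partial>lebesgue_on U)"
    proof (rule integral_lebesgue_on_mono_set[symmetric, OF Kgm U(1) KgU])
      fix z assume "z \<in> U - Kg"
      then have "g z = 0" using g0 by blast
      then have "bump x \<delta> z = 0" using \<delta> by (simp add: g_def axis_eq_0_iff)
      then show "\<delta> powr - N * (G z y $ j $ i * bump x \<delta> z) = 0" by simp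
    qed
    also have "\<dots> = I \<delta>" by (simp add: I_def)
    finally have wI: "w y $ i = I \<delta>" .
    have "\<bar>w y $ i\<bar> \<le> duality_const TYPE('n) lam \<mu>\<^sub>0 H\<^sub>0 * (K * c) * \<rho> powr (1 - real CARD('n) / 2)"
    proof (rule dual_solution_bound[OF n A H \<Omega> \<rho> w(1,2)])
      show "g z = 0" if "z \<in> ball y \<rho>" for z using that disjK g0 by blast
      show "continuous_on (ball y \<rho>) w" using w(3) by (rule continuous_on_subset) (use \<rho> disjK in blast)
      show "0 \<le> K * c" using K c by simp
      fix f :: "real^'n \<Rightarrow> real^'N" assume f: "test_function (ball y \<rho>) f"
      have f\<Omega>: "test_function \<Omega> f" by (rule test_function_mono[OF f \<rho>(2)])
      obtain u Du \<phi> where u: "energy_closure \<Omega> u Du \<phi>" "weak_equation A \<Omega> Du f" "continuous_on (\<Omega> - closure {z. f z \<noteq> 0}) u"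
        by (rule green_solution[OF G f\<Omega> refl]) blast
      define D where "D = l2norm (lebesgue_on \<Omega>) Du"
      have D: "D \<ge> 0" by (simp add: D_def)
      \<comment> \<open>The source has total mass c for every \<delta>, so the bound on u near x
        passes to the pairing with the factor c, which cancels at the end against the limit of the
        averages.\<close>
      have "\<bar>\<integral>z. g z \<bullet> u z \<partial>lebesgue_on \<Omega>\<bar> \<le> (\<integral>z. \<bar>g z \<bullet> u z\<bar> \<partial>lebesgue_on \<Omega>)"
        using integral_norm_bound[of "lebesgue_on \<Omega>" "\<lambda>z. g z \<bullet> u z"] by simp
      also have "\<dots> \<le> (\<integral>z. (\<delta> powr - N * (K * D)) * bump x \<delta> z \<partial>lebesgue_on \<Omega>)"
      proof (rule integral_mono')
        show "integrable (lebesgue_on \<Omega>) (\<lambda>z. (\<delta> powr - N * (K * D)) * bump x \<delta> z)"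
          by (intro integrable_mult_right integrable_lebesgue_on_lborel bump_integrable \<delta> \<Omega>m)
        show "0 \<le> (\<delta> powr - N * (K * D)) * bump x \<delta> z" for z using K D bump_nonneg[of x \<delta> z] by simp
        fix z
        show "\<bar>g z \<bullet> u z\<bar> \<le> (\<delta> powr - N * (K * D)) * bump x \<delta> z"
        proof (cases "z \<in> ball x \<delta>")
          case True
          then have "dist z x < \<delta>\<^sub>0" using \<delta> by (simp add: dist_commute)
          then have ub: "\<bar>u z $ j\<bar> \<le> K * D" unfolding D_def by (rule bound[OF f u])
          have "\<bar>g z \<bullet> u z\<bar> = \<delta> powr - N * bump x \<delta> z * \<bar>u z $ j\<bar>"
            by (simp add: g_def inner_axis' abs_mult bump_nonneg)
          also have "\<dots> \<le> \<delta> powr - N * bump x \<delta> z * (K * D)"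
            by (rule mult_left_mono[OF ub]) (simp add: bump_nonneg)
          finally show ?thesis by (simp add: mult.assoc mult.commute mult.left_commute)
        next
          case False
          then show ?thesis using gz[of z] K D bump_nonneg[of x \<delta> z] by simp
        qed
      qed
      also have "\<dots> = \<delta> powr - N * (K * D) * (\<delta> ^ CARD('n) * c)"
      proof -
        have "ball x \<delta> \<subseteq> \<Omega>" using cs ball_subset_cball by blast
        from integral_bump_lebesgue_on[OF \<delta>(1) \<Omega>m(2) this] show ?thesis by (simp add: c_def)
      qed
      also have "\<dots> = K * c * D" using \<delta> by (simp add: N_def powr_minus powr_realpow)
      finally have "\<bar>\<integral>z. g z \<bullet> u z \<partial>lebesgue_on \<Omega>\<bar> \<le> K * c * D" .
      moreover have "(\<integral>z. f z \<bullet> w z \<partial>lebesgue_on \<Omega>) = (\<integral>z. g z \<bullet> u z \<partial>lebesgue_on \<Omega>)"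
        by (rule green_adjoint[OF A(1-3) \<Omega> u(1,2) f\<Omega> w(1,2) g])
      ultimately have "\<bar>\<integral>z. f z \<bullet> w z \<partial>lebesgue_on \<Omega>\<bar> \<le> K * c * l2norm (lebesgue_on \<Omega>) Du" by (simp add: D_def)
      then show "\<exists>u Du \<phi>. energy_closure \<Omega> u Du \<phi> \<and> weak_equation A \<Omega> Du f \<and>
        \<bar>\<integral>x. f x \<bullet> w x \<partial>lebesgue_on \<Omega>\<bar> \<le> K * c * l2norm (lebesgue_on \<Omega>) Du" using u by blast
    qed
    then show ?thesis unfolding wI b_def N_def .
  qed
  have contG: "continuous_on (cball x (\<delta>\<^sub>0 / 2)) (\<lambda>z. G z y $ j $ i)"
  proof -
    have "continuous_on {(x, y). x \<in> \<Omega> \<and> y \<in> \<Omega> \<and> x \<noteq> y} (\<lambda>z. G (fst z) (snd z))"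
      using G by (simp add: green_off_diagonal_def case_prod_beta')
    then have "continuous_on (cball x (\<delta>\<^sub>0 / 2)) (\<lambda>z. (\<lambda>z. G (fst z) (snd z)) (z, y))"
      by (rule continuous_on_compose2) (use y cU \<delta>\<^sub>0 in \<open>auto intro!: continuous_intros\<close>)
    then show ?thesis by (intro continuous_on_component) simp
  qed
  have Usub: "U \<subseteq> cball x (\<delta>\<^sub>0 / 2)" by (simp add: U_def)
  have "integrable (lebesgue_on U) (\<lambda>z. G z y $ j $ i)"
    by (rule integrable_lebesgue_on_subset[OF integrable_continuous_compact[OF compact_cball contG] U(1) _ Usub]) simp
  then have lim: "(I \<longlongrightarrow> c * G x y $ j $ i) (at_right 0)"
    unfolding I_def c_def N_def using \<delta>\<^sub>0
    by (intro bump_average_tendsto continuous_on_subset[OF contG Usub]) (auto simp: U_def)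
  have "\<bar>c * G x y $ j $ i\<bar> \<le> b"
  proof (rule tendsto_upperbound)
    show "((\<lambda>\<delta>. \<bar>I \<delta>\<bar>) \<longlongrightarrow> \<bar>c * G x y $ j $ i\<bar>) (at_right 0)" by (intro tendsto_rabs lim)
    show "\<forall>\<^sub>F \<delta> in at_right 0. \<bar>I \<delta>\<bar> \<le> b"
      unfolding eventually_at_right_field using \<delta>\<^sub>0 small by (intro exI[of _ "\<delta>\<^sub>0 / 2"]) auto
  qed simp
  then have "c * \<bar>G x y $ j $ i\<bar> \<le> c * (duality_const TYPE('n) lam \<mu>\<^sub>0 H\<^sub>0 * K * \<rho> powr (1 - N / 2))"
    using c by (simp add: b_def abs_mult mult.assoc mult.commute mult.left_commute)
  then show ?thesis using c by (simp add: N_def)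
qed

lemma norm_matrix_le:
  fixes M :: "real^'n^'m"
  assumes "\<And>i j. \<bar>M $ i $ j\<bar> \<le> b"
  shows "norm M \<le> real CARD('m) * (real CARD('n) * b)"
proof -
  have row: "norm (M $ i) \<le> real CARD('n) * b" for i
  proof -
    have "norm (M $ i) \<le> (\<Sum>j\<in>UNIV. \<bar>M $ i $ j\<bar>)" by (rule norm_le_l1_cart)
    also have "\<dots> \<le> (\<Sum>j\<in>(UNIV::'n set). b)" by (intro sum_mono assms)
    finally show ?thesis by simp
  qed
  have "norm M \<le> (\<Sum>i\<in>UNIV. norm (M $ i))"
    unfolding norm_vec_def[of M] by (rule L2_set_le_sum) simp
  also have "\<dots> \<le> (\<Sum>i\<in>(UNIV::'m set). real CARD('n) * b)" by (intro sum_mono row)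
  finally show ?thesis by simp
qed

lemma norm_transpose: "norm (transpose (M :: real^'n^'m)) = norm M"
proof (rule power2_eq_imp_eq)
  show "(norm (transpose M))\<^sup>2 = (norm M)\<^sup>2"
    unfolding norm_matrix_square by (simp add: transpose_def) (rule sum.swap)
qed auto

subsection \<open>Decay at the boundary\<close>

lemma R_dist_ereal: "R_dist (ereal r) x y = min (dist x y) (4 * r)"
  by (simp add: R_dist_def numeral_eq_ereal min_def)

lemma R_dist_infinity: "R_dist \<infinity> x y = dist x y"
  by (simp add: R_dist_def)

text \<open>Dividing by 5 beats the factor 4 in \<open>R_dist\<close>, so R/5 is an admissible
  radius for (S) and (BH) even when \<open>R_dist\<close> equals 4 \<open>R\<^sub>a\<close>.\<close>

lemma R_dist_props:
  assumes "R\<^sub>a > 0" "x \<noteq> y"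
  shows "0 < R_dist R\<^sub>a x y" "R_dist R\<^sub>a x y \<le> dist x y" "ereal (R_dist R\<^sub>a x y / 5) < R\<^sub>a"
proof -
  have "0 < R_dist R\<^sub>a x y \<and> R_dist R\<^sub>a x y \<le> dist x y \<and> ereal (R_dist R\<^sub>a x y / 5) < R\<^sub>a"
  proof (cases R\<^sub>a)
    case (real r)
    have "R_dist R\<^sub>a x y = min (dist x y) (4 * r)" by (simp add: real R_dist_ereal)
    moreover have "r > 0" using assms real by simp
    ultimately show ?thesis using assms(2) real by (auto simp: min_def)
  next
    case PInf
    then show ?thesis using assms by (simp add: R_dist_infinity)
  qed (use assms in auto)
  then show "0 < R_dist R\<^sub>a x y" "R_dist R\<^sub>a x y \<le> dist x y" "ereal (R_dist R\<^sub>a x y / 5) < R\<^sub>a" by auto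
qed

lemma R_dist_commute: "R_dist R\<^sub>a x y = R_dist R\<^sub>a y x"
  by (simp add: R_dist_def dist_commute)

text \<open>A ball that meets both \<Omega> and its complement is connected and hence meets the
  frontier, at distance less than the infimum.\<close>

lemma infdist_frontier:
  fixes x :: "'a::euclidean_space"
  assumes \<Omega>: "open \<Omega>" "x \<in> \<Omega>" and F: "frontier \<Omega> \<noteq> {}"
  shows "infdist x (frontier \<Omega>) > 0" "ball x (infdist x (frontier \<Omega>)) \<subseteq> \<Omega>"
proof -
  have "x \<notin> frontier \<Omega>" using \<Omega> by (simp add: frontier_def interior_open)
  then show "infdist x (frontier \<Omega>) > 0"
    using F frontier_closed[of \<Omega>] in_closed_iff_infdist_zero[of "frontier \<Omega>" x] infdist_nonneg[of x "frontier \<Omega>"]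
    by (simp add: less_le)
  show "ball x (infdist x (frontier \<Omega>)) \<subseteq> \<Omega>"
  proof (rule ccontr)
    let ?B = "ball x (infdist x (frontier \<Omega>))"
    assume "\<not> ?B \<subseteq> \<Omega>"
    moreover have "x \<in> ?B" using \<open>infdist x (frontier \<Omega>) > 0\<close> by simp
    ultimately have "?B \<inter> \<Omega> \<noteq> {}" "?B - \<Omega> \<noteq> {}" using \<Omega>(2) by blast+
    then have "?B \<inter> frontier \<Omega> \<noteq> {}" by (rule connected_Int_frontier[OF connected_ball])
    then obtain z where "z \<in> frontier \<Omega>" "dist x z < infdist x (frontier \<Omega>)" by auto
    then show False using infdist_le[of z "frontier \<Omega>" x] by simp
  qed
qed

text \<open>The matrix norm is bounded by the entries at the cost of two factors
  \<open>CARD('N)\<close>; the powers of 5 and 2 come from the radii R/5 at the boundary and d_y / 2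
  around y.\<close>

definition green_const ::
    "'n::finite itself \<Rightarrow> 'N::finite itself \<Rightarrow> real \<Rightarrow> real \<Rightarrow> real \<Rightarrow> real \<Rightarrow> real \<Rightarrow> real \<Rightarrow> real" where
  "green_const t t' lam \<theta> \<mu> \<mu>\<^sub>0 H\<^sub>0 H\<^sub>1 = real CARD('N) * (real CARD('N) *
     (duality_const t lam \<mu>\<^sub>0 H\<^sub>0 * boundary_const t \<theta> \<mu> \<mu>\<^sub>0 H\<^sub>0 H\<^sub>1
      * 5 powr (real CARD('n) / 2 - 1 + \<mu>) * 2 powr (real CARD('n) / 2 - 1)))"

text \<open>Boundary regularity is used for solutions with sources in the ball of radius d_y / 2
  about y, interior regularity for the dual solution in that ball. What remains is to check that the
  three balls involved fit together.\<close>

lemma green_boundary_decay: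
  fixes G :: "real^'n \<Rightarrow> real^'n \<Rightarrow> real^'N^'N"
  assumes n: "CARD('n) \<ge> 3"
    and A: "measurable_coeffs A" "bounded_coeffs Lam A" "Lam \<ge> 0" "strongly_elliptic lam A" "lam > 0"
    and H: "property_H A \<mu>\<^sub>0 H\<^sub>0" "property_H (transpose_coeffs A) \<mu>\<^sub>0 H\<^sub>0" "H\<^sub>0 \<ge> 0" "\<mu>\<^sub>0 > 0"
    and BH: "property_BH A \<Omega> R\<^sub>a \<mu>\<^sub>1 H\<^sub>1" "H\<^sub>1 \<ge> 0" "\<mu> \<le> \<mu>\<^sub>1"
    and S: "condition_S \<Omega> \<theta> R\<^sub>a" "\<theta> > 0" "R\<^sub>a > 0"
    and \<Omega>: "open \<Omega>" and G: "green_off_diagonal A \<Omega> G"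
    and xy: "x \<in> \<Omega>" "y \<in> \<Omega>" "x \<noteq> y" and F: "frontier \<Omega> \<noteq> {}"
    and near: "infdist x (frontier \<Omega>) \<le> R_dist R\<^sub>a x y / 8"
  shows "norm (G x y) \<le> green_const TYPE('n) TYPE('N) lam \<theta> \<mu> \<mu>\<^sub>0 H\<^sub>0 H\<^sub>1 * infdist x (frontier \<Omega>) powr \<mu>
     * R_dist R\<^sub>a x y powr (1 - real CARD('n) / 2 - \<mu>) * infdist y (frontier \<Omega>) powr (1 - real CARD('n) / 2)"
proof -
  define N where "N = real CARD('n)"
  define d where "d = infdist x (frontier \<Omega>)"
  define D where "D = infdist y (frontier \<Omega>)"
  define R where "R = R_dist R\<^sub>a x y"
  have d: "d > 0" "ball x d \<subseteq> \<Omega>" unfolding d_def by (rule infdist_frontier[OF \<Omega> xy(1) F])+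
  have D: "D > 0" "ball y D \<subseteq> \<Omega>" unfolding D_def by (rule infdist_frontier[OF \<Omega> xy(2) F])+
  have R: "R > 0" "R \<le> dist x y" "ereal (R / 5) < R\<^sub>a" unfolding R_def by (rule R_dist_props[OF S(3) xy(3)])+
  have dR: "d \<le> R / 8" using near by (simp add: d_def R_def)
  obtain p where "p \<in> frontier \<Omega>" "infdist x (frontier \<Omega>) = dist x p"
    by (rule infdist_attains_inf[OF frontier_closed F])
  then have p: "p \<in> frontier \<Omega>" "dist x p = d" by (simp_all add: d_def)
  have Dd: "D \<le> d + dist x y"
    using infdist_triangle[of y "frontier \<Omega>" x] by (simp add: D_def d_def dist_commute)
  define K where "K = boundary_const TYPE('n) \<theta> \<mu> \<mu>\<^sub>0 H\<^sub>0 H\<^sub>1 * d powr \<mu> * (R / 5) powr (1 - N / 2 - \<mu>)"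
  have K: "K \<ge> 0" using boundary_const_nonneg[OF H(3) BH(2) H(4) S(2), where 'n='n] by (simp add: K_def)
  have entry: "\<bar>G x y $ j $ i\<bar> \<le> duality_const TYPE('n) lam \<mu>\<^sub>0 H\<^sub>0 * K * (D / 2) powr (1 - N / 2)" for i j
    unfolding N_def
  proof (rule green_pointwise_bound[OF n A H(2,3,4) \<Omega> G _ _ _ _ _ K])
    show "d / 8 > 0" using d by simp
    show "ball x (d / 8) \<subseteq> \<Omega>" using d by (auto intro: order_trans[OF subset_ball])
    show "D / 2 > 0" using D by simp
    show "ball y (D / 2) \<subseteq> \<Omega>" using D by (auto intro: order_trans[OF subset_ball])
    show "ball x (d / 8) \<inter> ball y (D / 2) = {}"
    proof (rule ccontr)
      assume "\<not> ?thesis"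
      then obtain z where "dist x z < d / 8" "dist y z < D / 2" by auto
      then have "dist x y < d / 8 + D / 2" using dist_triangle2[of x y z] by simp
      then show False using Dd dR R d by linarith
    qed
  next
    fix f u Du \<phi> x' i
    assume f: "test_function (ball y (D / 2)) f" and u: "energy_closure \<Omega> u Du \<phi>" "weak_equation A \<Omega> Du f"
      and cont: "continuous_on (\<Omega> - closure {z. f z \<noteq> 0}) (u :: real^'n \<Rightarrow> real^'N)" and x': "dist x' x < d / 8"
    \<comment> \<open>A common point would give dist x y < d + R/5 + D/2 with D \<le> d + dist x y,
      hence dist x y / 2 < 3d/2 + R/5 \<le> (3/16 + 1/5) R < R/2, contradicting R \<le> dist x
      y.\<close>
    have away: "z \<notin> ball y (D / 2)" if "z \<in> ball p (R / 5)" for z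
    proof
      assume "z \<in> ball y (D / 2)"
      then have "dist y z < D / 2" "dist p z < R / 5" using that by auto
      moreover have "dist x y \<le> dist x p + (dist p z + dist z y)"
        using dist_triangle[of x y p] dist_triangle[of p y z] by linarith
      ultimately have "dist x y < d + R / 5 + D / 2" using p by (simp add: dist_commute)
      then show False using Dd dR R d by linarith
    qed
    have supp: "closure {z. f z \<noteq> 0} \<subseteq> ball y (D / 2)" using f by (simp add: test_function_def)
    show "\<bar>u x' $ i\<bar> \<le> K * l2norm (lebesgue_on \<Omega>) Du"
      unfolding K_def N_def
    proof (rule boundary_estimate[OF H(1,3,4) _ BH(2,3) _ S(2) u(1) \<Omega> d(1) _ d(2) _ R(3) _ u(2)])
      show "property_BH_at A \<Omega> R\<^sub>a \<mu>\<^sub>1 H\<^sub>1 p" using BH(1) p by (simp add: property_BH_def)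
      show "condition_S_at \<Omega> \<theta> R\<^sub>a p" using S(1) p by (simp add: condition_S_def)
      show "dist x p \<le> d" using p by simp
      \<comment> \<open>From d \<le> R/8 and 3/16 < 1/5.\<close>
      show "3 * d / 2 < R / 5" using dR R by simp
      show "continuous_on (\<Omega> \<inter> ball p (R / 5)) u"
        by (rule continuous_on_subset[OF cont]) (use away supp in blast)
      show "f z = 0" if "z \<in> \<Omega> \<inter> ball p (R / 5)" for z
        using that away test_function_off_U[OF f] by blast
      show "dist x' x < d / 4" using x' d by simp
    qed
  qed
  have "norm (G x y) \<le> real CARD('N) * (real CARD('N) * (duality_const TYPE('n) lam \<mu>\<^sub>0 H\<^sub>0 * K * (D / 2) powr (1 - N / 2)))"
    by (rule norm_matrix_le[OF entry])
  also have "(D / 2) powr (1 - N / 2) = D powr (1 - N / 2) * 2 powr (N / 2 - 1)"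
    using powr_quotient[OF D(1), of 2 "1 - N / 2"] by simp
  also have "K = boundary_const TYPE('n) \<theta> \<mu> \<mu>\<^sub>0 H\<^sub>0 H\<^sub>1 * d powr \<mu> * (R powr (1 - N / 2 - \<mu>) * 5 powr (N / 2 - 1 + \<mu>))"
    using powr_quotient[OF R(1), of 5 "1 - N / 2 - \<mu>"] by (simp add: K_def algebra_simps)
  finally show ?thesis
    by (simp add: green_const_def d_def[symmetric] D_def[symmetric] R_def[symmetric] N_def[symmetric] mult.assoc mult.commute mult.left_commute)
qed

text \<open>Near a boundary point other than y, \<open>R_dist\<close> stays above some m > 0, and
  its exponent is nonpositive; the power of the distance to the frontier then forces the limit
  0.\<close>

lemma tendsto_boundary:
  fixes g :: "real^'n \<Rightarrow> 'b::real_normed_vector"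
  assumes bound: "\<And>x. x \<in> \<Omega> \<Longrightarrow> x \<noteq> y \<Longrightarrow> infdist x (frontier \<Omega>) \<le> R_dist R\<^sub>a x y / 8 \<Longrightarrow>
      norm (g x) \<le> C * infdist x (frontier \<Omega>) powr \<mu> * R_dist R\<^sub>a x y powr e * B"
    and nonneg: "C \<ge> 0" "B \<ge> 0" and e: "e \<le> 0" and \<mu>: "\<mu> > 0" and Ra: "R\<^sub>a > 0"
    and x0: "x\<^sub>0 \<in> frontier \<Omega>" "x\<^sub>0 \<noteq> y"
  shows "(g \<longlongrightarrow> 0) (at x\<^sub>0 within \<Omega>)"
proof -
  define q where "q = dist x\<^sub>0 y / 2"
  have q: "q > 0" using x0 by (simp add: q_def)
  obtain m where m: "m > 0" "m \<le> q" "\<And>x. dist x\<^sub>0 x < q \<Longrightarrow> m \<le> R_dist R\<^sub>a x y"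
  proof -
    have far: "q \<le> dist x y" if "dist x\<^sub>0 x < q" for x
      using that dist_triangle[of x\<^sub>0 y x] by (simp add: q_def)
    show ?thesis
    proof (cases R\<^sub>a)
      case (real r)
      have "r > 0" using Ra real by simp
      show ?thesis
      proof (rule that[of "min q (4 * r)"])
        show "min q (4 * r) \<le> R_dist R\<^sub>a x y" if "dist x\<^sub>0 x < q" for x
          using far[OF that] by (auto simp: real R_dist_ereal min_def)
      qed (use q \<open>r > 0\<close> in auto)
    next
      case PInf
      then show ?thesis using that[of q] q far by (simp add: R_dist_infinity)
    qed (use Ra in auto)
  qed
  have "((\<lambda>x. C * dist x x\<^sub>0 powr \<mu> * m powr e * B) \<longlongrightarrow> C * 0 powr \<mu> * m powr e * B) (at x\<^sub>0 within \<Omega>)"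
  proof (intro tendsto_mult tendsto_const tendsto_powr2)
    show "((\<lambda>x. dist x x\<^sub>0) \<longlongrightarrow> 0) (at x\<^sub>0 within \<Omega>)"
      using tendsto_dist[OF tendsto_ident_at tendsto_const, of x\<^sub>0 x\<^sub>0 \<Omega>] by simp
  qed (use \<mu> in auto)
  then have lim: "((\<lambda>x. C * dist x x\<^sub>0 powr \<mu> * m powr e * B) \<longlongrightarrow> 0) (at x\<^sub>0 within \<Omega>)" using \<mu> by simp
  have "\<forall>\<^sub>F x in at x\<^sub>0 within \<Omega>. norm (g x) \<le> C * dist x x\<^sub>0 powr \<mu> * m powr e * B"
    \<comment> \<open>Within m/8 of the boundary point, the distance to the frontier is at most m/8
      \<le> \<open>R_dist\<close>/8, so the estimate is available.\<close>
    unfolding eventually_at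
  proof (intro exI[of _ "m / 8"] conjI ballI impI)
    show "m / 8 > 0" using m by simp
    fix x assume x: "x \<in> \<Omega>" "x \<noteq> x\<^sub>0 \<and> dist x x\<^sub>0 < m / 8"
    have dq: "dist x\<^sub>0 x < q" using x m q by (simp add: dist_commute)
    have mR: "m \<le> R_dist R\<^sub>a x y" by (rule m(3)[OF dq])
    have id: "infdist x (frontier \<Omega>) \<le> dist x x\<^sub>0" by (rule infdist_le[OF x0(1)])
    have "x \<noteq> y" using dq q by (auto simp: q_def)
    then have "norm (g x) \<le> C * infdist x (frontier \<Omega>) powr \<mu> * R_dist R\<^sub>a x y powr e * B"
      using x id mR by (intro bound) auto
    also have "\<dots> \<le> C * dist x x\<^sub>0 powr \<mu> * m powr e * B"
      using nonneg id mR m e \<mu>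
      by (intro mult_right_mono mult_mono mult_left_mono powr_mono2 powr_mono2') (auto simp: infdist_nonneg)
    finally show "norm (g x) \<le> C * dist x x\<^sub>0 powr \<mu> * m powr e * B" .
  qed
  then show ?thesis by (rule Lim_null_comparison[OF _ lim])
qed

theorem theorem4p8:
  fixes lam Lam \<theta> \<mu>\<^sub>0 \<mu>\<^sub>1 H\<^sub>0 H\<^sub>1 :: real
  assumes "CARD('n::finite) \<ge> 3"
    and "lam > 0" "Lam > 0" "\<theta> > 0" "\<mu>\<^sub>0 > 0" "\<mu>\<^sub>1 > 0" "H\<^sub>0 > 0" "H\<^sub>1 > 0"
  shows "\<exists>C>0. \<forall>(\<Omega> :: (real^'n) set) (A :: ('n, 'N::finite) coeffs) (R\<^sub>a :: ereal)
      (G :: real^'n \<Rightarrow> real^'n \<Rightarrow> real^'N^'N).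
    open \<Omega> \<and> connected \<Omega> \<and>
    measurable_coeffs A \<and> strongly_elliptic lam A \<and> bounded_coeffs Lam A \<and>
    R\<^sub>a > 0 \<and> condition_S \<Omega> \<theta> R\<^sub>a \<and>
    property_H A \<mu>\<^sub>0 H\<^sub>0 \<and> property_H (transpose_coeffs A) \<mu>\<^sub>0 H\<^sub>0 \<and>
    property_BH A \<Omega> R\<^sub>a \<mu>\<^sub>1 H\<^sub>1 \<and> property_BH (transpose_coeffs A) \<Omega> R\<^sub>a \<mu>\<^sub>1 H\<^sub>1 \<and>
    is_green_matrix A \<Omega> G \<longrightarrow>
      (let \<mu> = min \<mu>\<^sub>0 \<mu>\<^sub>1; n = real CARD('n); d = (\<lambda>x. real_of_ereal (bdry_dist \<Omega> x)) in
        \<forall>x\<in>\<Omega>. \<forall>y\<in>\<Omega>. x \<noteq> y \<longrightarrow>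
          (bdry_dist \<Omega> x \<le> ereal (R_dist R\<^sub>a x y / 8) \<longrightarrow>
             norm (G x y) \<le> C * d x powr \<mu> * R_dist R\<^sub>a x y powr (1 - n / 2 - \<mu>)
                              * d y powr (1 - n / 2)) \<and>
          (bdry_dist \<Omega> y \<le> ereal (R_dist R\<^sub>a x y / 8) \<longrightarrow>
             norm (G x y) \<le> C * d y powr \<mu> * R_dist R\<^sub>a x y powr (1 - n / 2 - \<mu>)
                              * d x powr (1 - n / 2))) \<and>
      (\<forall>y\<in>\<Omega>. \<forall>x\<^sub>0\<in>frontier \<Omega>. ((\<lambda>x. G x y) \<longlongrightarrow> 0) (at x\<^sub>0 within \<Omega>)) \<and>
      (\<forall>x\<in>\<Omega>. \<forall>y\<^sub>0\<in>frontier \<Omega>. ((\<lambda>y. G x y) \<longlongrightarrow> 0) (at y\<^sub>0 within \<Omega>))"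
proof -
  define \<mu> where "\<mu> = min \<mu>\<^sub>0 \<mu>\<^sub>1"
  define N where "N = real CARD('n)"
  \<comment> \<open>The absolute value and the summand 1 give positivity at once; enlarging the
    constant is harmless since the other factors are nonnegative.\<close>
  define C where "C = \<bar>green_const TYPE('n) TYPE('N) lam \<theta> \<mu> \<mu>\<^sub>0 H\<^sub>0 H\<^sub>1\<bar> + 1"
  have C: "C > 0" by (simp add: C_def)
  have \<mu>: "\<mu> > 0" "\<mu> \<le> \<mu>\<^sub>1" using assms by (auto simp: \<mu>_def)
  have pos: "0 \<le> Lam" "0 \<le> H\<^sub>0" "0 \<le> H\<^sub>1" using assms by auto
  have e: "1 - N / 2 - \<mu> \<le> 0" using assms(1) \<mu> by (simp add: N_def)
  show ?thesis
  proof (intro exI[of _ C] conjI C allI impI)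
    fix \<Omega> :: "(real^'n) set" and A :: "('n, 'N) coeffs" and R\<^sub>a :: ereal and G :: "real^'n \<Rightarrow> real^'n \<Rightarrow> real^'N^'N"
    assume hyps: "open \<Omega> \<and> connected \<Omega> \<and>
      measurable_coeffs A \<and> strongly_elliptic lam A \<and> bounded_coeffs Lam A \<and>
      R\<^sub>a > 0 \<and> condition_S \<Omega> \<theta> R\<^sub>a \<and>
      property_H A \<mu>\<^sub>0 H\<^sub>0 \<and> property_H (transpose_coeffs A) \<mu>\<^sub>0 H\<^sub>0 \<and>
      property_BH A \<Omega> R\<^sub>a \<mu>\<^sub>1 H\<^sub>1 \<and> property_BH (transpose_coeffs A) \<Omega> R\<^sub>a \<mu>\<^sub>1 H\<^sub>1 \<and>
      is_green_matrix A \<Omega> G"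
    then have \<Omega>: "open \<Omega>" and A: "measurable_coeffs A" "bounded_coeffs Lam A" "strongly_elliptic lam A"
      and Ra: "R\<^sub>a > 0" and S: "condition_S \<Omega> \<theta> R\<^sub>a"
      and H: "property_H A \<mu>\<^sub>0 H\<^sub>0" "property_H (transpose_coeffs A) \<mu>\<^sub>0 H\<^sub>0"
      and BH: "property_BH A \<Omega> R\<^sub>a \<mu>\<^sub>1 H\<^sub>1" "property_BH (transpose_coeffs A) \<Omega> R\<^sub>a \<mu>\<^sub>1 H\<^sub>1"
      and GM: "is_green_matrix A \<Omega> G" by blast+
    have G: "green_off_diagonal A \<Omega> G" by (rule is_green_matrix_off_diagonal[OF assms(1) \<Omega> GM])
    have GT: "green_off_diagonal (transpose_coeffs A) \<Omega> (\<lambda>x y. transpose (G y x))"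
      by (rule green_off_diagonal_transpose[OF assms(1) A(1,2) pos(1) A(3) assms(2) \<Omega> G])
    define d where "d x = infdist x (frontier \<Omega>)" for x
    have enlarge: "t \<le> C * a * b * c" if "t \<le> green_const TYPE('n) TYPE('N) lam \<theta> \<mu> \<mu>\<^sub>0 H\<^sub>0 H\<^sub>1 * a * b * c" "0 \<le> a" "0 \<le> b" "0 \<le> c" for t a b c
    proof -
      have "green_const TYPE('n) TYPE('N) lam \<theta> \<mu> \<mu>\<^sub>0 H\<^sub>0 H\<^sub>1 * (a * b * c) \<le> C * (a * b * c)"
        using that by (intro mult_right_mono) (auto simp: C_def)
      then show ?thesis using that(1) by (simp add: mult.assoc)
    qed
    have est1: "norm (G x y) \<le> C * d x powr \<mu> * R_dist R\<^sub>a x y powr (1 - N / 2 - \<mu>) * d y powr (1 - N / 2)"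
      if "x \<in> \<Omega>" "y \<in> \<Omega>" "x \<noteq> y" "frontier \<Omega> \<noteq> {}" "d x \<le> R_dist R\<^sub>a x y / 8" for x y
      using green_boundary_decay[OF assms(1) A(1,2) pos(1) A(3) assms(2) H pos(2) assms(5) BH(1) pos(3) \<mu>(2) S assms(4) Ra \<Omega> G that(1-4)]
        that(5) by (intro enlarge) (simp_all add: d_def N_def)
    \<comment> \<open>The boundary decay for the transposed coefficients and kernel with x and y
      exchanged; the norm of a matrix and \<open>R_dist\<close> are invariant under this.\<close>
    have est2: "norm (G x y) \<le> C * d y powr \<mu> * R_dist R\<^sub>a x y powr (1 - N / 2 - \<mu>) * d x powr (1 - N / 2)"
      if "x \<in> \<Omega>" "y \<in> \<Omega>" "x \<noteq> y" "frontier \<Omega> \<noteq> {}" "d y \<le> R_dist R\<^sub>a x y / 8" for x y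
    proof -
      have "norm (transpose (G x y)) \<le> green_const TYPE('n) TYPE('N) lam \<theta> \<mu> \<mu>\<^sub>0 H\<^sub>0 H\<^sub>1 * d y powr \<mu>
          * R_dist R\<^sub>a y x powr (1 - N / 2 - \<mu>) * d x powr (1 - N / 2)"
        unfolding d_def N_def
      proof (rule green_boundary_decay[OF assms(1) measurable_coeffs_transpose[OF A(1)] bounded_coeffs_transpose[OF A(2)] pos(1)
            strongly_elliptic_transpose[OF A(3)] assms(2) H(2) _ pos(2) assms(5) BH(2) pos(3) \<mu>(2) S assms(4) Ra \<Omega> GT that(2,1) _ that(4)])
        show "property_H (transpose_coeffs (transpose_coeffs A)) \<mu>\<^sub>0 H\<^sub>0" using H(1) by simp
        show "y \<noteq> x" using that(3) by simp
        show "infdist y (frontier \<Omega>) \<le> R_dist R\<^sub>a y x / 8" using that(5) by (simp add: d_def R_dist_commute)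
      qed
      then show ?thesis by (intro enlarge) (simp_all add: norm_transpose R_dist_commute[of R\<^sub>a y x])
    qed
    \<comment> \<open>A finite bound on \<open>bdry_dist\<close> rules out the empty frontier, where
      it is infinite; only then does it agree with \<open>infdist\<close>.\<close>
    have bd: "frontier \<Omega> \<noteq> {} \<and> d x \<le> r \<and> real_of_ereal (bdry_dist \<Omega> z) = d z" if "bdry_dist \<Omega> x \<le> ereal r" for x z r
      using that by (auto simp: bdry_dist_def d_def split: if_splits)
    show "let \<mu> = min \<mu>\<^sub>0 \<mu>\<^sub>1; n = real CARD('n); d = (\<lambda>x. real_of_ereal (bdry_dist \<Omega> x)) in
        \<forall>x\<in>\<Omega>. \<forall>y\<in>\<Omega>. x \<noteq> y \<longrightarrow>
          (bdry_dist \<Omega> x \<le> ereal (R_dist R\<^sub>a x y / 8) \<longrightarrow>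
             norm (G x y) \<le> C * d x powr \<mu> * R_dist R\<^sub>a x y powr (1 - n / 2 - \<mu>)
                              * d y powr (1 - n / 2)) \<and>
          (bdry_dist \<Omega> y \<le> ereal (R_dist R\<^sub>a x y / 8) \<longrightarrow>
             norm (G x y) \<le> C * d y powr \<mu> * R_dist R\<^sub>a x y powr (1 - n / 2 - \<mu>)
                              * d x powr (1 - n / 2))"
      unfolding Let_def \<mu>_def[symmetric] N_def[symmetric]
    proof (intro ballI impI conjI)
      fix x y assume xy: "x \<in> \<Omega>" "y \<in> \<Omega>" "x \<noteq> y"
      show "norm (G x y) \<le> C * real_of_ereal (bdry_dist \<Omega> x) powr \<mu> * R_dist R\<^sub>a x y powr (1 - N / 2 - \<mu>)
          * real_of_ereal (bdry_dist \<Omega> y) powr (1 - N / 2)" if "bdry_dist \<Omega> x \<le> ereal (R_dist R\<^sub>a x y / 8)"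
        using est1[OF xy] bd[OF that] by simp
      show "norm (G x y) \<le> C * real_of_ereal (bdry_dist \<Omega> y) powr \<mu> * R_dist R\<^sub>a x y powr (1 - N / 2 - \<mu>)
          * real_of_ereal (bdry_dist \<Omega> x) powr (1 - N / 2)" if "bdry_dist \<Omega> y \<le> ereal (R_dist R\<^sub>a x y / 8)"
        using est2[OF xy] bd[OF that] by simp
    qed
    have off: "x\<^sub>0 \<noteq> y" if "y \<in> \<Omega>" "x\<^sub>0 \<in> frontier \<Omega>" for y x\<^sub>0
      using that \<Omega> by (auto simp: frontier_def interior_open)
    show "\<forall>y\<in>\<Omega>. \<forall>x\<^sub>0\<in>frontier \<Omega>. ((\<lambda>x. G x y) \<longlongrightarrow> 0) (at x\<^sub>0 within \<Omega>)"
    proof (intro ballI)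
      fix y x\<^sub>0 assume y: "y \<in> \<Omega>" "x\<^sub>0 \<in> frontier \<Omega>"
      show "((\<lambda>x. G x y) \<longlongrightarrow> 0) (at x\<^sub>0 within \<Omega>)"
      proof (rule tendsto_boundary[OF _ less_imp_le[OF C] _ e \<mu>(1) Ra y(2) off[OF y]])
        show "norm (G x y) \<le> C * infdist x (frontier \<Omega>) powr \<mu> * R_dist R\<^sub>a x y powr (1 - N / 2 - \<mu>) * d y powr (1 - N / 2)"
          if "x \<in> \<Omega>" "x \<noteq> y" "infdist x (frontier \<Omega>) \<le> R_dist R\<^sub>a x y / 8" for x
          using est1[OF that(1) y(1) that(2)] that(3) y(2) by (auto simp: d_def)
      qed simp
    qed
    show "\<forall>x\<in>\<Omega>. \<forall>y\<^sub>0\<in>frontier \<Omega>. ((\<lambda>y. G x y) \<longlongrightarrow> 0) (at y\<^sub>0 within \<Omega>)"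
    proof (intro ballI)
      fix x y\<^sub>0 assume x: "x \<in> \<Omega>" "y\<^sub>0 \<in> frontier \<Omega>"
      show "((\<lambda>y. G x y) \<longlongrightarrow> 0) (at y\<^sub>0 within \<Omega>)"
      proof (rule tendsto_boundary[OF _ less_imp_le[OF C] _ e \<mu>(1) Ra x(2) off[OF x]])
        show "norm (G x y) \<le> C * infdist y (frontier \<Omega>) powr \<mu> * R_dist R\<^sub>a y x powr (1 - N / 2 - \<mu>) * d x powr (1 - N / 2)"
          if "y \<in> \<Omega>" "y \<noteq> x" "infdist y (frontier \<Omega>) \<le> R_dist R\<^sub>a y x / 8" for y
          using est2[OF x(1) that(1) that(2)[symmetric]] that(3) x(2) by (auto simp: d_def R_dist_commute[of R\<^sub>a y x])
      qed simp
    qed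
  qed
qed

end
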